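(* Let $(M,\omega)$ be a symplectic manifold of dimension $2n$, $N\subseteq M$ a closed regular coisotropic submanifold, $f:N\to\mathbb R$ a Morse function, $\iota:M\to\mathbb R^{4n}$ an embedding, and $\varepsilon>0$. Then there exists $\varphi\in\operatorname{Ham}_{\mathrm c}(M,\omega)$ such that $(N,\varphi)$ is non-degenerate, $\operatorname{Fix}(\varphi,N)=\operatorname{Crit} f$, and $$\big\|\iota\circ\varphi\circ\iota^{-1}-\operatorname{id}\big\|_{C^1(\iota(M))}<\varepsilon.$$
   Context: Conventions: manifolds are smooth, Hausdorff, second countable and without boundary; submanifolds are embedded; "closed" means compact without boundary. $\operatorname{Crit} f$ is the set of critical points of $f$. For a smooth map $G:\iota(M)\to\mathbb R^{4n}$, $\|G\|_{C^1(\iota(M))}$ is the usual $C^1$-norm: the supremum over $\iota(M)$ of $|G|$ plus the supremum over $y\in\iota(M)$ of the operator norm of $dG(y):T_y\iota(M)\to\mathbb R^{4n}$. Hamiltonian diffeomorphisms: for $H\in C^\infty([0,1]\times M,\mathbb R)$, $H_t:=H(t,\cdot)$, $X_{H_t}$ is given by $dH_t=\omega(X_{H_t},\cdot)$, and $\varphi_H^t$ is the time-$t$ flow of $(X_{H_t})$. $\operatorname{Ham}_{\mathrm c}(M,\omega)$ is the group of diffeomorphisms $\varphi_H^1$ with $H:[0,1]\times M\to\mathbb R$ smooth and compactly supported. Coisotropic submanifolds: for $x\in N$ put $T_xN^\omega:=\{v\in T_xM\mid \omega(v,w)=0\ \forall w\in T_xN\}$. $N$ is coisotropic iff $T_xN^\omega\subseteq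 T_xN$ for all $x\in N$. Then $TN^\omega$ is an involutive distribution on $N$. The isotropic leaf through $x\in N$ is $N_x:=\{y(1)\mid y\in C^\infty([0,1],N),\ y(0)=x,\ \dot y(t)\in T_{y(t)}N^\omega\ \forall t\}$. $N$ is regular iff $\{(x,y)\in N\times N\mid y\in N_x\}$ is a closed subset and a submanifold of $N\times N$. $\operatorname{Fix}(\varphi,N):=\{x\in N\mid\varphi(x)\in N_x\}$. Linear holonomy: for $x_0\in N$ let $\operatorname{pr}_{x_0}:T_{x_0}N\to T_{x_0}N/T_{x_0}N^\omega$ be the canonical projection. Let $F\subseteq N$ be an isotropic leaf and $x\in C^\infty([0,1],F)$ (a smooth path with values in $F$). Put $V:=T_{x(0)}N/T_{x(0)}N^\omega$, choose a linear map $T:V\to T_{x(0)}N$ with $\operatorname{pr}_{x(0)}T=\operatorname{id}_V$ and a smooth map $u:[0,1]\times V\to N$ such that $u(t,0)=x(t)$ for all $t$, $u(t,y)$ and $u(0,y)$ lie in the same isotropic leaf for all $t,y$, and $d(u(0,\cdot))(0)=T$. The linear holonomy along $x$ is $\operatorname{hol}^{\omega,N}_x:=\operatorname{pr}_{x(1)}\,d(u(1,\cdot))(0):V\to T_{x(1)}N/T_{x(1)}N^\omega$; it exists and does not depend on the choices. Non-degeneracy: $(N,\varphi)$ is non-degenerate iff for every isotropic leaf $F\subseteq N$, every $x\in C^\infty([0,1],F)$ with $\varphi(x(0))=x(1)$, and every $0\neq v\in T_{x(0)}N\cap T_{x(0)}\varphi^{-1}(N)$ we have $\operatorname{hol}^{\omega,N}_x\operatorname{pr}_{x(0)}v\neq\operatorname{pr}_{x(1)}d\varphi(x(0))v$.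 *)

theory Defs
  imports "HOL-Analysis.Analysis"
begin

section \<open>Smooth maps between open sets of Euclidean spaces\<close>

primrec Ck_on :: "nat \<Rightarrow> 'v::euclidean_space set \<Rightarrow> ('v \<Rightarrow> 'w::euclidean_space) \<Rightarrow> bool" where
  "Ck_on 0 S f \<longleftrightarrow> continuous_on S f"
| "Ck_on (Suc k) S f \<longleftrightarrow>
     f differentiable_on S \<and> (\<forall>v. Ck_on k S (\<lambda>x. frechet_derivative f (at x) v))"

text \<open>Only meaningful for open \<open>S\<close>.\<close>
definition smooth_on :: "'v::euclidean_space set \<Rightarrow> ('v \<Rightarrow> 'w::euclidean_space) \<Rightarrow> bool" where
  "smooth_on S f \<longleftrightarrow> (\<forall>k. Ck_on k S f)"


section \<open>Smooth manifolds\<close>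

text \<open>A chart is a pair of its domain and its coordinate map; the values of the coordinate map
  outside the domain are irrelevant. The dimension of the manifold is \<open>DIM('e)\<close>. The atlas need
  not be maximal.\<close>

type_synonym ('a, 'e) chart = "'a set \<times> ('a \<Rightarrow> 'e)"

record ('a, 'e) manifold =
  mtop :: "'a topology"
  atlas :: "('a, 'e) chart set"

abbreviation points :: "('a, 'e) manifold \<Rightarrow> 'a set" where
  "points M \<equiv> topspace (mtop M)"

definition chart_inv :: "('a, 'e) chart \<Rightarrow> 'e \<Rightarrow> 'a" where
  "chart_inv c = inv_into (fst c) (snd c)"

definition is_chart :: "'a topology \<Rightarrow> ('a, 'e::euclidean_space) chart \<Rightarrow> bool" where
  "is_chart X c \<longleftrightarrow>
     openin X (fst c) \<and> open (snd c ` fst c) \<and>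
     homeomorphic_map (subtopology X (fst c)) (top_of_set (snd c ` fst c)) (snd c)"

definition smooth_transition ::
    "('a, 'e::euclidean_space) chart \<Rightarrow> ('a, 'e) chart \<Rightarrow> bool" where
  "smooth_transition c d \<longleftrightarrow> smooth_on (snd c ` (fst c \<inter> fst d)) (snd d \<circ> chart_inv c)"

definition smooth_manifold :: "('a, 'e::euclidean_space) manifold \<Rightarrow> bool" where
  "smooth_manifold M \<longleftrightarrow>
     Hausdorff_space (mtop M) \<and> second_countable (mtop M) \<and>
     (\<Union>c\<in>atlas M. fst c) = points M \<and>
     (\<forall>c\<in>atlas M. is_chart (mtop M) c) \<and>
     (\<forall>c\<in>atlas M. \<forall>d\<in>atlas M. smooth_transition c d)"

text \<open>The charts of the maximal atlas.\<close>
definition smooth_chart :: "('a, 'e::euclidean_space) manifold \<Rightarrow> ('a, 'e) chart \<Rightarrow> bool" where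
  "smooth_chart M c \<longleftrightarrow>
     is_chart (mtop M) c \<and> (\<forall>d\<in>atlas M. smooth_transition c d \<and> smooth_transition d c)"

definition euclidean_manifold :: "('v::euclidean_space, 'v) manifold" where
  "euclidean_manifold = \<lparr>mtop = euclidean, atlas = {(UNIV, id)}\<rparr>"

definition prod_manifold ::
    "('a, 'e) manifold \<Rightarrow> ('b, 'f) manifold \<Rightarrow> ('a \<times> 'b, 'e \<times> 'f) manifold" where
  "prod_manifold M M' =
     \<lparr>mtop = prod_topology (mtop M) (mtop M'),
      atlas = {(fst c \<times> fst d, map_prod (snd c) (snd d)) | c d. c \<in> atlas M \<and> d \<in> atlas M'}\<rparr>"

text \<open>Smoothness on an arbitrary subset \<open>S\<close> means that \<open>f\<close> extends, locally around each point of
  \<open>S\<close>, to a smooth map on an open set. For open \<open>S\<close> this is ordinary smoothness, for embedded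
  submanifolds \<open>S\<close> it is intrinsic smoothness, and for \<open>S = {0..1}\<close> it is smoothness up to the
  boundary. Smoothness as a map into an embedded submanifold \<open>N\<close> of \<open>M'\<close> is smoothness as a map into
  \<open>M'\<close> together with having values in \<open>N\<close>.\<close>
definition smooth_map_on ::
    "('a, 'e::euclidean_space) manifold \<Rightarrow> ('b, 'f::euclidean_space) manifold \<Rightarrow>
     'a set \<Rightarrow> ('a \<Rightarrow> 'b) \<Rightarrow> bool" where
  "smooth_map_on M M' S f \<longleftrightarrow>
     (\<forall>x\<in>S. \<exists>c\<in>atlas M. \<exists>d\<in>atlas M'. \<exists>W g.
        openin (mtop M) W \<and> x \<in> W \<and> W \<subseteq> fst c \<and> g ` W \<subseteq> fst d \<and>
        smooth_on (snd c ` W) (snd d \<circ> g \<circ> chart_inv c) \<and>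
        (\<forall>y\<in>W \<inter> S. g y = f y))"


section \<open>Tangent vectors and derivatives\<close>

text \<open>A tangent vector at \<open>x\<close> is represented by its coordinates, an element of \<open>'e\<close>, with respect to
  the chart \<open>chart_at M x\<close> that is chosen once and for all for the point \<open>x\<close>. Hence the whole type
  \<open>'e\<close> plays the role of the tangent space of \<open>M\<close> at \<open>x\<close>. On \<open>euclidean_manifold\<close> the chosen chart
  is always the identity.\<close>

definition chart_at :: "('a, 'e) manifold \<Rightarrow> 'a \<Rightarrow> ('a, 'e) chart" where
  "chart_at M x = (SOME c. c \<in> atlas M \<and> x \<in> fst c)"

definition mderiv ::
    "('a, 'e::euclidean_space) manifold \<Rightarrow> ('b, 'f::euclidean_space) manifold \<Rightarrow>
     ('a \<Rightarrow> 'b) \<Rightarrow> 'a \<Rightarrow> 'e \<Rightarrow> 'f" where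
  "mderiv M M' f x =
     frechet_derivative (snd (chart_at M' (f x)) \<circ> f \<circ> chart_inv (chart_at M x))
       (at (snd (chart_at M x) x))"

definition velocity_within ::
    "('a, 'e::euclidean_space) manifold \<Rightarrow> real set \<Rightarrow> (real \<Rightarrow> 'a) \<Rightarrow> real \<Rightarrow> 'e" where
  "velocity_within M I \<gamma> t =
     vector_derivative (\<lambda>s. snd (chart_at M (\<gamma> t)) (\<gamma> s)) (at t within I)"

abbreviation velocity ::
    "('a, 'e::euclidean_space) manifold \<Rightarrow> (real \<Rightarrow> 'a) \<Rightarrow> real \<Rightarrow> 'e" where
  "velocity M \<equiv> velocity_within M UNIV"

definition curve_through ::
    "('a, 'e::euclidean_space) manifold \<Rightarrow> 'a set \<Rightarrow> 'a \<Rightarrow> (real \<Rightarrow> 'a) \<Rightarrow> bool" where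
  "curve_through M S x \<gamma> \<longleftrightarrow>
     smooth_map_on euclidean_manifold M {-1<..<1} \<gamma> \<and> \<gamma> ` {-1<..<1} \<subseteq> S \<and> \<gamma> 0 = x"

text \<open>The tangent space of a submanifold \<open>S\<close> of \<open>M\<close>, as a subspace of that of \<open>M\<close>.\<close>
definition tangent_space ::
    "('a, 'e::euclidean_space) manifold \<Rightarrow> 'a set \<Rightarrow> 'a \<Rightarrow> 'e set" where
  "tangent_space M S x = {velocity M \<gamma> 0 | \<gamma>. curve_through M S x \<gamma>}"

text \<open>The derivative at \<open>x \<in> S\<close> of a smooth vector-valued map \<open>f\<close> defined on the submanifold \<open>S\<close> only,
  in the direction \<open>v \<in> tangent_space M S x\<close>.\<close>
definition submanifold_deriv ::
    "('a, 'e::euclidean_space) manifold \<Rightarrow> 'a set \<Rightarrow> ('a \<Rightarrow> 'v::euclidean_space) \<Rightarrow>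
     'a \<Rightarrow> 'e \<Rightarrow> 'v" where
  "submanifold_deriv M S f x v =
     (THE w. \<exists>\<gamma>. curve_through M S x \<gamma> \<and> velocity M \<gamma> 0 = v \<and>
                 w = vector_derivative (f \<circ> \<gamma>) (at 0))"


section \<open>Submanifolds, embeddings, Morse functions\<close>

definition slice_chart ::
    "('a, 'e::euclidean_space) manifold \<Rightarrow> 'a set \<Rightarrow> ('a, 'e) chart \<Rightarrow> 'e set \<Rightarrow> bool" where
  "slice_chart M S c L \<longleftrightarrow>
     smooth_chart M c \<and> subspace L \<and> snd c ` (fst c \<inter> S) = (snd c ` fst c) \<inter> L"

text \<open>Embedded submanifolds. For an embedded submanifold \<open>N\<close> of \<open>M\<close> and \<open>S \<subseteq> N\<close>, \<open>S\<close> is a submanifold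
  of \<open>N\<close> iff it is a submanifold of \<open>M\<close>.\<close>
definition submanifold :: "('a, 'e::euclidean_space) manifold \<Rightarrow> 'a set \<Rightarrow> bool" where
  "submanifold M S \<longleftrightarrow>
     S \<subseteq> points M \<and>
     (\<exists>k. \<forall>x\<in>S. \<exists>c L. slice_chart M S c L \<and> x \<in> fst c \<and> dim L = k)"

definition smooth_embedding ::
    "('a, 'e::euclidean_space) manifold \<Rightarrow> ('b, 'f::euclidean_space) manifold \<Rightarrow>
     ('a \<Rightarrow> 'b) \<Rightarrow> bool" where
  "smooth_embedding M M' f \<longleftrightarrow>
     smooth_map_on M M' (points M) f \<and>
     (\<forall>x\<in>points M. inj (mderiv M M' f x)) \<and>
     embedding_map (mtop M) (mtop M') f"

definition Crit ::
    "('a, 'e::euclidean_space) manifold \<Rightarrow> 'a set \<Rightarrow> ('a \<Rightarrow> real) \<Rightarrow> 'a set" where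
  "Crit M N f = {x\<in>N. \<forall>v\<in>tangent_space M N x. submanifold_deriv M N f x v = 0}"

definition second_deriv :: "('e::euclidean_space \<Rightarrow> real) \<Rightarrow> 'e \<Rightarrow> 'e \<Rightarrow> 'e \<Rightarrow> real" where
  "second_deriv F p v w = deriv (\<lambda>s. deriv (\<lambda>t. F (p + s *\<^sub>R v + t *\<^sub>R w)) 0) 0"

text \<open>At each critical point the Hessian in local coordinates, which are given by a slice chart
  of \<open>N\<close>, is non-degenerate on the model space \<open>L\<close> of \<open>N\<close>.\<close>
definition morse_function ::
    "('a, 'e::euclidean_space) manifold \<Rightarrow> 'a set \<Rightarrow> ('a \<Rightarrow> real) \<Rightarrow> bool" where
  "morse_function M N f \<longleftrightarrow>
     smooth_map_on M euclidean_manifold N f \<and>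
     (\<forall>x\<in>Crit M N f. \<exists>c L. slice_chart M N c L \<and> x \<in> fst c \<and>
        (\<forall>v\<in>L. v \<noteq> 0 \<longrightarrow>
           (\<exists>w\<in>L. second_deriv (f \<circ> chart_inv c) (snd c x) v w \<noteq> 0)))"

text \<open>The norm is valued in \<open>ennreal\<close>, so that an unbounded supremum is infinite and the supremum over the
  empty set is 0.\<close>
definition C1_norm ::
    "'v::euclidean_space set \<Rightarrow> ('v \<Rightarrow> 'w::euclidean_space) \<Rightarrow> ennreal" where
  "C1_norm S G =
     (SUP y\<in>S. ennreal (norm (G y))) +
     (SUP y\<in>S. SUP v\<in>{v\<in>tangent_space euclidean_manifold S y. norm v \<le> 1}.
        ennreal (norm (submanifold_deriv euclidean_manifold S G y v)))"


section \<open>Symplectic manifolds and Hamiltonian diffeomorphisms\<close>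

text \<open>The coordinate expression of a 2-form in the chart \<open>c\<close>: its pullback along the inverse of \<open>c\<close>.
  The inner derivative is the change of coordinates from \<open>c\<close> to the chosen chart at the point.\<close>
definition form_in_chart ::
    "('a, 'e::euclidean_space) manifold \<Rightarrow> ('a \<Rightarrow> 'e \<Rightarrow> 'e \<Rightarrow> real) \<Rightarrow> ('a, 'e) chart \<Rightarrow>
     'e \<Rightarrow> 'e \<Rightarrow> 'e \<Rightarrow> real" where
  "form_in_chart M \<omega> c p v w =
     (let x = chart_inv c p;
          A = frechet_derivative (snd (chart_at M x) \<circ> chart_inv c) (at p)
      in \<omega> x (A v) (A w))"

text \<open>In the closedness condition, the cyclic sum is \<open>d\<omega>\<close> evaluated on constant vector fields.\<close>
definition symplectic_form ::
    "('a, 'e::euclidean_space) manifold \<Rightarrow> ('a \<Rightarrow> 'e \<Rightarrow> 'e \<Rightarrow> real) \<Rightarrow> bool" where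
  "symplectic_form M \<omega> \<longleftrightarrow>
     (\<forall>x\<in>points M. bilinear (\<omega> x) \<and> (\<forall>v. \<omega> x v v = 0) \<and>
        (\<forall>v. (\<forall>w. \<omega> x v w = 0) \<longrightarrow> v = 0)) \<and>
     (\<forall>c\<in>atlas M. \<forall>v w. smooth_on (snd c ` fst c) (\<lambda>p. form_in_chart M \<omega> c p v w)) \<and>
     (\<forall>c\<in>atlas M. \<forall>p\<in>snd c ` fst c. \<forall>u v w.
        frechet_derivative (\<lambda>q. form_in_chart M \<omega> c q v w) (at p) u +
        frechet_derivative (\<lambda>q. form_in_chart M \<omega> c q w u) (at p) v +
        frechet_derivative (\<lambda>q. form_in_chart M \<omega> c q u v) (at p) w = 0)"

definition symplectic_manifold ::
    "('a, 'e::euclidean_space) manifold \<Rightarrow> ('a \<Rightarrow> 'e \<Rightarrow> 'e \<Rightarrow> real) \<Rightarrow> bool" where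
  "symplectic_manifold M \<omega> \<longleftrightarrow> smooth_manifold M \<and> symplectic_form M \<omega>"

definition ham_vector_field ::
    "('a, 'e::euclidean_space) manifold \<Rightarrow> ('a \<Rightarrow> 'e \<Rightarrow> 'e \<Rightarrow> real) \<Rightarrow> ('a \<Rightarrow> real) \<Rightarrow> 'a \<Rightarrow> 'e" where
  "ham_vector_field M \<omega> h x = (THE X. mderiv M euclidean_manifold h x = \<omega> x X)"

definition compactly_supported_hamiltonian ::
    "('a, 'e::euclidean_space) manifold \<Rightarrow> (real \<times> 'a \<Rightarrow> real) \<Rightarrow> bool" where
  "compactly_supported_hamiltonian M H \<longleftrightarrow>
     smooth_map_on (prod_manifold euclidean_manifold M) euclidean_manifold ({0..1} \<times> points M) H \<and>
     compactin (prod_topology euclidean (mtop M))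
       (prod_topology euclidean (mtop M) closure_of {z \<in> {0..1} \<times> points M. H z \<noteq> 0})"

text \<open>\<open>\<Phi> t\<close> is the time-\<open>t\<close> flow of the time-dependent Hamiltonian vector field.\<close>
definition hamiltonian_flow ::
    "('a, 'e::euclidean_space) manifold \<Rightarrow> ('a \<Rightarrow> 'e \<Rightarrow> 'e \<Rightarrow> real) \<Rightarrow> (real \<times> 'a \<Rightarrow> real) \<Rightarrow>
     (real \<Rightarrow> 'a \<Rightarrow> 'a) \<Rightarrow> bool" where
  "hamiltonian_flow M \<omega> H \<Phi> \<longleftrightarrow>
     (\<forall>x\<in>points M. \<Phi> 0 x = x \<and>
        smooth_map_on euclidean_manifold M {0..1} (\<lambda>t. \<Phi> t x) \<and>
        (\<forall>t\<in>{0..1}. velocity_within M {0..1} (\<lambda>s. \<Phi> s x) t =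
           ham_vector_field M \<omega> (\<lambda>y. H (t, y)) (\<Phi> t x)))"

text \<open>A map belongs to \<open>Ham_c\<close> according to its restriction to \<open>points M\<close>; its other values are
  irrelevant.\<close>
definition Ham_c ::
    "('a, 'e::euclidean_space) manifold \<Rightarrow> ('a \<Rightarrow> 'e \<Rightarrow> 'e \<Rightarrow> real) \<Rightarrow> ('a \<Rightarrow> 'a) set" where
  "Ham_c M \<omega> =
     {\<phi>. \<exists>H \<Phi>. compactly_supported_hamiltonian M H \<and> hamiltonian_flow M \<omega> H \<Phi> \<and>
           (\<forall>x\<in>points M. \<phi> x = \<Phi> 1 x)}"


section \<open>Coisotropic submanifolds\<close>

definition tangent_perp ::
    "('a, 'e::euclidean_space) manifold \<Rightarrow> ('a \<Rightarrow> 'e \<Rightarrow> 'e \<Rightarrow> real) \<Rightarrow> 'a set \<Rightarrow> 'a \<Rightarrow> 'e set" where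
  "tangent_perp M \<omega> N x = {v. \<forall>w\<in>tangent_space M N x. \<omega> x v w = 0}"

definition coisotropic ::
    "('a, 'e::euclidean_space) manifold \<Rightarrow> ('a \<Rightarrow> 'e \<Rightarrow> 'e \<Rightarrow> real) \<Rightarrow> 'a set \<Rightarrow> bool" where
  "coisotropic M \<omega> N \<longleftrightarrow>
     submanifold M N \<and> (\<forall>x\<in>N. tangent_perp M \<omega> N x \<subseteq> tangent_space M N x)"

definition leaf ::
    "('a, 'e::euclidean_space) manifold \<Rightarrow> ('a \<Rightarrow> 'e \<Rightarrow> 'e \<Rightarrow> real) \<Rightarrow> 'a set \<Rightarrow> 'a \<Rightarrow> 'a set" where
  "leaf M \<omega> N x =
     {\<gamma> 1 | \<gamma>. smooth_map_on euclidean_manifold M {0..1} \<gamma> \<and> \<gamma> ` {0..1} \<subseteq> N \<and> \<gamma> 0 = x \<and>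
        (\<forall>t\<in>{0..1}. velocity_within M {0..1} \<gamma> t \<in> tangent_perp M \<omega> N (\<gamma> t))}"

definition leaf_relation ::
    "('a, 'e::euclidean_space) manifold \<Rightarrow> ('a \<Rightarrow> 'e \<Rightarrow> 'e \<Rightarrow> real) \<Rightarrow> 'a set \<Rightarrow> ('a \<times> 'a) set" where
  "leaf_relation M \<omega> N = {(x, y). x \<in> N \<and> y \<in> N \<and> y \<in> leaf M \<omega> N x}"

definition regular ::
    "('a, 'e::euclidean_space) manifold \<Rightarrow> ('a \<Rightarrow> 'e \<Rightarrow> 'e \<Rightarrow> real) \<Rightarrow> 'a set \<Rightarrow> bool" where
  "regular M \<omega> N \<longleftrightarrow>
     closedin (subtopology (mtop (prod_manifold M M)) (N \<times> N)) (leaf_relation M \<omega> N) \<and>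
     submanifold (prod_manifold M M) (leaf_relation M \<omega> N)"

definition Fix ::
    "('a, 'e::euclidean_space) manifold \<Rightarrow> ('a \<Rightarrow> 'e \<Rightarrow> 'e \<Rightarrow> real) \<Rightarrow> ('a \<Rightarrow> 'a) \<Rightarrow> 'a set \<Rightarrow> 'a set"
    where
  "Fix M \<omega> \<phi> N = {x\<in>N. \<phi> x \<in> leaf M \<omega> N x}"


section \<open>Linear holonomy and non-degeneracy\<close>

text \<open>The quotient of the tangent space of \<open>N\<close> at \<open>x\<close> by its symplectic complement consists of
  cosets, i.e. of elements of \<open>'e set\<close>; \<open>quot_proj\<close> is the canonical projection.\<close>

definition quot_proj ::
    "('a, 'e::euclidean_space) manifold \<Rightarrow> ('a \<Rightarrow> 'e \<Rightarrow> 'e \<Rightarrow> real) \<Rightarrow> 'a set \<Rightarrow> 'a \<Rightarrow> 'e \<Rightarrow> 'e set"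
    where
  "quot_proj M \<omega> N x v = (+) v ` tangent_perp M \<omega> N x"

definition linear_section ::
    "('a, 'e::euclidean_space) manifold \<Rightarrow> ('a \<Rightarrow> 'e \<Rightarrow> 'e \<Rightarrow> real) \<Rightarrow> 'a set \<Rightarrow> 'a \<Rightarrow>
     ('e set \<Rightarrow> 'e) \<Rightarrow> bool" where
  "linear_section M \<omega> N x T \<longleftrightarrow>
     (\<forall>v\<in>tangent_space M N x.
        T (quot_proj M \<omega> N x v) \<in> tangent_space M N x \<and>
        quot_proj M \<omega> N x (T (quot_proj M \<omega> N x v)) = quot_proj M \<omega> N x v) \<and>
     (\<forall>v\<in>tangent_space M N x. \<forall>w\<in>tangent_space M N x.
        T (quot_proj M \<omega> N x (v + w)) = T (quot_proj M \<omega> N x v) + T (quot_proj M \<omega> N x w)) \<and>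
     (\<forall>a. \<forall>v\<in>tangent_space M N x.
        T (quot_proj M \<omega> N x (a *\<^sub>R v)) = a *\<^sub>R T (quot_proj M \<omega> N x v))"

text \<open>The maps \<open>T\<close> and \<open>u\<close> used to define the holonomy along the path \<open>x\<close>. A map on the quotient
  vector space is smooth iff its pullback along the surjective linear map \<open>quot_proj\<close> is smooth, and its
  derivative at 0 in the direction of the class of \<open>v\<close> is the velocity along \<open>s \<mapsto>\<close> class of
  \<open>s *\<^sub>R v\<close>.\<close>
definition holonomy_data ::
    "('a, 'e::euclidean_space) manifold \<Rightarrow> ('a \<Rightarrow> 'e \<Rightarrow> 'e \<Rightarrow> real) \<Rightarrow> 'a set \<Rightarrow> (real \<Rightarrow> 'a) \<Rightarrow>
     ('e set \<Rightarrow> 'e) \<Rightarrow> (real \<times> 'e set \<Rightarrow> 'a) \<Rightarrow> bool" where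
  "holonomy_data M \<omega> N x T u \<longleftrightarrow>
     (let TN = tangent_space M N (x 0); pr = quot_proj M \<omega> N (x 0) in
        linear_section M \<omega> N (x 0) T \<and>
        smooth_map_on euclidean_manifold M ({0..1} \<times> TN) (\<lambda>(t, v). u (t, pr v)) \<and>
        (\<forall>t\<in>{0..1}. \<forall>v\<in>TN. u (t, pr v) \<in> N) \<and>
        (\<forall>t\<in>{0..1}. u (t, pr 0) = x t) \<and>
        (\<forall>t\<in>{0..1}. \<forall>v\<in>TN. u (t, pr v) \<in> leaf M \<omega> N (u (0, pr v))) \<and>
        (\<forall>v\<in>TN. velocity M (\<lambda>s. u (0, pr (s *\<^sub>R v))) 0 = T (pr v)))"

definition linear_holonomy ::
    "('a, 'e::euclidean_space) manifold \<Rightarrow> ('a \<Rightarrow> 'e \<Rightarrow> 'e \<Rightarrow> real) \<Rightarrow> 'a set \<Rightarrow> (real \<Rightarrow> 'a) \<Rightarrow>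
     'e set \<Rightarrow> 'e set" where
  "linear_holonomy M \<omega> N x Y =
     (THE Z. \<exists>T u v. holonomy_data M \<omega> N x T u \<and> v \<in> tangent_space M N (x 0) \<and>
        Y = quot_proj M \<omega> N (x 0) v \<and>
        Z = quot_proj M \<omega> N (x 1)
              (velocity M (\<lambda>s. u (1, quot_proj M \<omega> N (x 0) (s *\<^sub>R v))) 0))"

definition nondegenerate ::
    "('a, 'e::euclidean_space) manifold \<Rightarrow> ('a \<Rightarrow> 'e \<Rightarrow> 'e \<Rightarrow> real) \<Rightarrow> 'a set \<Rightarrow> ('a \<Rightarrow> 'a) \<Rightarrow> bool" where
  "nondegenerate M \<omega> N \<phi> \<longleftrightarrow>
     (\<forall>F\<in>leaf M \<omega> N ` N. \<forall>x.
        smooth_map_on euclidean_manifold M {0..1} x \<and> x ` {0..1} \<subseteq> F \<and> \<phi> (x 0) = x 1 \<longrightarrow>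
        (\<forall>v \<in> tangent_space M N (x 0) \<inter> tangent_space M {y \<in> points M. \<phi> y \<in> N} (x 0).
           v \<noteq> 0 \<longrightarrow>
           linear_holonomy M \<omega> N x (quot_proj M \<omega> N (x 0) v) \<noteq>
           quot_proj M \<omega> N (x 1) (mderiv M M \<phi> (x 0) v)))"

end

(* The Hamiltonian h of the flow extends f so that its differential along N is controlled by the
   restriction to TN; hence X_h vanishes exactly on Crit f and is nowhere tangent to the isotropic leaves
   otherwise. By regularity N has slice charts in which the leaves are the affine subspaces
   parallel to a fixed subspace, globally on the chart. The time-one map of the flow of delta * h differs from
   the identity by delta * X_h up to a relative error of order delta, so by compactness of N, for small
   delta, a point of N can only return to its own leaf if it is critical. Leafwise fixed points are
   therefore fixed points, the holonomy along the resulting loops is trivial because the loop stays in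
   one leaf which is embedded, and non-degeneracy reduces to that of the Hessian of f. *)
theory Submission
  imports Defs
begin

section \<open>Calculus of smooth maps\<close>

text \<open>Near a critical point the field and the motion both tend to 0, so every estimate is
  relative to the norm of the field. If \<open>ph de x\<close> lies in the leaf of \<open>x\<close>,
  the difference quotient of the orbit lies, in a plaque chart, in the kernel of the form on TN, and
  it differs from the Hamiltonian vector \<open>Xx\<close> by some \<open>E\<close> with
  \<open>norm E\<close> at most a constant times \<open>de * norm Xx\<close>. Pairing with TN bounds
  df by \<open>norm E\<close>; \<open>control\<close>, which bounds all of dh by its restriction to
  TN, turns this into \<open>norm Xx \<le> ka * de * norm Xx\<close>, whence \<open>Xx = 0\<close>.
  That plaques have exactly the directions of the kernel is not part of regularity. One inclusion
  comes from kernel curves, the other from counting: by Frobenius a leaf meets only countably many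
  plaques of a foliation box, whereas a larger subspace would force uncountably many. Since M is
  embedded, the Hamiltonian field is extended to a compactly supported field on the ambient space
  and integrated there; the C1 estimate is then one on that flow, and scaling by \<open>de\<close>
  makes its Lipschitz constant small enough for elementary arguments.\<close>

lemmas hd_transform = has_derivative_transform_within_open

abbreviation (input) euc :: "('v::euclidean_space,'v) manifold" where "euc == euclidean_manifold"

abbreviation fder :: "('v::euclidean_space => 'w::euclidean_space) => 'v => 'v => 'w" where
	"fder f x == frechet_derivative f (at x)"

lemma fder_eq:"(f has_derivative f') (at x) ==> f' h = fder f x h"
	by (metis frechet_derivative_at)

lemma Ck_on_Suc_has_derivative:
	assumes "open S" "Ck_on (Suc k) S f" "x : S"
	shows "(f has_derivative fder f x) (at x)"
	using assms at_within_open[OF assms(3,1)]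
	by (auto simp:differentiable_on_def frechet_derivative_works)

lemma Ck_on_cong:
	assumes "open S" "!!x. x : S ==> f x = g x" "Ck_on k S f"
	shows "Ck_on k S g"
	using assms(2,3)
proof (induction k arbitrary: f g)
	case 0
	thus ?case using continuous_on_cong by fastforce
next
	case (Suc k)
	have d:"(g has_derivative fder f x) (at x)" if "x : S" for x
	using hd_transform[OF Ck_on_Suc_has_derivative[OF assms(1) Suc.prems(2) that]
	assms(1) that Suc.prems(1)] .
	hence "fder g x = fder f x" if "x : S" for x
	using that frechet_derivative_at by fastforce
	hence "Ck_on k S (%x. fder g x v)" for v
	using Suc.IH[of "%x. fder f x v" "%x. fder g x v"] Suc.prems(2) by simp
	thus ?case using d
	by (auto simp:differentiable_on_def differentiable_def intro:has_derivative_at_withinI)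
qed

lemma Ck_on_SucI:
	assumes "open S" "!!x. x : S ==> (f has_derivative f' x) (at x)" "!!v. Ck_on k S (%x. f' x v)"
	shows "Ck_on (Suc k) S f"
proof -
	have "f' x = fder f x" if "x : S" for x
	using frechet_derivative_at[OF assms(2)[OF that]] by simp
	hence "Ck_on k S (%x. fder f x v)" for v
	using Ck_on_cong[OF assms(1) _ assms(3)[of v]] by simp
	thus ?thesis using assms(2)
	by (auto simp:differentiable_on_def differentiable_def intro:has_derivative_at_withinI)
qed

lemma Ck_on_Suc_imp:"Ck_on (Suc k) S f ==> Ck_on k S f"
proof (induction k arbitrary: f)
	case 0
	thus ?case by (simp add:differentiable_imp_continuous_on)
qed simp

lemma Ck_on_imp_continuous_on:"Ck_on k S f ==> continuous_on S f"
	by (induction k) (auto simp:differentiable_imp_continuous_on)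

lemma Ck_on_subset:"Ck_on k S f ==> T \<subseteq> S ==> Ck_on k T f"
	by (induction k arbitrary: f) (auto intro:continuous_on_subset differentiable_on_subset)

text \<open>Differentiability and the derivative at a point depend on a neighbourhood only, so the
  induction goes through. This is what permits gluing over overlapping open sets.\<close>

lemma Ck_on_local:
	assumes "!!x. x : S ==> EX U. open U & x : U & Ck_on k U f"
	shows "Ck_on k S f"
	using assms
proof (induction k arbitrary: f)
	case 0
	thus ?case
	by (metis Ck_on.simps(1) at_within_open continuous_at_imp_continuous_on continuous_on_eq_continuous_within)
next
	case (Suc k)
	have "f differentiable (at x)" if "x : S" for x
	using Suc.prems[OF that] Ck_on_Suc_has_derivative differentiableI by blast
	moreover have "Ck_on k S (%x. fder f x v)" for v
	proof (rule Suc.IH)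
	fix x assume "x : S"
	then obtain U where "open U" "x : U" "Ck_on (Suc k) U f" using Suc.prems by blast
	thus "EX U. open U & x : U & Ck_on k U (%x. fder f x v)" by auto
	qed
	ultimately show ?case by (auto simp:differentiable_on_def differentiable_at_withinI)
qed

lemma Ck_on_const:"Ck_on k S (%x. c)"
	by (induction k arbitrary: c) (auto simp:differentiable_on_def)

lemma Ck_on_linear:
	assumes "linear f"
	shows "Ck_on k S f"
proof -
	have b:"bounded_linear f" using assms linear_conv_bounded_linear by blast
	hence d:"(f has_derivative f) (at x)" for x by (simp add:bounded_linear_imp_has_derivative)
	hence fd:"fder f x = f" for x using frechet_derivative_at by metis
	show ?thesis
	by (cases k) (use b in \<open>auto simp:fd Ck_on_const linear_continuous_on bounded_linear_imp_differentiable_on\<close>)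
qed

lemma Ck_on_id:"Ck_on k S (%x. x)"
	by (rule Ck_on_linear) (simp add:linear_id[unfolded id_def])

lemma Ck_on_add:
	assumes "open S" "Ck_on k S f" "Ck_on k S g"
	shows "Ck_on k S (%x. f x + g x)"
	using assms(2,3)
proof (induction k arbitrary: f g)
	case 0
	thus ?case by (simp add:continuous_on_add)
next
	case (Suc k)
	show ?case
	proof (rule Ck_on_SucI[OF assms(1)])
	show "((%x. f x + g x) has_derivative (%v. fder f x v + fder g x v)) (at x)" if "x : S" for x
	using has_derivative_add[OF Ck_on_Suc_has_derivative[OF assms(1) Suc.prems(1) that]
	Ck_on_Suc_has_derivative[OF assms(1) Suc.prems(2) that]] .
	qed (use Suc in auto)
qed

lemma Ck_on_bilinear:
	assumes "bounded_bilinear (h :: 'a::euclidean_space => 'b::euclidean_space => 'c::euclidean_space)"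
	and "open S" "Ck_on k S f" "Ck_on k S g"
	shows "Ck_on k S (%x. h (f x) (g x))"
	using assms(3,4)
proof (induction k arbitrary: f g)
	case 0
	thus ?case using bounded_bilinear.continuous_on[OF assms(1)] by fastforce
next
	case (Suc k)
	show ?case
	proof (rule Ck_on_SucI[OF assms(2)])
	show "((%x. h (f x) (g x)) has_derivative (%v. h (f x) (fder g x v) + h (fder f x v) (g x))) (at x)"
	if "x : S" for x
	using bounded_bilinear.FDERIV[OF assms(1) Ck_on_Suc_has_derivative[OF assms(2) Suc.prems(1) that]
	Ck_on_Suc_has_derivative[OF assms(2) Suc.prems(2) that]] .
	show "Ck_on k S (%x. h (f x) (fder g x v) + h (fder f x v) (g x))" for v
	using Suc.prems Ck_on_Suc_imp[OF Suc.prems(1)] Ck_on_Suc_imp[OF Suc.prems(2)]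
	by (intro Ck_on_add assms(2) Suc.IH) auto
	qed
qed

lemmas Ck_on_scaleR = Ck_on_bilinear[OF bounded_bilinear_scaleR]

lemma Ck_on_sum:
	assumes "open S" "!!i. i : I ==> Ck_on k S (f i)"
	shows "Ck_on k S (%x. SUM i:I. f i x)"
	using assms(2) by (induction I rule: infinite_finite_induct) (auto simp:Ck_on_const Ck_on_add[OF assms(1)])

lemma linear_sum_Basis:
	assumes "linear (f :: 'a::euclidean_space => 'b::real_vector)"
	shows "f v = (SUM i:Basis. (v \<bullet> i) *\<^sub>R f i)"
proof -
	have "f v = f (SUM i:Basis. (v \<bullet> i) *\<^sub>R i)" by (simp add:euclidean_representation)
	thus ?thesis by (simp add:linear_sum[OF assms] linear_scale[OF assms])
qed

text \<open>Smoothness of an operator family is always expressed on fixed vectors; expanding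
  \<open>g x\<close> in the basis reduces a moving argument to that case.\<close>

lemma Ck_on_apply_linear:
	assumes "open S" "!!x. x : S ==> linear (A x)" "!!v. v : Basis ==> Ck_on k S (%x. A x v)" "Ck_on k S g"
	shows "Ck_on k S (%x. A x (g x))"
proof (rule Ck_on_cong[OF assms(1)])
	show "(SUM i:Basis. (g x \<bullet> i) *\<^sub>R A x i) = A x (g x)" if "x : S" for x
	by (rule linear_sum_Basis[OF assms(2)[OF that],symmetric])
	have "Ck_on k S (%x. (g x \<bullet> i) *\<^sub>R A x i)" if "i : Basis" for i
	by (rule Ck_on_scaleR[OF assms(1) Ck_on_bilinear[OF bounded_bilinear_inner assms(1,4) Ck_on_const] assms(3)[OF that]])
	thus "Ck_on k S (%x. SUM i:Basis. (g x \<bullet> i) *\<^sub>R A x i)"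
	by (rule Ck_on_sum[OF assms(1)])
qed

text \<open>The chain rule gives an operator family applied to a moving vector. The induction varies
  \<open>g\<close>, because the composite of \<open>fder g\<close> with \<open>f\<close>
  recurs.\<close>

lemma Ck_on_compose:
	assumes "open S" "open T" "Ck_on k S f" "Ck_on k T g" "f ` S \<subseteq> T"
	shows "Ck_on k S (%x. g (f x))"
	using assms(3,4)
proof (induction k arbitrary: g)
	case 0
	thus ?case using continuous_on_compose2[of T g S f] assms(5) by simp
next
	case (Suc k)
	show ?case
	proof (rule Ck_on_SucI[OF assms(1)])
	show "((%x. g (f x)) has_derivative (%v. fder g (f x) (fder f x v))) (at x)" if "x : S" for x
	by (rule has_derivative_compose[OF Ck_on_Suc_has_derivative[OF assms(1) Suc.prems(1) that]
	Ck_on_Suc_has_derivative[OF assms(2) Suc.prems(2)]]) (use that assms(5) in auto)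
	show "Ck_on k S (%x. fder g (f x) (fder f x v))" for v
	proof (rule Ck_on_apply_linear[of S "%x. fder g (f x)" k "%x. fder f x v",OF assms(1)])
	show "linear (fder g (f x))" if "x : S" for x
	using Ck_on_Suc_has_derivative[OF assms(2) Suc.prems(2)] that assms(5)
	by (meson has_derivative_linear image_subset_iff)
	show "Ck_on k S (%x. fder g (f x) w)" for w
	by (rule Suc.IH[OF Ck_on_Suc_imp[OF Suc.prems(1)]]) (use Suc.prems(2) in simp)
	qed (use Suc.prems in simp)
	qed
qed

lemma Ck_on_Pair:
	fixes f :: "'a::euclidean_space => 'b::euclidean_space" and g :: "'a => 'c::euclidean_space"
	assumes "open S" "Ck_on k S f" "Ck_on k S g"
	shows "Ck_on k S (%x. (f x,g x))"
proof -
	have l:"linear (%a :: 'b. (a,0 :: 'c))" "linear (%b :: 'c. (0 :: 'b,b))"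
	by (auto simp:linear_iff)
	have "Ck_on k S (%x. (f x,0 :: 'c))"
	using Ck_on_compose[OF assms(1) open_UNIV assms(2) Ck_on_linear[OF l(1)]] by simp
	moreover have "Ck_on k S (%x. (0 :: 'b,g x))"
	using Ck_on_compose[OF assms(1) open_UNIV assms(3) Ck_on_linear[OF l(2)]] by simp
	ultimately have "Ck_on k S (%x. (f x,0) + (0,g x))"
	by (rule Ck_on_add[OF assms(1)])
	thus ?thesis by simp
qed

lemma sm_hd:
	assumes "open S" "smooth_on S f" "x : S"
	shows "(f has_derivative fder f x) (at x)"
	using assms Ck_on_Suc_has_derivative unfolding smooth_on_def by blast

lemma sm_linear_fder:
	"open S ==> smooth_on S f ==> x : S ==> linear (fder f x)"
	using sm_hd has_derivative_linear by blast

lemma sm_cont:"smooth_on S f ==> continuous_on S f"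
	using Ck_on_imp_continuous_on unfolding smooth_on_def by blast

lemma sm_cong:"open S ==> (!!x. x : S ==> f x = g x) ==> smooth_on S f ==> smooth_on S g"
	using Ck_on_cong unfolding smooth_on_def by metis

lemma sm_subset:"smooth_on S f ==> T \<subseteq> S ==> smooth_on T f"
	using Ck_on_subset unfolding smooth_on_def by blast

lemma sm_local:
	"(!!x. x : S ==> EX U. open U & x : U & smooth_on U f) ==> smooth_on S f"
	unfolding smooth_on_def by (intro allI Ck_on_local) blast

lemma sm_const:"smooth_on S (%x. c)"
	by (simp add:smooth_on_def Ck_on_const)

lemma sm_linear:"linear f ==> smooth_on S f"
	by (simp add:smooth_on_def Ck_on_linear)

lemma sm_id:"smooth_on S (%x. x)"
	by (simp add:smooth_on_def Ck_on_id)

lemma sm_add:"open S ==> smooth_on S f ==> smooth_on S g ==> smooth_on S (%x. f x + g x)"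
	by (simp add:smooth_on_def Ck_on_add)

lemma sm_bilinear:
	"bounded_bilinear (h :: 'a::euclidean_space => 'b::euclidean_space => 'c::euclidean_space) ==>
	open S ==> smooth_on S f ==> smooth_on S g ==> smooth_on S (%x. h (f x) (g x))"
	unfolding smooth_on_def by (intro allI Ck_on_bilinear[of h S _ f g]) auto

lemmas sm_scaleR = sm_bilinear[OF bounded_bilinear_scaleR]
lemmas sm_inner = sm_bilinear[OF bounded_bilinear_inner]
lemmas sm_mult = sm_bilinear[OF bounded_bilinear_mult[where 'a = real]]

lemma sm_uminus:"open S ==> smooth_on S f ==> smooth_on S (%x. - f x)"
	using sm_scaleR[of S "%_. -1" f] sm_const[of S "-1::real"] by simp

lemma sm_diff:
	assumes "open S" "smooth_on S f" "smooth_on S g"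
	shows "smooth_on S (%x. f x - g x)"
	using sm_add[OF assms(1,2) sm_uminus[OF assms(1,3)]] by simp

lemma sm_sum:
	"open S ==> (!!i. i : I ==> smooth_on S (f i)) ==> smooth_on S (%x. SUM i:I. f i x)"
	by (simp add:smooth_on_def Ck_on_sum)

lemma smooth_on_Pair:"open S ==> smooth_on S f ==> smooth_on S g ==> smooth_on S (%x. (f x,g x))"
	by (simp add:smooth_on_def Ck_on_Pair)

lemma sm_compose:
	"open S ==> open T ==> smooth_on S f ==> smooth_on T g ==> f ` S \<subseteq> T ==> smooth_on S (%x. g (f x))"
	unfolding smooth_on_def by (intro allI Ck_on_compose[of S T _ f g]) auto

lemma sm_linear_compose:
	"open S ==> linear A ==> smooth_on S f ==> smooth_on S (%x. A (f x))"
	by (rule sm_compose[where T = UNIV and f = f and g = A]) (auto intro:sm_linear)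

lemma sm_apply_linear:
	"open S ==> (!!x. x : S ==> linear (A x)) ==> (!!v. v : Basis ==> smooth_on S (%x. A x v)) ==>
	smooth_on S g ==> smooth_on S (%x. A x (g x))"
	unfolding smooth_on_def by (intro allI Ck_on_apply_linear[of S A _ g]) auto

lemma sm_fder:
	assumes "smooth_on S f"
	shows "smooth_on S (%x. fder f x v)"
	unfolding smooth_on_def
proof
	fix k
	have "Ck_on (Suc k) S f" using assms by (simp only: smooth_on_def)
	thus "Ck_on k S (%x. fder f x v)" by simp
qed

lemma sm_fder_apply:
	"open S ==> smooth_on S f ==> smooth_on S g ==> smooth_on S (%x. fder f x (g x))"
	by (rule sm_apply_linear[of S "fder f" g]) (auto intro:sm_linear_fder sm_fder)

text \<open>Bootstrapping for maps whose derivative is expressed through the map itself: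
  reciprocals, inverse functions and integral curves.\<close>

lemma smooth_onI_derivative:
	assumes "open S" "!!x. x : S ==> (f has_derivative f' x) (at x)"
	and "!!k v. Ck_on k S f ==> Ck_on k S (%x. f' x v)"
	shows "smooth_on S f"
proof -
	have "continuous_on S f"
	using assms(2) by (meson continuous_at_imp_continuous_on has_derivative_continuous)
	have "Ck_on k S f" for k
	proof (induction k)
	case 0
	show ?case using \<open>continuous_on S f\<close> by simp
	next
	case (Suc k)
	show ?case by (rule Ck_on_SucI[OF assms(1,2) assms(3)[OF Suc.IH]])
	qed
	thus ?thesis by (simp add:smooth_on_def)
qed

lemma sm_inverse_real:"smooth_on (- {0}) (inverse :: real => real)"
proof (rule smooth_onI_derivative)
	show "((inverse :: real => real) has_derivative (%v. - (inverse x * v * inverse x))) (at x)"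
	if "x : - {0}" for x :: real
	using that by (auto intro!:derivative_eq_intros)
	show "Ck_on k (- {0}) (%x::real. - (inverse x * v * inverse x))" if "Ck_on k (- {0::real}) inverse" for k v
	using Ck_on_bilinear[OF bounded_bilinear_mult[where 'a = real] _ that that]
	Ck_on_scaleR[of "-{0::real}" k "%_. -v" "%x. inverse x * inverse x"]
	by (simp add:Ck_on_const mult.commute mult.left_commute open_Compl)
qed auto

lemma sm_divide:
	fixes f g :: "'v::euclidean_space => real"
	assumes "open S" "smooth_on S f" "smooth_on S g" "!!x. x : S ==> g x ~= 0"
	shows "smooth_on S (%x. f x / g x)"
proof -
	have "smooth_on S (%x. inverse (g x))"
	by (rule sm_compose[OF assms(1) _ assms(3) sm_inverse_real]) (use assms(4) in auto)
	thus ?thesis unfolding divide_inverse by (rule sm_mult[OF assms(1,2)])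
qed

section \<open>Cut-off functions\<close>

text \<open>The whole family is introduced, not only \<open>exp (- (1 / x))\<close>, because up to
  linear combinations it is closed under differentiation; one induction then gives smoothness,
  including at 0.\<close>

definition flat :: "nat => real => real" where
	"flat n x = (if x <= 0 then 0 else (1 / x) ^ n * exp (- (1 / x)))"

lemma flat_tendsto_0:"(flat n \<longlongrightarrow> 0) (at 0)"
proof -
	have r:"(flat n \<longlongrightarrow> 0) (at_right 0)"
	proof -
	have "((%u. u ^ n / exp u) \<longlongrightarrow> 0) (at_top :: real filter)" by (rule tendsto_power_div_exp_0)
	hence "((%x::real. (inverse x) ^ n / exp (inverse x)) \<longlongrightarrow> 0) (at_right 0)"
	using filterlim_compose filterlim_inverse_at_top_right by blast
	moreover have "\<forall>\<^sub>F x::real in at_right 0. (inverse x) ^ n / exp (inverse x) = flat n x"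
	by (rule eventually_at_rightI[of 0 1]) (auto simp:flat_def exp_minus divide_inverse)
	ultimately show ?thesis using Lim_transform_eventually by fastforce
	qed
	have l:"(flat n \<longlongrightarrow> 0) (at_left 0)"
	by (rule Lim_transform_eventually[OF tendsto_const],rule eventually_at_leftI[of "-1"])
	(auto simp:flat_def)
	show ?thesis using r l filterlim_split_at_real by blast
qed

lemma flat_has_derivative:
	"(flat n has_field_derivative (flat (n + 2) x - real n * flat (n + 1) x)) (at x)"
proof -
	consider "x < 0" | "x = 0" | "x > 0" by linarith
	thus ?thesis
	proof cases
	case 1
	have "((%_. 0) has_field_derivative (0::real)) (at x)" by simp
	thus ?thesis
	using 1 DERIV_cong_ev[of x x "flat n" "%_. 0"] eventually_nhds_in_open[of "{..<0}" x]
	by (simp add:flat_def eventually_mono)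
	next
	case 2
	\<comment> \<open>At 0 the difference quotient just raises the exponent by one, so it again tends
	  to 0.\<close>
	have "(%h. (flat n h - flat n 0) / h) = flat (Suc n)"
	by (auto simp:flat_def)
	thus ?thesis using flat_tendsto_0[of "Suc n"] 2
	by (simp add:DERIV_def) (simp add:flat_def)
	next
	case 3
	define u where "u = 1 / x"
	have u:"((%x. 1 / x) has_field_derivative - (u\<^sup>2)) (at x)"
	using 3 by (auto intro!:derivative_eq_intros simp:u_def power2_eq_square)
	have "((%x. (1 / x) ^ n * exp (- (1 / x))) has_field_derivative
	real n * (- (u\<^sup>2) * (1 / x) ^ (n - 1)) * exp (- (1 / x)) + exp (- (1 / x)) * - (- (u\<^sup>2)) * (1 / x) ^ n) (at x)"
	using DERIV_mult[OF DERIV_power[OF u,of n] DERIV_fun_exp[OF DERIV_minus[OF u]]] by simp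
	moreover have "real n * (- (u\<^sup>2) * (1 / x) ^ (n - 1)) * exp (- (1 / x)) + exp (- (1 / x)) * - (- (u\<^sup>2)) * (1 / x) ^ n
	= flat (n + 2) x - real n * flat (n + 1) x"
	using 3 unfolding flat_def u_def[symmetric] by (cases n) (auto simp:algebra_simps power2_eq_square)
	ultimately have *: "((%x. (1 / x) ^ n * exp (- (1 / x))) has_field_derivative
	(flat (n + 2) x - real n * flat (n + 1) x)) (at x)" by simp
	have "\<forall>\<^sub>F y in nhds x. (1 / y) ^ n * exp (- (1 / y)) = flat n y"
	using eventually_nhds_in_open[of "{0<..}" x] 3 by (auto simp:flat_def elim!: eventually_mono)
	from DERIV_cong_ev[OF refl this refl] * show ?thesis by simp
	qed
qed

lemma sm_flat:"smooth_on UNIV (flat n)"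
proof -
	have "Ck_on k UNIV (flat n)" for k
	proof (induction k arbitrary: n)
	case 0
	show ?case using DERIV_isCont[OF flat_has_derivative] by (simp add:continuous_at_imp_continuous_on)
	next
	case (Suc k)
	show ?case
	proof (rule Ck_on_SucI)
	show "(flat n has_derivative (%v. v *\<^sub>R (flat (n + 2) x + (- real n) *\<^sub>R flat (n + 1) x))) (at x)" for x
	using flat_has_derivative[of n x] by (simp add:has_field_derivative_def mult_commute_abs)
	show "Ck_on k UNIV (%x. v *\<^sub>R (flat (n + 2) x + (- real n) *\<^sub>R flat (n + 1) x))" for v
	by (intro Ck_on_scaleR Ck_on_add Ck_on_const Suc.IH) auto
	qed auto
	qed
	thus ?thesis by (simp add:smooth_on_def)
qed

definition smooth_step :: "real => real" where
	"smooth_step x = flat 0 x / (flat 0 x + flat 0 (1 - x))"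

lemma sm_smooth_step:"smooth_on UNIV smooth_step"
proof -
	have "flat 0 x + flat 0 (1 - x) ~= 0" for x
	proof (cases "x <= 0")
	case True
	thus ?thesis by (simp add:flat_def)
	next
	case False
	hence "flat 0 x > 0" "flat 0 (1 - x) >= 0" by (auto simp:flat_def)
	thus ?thesis by linarith
	qed
	moreover have "smooth_on UNIV (%x. flat 0 (1 - x))"
	by (rule sm_compose[OF _ _ _ sm_flat]) (auto intro!:sm_diff sm_const sm_id)
	ultimately have "smooth_on UNIV (%x. flat 0 x / (flat 0 x + flat 0 (1 - x)))"
	by (intro sm_divide sm_add sm_flat) auto
	thus ?thesis by (simp add:smooth_step_def[abs_def])
qed

lemma smooth_step_simps:
	"x <= 0 ==> smooth_step x = 0" "x >= 1 ==> smooth_step x = 1"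
	by (auto simp:smooth_step_def flat_def)

lemma smooth_step_bounds:"0 <= smooth_step x" "smooth_step x <= 1"
proof -
	have "flat 0 x >= 0" "flat 0 (1 - x) >= 0" by (auto simp:flat_def)
	thus "0 <= smooth_step x" "smooth_step x <= 1"
	unfolding smooth_step_def by (auto intro!:divide_nonneg_nonneg divide_le_eq_1[THEN iffD2])
qed

text \<open>The squared distance divided by \<open>r\<^sup>2\<close> is 1 at radius \<open>r\<close>
  and 4 at radius \<open>2 * r\<close>, hence the shift by 1 and the division by 3: the function is
  1 on the ball of radius \<open>r\<close> and 0 outside the ball of radius
  \<open>2 * r\<close>.\<close>

definition bump :: "'v::euclidean_space => real => 'v => real" where
	"bump a r y = 1 - smooth_step (((y - a) \<bullet> (y - a) / r\<^sup>2 - 1) / 3)"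

lemma sm_bump:"smooth_on UNIV (bump a r)"
proof -
	have eq:"((y - a) \<bullet> (y - a) / r\<^sup>2 - 1) / 3 = (1 / (3 * r\<^sup>2)) *\<^sub>R ((y - a) \<bullet> (y - a)) - 1 / 3" for y
	by (simp add:field_simps)
	have "smooth_on UNIV (%y. 1 - smooth_step (((y - a) \<bullet> (y - a) / r\<^sup>2 - 1) / 3))"
	unfolding eq
	by (intro sm_diff sm_const sm_compose[OF _ _ _ sm_smooth_step]
	sm_scaleR sm_inner sm_id) auto
	thus ?thesis by (simp add:bump_def[abs_def])
qed

lemma bump_eq_1:"r > 0 ==> dist y a <= r ==> bump a r y = 1"
proof -
	assume "r > 0" "dist y a <= r"
	hence "(norm (y - a))\<^sup>2 <= r\<^sup>2" by (simp add:dist_norm power_mono)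
	thus ?thesis using \<open>r > 0\<close>
	by (simp add:bump_def power2_norm_eq_inner smooth_step_simps(1) field_simps)
qed

lemma bump_eq_0:"r > 0 ==> dist y a >= 2 * r ==> bump a r y = 0"
proof -
	assume "r > 0" "dist y a >= 2 * r"
	hence "(2 * r)\<^sup>2 <= (norm (y - a))\<^sup>2" by (intro power_mono) (auto simp:dist_norm)
	hence "((y - a) \<bullet> (y - a) / r\<^sup>2 - 1) / 3 >= 1" using \<open>r > 0\<close>
	by (simp add:power2_norm_eq_inner field_simps power_mult_distrib)
	thus ?thesis by (simp add:bump_def smooth_step_simps(2))
qed

lemma bump_bounds:"0 <= bump a r y" "bump a r y <= 1"
	by (auto simp:bump_def smooth_step_bounds)

section \<open>Inverse functions and second derivatives\<close>

lemma norm_linear_diff_le: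
	fixes f g :: "'a::euclidean_space => 'b::real_normed_vector"
	assumes "linear f" "linear g"
	shows "norm (f x - g x) <= norm x * (SUM i:Basis. norm (f i - g i))"
proof -
	have "f x - g x = (SUM i:Basis. (x \<bullet> i) *\<^sub>R (f i - g i))"
	using linear_sum_Basis[OF linear_compose_sub[OF assms],of x] by simp
	also have "norm ... <= (SUM i:Basis. norm x * norm (f i - g i))"
	by (intro sum_norm_le) (auto simp:mult_right_mono Basis_le_norm)
	finally show ?thesis by (simp add:sum_distrib_left)
qed

text \<open>A lower bound \<open>c\<close> for \<open>A p0\<close> survives as \<open>c / 2\<close>
  once \<open>A p\<close> is within \<open>c / 2\<close> of it. The inverses are thus uniformly
  bounded near \<open>p0\<close>, which is all that their continuity and differentiability
  require.\<close>

lemma inv_operator_bounded_near: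
	fixes A :: "'p::euclidean_space => 'e::euclidean_space => 'e"
	assumes "open S" "p0 : S" and lin:"!!p. p : S ==> linear (A p)" and bij:"!!p. p : S ==> bij (A p)"
	and cont:"!!v. continuous_on S (%p. A p v)"
	obtains C where "C > 0" "\<forall>\<^sub>F p in at p0. p : S & (ALL y. norm (inv (A p) y) <= C * norm y)"
proof -
	obtain c where c:"c > 0" "!!x. c * norm x <= norm (A p0 x)"
	using linear_inj_bounded_below_pos[OF lin[OF assms(2)]] bij[OF assms(2)] bij_is_inj by metis
	define s where "s p = (SUM i:Basis. norm (A p i - A p0 i))" for p
	have "isCont (%p. A p v) p0" for v
	using cont assms(1,2) continuous_on_eq_continuous_at by blast
	hence "(s \<longlongrightarrow> (SUM i:Basis. norm (A p0 i - A p0 i))) (at p0)"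
	unfolding s_def by (intro tendsto_sum tendsto_norm tendsto_diff tendsto_const) (simp add:isCont_def)
	hence "(s \<longlongrightarrow> 0) (at p0)" by simp
	hence "\<forall>\<^sub>F p in at p0. s p < c / 2"
	using c(1) order_tendstoD(2)[of s 0 "at p0" "c / 2"] by simp
	moreover have "\<forall>\<^sub>F p in at p0. p : S"
	using assms(1,2) by (simp add:eventually_at_topological) blast
	ultimately have "\<forall>\<^sub>F p in at p0. p : S & (ALL y. norm (inv (A p) y) <= (2 / c) * norm y)"
	proof eventually_elim
	case (elim p)
	have "norm (inv (A p) y) <= (2 / c) * norm y" for y
	proof -
	define x where "x = inv (A p) y"
	have y:"A p x = y" unfolding x_def using bij[OF elim(2)] by (simp add:bij_is_surj surj_f_inv_f)
	have "norm (A p x - A p0 x) <= norm x * s p"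
	unfolding s_def by (rule norm_linear_diff_le[OF lin[OF elim(2)] lin[OF assms(2)]])
	also have "... <= norm x * (c / 2)" using elim(1) by (intro mult_left_mono) auto
	finally have "norm (A p x - A p0 x) <= norm x * (c / 2)" .
	hence "norm (A p0 x) - norm x * (c / 2) <= norm y"
	using norm_triangle_ineq3[of "A p x" "A p0 x"] y by simp
	hence "c * norm x - norm x * (c / 2) <= norm y" using c(2)[of x] by linarith
	thus ?thesis using c(1) unfolding x_def[symmetric] by (simp add:field_simps)
	qed
	thus ?case using elim(2) by blast
	qed
	thus thesis using c(1) by (intro that[of "2 / c"]) auto
qed

text \<open>With \<open>y = inv (A p0) w\<close>, the difference \<open>inv (A p) w - y\<close>
  equals \<open>inv (A p) (A p0 y - A p y)\<close>, and the inverses are bounded near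
  \<open>p0\<close>.\<close>

lemma cont_inv_operator:
	fixes A :: "'p::euclidean_space => 'e::euclidean_space => 'e"
	assumes "open S" and lin:"!!p. p : S ==> linear (A p)" and bij:"!!p. p : S ==> bij (A p)"
	and cont:"!!v. continuous_on S (%p. A p v)"
	shows "continuous_on S (%p. inv (A p) w)"
proof (rule continuous_at_imp_continuous_on,rule ballI)
	fix p0 assume p0:"p0 : S"
	obtain C where C:"C > 0" "\<forall>\<^sub>F p in at p0. p : S & (ALL y. norm (inv (A p) y) <= C * norm y)"
	by (rule inv_operator_bounded_near[OF assms(1) p0 lin bij cont])
	define y where "y = inv (A p0) w"
	have y:"A p0 y = w" unfolding y_def using bij[OF p0] by (simp add:bij_is_surj surj_f_inv_f)
	have "isCont (%p. A p y) p0"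
	using cont assms(1) p0 continuous_on_eq_continuous_at by blast
	hence "((%p. C * norm (A p0 y - A p y)) \<longlongrightarrow> C * norm (A p0 y - A p0 y)) (at p0)"
	by (intro tendsto_mult tendsto_norm tendsto_diff tendsto_const) (simp add:isCont_def)
	hence "((%p. C * norm (A p0 y - A p y)) \<longlongrightarrow> 0) (at p0)" by simp
	moreover have "\<forall>\<^sub>F p in at p0. norm (inv (A p) w - y) <= C * norm (A p0 y - A p y)"
	using C(2)
	proof eventually_elim
	case (elim p)
	have l:"linear (inv (A p))" using lin bij elim by (simp add:bij_is_inj bij_is_surj inj_linear_imp_inv_linear)
	have "inv (A p) w - y = inv (A p) (A p0 y - A p y)"
	unfolding linear_diff[OF l] y using bij[of p] elim by (simp add:bij_is_inj)
	thus ?case using elim by simp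
	qed
	ultimately have "((%p. inv (A p) w - y) \<longlongrightarrow> 0) (at p0)"
	by (rule Lim_null_comparison[rotated])
	thus "isCont (%p. inv (A p) w) p0"
	unfolding isCont_def y_def[symmetric] by (simp add:LIM_zero_iff)
qed

text \<open>The rule for differentiating an inverse matrix, in a form that asks for the derivative
  of \<open>A p\<close> on the one vector \<open>inv (A p0) w\<close> only.\<close>

lemma inv_operator_has_derivative:
	fixes A :: "'p::euclidean_space => 'e::euclidean_space => 'e"
	assumes "open S" "p0 : S" and lin:"!!p. p : S ==> linear (A p)" and bij:"!!p. p : S ==> bij (A p)"
	and cont:"!!v. continuous_on S (%p. A p v)"
	and d:"((%p. A p (inv (A p0) w)) has_derivative d) (at p0)"
	shows "((%p. inv (A p) w) has_derivative (%h. - inv (A p0) (d h))) (at p0)"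
proof -
	obtain C where C:"C > 0" "\<forall>\<^sub>F p in at p0. p : S & (ALL y. norm (inv (A p) y) <= C * norm y)"
	by (rule inv_operator_bounded_near[OF assms(1,2) lin bij cont])
	define y where "y = inv (A p0) w"
	define r where "r p = A p y - A p0 y - d (p - p0)" for p
	have linv:"linear (inv (A p))" if "p : S" for p
	using lin[OF that] bij[OF that] by (simp add:bij_is_inj bij_is_surj inj_linear_imp_inv_linear)
	have y:"A p0 y = w" unfolding y_def using bij[OF assms(2)] by (simp add:bij_is_surj surj_f_inv_f)
	have bl:"bounded_linear d" using d has_derivative_bounded_linear by blast
	obtain K where K:"K > 0" "!!h. norm (d h) <= K * norm h"
	using bounded_linear.pos_bounded[OF bl] by (metis mult.commute)
	have r:"((%p. norm (r p) / norm (p - p0)) \<longlongrightarrow> 0) (at p0)"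
	using d unfolding has_derivative_iff_norm r_def y_def by simp
	define s where "s p = (SUM i:Basis. norm (inv (A p) i - inv (A p0) i))" for p
	have "isCont (%p. inv (A p) v) p0" for v
	using cont_inv_operator[OF assms(1) lin bij cont] assms(1,2) continuous_on_eq_continuous_at by blast
	hence "(s \<longlongrightarrow> (SUM i:Basis. norm (inv (A p0) i - inv (A p0) i))) (at p0)"
	unfolding s_def by (intro tendsto_sum tendsto_norm tendsto_diff tendsto_const) (simp add:isCont_def)
	hence s:"(s \<longlongrightarrow> 0) (at p0)" by simp
	have lim:"((%p. C * (norm (r p) / norm (p - p0)) + K * s p) \<longlongrightarrow> 0) (at p0)"
	using tendsto_add[OF tendsto_mult[OF tendsto_const[of C] r] tendsto_mult[OF tendsto_const[of K] s]] by simp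
	have "\<forall>\<^sub>F p in at p0. p ~= p0" by (simp add:eventually_at_topological) auto
	hence "\<forall>\<^sub>F p in at p0. norm (norm (inv (A p) w - inv (A p0) w - (- inv (A p0) (d (p - p0)))) / norm (p - p0))
	<= C * (norm (r p) / norm (p - p0)) + K * s p"
	using C(2)
	proof eventually_elim
	case (elim p)
	have pS:"p : S" using elim by blast
	define h where "h = p - p0"
	have h:"norm h > 0" using elim by (simp add:h_def)
	have ipy:"inv (A p) (A p y) = y" using bij[OF pS] by (simp add:bij_is_inj)
	have Apy:"A p y = w + r p + d h" using y by (simp add:r_def h_def)
	have e:"inv (A p) w = y - inv (A p) (r p) - inv (A p) (d h)"
	using ipy unfolding Apy linear_add[OF linv[OF pS]] by (simp add:algebra_simps)
	have "inv (A p) w - inv (A p0) w - (- inv (A p0) (d h)) =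
	- inv (A p) (r p) - (inv (A p) (d h) - inv (A p0) (d h))"
	unfolding e y_def[symmetric] by (simp add:algebra_simps)
	also have "norm ... <= norm (inv (A p) (r p)) + norm (inv (A p) (d h) - inv (A p0) (d h))"
	using norm_triangle_ineq4[of "- inv (A p) (r p)" "inv (A p) (d h) - inv (A p0) (d h)"] by simp
	also have "... <= C * norm (r p) + norm (d h) * s p"
	unfolding s_def using elim norm_linear_diff_le[OF linv[OF pS] linv[OF assms(2)],of "d h"]
	by (intro add_mono) blast+
	also have "... <= C * norm (r p) + (K * norm h) * s p"
	using K(2)[of h] by (intro add_mono mult_right_mono) (auto simp:s_def sum_nonneg)
	finally show ?case using h unfolding h_def[symmetric]
	by (simp add:field_simps)
	qed
	hence "((%p. norm (inv (A p) w - inv (A p0) w - (- inv (A p0) (d (p - p0)))) / norm (p - p0)) \<longlongrightarrow> 0) (at p0)"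
	using lim by (rule Lim_null_comparison)
	moreover have "bounded_linear (%h. - inv (A p0) (d h))"
	using bounded_linear_compose[OF _ bl] linv[OF assms(2)] linear_conv_bounded_linear
	by (intro bounded_linear_minus) blast
	ultimately show ?thesis unfolding has_derivative_iff_norm by simp
qed

lemma Ck_on_inv_operator:
	fixes A :: "'p::euclidean_space => 'e::euclidean_space => 'e"
	assumes "open S" and lin:"!!p. p : S ==> linear (A p)" and bij:"!!p. p : S ==> bij (A p)"
	and "!!v. Ck_on k S (%p. A p v)"
	shows "Ck_on k S (%p. inv (A p) w)"
	using assms(4)
proof (induction k arbitrary: w)
	case 0
	thus ?case using cont_inv_operator[OF assms(1) lin bij] by simp
next
	case (Suc k)
	have C:"continuous_on S (%p. A p v)" for v using Suc.prems Ck_on_imp_continuous_on by blast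
	have dA:"((%p. A p y) has_derivative fder (%p. A p y) p0) (at p0)" if "p0 : S" for p0 y
	by (rule Ck_on_Suc_has_derivative[OF assms(1) Suc.prems that])
	have IH:"Ck_on k S (%p. inv (A p) w)" for w
	by (rule Suc.IH) (rule Ck_on_Suc_imp[OF Suc.prems])
	have linv:"linear (inv (A p))" if "p : S" for p
	using lin[OF that] bij[OF that] by (simp add:bij_is_inj bij_is_surj inj_linear_imp_inv_linear)
	show ?case
	proof (rule Ck_on_SucI[OF assms(1)])
	show "((%p. inv (A p) w) has_derivative (%h. - inv (A p0) (fder (%p. A p (inv (A p0) w)) p0 h))) (at p0)"
	if "p0 : S" for p0
	by (rule inv_operator_has_derivative[OF assms(1) that lin bij C dA[OF that]])
	fix v
	\<comment> \<open>Linearity in \<open>y\<close> has to be proved, since \<open>fder\<close> is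
	  taken separately for each fixed vector.\<close>
	define A' where "A' p y = fder (%p. A p y) p v" for p y
	have linA':"linear (A' p)" if p:"p : S" for p
	proof (rule linearI)
	fix a b :: 'e and c :: real
	have "((%q. A q (a + b)) has_derivative (%h. fder (%p. A p a) p h + fder (%p. A p b) p h)) (at p)"
	by (rule hd_transform[OF has_derivative_add[OF dA[OF p,of a] dA[OF p,of b]] assms(1) p])
	(simp add:linear_add[OF lin])
	from frechet_derivative_at[OF this] show "A' p (a + b) = A' p a + A' p b"
	unfolding A'_def by metis
	have "((%q. A q (c *\<^sub>R a)) has_derivative (%h. c *\<^sub>R fder (%p. A p a) p h)) (at p)"
	by (rule hd_transform[OF has_derivative_scaleR_right[OF dA[OF p,of a]] assms(1) p])
	(simp add:linear_scale[OF lin])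
	from frechet_derivative_at[OF this] show "A' p (c *\<^sub>R a) = c *\<^sub>R A' p a"
	unfolding A'_def by metis
	qed
	have "Ck_on k S (%p. A' p y)" for y using Suc.prems[of y] unfolding A'_def by simp
	hence "Ck_on k S (%p. A' p (inv (A p) w))"
	by (intro Ck_on_apply_linear[of S A' k "%p. inv (A p) w",OF assms(1) linA'] IH)
	hence "Ck_on k S (%p. inv (A p) (A' p (inv (A p) w)))"
	by (intro Ck_on_apply_linear[of S "%p. inv (A p)" k "%p. A' p (inv (A p) w)"] assms(1) linv IH)
	from Ck_on_compose[OF assms(1) open_UNIV this Ck_on_linear[of uminus]]
	show "Ck_on k S (%x. - inv (A x) (fder (%p. A p (inv (A x) w)) x v))"
	unfolding A'_def by (simp add:linear_uminus module_hom_uminus linear_iff)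
	qed
qed

lemma sm_inv_operator:
	fixes A :: "'p::euclidean_space => 'e::euclidean_space => 'e"
	assumes "open S" "!!p. p : S ==> linear (A p)" "!!p. p : S ==> bij (A p)" "!!v. smooth_on S (%p. A p v)"
	shows "smooth_on S (%p. inv (A p) w)"
	unfolding smooth_on_def
	by (rule allI,rule Ck_on_inv_operator[OF assms(1-3)]) (use assms(4) in \<open>simp_all add:smooth_on_def\<close>)

text \<open>The C1 inverse function theorem gives \<open>g' y = inv (fder f (g y))\<close>; this
  formula gains one derivative of \<open>g\<close> at each step of the bootstrapping.\<close>

lemma smooth_inverse_function:
	fixes f :: "'e::euclidean_space => 'e"
	assumes "open U" "smooth_on U f" "x0 : U" "inj (fder f x0)"
	obtains U' V g where "open U'" "U' \<subseteq> U" "x0 : U'" "open V" "f x0 : V" "homeomorphism U' V f g"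
	"smooth_on V g" "!!x. x : U' ==> bij (fder f x)"
proof -
	define f' where "f' x = Blinfun (fder f x)" for x
	have bl:"bounded_linear (fder f x)" if "x : U" for x
	using sm_hd[OF assms(1,2) that] has_derivative_bounded_linear by blast
	have f':"blinfun_apply (f' x) = fder f x" if "x : U" for x
	unfolding f'_def by (rule bounded_linear_Blinfun_apply[OF bl[OF that]])
	have der:"(f has_derivative blinfun_apply (f' x)) (at x)" if "x : U" for x
	using sm_hd[OF assms(1,2) that] f'[OF that] by simp
	have cont:"continuous_on U f'"
	proof (rule continuous_on_blinfun_componentwise)
	fix i :: 'e
	show "continuous_on U (%x. f' x i)"
	using sm_cont[OF sm_fder[OF assms(2),of i]] f' continuous_on_cong by fastforce
	qed
	have b:"bij (fder f x0)"
	using assms(4) linear_injective_imp_surjective[OF sm_linear_fder[OF assms(1-3)] assms(4)]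
	by (simp add:bij_def)
	have bli:"bounded_linear (inv (fder f x0))"
	using inj_linear_imp_inv_linear[OF sm_linear_fder[OF assms(1-3)]] assms(4)
	by (simp add:linear_conv_bounded_linear)
	have invf:"Blinfun (inv (fder f x0)) o\<^sub>L f' x0 = id_blinfun"
	by (rule blinfun_eqI) (simp add:bounded_linear_Blinfun_apply[OF bli] f'[OF assms(3)] assms(4))
	show thesis
	proof (rule inverse_function_theorem[OF assms(1) der cont assms(3) invf])
	fix U' V g g'
	assume *: "open U'" "U' \<subseteq> U" "x0 : U'" "open V" "f x0 : V" "homeomorphism U' V f g"
	"!!y. y : V ==> (g has_derivative (g' y)) (at y)"
	"!!y. y : V ==> g' y = inv (blinfun_apply (f'(g y)))"
	"!!y. y : V ==> bij (blinfun_apply (f'(g y)))"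
	have gV:"g ` V = U'" using *(6) by (simp add:homeomorphism_def)
	hence gU:"g y : U" if "y : V" for y using that *(2) by blast
	have bij:"bij (fder f (g y))" if "y : V" for y using *(9)[OF that] f'[OF gU[OF that]] by simp
	have "smooth_on V g"
	proof (rule smooth_onI_derivative[OF *(4,7)])
	fix k v assume k:"Ck_on k V g"
	have "Ck_on k V (%y. fder f (g y) w)" for w
	using Ck_on_compose[OF *(4) assms(1) k,of "%x. fder f x w"] sm_fder[OF assms(2),of w] gU
	by (auto simp:smooth_on_def)
	hence "Ck_on k V (%y. inv (fder f (g y)) v)"
	by (intro Ck_on_inv_operator[OF *(4) _ bij]) (auto intro:sm_linear_fder[OF assms(1,2)] gU)
	thus "Ck_on k V (%y. g' y v)"
	by (rule Ck_on_cong[OF *(4),rotated]) (simp add:*(8) f' gU)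
	qed
	moreover have "bij (fder f x)" if "x : U'" for x
	using bij[of "f x"] that *(6) by (auto simp:homeomorphism_def)
	ultimately show thesis by (rule that[OF *(1-6)])
	qed
qed

section \<open>Uniform bounds on compact sets\<close>

lemma fder_bounded_on_compact:
	assumes "open S" "smooth_on S f" "compact K" "K \<subseteq> S"
	obtains B where "B > 0" "!!x v. x : K ==> norm (fder f x v) <= B * norm v"
proof -
	have "EX b. ALL x:K. norm (fder f x i) <= b" for i
	proof -
	have "compact ((%x. fder f x i) ` K)"
	using compact_continuous_image[OF continuous_on_subset[OF sm_cont[OF sm_fder[OF assms(2)]] assms(4)] assms(3)] .
	hence "bounded ((%x. fder f x i) ` K)" by (rule compact_imp_bounded)
	thus ?thesis unfolding bounded_iff by auto
	qed
	then obtain b where b:"!!i x. x : K ==> norm (fder f x i) <= b i" by metis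
	define B where "B = (SUM i:Basis. \<bar>b i\<bar>) + 1"
	have "norm (fder f x v) <= B * norm v" if x:"x : K" for x v
	proof -
	have "norm (fder f x v) <= norm v * (SUM i:Basis. norm (fder f x i))"
	using norm_linear_diff_le[OF sm_linear_fder[OF assms(1,2)] linear_zero,of x v] x assms(4) by auto
	also have "... <= norm v * B"
	proof -
	have "(SUM i:Basis. norm (fder f x i)) <= (SUM i:Basis. \<bar>b i\<bar>)"
	by (rule sum_mono) (use b[OF x] in \<open>metis abs_ge_self order_trans\<close>)
	thus ?thesis unfolding B_def by (intro mult_left_mono) auto
	qed
	finally show ?thesis by (simp add:mult.commute)
	qed
	moreover have "B > 0" unfolding B_def by (simp add:add_nonneg_pos sum_nonneg)
	ultimately show thesis using that by blast
qed

lemma Lipschitz_on_convex_compact: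
	assumes "open S" "smooth_on S f" "compact K" "convex K" "K \<subseteq> S"
	obtains B where "B > 0" "!!x y. x : K ==> y : K ==> norm (f x - f y) <= B * norm (x - y)"
proof -
	obtain B where B:"B > 0" "!!x v. x : K ==> norm (fder f x v) <= B * norm v"
	by (rule fder_bounded_on_compact[OF assms(1,2,3,5)]) (rule that; blast)
	have "norm (f x - f y) <= B * norm (x - y)" if "x : K" "y : K" for x y
	proof (rule differentiable_bound[OF assms(4) _ _ that])
	show "(f has_derivative fder f x) (at x within K)" if "x : K" for x
	using sm_hd[OF assms(1,2)] that assms(5) has_derivative_at_withinI by blast
	show "onorm (fder f x) <= B" if "x : K" for x
	using B that by (intro onorm_bound) auto
	qed
	thus thesis using that B(1) by blast
qed

text \<open>Off \<open>C\<close> the derivative vanishes as well, the complement of a compact set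
  being open, so bounds on \<open>C\<close> are global. A single \<open>B\<close> serves the field,
  its derivative and its Lipschitz constant, so that one rescaling makes all three small.\<close>

lemma compact_support_bounds:
	assumes "smooth_on UNIV W" "compact C" "!!x. x ~: C ==> W x = 0"
	obtains B where "B > 0" "!!x. norm (W x) <= B" "!!x v. norm (fder W x v) <= B * norm v"
	"!!x y. norm (W x - W y) <= B * norm (x - y)"
proof -
	have 0:"fder W x v = 0" if "x ~: C" for x v
	proof -
	have "open (- C)" using assms(2) compact_imp_closed by auto
	hence "(W has_derivative (%_. 0)) (at x)"
	by (rule hd_transform[OF has_derivative_const[of 0]]) (use that assms(3) in auto)
	from frechet_derivative_at[OF this] show ?thesis by metis
	qed
	obtain B where B:"B > 0" "!!x v. x : C ==> norm (fder W x v) <= B * norm v"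
	by (rule fder_bounded_on_compact[OF open_UNIV assms(1,2) subset_UNIV]) (rule that; blast)
	have B2:"norm (fder W x v) <= B * norm v" for x v
	using B 0 by (cases "x : C") auto
	have L:"norm (W x - W y) <= B * norm (x - y)" for x y
	proof (rule differentiable_bound[OF convex_UNIV])
	show "(W has_derivative fder W x) (at x)" for x
	by (rule sm_hd[OF open_UNIV assms(1)]) auto
	show "onorm (fder W x) <= B" for x using B2 B(1) by (intro onorm_bound) auto
	qed auto
	have "bounded (W ` C)"
	using compact_continuous_image[OF continuous_on_subset[OF sm_cont[OF assms(1)]] assms(2)]
	compact_imp_bounded by blast
	then obtain b where b:"!!x. x : C ==> norm (W x) <= b" unfolding bounded_iff by auto
	define B' where "B' = max B \<bar>b\<bar>"
	have "B <= B'" by (simp add:B'_def)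
	have "norm (W x) <= B'" for x
	using b[of x] B(1) assms(3)[of x] by (cases "x : C") (auto simp:B'_def)
	moreover have "norm (fder W x v) <= B' * norm v" for x v
	using B2[of x v] mult_right_mono[OF \<open>B <= B'\<close>,of "norm v"] by simp
	moreover have "norm (W x - W y) <= B' * norm (x - y)" for x y
	using L[of x y] mult_right_mono[OF \<open>B <= B'\<close>,of "norm (x - y)"] by simp
	ultimately show thesis using that[of B'] B(1) \<open>B <= B'\<close> by simp
qed

section \<open>Chain rule for curves, symmetry of second derivatives, pullback of closed
  forms\<close>

lemma has_vector_derivative_chain:
	assumes "(c has_vector_derivative c') (at t within I)" "(h has_derivative h') (at (c t))"
	shows "((%t. h (c t)) has_vector_derivative h' c') (at t within I)"
proof -
	have "((%t. h (c t)) has_derivative (%s. h' (s *\<^sub>R c'))) (at t within I)"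
	using has_derivative_compose[OF assms(1)[unfolded has_vector_derivative_def] assms(2)] .
	thus ?thesis
	using linear_scale[OF has_derivative_linear[OF assms(2)]] by (simp add:has_vector_derivative_def)
qed

lemma has_vector_derivative_line:
	"((%s. p + s *\<^sub>R u) has_vector_derivative u) (at s within I)"
	by (auto intro!:derivative_eq_intros)

text \<open>Two applications of the mean value theorem, first along \<open>u\<close> and then along
  \<open>v\<close>. The quotient is symmetric in \<open>u\<close> and \<open>v\<close>, which makes
  the mixed derivatives agree.\<close>

lemma second_difference_tendsto:
	fixes f :: "'e::euclidean_space => real"
	assumes "open S" "smooth_on S f" "x : S"
	shows "((%s. (f (x + s *\<^sub>R u + s *\<^sub>R v) - f (x + s *\<^sub>R u) - f (x + s *\<^sub>R v) + f x) / s\<^sup>2)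
	\<longlongrightarrow> fder (%y. fder f y u) x v) (at_right 0)"
proof (rule tendstoI)
	fix e :: real assume "e > 0"
	define g where "g y = fder (%y. fder f y u) y v" for y
	have sg:"smooth_on S (%y. fder f y u)" by (rule sm_fder[OF assms(2)])
	have "isCont g x"
	using sm_cont[OF sm_fder[OF sg,of v]] assms(1,3)
	unfolding g_def by (simp add:continuous_on_eq_continuous_at)
	then obtain d1 where d1:"d1 > 0" "!!y. dist y x < d1 ==> dist (g y) (g x) < e"
	using \<open>e > 0\<close> unfolding continuous_at_eps_delta by (metis)
	obtain d2 where d2:"d2 > 0" "!!y. dist y x < d2 ==> y : S"
	using assms(1,3) unfolding open_dist by blast
	define d where "d = min d1 d2"
	define r where "r = d / (norm u + norm v + 1)"
	have "r > 0" using d1 d2 by (simp add:r_def d_def add_nonneg_pos)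
	have near:"dist (x + a *\<^sub>R u + b *\<^sub>R v) x < d" if "0 <= a" "a <= s" "0 <= b" "b <= s" "s < r" for a b s
	proof -
	have "norm (a *\<^sub>R u + b *\<^sub>R v) <= a * norm u + b * norm v"
	using norm_triangle_ineq[of "a *\<^sub>R u" "b *\<^sub>R v"] that by simp
	also have "... <= s * (norm u + norm v + 1)"
	using mult_right_mono[OF that(2),of "norm u"] mult_right_mono[OF that(4),of "norm v"] that
	by (simp add:algebra_simps)
	also have "... < r * (norm u + norm v + 1)"
	using that by (intro mult_strict_right_mono) (auto simp:add_nonneg_pos)
	also have "... = d" by (simp add:r_def) (metis add_nonneg_pos norm_ge_zero add_nonneg_nonneg zero_less_one less_irrefl)
	finally show ?thesis by (simp add:dist_norm add.assoc)
	qed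
	have inS:"x + a *\<^sub>R u + b *\<^sub>R v : S" if "0 <= a" "a <= s" "0 <= b" "b <= s" "s < r" for a b s
	using near[OF that] d2(2) by (simp add:d_def)
	have "dist ((f (x + s *\<^sub>R u + s *\<^sub>R v) - f (x + s *\<^sub>R u) - f (x + s *\<^sub>R v) + f x) / s\<^sup>2) (g x) < e"
	if s:"0 < s" "s < r" for s
	proof -
	define ph where "ph a = f (x + s *\<^sub>R v + a *\<^sub>R u) - f (x + a *\<^sub>R u)" for a
	have "(ph has_real_derivative (fder f (x + s *\<^sub>R v + a *\<^sub>R u) u - fder f (x + a *\<^sub>R u) u)) (at a)"
	if "0 <= a" "a <= s" for a
	proof -
	have "x + s *\<^sub>R v + a *\<^sub>R u : S" "x + a *\<^sub>R u : S"
	using inS[of a s s] inS[of a s 0] that s by (auto simp:algebra_simps)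
	thus ?thesis unfolding ph_def
	using has_vector_derivative_chain[OF has_vector_derivative_line sm_hd[OF assms(1,2)]]
	by (intro DERIV_diff) (simp_all add:has_real_derivative_iff_has_vector_derivative)
	qed
	from MVT2[OF s(1) this] obtain a where a:"0 < a" "a < s"
	"ph s - ph 0 = s * (fder f (x + s *\<^sub>R v + a *\<^sub>R u) u - fder f (x + a *\<^sub>R u) u)" by auto
	define ps where "ps b = fder f (x + a *\<^sub>R u + b *\<^sub>R v) u" for b
	have "(ps has_real_derivative g (x + a *\<^sub>R u + b *\<^sub>R v)) (at b)" if "0 <= b" "b <= s" for b
	using has_vector_derivative_chain[OF has_vector_derivative_line[of "x + a *\<^sub>R u" v b UNIV]
	sm_hd[OF assms(1) sg inS[of a s b]]] a s that
	unfolding ps_def g_def by (simp add:has_real_derivative_iff_has_vector_derivative)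
	from MVT2[OF s(1) this] obtain b where b:"0 < b" "b < s" "ps s - ps 0 = s * g (x + a *\<^sub>R u + b *\<^sub>R v)"
	by auto
	have e:"x + s *\<^sub>R v + a *\<^sub>R u = x + a *\<^sub>R u + s *\<^sub>R v" by (simp add:algebra_simps)
	have "ph s - ph 0 = s * (s * g (x + a *\<^sub>R u + b *\<^sub>R v))"
	using a(3) b(3) unfolding ps_def e by simp
	moreover have "f (x + s *\<^sub>R u + s *\<^sub>R v) - f (x + s *\<^sub>R u) - f (x + s *\<^sub>R v) + f x = ph s - ph 0"
	by (simp add:ph_def algebra_simps)
	ultimately have "(f (x + s *\<^sub>R u + s *\<^sub>R v) - f (x + s *\<^sub>R u) - f (x + s *\<^sub>R v) + f x) / s\<^sup>2
	= g (x + a *\<^sub>R u + b *\<^sub>R v)"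
	using s by (simp add:power2_eq_square)
	moreover have "dist (g (x + a *\<^sub>R u + b *\<^sub>R v)) (g x) < e"
	using near[of a s b] a b s by (intro d1(2)) (simp add:d_def)
	ultimately show ?thesis by simp
	qed
	thus "\<forall>\<^sub>F s in at_right 0. dist ((f (x + s *\<^sub>R u + s *\<^sub>R v) - f (x + s *\<^sub>R u) - f (x + s *\<^sub>R v) + f x) / s\<^sup>2)
	(fder (%y. fder f y u) x v) < e"
	unfolding g_def by (intro eventually_at_rightI[OF _ \<open>r > 0\<close>]) auto
qed

lemma fder_inner:
	assumes "open S" "smooth_on S f" "x : S"
	shows "fder (%y. f y \<bullet> c) x v = fder f x v \<bullet> c"
	using frechet_derivative_at[OF has_derivative_inner_left[OF sm_hd[OF assms]]] by metis

lemma symmetric_second_derivative: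
	assumes "open S" "smooth_on S f" "x : S"
	shows "fder (%y. fder f y u) x v = fder (%y. fder f y v) x u"
proof (rule euclidean_eqI)
	\<comment> \<open>The mean value theorem is one for real functions, hence the passage to
	  components.\<close>
	fix i :: 'b assume "i : Basis"
	define g where "g y = f y \<bullet> i" for y
	have sg:"smooth_on S g" unfolding g_def by (intro sm_inner assms sm_const)
	have "fder (%y. fder g y u) x v = fder (%y. fder f y u) x v \<bullet> i" for u v
	proof -
	have "((%y. fder f y u \<bullet> i) has_derivative (%h. fder (%y. fder f y u) x h \<bullet> i)) (at x)"
	by (intro has_derivative_inner_left sm_hd[OF assms(1) sm_fder[OF assms(2)] assms(3)])
	hence "((%y. fder g y u) has_derivative (%h. fder (%y. fder f y u) x h \<bullet> i)) (at x)"
	by (rule hd_transform[OF _ assms(1,3)])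
	(simp add:g_def[abs_def] fder_inner[OF assms(1,2)])
	from frechet_derivative_at[OF this] show ?thesis by metis
	qed
	moreover have "fder (%y. fder g y u) x v = fder (%y. fder g y v) x u"
	proof (rule tendsto_unique[OF _ second_difference_tendsto[OF assms(1) sg assms(3),of u v]])
	show "((%s. (g (x + s *\<^sub>R u + s *\<^sub>R v) - g (x + s *\<^sub>R u) - g (x + s *\<^sub>R v) + g x) / s\<^sup>2)
	\<longlongrightarrow> fder (%y. fder g y v) x u) (at_right 0)"
	using second_difference_tendsto[OF assms(1) sg assms(3),of v u]
	by (simp add:algebra_simps)
	qed simp
	ultimately show "fder (%y. fder f y u) x v \<bullet> i = fder (%y. fder f y v) x u \<bullet> i" by metis
qed

lemma bilinear_sum_Basis:
	fixes w :: "'a::euclidean_space => 'b::euclidean_space => 'c::real_vector"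
	assumes "bilinear w"
	shows "w x y = (SUM i:Basis. SUM j:Basis. ((x \<bullet> i) * (y \<bullet> j)) *\<^sub>R w i j)"
proof -
	have l:"linear (%x. w x b)" for b using assms by (simp add:bilinear_def)
	have r:"linear (w a)" for a using assms by (simp add:bilinear_def)
	have "w i y = (SUM j:Basis. (y \<bullet> j) *\<^sub>R w i j)" for i by (rule linear_sum_Basis[OF r])
	hence "(SUM i:Basis. (x \<bullet> i) *\<^sub>R w i y) = (SUM i:Basis. (x \<bullet> i) *\<^sub>R (SUM j:Basis. (y \<bullet> j) *\<^sub>R w i j))"
	by simp
	with linear_sum_Basis[OF l[of y],of x] show ?thesis by (simp add:scaleR_sum_right)
qed

text \<open>The derivative \<open>w' a b\<close> is given separately for each pair of constant
  vectors; its bilinear expansion (\<open>fixed\<close>) is obtained from uniqueness of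
  derivatives.\<close>

lemma has_derivative_bilinear_family:
	fixes w :: "'p::euclidean_space => 'a::euclidean_space => 'b::euclidean_space => real"
	assumes "open S" "p : S" and bil:"!!q. q : S ==> bilinear (w q)"
	and w':"!!a b. ((%q. w q a b) has_derivative w' a b) (at p)"
	and X:"(X has_derivative X') (at p)" and Y:"(Y has_derivative Y') (at p)"
	shows "((%q. w q (X q) (Y q)) has_derivative
	(%h. w' (X p) (Y p) h + w p (X' h) (Y p) + w p (X p) (Y' h))) (at p)"
proof -
	define x where "x = X p" define y where "y = Y p"
	have fixed:"w' x y h = (SUM i:Basis. SUM j:Basis. ((x \<bullet> i) * (y \<bullet> j)) * w' i j h)" for h
	proof -
	have "((%q. SUM i:Basis. SUM j:Basis. ((x \<bullet> i) * (y \<bullet> j)) * w q i j) has_derivative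
	(%h. SUM i:Basis. SUM j:Basis. ((x \<bullet> i) * (y \<bullet> j)) * w' i j h)) (at p)"
	by (intro has_derivative_sum has_derivative_mult_right w')
	hence "((%q. w q x y) has_derivative
	(%h. SUM i:Basis. SUM j:Basis. ((x \<bullet> i) * (y \<bullet> j)) * w' i j h)) (at p)"
	by (rule hd_transform[OF _ assms(1,2)])
	(use bilinear_sum_Basis[OF bil] in \<open>simp add:scaleR_conv_of_real\<close>)
	from fun_cong[OF has_derivative_unique[OF w' this],of h] show ?thesis .
	qed
	have "((%q. SUM i:Basis. SUM j:Basis. ((X q \<bullet> i) * (Y q \<bullet> j)) * w q i j) has_derivative
	(%h. SUM i:Basis. SUM j:Basis. ((X p \<bullet> i) * (Y p \<bullet> j)) * w' i j h +
	((X p \<bullet> i) * (Y' h \<bullet> j) + (X' h \<bullet> i) * (Y p \<bullet> j)) * w p i j)) (at p)"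
	by (intro has_derivative_sum has_derivative_mult has_derivative_inner_left X Y w')
	hence "((%q. w q (X q) (Y q)) has_derivative
	(%h. SUM i:Basis. SUM j:Basis. ((X p \<bullet> i) * (Y p \<bullet> j)) * w' i j h +
	((X p \<bullet> i) * (Y' h \<bullet> j) + (X' h \<bullet> i) * (Y p \<bullet> j)) * w p i j)) (at p)"
	by (rule hd_transform[OF _ assms(1,2)])
	(use bilinear_sum_Basis[OF bil] in \<open>simp add:scaleR_conv_of_real\<close>)
	moreover have "(SUM i:Basis. SUM j:Basis. ((X p \<bullet> i) * (Y p \<bullet> j)) * w' i j h +
	((X p \<bullet> i) * (Y' h \<bullet> j) + (X' h \<bullet> i) * (Y p \<bullet> j)) * w p i j)
	= w' (X p) (Y p) h + w p (X' h) (Y p) + w p (X p) (Y' h)" for h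
	unfolding fixed[unfolded x_def y_def] bilinear_sum_Basis[OF bil[OF assms(2)],of "X' h" "Y p"]
	bilinear_sum_Basis[OF bil[OF assms(2)],of "X p" "Y' h"]
	by (simp add:sum.distrib distrib_right)
	ultimately show ?thesis by simp
qed

text \<open>The terms with second derivatives of \<open>ta\<close> cancel in pairs, by antisymmetry
  of \<open>w\<close> and symmetry of \<open>H\<close>; what remains is closedness of
  \<open>w\<close> on the images of the three vectors. It carries closedness from the atlas to
  arbitrary smooth charts.\<close>

lemma closed_form_pullback:
	fixes w :: "'e::euclidean_space => 'e => 'e => real" and ta :: "'f::euclidean_space => 'e"
	assumes "open S" "open T" "smooth_on S ta" "ta ` S \<subseteq> T"
	and bil:"!!q. q : T ==> bilinear (w q)" and alt:"!!q v. q : T ==> w q v v = 0"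
	and smooth:"!!a b. smooth_on T (%q. w q a b)"
	and closed:"!!q u v x. q : T ==> fder (%q. w q v x) q u + fder (%q. w q x u) q v + fder (%q. w q u v) q x = 0"
	and si:"!!p a b. p : S ==> si p a b = w (ta p) (fder ta p a) (fder ta p b)" and "p : S"
	shows "fder (%q. si q b c) p a + fder (%q. si q c a) p b + fder (%q. si q a b) p c = 0"
proof -
	define D where "D = fder ta p"
	define H where "H a b = fder (%q. fder ta q a) p b" for a b
	have H:"H a b = H b a" for a b
	unfolding H_def by (rule symmetric_second_derivative[OF assms(1,3) \<open>p : S\<close>])
	have tap:"ta p : T" using assms(4) \<open>p : S\<close> by blast
	have anti:"w (ta p) x y = - w (ta p) y x" for x y
	proof -
	have "w (ta p) (x + y) (x + y) = 0" by (rule alt[OF tap])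
	thus ?thesis using alt[OF tap,of x] alt[OF tap,of y]
	by (simp add:bilinear_ladd[OF bil[OF tap]] bilinear_radd[OF bil[OF tap]])
	qed
	have key:"fder (%q. si q b c) p a = fder (%q. w q (D b) (D c)) (ta p) (D a) + w (ta p) (H b a) (D c) + w (ta p) (D b) (H c a)"
	for a b c
	proof -
	have "((%q. w (ta q) x y) has_derivative (%h. fder (%q. w q x y) (ta p) (D h))) (at p)" for x y
	unfolding D_def
	by (rule has_derivative_compose[OF sm_hd[OF assms(1,3) \<open>p : S\<close>]
	sm_hd[OF assms(2) smooth tap]])
	moreover have "((%q. fder ta q v) has_derivative H v) (at p)" for v
	using sm_hd[OF assms(1) sm_fder[OF assms(3),of v] \<open>p : S\<close>]
	by (simp add:H_def[abs_def])
	ultimately have "((%q. w (ta q) (fder ta q b) (fder ta q c)) has_derivative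
	(%h. fder (%q. w q (fder ta p b) (fder ta p c)) (ta p) (D h) + w (ta p) (H b h) (fder ta p c) + w (ta p) (fder ta p b) (H c h))) (at p)"
	by (intro has_derivative_bilinear_family[OF assms(1) \<open>p : S\<close>]) (use bil assms(4) in auto)
	hence "((%q. si q b c) has_derivative
	(%h. fder (%q. w q (fder ta p b) (fder ta p c)) (ta p) (D h) + w (ta p) (H b h) (fder ta p c) + w (ta p) (fder ta p b) (H c h))) (at p)"
	by (rule hd_transform[OF _ assms(1) \<open>p : S\<close>]) (simp add:si)
	from fder_eq[OF this,of a] show ?thesis unfolding D_def[symmetric] by simp
	qed
	show ?thesis
	unfolding key using closed[OF tap,of "D b" "D c" "D a"]
	anti[of "D b" "H c a"] anti[of "D c" "H a b"] anti[of "D a" "H b c"] H[of a b] H[of b c] H[of c a]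
	by simp
qed

section \<open>Ordinary differential equations with a small Lipschitz constant\<close>

text \<open>Picard iteration. The integral runs from -1, so \<open>J z 0\<close> is subtracted; on
  an interval of length 3 each of the two terms contracts by \<open>3 * K\<close>, and
  \<open>6 * K \<le> 1 / 2\<close> is where 1/12 comes from. The interval from -1 to 2 contains
  {0..1} in its interior and leaves room for flowing backwards by time 1.\<close>

lemma ode_exists:
	fixes W :: "real => 'v::euclidean_space => 'v"
	assumes cont:"continuous_on ({-1..2} \<times> UNIV) (%(t,y). W t y)"
	and Lip:"!!t y z. t : {-1..2} ==> norm (W t y - W t z) <= K * norm (y - z)" and K:"0 <= K" "K <= 1/12"
	shows "EX y. y 0 = x & (ALL t:{-1..2}. (y has_vector_derivative W t (y t)) (at t within {-1..2}))"
proof -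
	define J where "J z t = integral {-1..t} (%s. W s (z s))" for z :: "real => 'v" and t
	\<comment> \<open>Clamping the time lets the iteration act on the complete space of bounded
	  continuous functions on the whole line.\<close>
	define cl :: "real => real" where "cl t = max (-1) (min 2 t)" for t
	have cl:"cl t : {-1..2}" "t : {-1..2} ==> cl t = t" for t by (auto simp:cl_def)
	define F where "F z t = x + J z (cl t) - J z 0" for z t
	have cW:"continuous_on {-1..2} (%s. W s (z s))" if "continuous_on {-1..2} z" for z
	proof -
	have "continuous_on {-1..2} (%s. (s,z s))" by (intro continuous_intros that)
	from continuous_on_compose2[OF cont this] show ?thesis by auto
	qed
	have cJ:"continuous_on {-1..2} (J z)" if "continuous_on {-1..2} z" for z
	unfolding J_def using indefinite_integral_continuous_1[OF integrable_continuous_real[OF cW[OF that]]] .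
	have FB:"F z : bcontfun" if z:"continuous_on {-1..2} z" for z
	proof -
	have "compact (J z ` {-1..2})" using compact_continuous_image[OF cJ[OF z]] by simp
	hence "bounded (J z ` {-1..2})" by (rule compact_imp_bounded)
	then obtain b where "ALL y:J z ` {-1..2}. norm y <= b" unfolding bounded_iff by blast
	hence b:"norm (J z t) <= b" if "t : {-1..2}" for t using that by blast
	show ?thesis
	proof (rule bcontfun_normI)
	show "continuous_on UNIV (F z)"
	proof -
	have "continuous_on UNIV cl" unfolding cl_def[abs_def] by (intro continuous_intros)
	hence "continuous_on UNIV (%t. J z (cl t))"
	by (rule continuous_on_compose2[OF cJ[OF z]]) (use cl in blast)
	thus ?thesis unfolding F_def[abs_def] by (intro continuous_intros)
	qed
	show "norm (F z t) <= norm x + b + norm (J z 0)" for t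
	unfolding F_def using norm_triangle_ineq4[of "x + J z (cl t)" "J z 0"]
	norm_triangle_ineq[of x "J z (cl t)"] b[OF cl(1),of t] by linarith
	qed
	qed
	define \<F> where "\<F> z = Bcontfun (F (apply_bcontfun z))" for z
	have app:"apply_bcontfun (\<F> z) = F (apply_bcontfun z)" for z
	unfolding \<F>_def by (intro Bcontfun_inverse FB) simp
	have "dist (\<F> z) (\<F> w) <= (1/2) * dist z w" for z w
	proof (rule dist_bound)
	fix t
	have c:"continuous_on {-1..2} (apply_bcontfun z)" "continuous_on {-1..2} (apply_bcontfun w)" by auto
	have *: "norm (J z s - J w s) <= 3 * K * dist z w" if s:"s : {-1..2}" for s
	proof -
	have c':"continuous_on {-1..s} (%s. W s (z s))" "continuous_on {-1..s} (%s. W s (w s))"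
	using cW[OF c(1)] cW[OF c(2)] s by (auto elim: continuous_on_subset)
	have "norm (integral {-1..s} (%s. W s (z s) - W s (w s))) <= (K * dist z w) * (s - (-1))"
	proof (rule integral_bound)
	fix r assume "r : {-1..s}"
	hence "norm (W r (z r) - W r (w r)) <= K * norm (z r - w r)" using s by (intro Lip) auto
	also have "... <= K * dist z w" using K(1) dist_bounded[of z r w]
	by (intro mult_left_mono) (auto simp:dist_norm)
	finally show "norm (W r (z r) - W r (w r)) <= K * dist z w" .
	qed (use s c' in \<open>auto intro:continuous_on_diff\<close>)
	also have "... <= (K * dist z w) * 3" using s K(1) by (intro mult_left_mono) auto
	finally show ?thesis unfolding J_def
	by (subst Henstock_Kurzweil_Integration.integral_diff[symmetric])
	(auto intro!:integrable_continuous_real c' simp:algebra_simps)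
	qed
	have "dist (\<F> z t) (\<F> w t) = norm ((J z (cl t) - J w (cl t)) - (J z 0 - J w 0))"
	unfolding app F_def by (simp add:dist_norm algebra_simps)
	also have "... <= 6 * K * dist z w"
	using norm_triangle_ineq4[of "J z (cl t) - J w (cl t)" "J z 0 - J w 0"] *[OF cl(1),of t] *[of 0] by simp
	also have "... <= (1/2) * dist z w" using K by (intro mult_right_mono) auto
	finally show "dist (\<F> z t) (\<F> w t) <= (1/2) * dist z w" .
	qed
	then obtain z where z:"\<F> z = z" using banach_fix_type[of "1/2" \<F>] by auto
	have zt:"z t = F z t" for t using app[of z] unfolding z by metis
	have "(z has_vector_derivative W t (z t)) (at t within {-1..2})" if t:"t : {-1..2}" for t
	proof -
	have "(J z has_vector_derivative W t (z t)) (at t within {-1..2})"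
	unfolding J_def by (rule integral_has_vector_derivative[OF cW t]) simp
	hence "((%t. x + J z t - J z 0) has_vector_derivative W t (z t)) (at t within {-1..2})"
	by (auto intro!:derivative_eq_intros)
	thus ?thesis
	by (rule has_vector_derivative_transform[OF t,rotated]) (simp add:zt F_def cl(2))
	qed
	moreover have "z 0 = x" using zt[of 0] by (simp add:F_def cl(2))
	ultimately show ?thesis by (intro exI[of _ "apply_bcontfun z"]) simp
qed

lemma speed_bound:
	fixes y :: "real => 'v::real_normed_vector"
	assumes "!!t. t : {a..b} ==> (y has_vector_derivative y' t) (at t within {a..b})"
	and "!!t. t : {a..b} ==> norm (y' t) <= B" "s : {a..b}" "t : {a..b}"
	shows "norm (y s - y t) <= B * \<bar>s - t\<bar>"
proof -
	have "norm (y s - y t) <= B * norm (s - t)"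
	proof (rule differentiable_bound[OF convex_real_interval(5) _ _ assms(3,4)])
	show "(y has_derivative (%h. h *\<^sub>R y' x)) (at x within {a..b})" if "x : {a..b}" for x
	using assms(1)[OF that] by (simp add:has_vector_derivative_def)
	show "onorm (%h. h *\<^sub>R y' x) <= B" if "x : {a..b}" for x
	using assms(2)[OF that] onorm_bound[of B "%h. h *\<^sub>R y' x"] norm_ge_zero[of "y' x"]
	by (smt (verit,best) mult.commute mult_right_mono norm_ge_zero norm_scaleR onorm_bound real_norm_def)
	qed
	thus ?thesis by simp
qed

text \<open>At the time \<open>m\<close> at which the distance is largest, integration gives
  \<open>M - norm (d 0) \<le> (K * M + e) * 2 \<le> M / 6 + 2 * e\<close>, and \<open>M / 6\<close>
  is absorbed on the left; 2 and 3 are rounded constants. Uniqueness, Lipschitz dependence,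
  displacement and differentiability of the flow are all instances, with a suitable comparison curve
  \<open>z\<close>.\<close>

lemma ode_stability:
	fixes W :: "real => 'v::euclidean_space => 'v"
	assumes ab:"a <= 0" "0 <= b" "-1 <= a" "b <= 2"
	and Lip:"!!t y z. t : {a..b} ==> norm (W t y - W t z) <= K * norm (y - z)" and K:"0 <= K" "K <= 1/12"
	and y:"!!t. t : {a..b} ==> (y has_vector_derivative W t (y t)) (at t within {a..b})"
	and z:"!!t. t : {a..b} ==> (z has_vector_derivative g t) (at t within {a..b})"
	and g:"!!t. t : {a..b} ==> norm (W t (z t) - g t) <= e" and "t : {a..b}"
	shows "norm (y t - z t) <= 2 * norm (y 0 - z 0) + 3 * e"
proof -
	define d where "d t = y t - z t" for t
	have d:"(d has_vector_derivative (W t (y t) - g t)) (at t within {a..b})" if "t : {a..b}" for t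
	unfolding d_def by (intro has_vector_derivative_diff y z that)
	have "continuous_on {a..b} d"
	using d by (meson continuous_on_eq_continuous_within has_vector_derivative_continuous)
	hence "continuous_on {a..b} (%t. norm (d t))" by (intro continuous_intros)
	then obtain m where m:"m : {a..b}" "!!t. t : {a..b} ==> norm (d t) <= norm (d m)"
	using continuous_attains_sup[of "{a..b}" "%t. norm (d t)"] ab by auto
	have e:"e >= 0" using g[OF m(1)] norm_ge_zero order_trans by blast
	define M where "M = norm (d m)"
	have v:"norm (W t (y t) - g t) <= K * M + e" if t:"t : {a..b}" for t
	proof -
	have "norm (W t (y t) - g t) <= norm (W t (y t) - W t (z t)) + norm (W t (z t) - g t)"
	using norm_triangle_ineq[of "W t (y t) - W t (z t)" "W t (z t) - g t"] by simp
	also have "... <= K * norm (d t) + e" unfolding d_def using Lip[OF t] g[OF t] by (rule add_mono)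
	also have "... <= K * M + e" using m(2)[OF t] K(1) by (simp add:M_def mult_left_mono)
	finally show ?thesis .
	qed
	have "norm (d m - d 0) <= (K * M + e) * \<bar>m - 0\<bar>"
	by (rule speed_bound[OF d v m(1)]) (use ab in auto)
	also have "... <= (K * M + e) * 2"
	using m(1) ab K(1) e by (intro mult_left_mono) (auto simp:M_def)
	also have "... <= M / 6 + 2 * e" using K mult_right_mono[OF K(2),of M] by (simp add:M_def)
	finally have "M - norm (d 0) <= M / 6 + 2 * e"
	using norm_triangle_ineq2[of "d m" "d 0"] by (simp add:M_def)
	moreover have "M >= 0" "norm (d 0) >= 0" by (auto simp:M_def)
	ultimately have "M <= 2 * norm (d 0) + 3 * e" using e by linarith
	thus ?thesis using m(2)[OF \<open>t : {a..b}\<close>] by (simp add:M_def d_def)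
qed

section \<open>The flow of a compactly supported field and its derivative\<close>

definition flow :: "('v::euclidean_space => 'v) => 'v => real => 'v" where
	"flow W x = (SOME y. y 0 = x & (ALL t:{-1..2}. (y has_vector_derivative W (y t)) (at t within {-1..2})))"

text \<open>Small Lipschitz constants avoid weighted norms and Gronwall's inequality; they are
	achieved by rescaling the vector field.\<close>

locale smooth_flow =
	fixes W :: "'v::euclidean_space => 'v" and C :: "'v set" and K :: real
	assumes smooth:"smooth_on UNIV W" and compact_C:"compact C" and outside:"!!x. x ~: C ==> W x = 0"
	and K:"0 <= K" "K <= 1/12" and bound:"!!x v. norm (fder W x v) <= K * norm v"
begin

lemma has_derivative:"(W has_derivative fder W x) (at x)"
	by (rule sm_hd[OF open_UNIV smooth]) simp

lemma linear_fder:"linear (fder W x)"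
	using has_derivative has_derivative_linear by blast

lemma Lipschitz:"norm (W x - W y) <= K * norm (x - y)"
	by (rule differentiable_bound[OF convex_UNIV has_derivative[THEN has_derivative_at_withinI]])
	(use bound K(1) in \<open>auto intro!:onorm_bound\<close>)

lemma continuous_W:"continuous_on S W"
	using continuous_on_subset[OF sm_cont[OF smooth]] by simp

lemma flow_props:"flow W x 0 = x & (ALL t:{-1..2}. (flow W x has_vector_derivative W (flow W x t)) (at t within {-1..2}))"
proof -
	have "continuous_on ({-1..2} \<times> UNIV) (%p :: real \<times> 'v. W (snd p))"
	by (rule continuous_on_compose2[OF continuous_W[of UNIV]]) (auto intro:continuous_intros)
	hence c:"continuous_on ({-1..2} \<times> UNIV) (%(t :: real,y). W y)" by (simp add:case_prod_beta')
	have "EX y. y 0 = x & (ALL t:{-1..2}. (y has_vector_derivative W (y t)) (at t within {-1..2}))"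
	by (rule ode_exists[of "%_. W",OF c Lipschitz K])
	thus ?thesis unfolding flow_def by (rule someI_ex)
qed

lemma flow_0:"flow W x 0 = x" using flow_props by blast

lemma flow_deriv:"t : {-1..2} ==> (flow W x has_vector_derivative W (flow W x t)) (at t within {-1..2})"
	using flow_props by blast

lemma flow_deriv_within:
	"t : I ==> I \<subseteq> {-1..2} ==> (flow W x has_vector_derivative W (flow W x t)) (at t within I)"
	using flow_deriv has_vector_derivative_within_subset by blast

lemma flow_unique:
	assumes "a <= 0" "0 <= b" "-1 <= a" "b <= 2"
	and "!!t. t : {a..b} ==> (z has_vector_derivative W (z t)) (at t within {a..b})" "t : {a..b}"
	shows "z t = flow W (z 0) t"
proof -
	have "norm (flow W (z 0) t - z t) <= 2 * norm (flow W (z 0) 0 - z 0) + 3 * 0"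
	by (rule ode_stability[where W = "%_. W" and K = K and g = "%t. W (z t)" and a = a and b = b])
	(use assms Lipschitz K in \<open>auto intro!:flow_deriv_within\<close>)
	thus ?thesis by (simp add:flow_0)
qed

lemma flow_Lipschitz:
	assumes "t : {-1..2}"
	shows "norm (flow W x t - flow W y t) <= 2 * norm (x - y)"
proof -
	have "norm (flow W x t - flow W y t) <= 2 * norm (flow W x 0 - flow W y 0) + 3 * 0"
	by (rule ode_stability[where W = "%_. W" and K = K and g = "%t. W (flow W y t)" and a = "-1" and b = 2])
	(use assms Lipschitz K in \<open>auto intro!:flow_deriv_within\<close>)
	thus ?thesis by (simp add:flow_0)
qed

lemma flow_displacement:
	assumes "t : {-1..2}"
	shows "norm (flow W x t - x) <= 3 * norm (W x)"
proof -
	have "norm (flow W x t - x) <= 2 * norm (flow W x 0 - x) + 3 * norm (W x)"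
	by (rule ode_stability[where W = "%_. W" and K = K and g = "%t. 0" and a = "-1" and b = 2])
	(use assms Lipschitz K in \<open>auto intro!:flow_deriv_within\<close>)
	thus ?thesis by (simp add:flow_0)
qed

lemma flow_fixed:"W x = 0 ==> t : {-1..2} ==> flow W x t = x"
	using flow_displacement[of t x] by simp

lemma flow_smooth:"smooth_on {-1<..<2} (flow W x)"
proof (rule smooth_onI_derivative)
	fix t :: real assume "t : {-1<..<2}"
	hence "(flow W x has_vector_derivative W (flow W x t)) (at t within {-1<..<2})"
	by (intro flow_deriv_within) auto
	thus "(flow W x has_derivative (%h. h *\<^sub>R W (flow W x t))) (at t)"
	using \<open>t : {-1<..<2}\<close> by (simp add:has_vector_derivative_def at_within_open[of t "{-1<..<2}"])
next
	fix k v assume "Ck_on k {-1<..<2} (flow W x)"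
	from Ck_on_compose[OF _ open_UNIV this,of W] have "Ck_on k {-1<..<2} (%t. W (flow W x t))"
	using smooth by (simp add:smooth_on_def)
	thus "Ck_on k {-1<..<2} (%t. v *\<^sub>R W (flow W x t))"
	by (rule Ck_on_scaleR[of _ _ "%_. v",OF _ Ck_on_const,rotated]) simp
qed simp

lemma fder_Lipschitz: obtains B where "B > 0" "!!x y v. norm (fder W x v - fder W y v) <= B * norm (x - y) * norm v"
proof -
	have "EX B. ALL x y. norm (fder W x i - fder W y i) <= B * norm (x - y)" for i
	proof -
	have "open (- C)" using compact_C compact_imp_closed by auto
	have "fder W x i = 0" if "x ~: C" for x
	proof -
	have "(W has_derivative (%_. 0)) (at x)"
	by (rule hd_transform[OF has_derivative_const[of 0] \<open>open (- C)\<close>]) (use that outside in auto)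
	from fder_eq[OF this,of i] show ?thesis by simp
	qed
	obtain B where "!!x y. norm (fder W x i - fder W y i) <= B * norm (x - y)"
	by (rule compact_support_bounds[OF sm_fder[OF smooth,of i] compact_C \<open>!!x. x ~: C ==> fder W x i = 0\<close>])
	(assumption,rule that,assumption)
	thus ?thesis by blast
	qed
	then obtain b where b:"!!i x y. norm (fder W x i - fder W y i) <= b i * norm (x - y)" by metis
	define B where "B = (SUM i:Basis. \<bar>b i\<bar>) + 1"
	have "norm (fder W x v - fder W y v) <= B * norm (x - y) * norm v" for x y v
	proof -
	have "norm (fder W x i - fder W y i) <= \<bar>b i\<bar> * norm (x - y)" for i
	using b[of x i y] mult_right_mono[OF abs_ge_self[of "b i"],of "norm (x - y)"] by simp
	hence "(SUM i:Basis. norm (fder W x i - fder W y i)) <= (SUM i:Basis. \<bar>b i\<bar> * norm (x - y))"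
	by (rule sum_mono)
	also have "... = (SUM i:Basis. \<bar>b i\<bar>) * norm (x - y)" by (rule sum_distrib_right[symmetric])
	also have "... <= B * norm (x - y)" by (rule mult_right_mono) (auto simp:B_def)
	finally have "norm v * (SUM i:Basis. norm (fder W x i - fder W y i)) <= norm v * (B * norm (x - y))"
	by (rule mult_left_mono) simp
	with norm_linear_diff_le[OF linear_fder linear_fder,of x v y] show ?thesis by (simp add:mult.commute)
	qed
	moreover have "B > 0" unfolding B_def by (simp add:add_nonneg_pos sum_nonneg)
	ultimately show thesis using that by blast
qed

lemma Taylor: obtains B where "B > 0" "!!x y. norm (W y - W x - fder W x (y - x)) <= B * (norm (y - x))\<^sup>2"
proof -
	obtain B where B:"B > 0" "!!x y v. norm (fder W x v - fder W y v) <= B * norm (x - y) * norm v"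
	by (rule fder_Lipschitz) (rule that; blast)
	have "norm (W y - W x - fder W x (y - x)) <= B * (norm (y - x))\<^sup>2" for x y
	proof -
	have "norm ((W y - fder W x y) - (W x - fder W x x)) <= (B * norm (y - x)) * norm (y - x)"
	proof (rule differentiable_bound[OF convex_closed_segment[of x y]])
	fix z assume z:"z : closed_segment x y"
	have "(fder W x has_derivative fder W x) (at z)"
	using linear_fder by (simp add:linear_conv_bounded_linear bounded_linear_imp_has_derivative)
	from has_derivative_diff[OF has_derivative this]
	show "((%z. W z - fder W x z) has_derivative (%v. fder W z v - fder W x v)) (at z within closed_segment x y)"
	by (rule has_derivative_at_withinI)
	have "norm (z - x) <= norm (y - x)" using segment_bound1[OF z] by (simp add:norm_minus_commute)
	hence "B * norm (z - x) * norm v <= B * norm (y - x) * norm v" for v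
	using B(1) by (intro mult_right_mono mult_left_mono) auto
	hence "norm (fder W z v - fder W x v) <= B * norm (y - x) * norm v" for v
	using B(2)[of z v x] order_trans by blast
	thus "onorm (%v. fder W z v - fder W x v) <= B * norm (y - x)"
	using B(1) by (intro onorm_bound) auto
	qed auto
	thus ?thesis by (simp add:linear_diff[OF linear_fder] power2_eq_square algebra_simps)
	qed
	thus thesis by (rule that[OF B(1)])
qed

text \<open>The derivative is the solution \<open>D\<close> of the linearised equation along the
  orbit. The difference of two orbits solves that equation up to an error quadratic in their
  distance, by \<open>Taylor\<close>, so \<open>ode_stability\<close> bounds the remainder by
  \<open>12 * B * (norm (y - x))\<^sup>2\<close>.\<close>

lemma flow_has_derivative:
	"EX D. (ALL t:{-1..2}. ((%x. flow W x t) has_derivative (%h. D h t)) (at x)) & (ALL h. D h 0 = h) &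
	(ALL h. ALL t:{-1..2}. (D h has_vector_derivative fder W (flow W x t) (D h t)) (at t within {-1..2}))"
proof -
	define A where "A t = fder W (flow W x t)" for t
	have linA:"linear (A t)" for t unfolding A_def by (rule linear_fder)
	have LipA:"norm (A t y - A t z) <= K * norm (y - z)" for t y z
	using bound[of "flow W x t" "y - z"] by (simp add:A_def linear_diff[OF linear_fder])
	have cflow:"continuous_on {-1..2} (flow W x)"
	using flow_deriv by (meson continuous_on_eq_continuous_within has_vector_derivative_continuous)
	have contA:"continuous_on ({-1..2} \<times> UNIV) (%(t,y). A t y)"
	proof -
	have "continuous_on ({-1..2} \<times> UNIV) (%p :: real \<times> 'v. SUM i:Basis. (snd p \<bullet> i) *\<^sub>R fder W (flow W x (fst p)) i)"
	proof (intro continuous_intros)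
	fix i :: 'v
	have "continuous_on ({-1..2} \<times> UNIV) (%p :: real \<times> 'v. flow W x (fst p))"
	by (rule continuous_on_compose2[OF cflow]) (auto intro:continuous_intros)
	thus "continuous_on ({-1..2} \<times> UNIV) (%p :: real \<times> 'v. fder W (flow W x (fst p)) i)"
	by (rule continuous_on_compose2[OF sm_cont[OF sm_fder[OF smooth,of i]]]) auto
	qed
	moreover have "(%p :: real \<times> 'v. SUM i:Basis. (snd p \<bullet> i) *\<^sub>R fder W (flow W x (fst p)) i) = (%(t,y). A t y)"
	proof (rule ext)
	fix p :: "real \<times> 'v"
	show "(SUM i:Basis. (snd p \<bullet> i) *\<^sub>R fder W (flow W x (fst p)) i) = (%(t,y). A t y) p"
	by (simp only: case_prod_beta' A_def) (rule linear_sum_Basis[OF linear_fder,symmetric])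
	qed
	ultimately show ?thesis by (simp only:)
	qed
	have "EX y. y 0 = h & (ALL t:{-1..2}. (y has_vector_derivative A t (y t)) (at t within {-1..2}))" for h
	by (rule ode_exists[of A,OF contA LipA K])
	then obtain D where D:"!!h. D h 0 = h"
	"!!h t. t : {-1..2} ==> (D h has_vector_derivative A t (D h t)) (at t within {-1..2})" by metis
	have uniq:"D h t = z t" if "z 0 = h" "t : {-1..2}"
	"!!t. t : {-1..2} ==> (z has_vector_derivative A t (z t)) (at t within {-1..2})" for h z t
	proof -
	have "norm (D h t - z t) <= 2 * norm (D h 0 - z 0) + 3 * 0"
	by (rule ode_stability[where W = A and K = K and g = "%t. A t (z t)" and a = "-1" and b = 2])
	(use that LipA K D(2) in auto)
	thus ?thesis using D(1) that(1) by simp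
	qed
	\<comment> \<open>Solutions of the linearised equation were chosen one by one; uniqueness makes
	  them depend linearly on the initial value.\<close>
	have lin:"linear (%h. D h t)" if t:"t : {-1..2}" for t
	proof (rule linearI)
	show "D (h + k) t = D h t + D k t" for h k
	by (rule uniq[where z = "%t. D h t + D k t",OF _ t])
	(auto simp:D(1) linear_add[OF linA] intro!:has_vector_derivative_add D(2))
	show "D (c *\<^sub>R h) t = c *\<^sub>R D h t" for c h
	by (rule uniq[where z = "%t. c *\<^sub>R D h t",OF _ t])
	(auto simp:D(1) linear_scale[OF linA] intro!:bounded_linear.has_vector_derivative[OF bounded_linear_scaleR_right] D(2))
	qed
	obtain B where B:"B > 0" "!!x y. norm (W y - W x - fder W x (y - x)) <= B * (norm (y - x))\<^sup>2"
	by (rule Taylor) (rule that; blast)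
	have est:"norm (flow W y t - flow W x t - D (y - x) t) <= (12 * B) * (norm (y - x))\<^sup>2" if t:"t : {-1..2}" for y t
	proof -
	have "norm (D (y - x) t - (flow W y t - flow W x t)) <=
	2 * norm (D (y - x) 0 - (flow W y 0 - flow W x 0)) + 3 * (B * (2 * norm (y - x))\<^sup>2)"
	proof (rule ode_stability[where W = A and K = K and g = "%t. W (flow W y t) - W (flow W x t)" and a = "-1" and b = 2])
	fix s :: real assume s:"s : {-1..2}"
	show "norm (A s (flow W y s - flow W x s) - (W (flow W y s) - W (flow W x s))) <= B * (2 * norm (y - x))\<^sup>2"
	proof -
	have "norm (A s (flow W y s - flow W x s) - (W (flow W y s) - W (flow W x s))) <= B * (norm (flow W y s - flow W x s))\<^sup>2"
	using B(2)[of "flow W y s" "flow W x s"] unfolding A_def by (subst norm_minus_commute) simp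
	also have "... <= B * (2 * norm (y - x))\<^sup>2"
	using B(1) flow_Lipschitz[OF s,of y x] by (intro mult_left_mono power_mono) auto
	finally show ?thesis .
	qed
	qed (use t LipA K D(2) flow_deriv in \<open>auto intro!:has_vector_derivative_diff\<close>)
	thus ?thesis by (subst norm_minus_commute) (simp add:D(1) flow_0 power2_eq_square algebra_simps)
	qed
	have "((%x. flow W x t) has_derivative (%h. D h t)) (at x)" if t:"t : {-1..2}" for t
	unfolding has_derivative_iff_norm
	proof
	show "bounded_linear (%h. D h t)" using lin[OF t] linear_conv_bounded_linear by blast
	have "((%y. (12 * B) * norm (y - x)) \<longlongrightarrow> (12 * B) * norm (x - x)) (at x)"
	by (intro tendsto_intros)
	hence "((%y. (12 * B) * norm (y - x)) \<longlongrightarrow> 0) (at x)" by simp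
	moreover have "\<forall>\<^sub>F y in at x. norm (norm (flow W y t - flow W x t - D (y - x) t) / norm (y - x)) <= (12 * B) * norm (y - x)"
	proof (rule always_eventually,rule allI)
	fix y
	show "norm (norm (flow W y t - flow W x t - D (y - x) t) / norm (y - x)) <= (12 * B) * norm (y - x)"
	using est[OF t,of y] by (cases "y = x") (auto simp:field_simps power2_eq_square)
	qed
	ultimately show "((%y. norm (flow W y t - flow W x t - D (y - x) t) / norm (y - x)) \<longlongrightarrow> 0) (at x)"
	by (rule Lim_null_comparison[rotated])
	qed
	thus ?thesis using D unfolding A_def by (intro exI[of _ D] conjI ballI allI)
qed

text \<open>At a rest point the linearised equation has the constant coefficient
  \<open>fder W x\<close>, so its solution at time 1 is \<open>h + fder W x h\<close> up to an error
  quadratic in \<open>K\<close>, hence of second order when the field is scaled down. The first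
  bound serves the C1 estimate, the second one non-degeneracy.\<close>

lemma flow_derivative_first_order:
	assumes "((%x. flow W x 1) has_derivative D1) (at x)"
	shows "norm (D1 h - h) <= 3 * K * norm h"
	and "W x = 0 ==> norm (D1 h - h - fder W x h) <= 3 * K\<^sup>2 * norm h"
proof -
	obtain D where D:"!!t. t : {-1..2} ==> ((%x. flow W x t) has_derivative (%h. D h t)) (at x)"
	"!!h. D h 0 = h"
	"!!h t. t : {-1..2} ==> (D h has_vector_derivative fder W (flow W x t) (D h t)) (at t within {-1..2})"
	using flow_has_derivative[of x] by blast
	have D1:"D1 = (%h. D h 1)" by (rule has_derivative_unique[OF assms D(1)]) simp
	have small:"norm (D h t - h) <= 3 * (K * norm h)" if t:"t : {-1..2}" for t
	proof -
	have "norm (D h t - h) <= 2 * norm (D h 0 - h) + 3 * (K * norm h)"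
	by (rule ode_stability[where W = "%t. fder W (flow W x t)" and K = K and g = "%t. 0" and a = "-1" and b = 2])
	(use t K D(3) bound in \<open>auto simp:linear_diff[OF linear_fder,symmetric]\<close>)
	thus ?thesis by (simp add:D(2))
	qed
	show "norm (D1 h - h) <= 3 * K * norm h" using small[of 1] by (simp add:D1)
	assume fp:"W x = 0"
	have "norm ((D h 1 - 1 *\<^sub>R fder W x h) - (D h 0 - 0 *\<^sub>R fder W x h)) <= (K * (3 * (K * norm h))) * \<bar>1 - 0\<bar>"
	proof (rule speed_bound)
	fix t :: real assume t:"t : {-1..2}"
	show "((%t. D h t - t *\<^sub>R fder W x h) has_vector_derivative (fder W x (D h t) - fder W x h)) (at t within {-1..2})"
	using D(3)[OF t,of h] flow_fixed[OF fp t] by (auto intro!:derivative_eq_intros)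
	have "norm (fder W x (D h t) - fder W x h) <= K * norm (D h t - h)"
	using bound[of x "D h t - h"] by (simp add:linear_diff[OF linear_fder])
	thus "norm (fder W x (D h t) - fder W x h) <= K * (3 * (K * norm h))"
	using mult_left_mono[OF small[OF t] K(1)] by linarith
	qed auto
	thus "norm (D1 h - h - fder W x h) <= 3 * K\<^sup>2 * norm h"
	by (simp add:D1 D(2) power2_eq_square algebra_simps)
qed

end

section \<open>Charts\<close>

text \<open>For a subspace this is the orthogonal projection, fixed by its characteristic
  properties.\<close>

definition proj :: "'e::euclidean_space set => 'e => 'e" where
	"proj S = (SOME P. linear P & (ALL x. P x : S) & (ALL x:S. P x = x) & (ALL x. ALL y:S. (x - P x) \<bullet> y = 0))"

lemma proj_props:
	assumes "subspace (S :: 'e::euclidean_space set)"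
	shows "linear (proj S) & (ALL x. proj S x : S) & (ALL x:S. proj S x = x) & (ALL x. ALL y:S. (x - proj S x) \<bullet> y = 0)"
proof -
	obtain B where B:"B \<subseteq> S" "pairwise orthogonal B" "!!x. x : B ==> norm x = 1" "independent B" "span B = S"
	using orthonormal_basis_subspace[OF assms] by metis
	have fin:"finite B" using B(4) independent_imp_finite by blast
	define P where "P x = (SUM b:B. (x \<bullet> b) *\<^sub>R b)" for x
	have lin:"linear P" unfolding P_def
	by (rule linearI) (auto simp:inner_add_left scaleR_add_left sum.distrib scaleR_sum_right)
	have inS:"P x : S" for x
	unfolding P_def using B(1) assms by (intro subspace_sum) (auto intro:subspace_scale)
	have b:"(x - P x) \<bullet> b = 0" if "b : B" for x b
	proof -
	have "P x \<bullet> b = (SUM c:B. (x \<bullet> c) * (c \<bullet> b))" by (simp add:P_def inner_sum_left)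
	also have "... = (SUM c:B. if c = b then x \<bullet> b else 0)"
	using B(2,3) that by (intro sum.cong) (auto simp:pairwise_def orthogonal_def norm_eq_1)
	also have "... = x \<bullet> b" using fin that by simp
	finally show ?thesis by (simp add:inner_diff_left)
	qed
	have orth:"(x - P x) \<bullet> y = 0" if "y : S" for x y
	proof -
	have "orthogonal (x - P x) y"
	by (rule orthogonal_to_span[of y B]) (use that B(5) b in \<open>auto simp:orthogonal_def\<close>)
	thus ?thesis by (simp add:orthogonal_def)
	qed
	have "P x = x" if "x : S" for x
	proof -
	have "x - P x : S" using that inS assms by (simp add:subspace_diff)
	from orth[OF this,of x] show ?thesis by simp
	qed
	hence "EX P. linear P & (ALL x. P x : S) & (ALL x:S. P x = x) & (ALL x. ALL y:S. (x - P x) \<bullet> y = 0)"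
	using lin inS orth by (intro exI[of _ P]) simp
	thus ?thesis unfolding proj_def by (rule someI_ex)
qed

lemma linear_proj:"subspace S ==> linear (proj S)"
	and proj_in:"subspace S ==> proj S x : S"
	and proj_id:"subspace S ==> x : S ==> proj S x = x"
	and proj_orthogonal:"subspace S ==> y : S ==> (x - proj S x) \<bullet> y = 0"
	using proj_props[of S] by auto

lemma proj_eq_iff:"subspace S ==> proj S x = x \<longleftrightarrow> x : S"
	using proj_in proj_id by metis

text \<open>The linear map \<open>x - proj G x\<close> kills all nearby increments, hence also the
  derivative. This is how all tangency statements are obtained.\<close>

lemma has_vector_derivative_in_subspace:
	fixes h :: "real => 'e::euclidean_space"
	assumes "(h has_vector_derivative h') (at t within I)" "subspace G"
	and "\<forall>\<^sub>F s in at t within I. h s - h t : G" "at t within I ~= bot" "t : I"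
	shows "h' : G"
proof -
	have "linear (%x. x - proj G x)" using linear_proj[OF assms(2)] by (simp add:linear_compose_sub linear_id[unfolded id_def])
	hence "bounded_linear (%x. x - proj G x)" by (simp add:linear_conv_bounded_linear)
	moreover have "((%s. h s - h t) has_vector_derivative h') (at t within I)"
	using has_vector_derivative_diff[OF assms(1) has_vector_derivative_const[of "h t"]] by simp
	ultimately have "((%s. (h s - h t) - proj G (h s - h t)) has_vector_derivative (h' - proj G h')) (at t within I)"
	by (rule bounded_linear.has_vector_derivative)
	moreover have "((%s. (h s - h t) - proj G (h s - h t)) has_vector_derivative 0) (at t within I)"
	proof -
	have "((%s. 0) has_vector_derivative (0::'e)) (at t within I)" by simp
	moreover have "\<forall>\<^sub>F s in at t within I. 0 = (h s - h t) - proj G (h s - h t)"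
	using assms(3) by eventually_elim (simp add:proj_id[OF assms(2)])
	ultimately show ?thesis
	unfolding has_vector_derivative_def
	by (rule has_derivative_transform_eventually)
	(use assms(5) linear_0[OF linear_proj[OF assms(2)]] in auto)
	qed
	ultimately have "h' - proj G h' = 0"
	using vector_derivative_unique_within[OF assms(4)] by blast
	thus ?thesis using proj_in[OF assms(2)] by (metis eq_iff_diff_eq_0)
qed

lemma at_unit_interval_nontrivial:"t : {0..1} ==> at t within {0..1::real} ~= bot"
	by (simp add:at_within_Icc_at_right at_within_Icc_at_left at_within_Icc_at trivial_limit_within islimpt_Icc)

lemma openin_charts:
	assumes "is_chart X c"
	shows chart_openin:"openin X (fst c)"
	and chart_image_open:"open (snd c ` fst c)"
	and chart_inj:"inj_on (snd c) (fst c)"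
	and chart_open_map:"!!W. openin X W ==> W \<subseteq> fst c ==> open (snd c ` W)"
	and chart_preimage_open:"!!T. open T ==> openin X {x : fst c. snd c x : T}"
proof -
	have o:"openin X (fst c)" "open (snd c ` fst c)"
	and h:"homeomorphic_map (subtopology X (fst c)) (top_of_set (snd c ` fst c)) (snd c)"
	using assms by (auto simp:is_chart_def)
	show "openin X (fst c)" "open (snd c ` fst c)" by (fact o)+
	have ts:"topspace (subtopology X (fst c)) = fst c"
	using openin_subset[OF o(1)] by auto
	show "inj_on (snd c) (fst c)"
	using homeomorphic_imp_injective_map[OF h] ts by simp
	show "open (snd c ` W)" if "openin X W" "W \<subseteq> fst c" for W
	proof -
	have "openin (subtopology X (fst c)) W" using that by (metis inf.absorb1 openin_subtopology)
	hence "openin (top_of_set (snd c ` fst c)) (snd c ` W)"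
	using homeomorphic_imp_open_map[OF h] by (simp add:open_map_def)
	thus ?thesis using o(2) openin_open_trans by blast
	qed
	show "openin X {x : fst c. snd c x : T}" if "open T" for T
	proof -
	have "openin (top_of_set (snd c ` fst c)) (snd c ` fst c Int T)" using that by (simp add:openin_open_Int)
	from openin_continuous_map_preimage[OF homeomorphic_imp_continuous_map[OF h] this]
	have "openin (subtopology X (fst c)) {x : fst c. snd c x : T}"
	unfolding ts by (rule back_subst[of "openin _"]) auto
	thus ?thesis using o(1) openin_trans_full by blast
	qed
qed

lemma chart_inv_into:"p : snd c ` fst c ==> chart_inv c p : fst c"
	unfolding chart_inv_def by (rule inv_into_into)

lemma chart_chart_inv:"p : snd c ` fst c ==> snd c (chart_inv c p) = p"
	unfolding chart_inv_def by (rule f_inv_into_f)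

lemma chart_inv_chart:"is_chart X c ==> x : fst c ==> chart_inv c (snd c x) = x"
	unfolding chart_inv_def using chart_inj by (rule inv_into_f_f)

lemma chart_inv_identity:"chart_inv (UNIV,id) = id"
	by (rule ext) (simp add:chart_inv_def inv_into_def)

lemma atlas_euclidean:"atlas euc = {(UNIV,id)}" "mtop euc = euclidean"
	by (auto simp:euclidean_manifold_def)

lemma chart_at_euclidean:"chart_at euc x = (UNIV,id)"
	unfolding chart_at_def atlas_euclidean by (rule some_equality) auto

text \<open>Tangent vectors are coordinates in the chosen chart at \<open>x\<close>; this is the
  change to them from the coordinates in \<open>c\<close>, that is, the isomorphism from the model
  space seen through \<open>c\<close> onto the tangent space.\<close>

definition chart_deriv :: "('a,'e::euclidean_space) manifold => ('a,'e) chart => 'a => 'e => 'e" where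
	"chart_deriv M c x = fder (snd (chart_at M x) o chart_inv c) (snd c x)"

text \<open>The coordinate expression \<open>h\<close> is smooth on a full neighbourhood but
  represents \<open>ga\<close> on \<open>S\<close> only. One-sided derivatives of a path on {0..1}
  thereby become ordinary derivatives of \<open>h\<close>.\<close>

definition local_rep ::
	"('a,'e::euclidean_space) chart \<Rightarrow> 'v::euclidean_space set \<Rightarrow> ('v \<Rightarrow> 'a) \<Rightarrow> 'v \<Rightarrow> 'v set \<Rightarrow> ('v \<Rightarrow> 'e) \<Rightarrow> bool" where
	"local_rep c S ga t W h \<longleftrightarrow> open W \<and> t \<in> W \<and> smooth_on W h \<and> h ` W \<subseteq> snd c ` fst c \<and>
	(\<forall>y\<in>W \<inter> S. ga y = chart_inv c (h y))"

lemma local_rep_value: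
	assumes "local_rep c S ga t W h" "y : W" "y : S"
	shows "ga y : fst c" "snd c (ga y) = h y"
proof -
	have "h y : snd c ` fst c" "ga y = chart_inv c (h y)" using assms by (auto simp:local_rep_def)
	thus "ga y : fst c" "snd c (ga y) = h y" by (auto simp:chart_inv_into chart_chart_inv)
qed

locale smooth_mfd =
	fixes M :: "('a,'e::euclidean_space) manifold"
	assumes atlas_cover:"(UN c:atlas M. fst c) = points M"
	and atlas_chart:"!!c. c : atlas M ==> is_chart (mtop M) c"
	and atlas_transition:"!!c d. c : atlas M ==> d : atlas M ==> smooth_transition c d"
begin

lemma atlas_smooth_chart:"c : atlas M ==> smooth_chart M c"
	using atlas_chart atlas_transition by (simp add:smooth_chart_def)

lemma is_chart:"smooth_chart M c ==> is_chart (mtop M) c"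
	by (simp add:smooth_chart_def)

lemma chart_subset:"smooth_chart M c ==> fst c \<subseteq> points M"
	using openin_subset[OF chart_openin[OF is_chart]] .

lemma img_open:"smooth_chart M c ==> open (snd c ` fst c)"
	by (rule chart_image_open[OF is_chart])

lemma exists_atlas_chart:"x : points M ==> EX c:atlas M. x : fst c"
	using atlas_cover by blast

lemma chart_at:"x : points M ==> chart_at M x : atlas M & x : fst (chart_at M x)"
	unfolding chart_at_def by (rule someI_ex) (use exists_atlas_chart in blast)

lemma chart_at_smooth:"x : points M ==> smooth_chart M (chart_at M x)"
	using chart_at atlas_smooth_chart by blast

lemma inv_chart:"smooth_chart M c ==> x : fst c ==> chart_inv c (snd c x) = x"
	by (rule chart_inv_chart[OF is_chart])

lemma overlap_open:
	assumes "smooth_chart M c" "smooth_chart M d"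
	shows "open (snd c ` (fst c Int fst d))"
	using chart_openin[OF is_chart[OF assms(1)]] chart_openin[OF is_chart[OF assms(2)]]
	by (intro chart_open_map[OF is_chart[OF assms(1)]]) auto

lemma overlap_iff:
	assumes "smooth_chart M c" "p : snd c ` fst c"
	shows "p : snd c ` (fst c Int T) \<longleftrightarrow> chart_inv c p : T"
proof
	assume "p : snd c ` (fst c Int T)"
	thus "chart_inv c p : T" using inv_chart[OF assms(1)] by auto
next
	assume "chart_inv c p : T"
	thus "p : snd c ` (fst c Int T)"
	using chart_inv_into[OF assms(2)] chart_chart_inv[OF assms(2)] by (intro image_eqI[of _ _ "chart_inv c p"]) auto
qed

text \<open>A smooth chart is compared by definition with the atlas only; two smooth charts are
  compared near each point through an atlas chart \<open>e\<close>.\<close>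

lemma transition_smooth:
	assumes c:"smooth_chart M c" and d:"smooth_chart M d"
	shows "smooth_on (snd c ` (fst c Int fst d)) (%p. snd d (chart_inv c p))"
proof (rule sm_local)
	fix p assume "p : snd c ` (fst c Int fst d)"
	then obtain x where x:"x : fst c" "x : fst d" "p = snd c x" by blast
	obtain e where e:"e : atlas M" "x : fst e" using exists_atlas_chart chart_subset[OF c] x(1) by blast
	have es:"smooth_chart M e" using atlas_smooth_chart[OF e(1)] .
	define U where "U = snd c ` (fst c Int fst d Int fst e)"
	have U:"open U" unfolding U_def
	using chart_openin[OF is_chart[OF c]] chart_openin[OF is_chart[OF d]] chart_openin[OF is_chart[OF es]]
	by (intro chart_open_map[OF is_chart[OF c]]) auto
	have ce:"smooth_on U (%p. snd e (chart_inv c p))"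
	using c e(1) unfolding smooth_chart_def smooth_transition_def U_def
	by (auto intro:sm_subset simp:comp_def)
	have ed:"smooth_on (snd e ` (fst e Int fst d)) (%p. snd d (chart_inv e p))"
	using d e(1) unfolding smooth_chart_def smooth_transition_def by (auto simp:comp_def)
	have "smooth_on U (%p. snd d (chart_inv e (snd e (chart_inv c p))))"
	by (rule sm_compose[OF U overlap_open[OF es d] ce ed]) (auto simp:U_def inv_chart[OF c])
	hence "smooth_on U (%p. snd d (chart_inv c p))"
	by (rule sm_cong[OF U,rotated]) (auto simp:U_def inv_chart[OF c] inv_chart[OF es])
	thus "EX U. open U & p : U & smooth_on U (%p. snd d (chart_inv c p))"
	using U x e(2) by (auto simp:U_def)
qed

lemma transition_derivative:
	assumes "smooth_chart M c" "smooth_chart M d" "x : fst c" "x : fst d"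
	shows "((%p. snd d (chart_inv c p)) has_derivative fder (%p. snd d (chart_inv c p)) (snd c x)) (at (snd c x))"
	using sm_hd[OF overlap_open transition_smooth] assms by blast

lemma transition_chain:
	assumes c:"smooth_chart M c" and d:"smooth_chart M d" and e:"smooth_chart M e"
	and x:"x : fst c" "x : fst d" "x : fst e"
	shows "fder (%p. snd e (chart_inv c p)) (snd c x) =
	(%v. fder (%p. snd e (chart_inv d p)) (snd d x) (fder (%p. snd d (chart_inv c p)) (snd c x) v))"
proof -
	have "((%p. snd e (chart_inv d p)) has_derivative fder (%p. snd e (chart_inv d p)) (snd d x)) (at (snd d (chart_inv c (snd c x))))"
	using transition_derivative[OF d e x(2,3)] by (simp add:inv_chart[OF c x(1)])
	from has_derivative_compose[OF transition_derivative[OF c d x(1,2)] this]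
	have "((%p. snd e (chart_inv d (snd d (chart_inv c p)))) has_derivative
	(%v. fder (%p. snd e (chart_inv d p)) (snd d x) (fder (%p. snd d (chart_inv c p)) (snd c x) v))) (at (snd c x))" .
	hence "((%p. snd e (chart_inv c p)) has_derivative
	(%v. fder (%p. snd e (chart_inv d p)) (snd d x) (fder (%p. snd d (chart_inv c p)) (snd c x) v))) (at (snd c x))"
	by (rule hd_transform[OF _ overlap_open[OF c d]])
	(use x in \<open>auto simp:inv_chart[OF c] inv_chart[OF d]\<close>)
	from frechet_derivative_at[OF this] show ?thesis by (rule sym)
qed

lemma transition_id:
	assumes c:"smooth_chart M c" and x:"x : fst c"
	shows "fder (%p. snd c (chart_inv c p)) (snd c x) = (%v. v)"
proof -
	have "((%p. snd c (chart_inv c p)) has_derivative (%v. v)) (at (snd c x))"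
	by (rule hd_transform[OF has_derivative_ident img_open[OF c]])
	(use x in \<open>auto simp:inv_chart[OF c]\<close>)
	from frechet_derivative_at[OF this] show ?thesis by (rule sym)
qed

lemma linear_transition:
	assumes "smooth_chart M c" "smooth_chart M d" "x : fst c" "x : fst d"
	shows "linear (fder (%p. snd d (chart_inv c p)) (snd c x))"
	using transition_derivative[OF assms] has_derivative_linear by blast

lemma chart_deriv_eq:"chart_deriv M c x = fder (%p. snd (chart_at M x) (chart_inv c p)) (snd c x)"
	by (simp add:chart_deriv_def comp_def)

lemma chart_deriv_chain:
	assumes "smooth_chart M c" "smooth_chart M d" "x : fst c" "x : fst d"
	shows "chart_deriv M c x v = chart_deriv M d x (fder (%p. snd d (chart_inv c p)) (snd c x) v)"
proof -
	have p:"x : points M" using chart_subset assms by blast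
	have b:"smooth_chart M (chart_at M x)" "x : fst (chart_at M x)" using chart_at[OF p] chart_at_smooth[OF p] by auto
	show ?thesis unfolding chart_deriv_eq
	by (rule fun_cong[OF transition_chain[OF assms(1,2) b(1) assms(3,4) b(2)]])
qed

lemma linear_chart_deriv:
	assumes "smooth_chart M c" "x : fst c"
	shows "linear (chart_deriv M c x)"
proof -
	have "x : points M" using chart_subset assms by blast
	thus ?thesis unfolding chart_deriv_eq
	using linear_transition[OF assms(1) chart_at_smooth assms(2)] chart_at by blast
qed

lemma bij_chart_deriv:
	assumes "smooth_chart M c" "x : fst c"
	shows "bij (chart_deriv M c x)"
proof -
	have x:"x : points M" using chart_subset assms by blast
	define b where "b = chart_at M x"
	have b:"smooth_chart M b" "x : fst b" using chart_at[OF x] chart_at_smooth[OF x] by (auto simp:b_def)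
	show ?thesis unfolding chart_deriv_eq b_def[symmetric]
	proof (rule o_bij[of "fder (%p. snd c (chart_inv b p)) (snd b x)"])
	show "fder (%p. snd c (chart_inv b p)) (snd b x) o fder (%p. snd b (chart_inv c p)) (snd c x) = id"
	using transition_chain[OF assms(1) b(1) assms(1) assms(2) b(2) assms(2)] transition_id[OF assms]
	by (simp add:comp_def id_def)
	show "fder (%p. snd b (chart_inv c p)) (snd c x) o fder (%p. snd c (chart_inv b p)) (snd b x) = id"
	using transition_chain[OF b(1) assms(1) b(1) b(2) assms(2) b(2)] transition_id[OF b]
	by (simp add:comp_def id_def)
	qed
qed

lemma velocity_chart:
	assumes c:"smooth_chart M c" and x:"ga t : fst c" and t:"t : I" "at t within I ~= bot"
	and near:"\<forall>\<^sub>F s in at t within I. ga s : fst c"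
	and v:"((%s. snd c (ga s)) has_vector_derivative v) (at t within I)"
	shows "velocity_within M I ga t = chart_deriv M c (ga t) v"
proof -
	define b where "b = chart_at M (ga t)"
	have p:"ga t : points M" using chart_subset[OF c] x by blast
	have b:"smooth_chart M b" "ga t : fst b" using chart_at[OF p] chart_at_smooth[OF p] by (auto simp:b_def)
	have "((%s. snd b (chart_inv c (snd c (ga s)))) has_vector_derivative
	fder (%p. snd b (chart_inv c p)) (snd c (ga t)) v) (at t within I)"
	by (rule has_vector_derivative_chain[OF v transition_derivative[OF c b(1) x b(2)]])
	hence "((%s. snd b (ga s)) has_vector_derivative chart_deriv M c (ga t) v) (at t within I)"
	unfolding chart_deriv_eq b_def[symmetric] has_vector_derivative_def
	by (rule has_derivative_transform_eventually)
	(use near in \<open>auto elim!: eventually_mono simp:inv_chart[OF c] x t\<close>)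
	thus ?thesis unfolding velocity_within_def b_def[symmetric]
	by (rule vector_derivative_within[OF t(2)])
qed

text \<open>Smoothness provides some atlas chart \<open>d\<close> of the target; on the part that
  lands in the overlap with \<open>c\<close> the expression is converted, so the chart may be chosen
  at will.\<close>

lemma smooth_map_on_local_rep:
	assumes ga:"smooth_map_on euc M S ga" and t:"t : S" and c:"smooth_chart M c" "ga t : fst c"
	shows "EX W h. local_rep c S ga t W h"
proof -
	obtain d W g where d:"d : atlas M" and W:"open W" "t : W" "g ` W \<subseteq> fst d"
	and s:"smooth_on W (%y. snd d (g y))" and g:"ALL y:W Int S. g y = ga y"
	using ga t unfolding smooth_map_on_def atlas_euclidean
	by (auto simp:chart_inv_identity comp_def)
	have ds:"smooth_chart M d" using atlas_smooth_chart[OF d] .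
	define W' where "W' = W Int (%y. snd d (g y)) -` (snd d ` (fst d Int fst c))"
	have "open W'" unfolding W'_def
	using continuous_open_preimage[OF sm_cont[OF s] W(1) overlap_open[OF ds c(1)]] .
	moreover have "t : W'" using W t g c(2) by (auto simp:W'_def)
	moreover have "smooth_on W' (%y. snd c (chart_inv d (snd d (g y))))"
	by (rule sm_compose[OF \<open>open W'\<close> overlap_open[OF ds c(1)] sm_subset[OF s] transition_smooth[OF ds c(1)]])
	(auto simp:W'_def)
	moreover have gc:"g y : fst c" "chart_inv d (snd d (g y)) = g y" if "y : W'" for y
	proof -
	have "g y : fst d" using that W(3) by (auto simp:W'_def)
	thus "chart_inv d (snd d (g y)) = g y" by (rule inv_chart[OF ds])
	thus "g y : fst c" using that overlap_iff[OF ds,of "snd d (g y)" "fst c"] \<open>g y : fst d\<close> by (auto simp:W'_def)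
	qed
	moreover have "ga y = chart_inv c (snd c (chart_inv d (snd d (g y))))" if "y : W' Int S" for y
	proof -
	have "y : W'" "y : W Int S" using that by (auto simp:W'_def)
	thus ?thesis using gc[of y] g by (simp add:inv_chart[OF c(1)])
	qed
	moreover have "(%y. snd c (chart_inv d (snd d (g y)))) ` W' \<subseteq> snd c ` fst c"
	using gc by (intro image_subsetI) simp
	ultimately have "local_rep c S ga t W' (%y. snd c (chart_inv d (snd d (g y))))"
	unfolding local_rep_def by blast
	thus ?thesis by blast
qed

lemma smooth_map_on_if_local_rep:
	assumes "!!t. t : S ==> EX c W h. smooth_chart M c & local_rep c S ga t W h"
	shows "smooth_map_on euc M S ga"
	unfolding smooth_map_on_def
proof (rule ballI)
	fix t assume t:"t : S"
	then obtain c W h where c:"smooth_chart M c" and r:"local_rep c S ga t W h" using assms by blast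
	have W:"open W" "t : W" "smooth_on W h" "h ` W \<subseteq> snd c ` fst c" "ALL y:W Int S. ga y = chart_inv c (h y)"
	using r by (auto simp:local_rep_def)
	have "ga t : fst c" using local_rep_value[OF r W(2) t] by blast
	then obtain d where d:"d : atlas M" "ga t : fst d" using exists_atlas_chart chart_subset[OF c] by blast
	have ds:"smooth_chart M d" using atlas_smooth_chart[OF d(1)] .
	define W' where "W' = W Int h -` (snd c ` (fst c Int fst d))"
	define g where "g y = chart_inv c (h y)" for y
	have o:"open W'" unfolding W'_def
	using continuous_open_preimage[OF sm_cont[OF W(3)] W(1) overlap_open[OF c ds]] .
	have gt:"g t = ga t" using W t by (simp add:g_def)
	have "h t : snd c ` (fst c Int fst d)" using overlap_iff[OF c,of "h t" "fst d"] W d(2) gt by (auto simp:g_def)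
	hence tW:"t : W'" using W by (simp add:W'_def)
	have "g ` W' \<subseteq> fst d" using overlap_iff[OF c] W(4) by (auto simp:W'_def g_def)
	moreover have "smooth_on W' (%y. snd d (chart_inv c (h y)))"
	by (rule sm_compose[OF o overlap_open[OF c ds] sm_subset[OF W(3)] transition_smooth[OF c ds]])
	(auto simp:W'_def)
	ultimately show "EX c:atlas euc. EX d:atlas M. EX W g.
	openin (mtop euc) W & t : W & W \<subseteq> fst c & g ` W \<subseteq> fst d &
	smooth_on (snd c ` W) (snd d o g o chart_inv c) & (ALL y:W Int S. g y = ga y)"
	unfolding atlas_euclidean using d(1) o tW W(5)
	by (intro bexI[of _ "(UNIV,id)"] bexI[of _ d] exI[of _ W'] exI[of _ g])
	(auto simp:chart_inv_identity comp_def g_def W'_def)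
qed

lemma local_rep_velocity:
	assumes c:"smooth_chart M c" and r:"local_rep c S ga t W h" and t:"t : S" "at t within S ~= bot"
	shows "((%s. snd c (ga s)) has_vector_derivative fder h t 1) (at t within S)"
	and "velocity_within M S ga t = chart_deriv M c (ga t) (fder h t 1)"
	and "\<forall>\<^sub>F s in at t within S. ga s : fst c"
proof -
	have W:"open W" "t : W" "smooth_on W h" using r by (auto simp:local_rep_def)
	have "(h has_derivative fder h t) (at t within S)"
	using sm_hd[OF W(1,3,2)] has_derivative_at_withinI by blast
	moreover have "fder h t = (%s. s *\<^sub>R fder h t 1)"
	proof (rule ext)
	fix s :: real
	show "fder h t s = s *\<^sub>R fder h t 1"
	using linear_scale[OF sm_linear_fder[OF W(1,3,2)],of s 1] by simp
	qed
	ultimately have hv:"(h has_vector_derivative fder h t 1) (at t within S)"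
	by (simp add:has_vector_derivative_def)
	have ev:"\<forall>\<^sub>F s in at t within S. s : W & s : S"
	using W(1,2) by (auto simp:eventually_at_topological)
	show d:"((%s. snd c (ga s)) has_vector_derivative fder h t 1) (at t within S)"
	using hv unfolding has_vector_derivative_def
	by (rule has_derivative_transform_eventually)
	(use ev local_rep_value(2)[OF r] W t in \<open>auto elim!: eventually_mono\<close>)
	show near:"\<forall>\<^sub>F s in at t within S. ga s : fst c"
	using ev by (rule eventually_mono) (use local_rep_value(1)[OF r] in blast)
	show "velocity_within M S ga t = chart_deriv M c (ga t) (fder h t 1)"
	by (rule velocity_chart[OF c local_rep_value(1)[OF r W(2) t(1)] t near d])
qed

end

section \<open>First integrals of the kernel distribution\<close>

lemma has_derivative_linear_family:
	fixes A :: "'p::euclidean_space => 'a::euclidean_space => 'b::euclidean_space"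
	assumes "open S" "p : S" and lin:"!!q. q : S ==> linear (A q)"
	and A':"!!v. ((%q. A q v) has_derivative A' v) (at p)" and g:"(g has_derivative g') (at p)"
	shows "((%q. A q (g q)) has_derivative (%h. A' (g p) h + A p (g' h))) (at p)"
proof -
	define v where "v = g p"
	have fixed:"A' v h = (SUM i:Basis. (v \<bullet> i) *\<^sub>R A' i h)" for h
	proof -
	have "((%q. SUM i:Basis. (v \<bullet> i) *\<^sub>R A q i) has_derivative (%h. SUM i:Basis. (v \<bullet> i) *\<^sub>R A' i h)) (at p)"
	by (intro has_derivative_sum has_derivative_scaleR_right A')
	hence "((%q. A q v) has_derivative (%h. SUM i:Basis. (v \<bullet> i) *\<^sub>R A' i h)) (at p)"
	by (rule hd_transform[OF _ assms(1,2)]) (rule linear_sum_Basis[OF lin,symmetric])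
	from fun_cong[OF has_derivative_unique[OF A' this],of h] show ?thesis .
	qed
	have "((%q. SUM i:Basis. (g q \<bullet> i) *\<^sub>R A q i) has_derivative
	(%h. SUM i:Basis. (g p \<bullet> i) *\<^sub>R A' i h + (g' h \<bullet> i) *\<^sub>R A p i)) (at p)"
	by (intro has_derivative_sum has_derivative_scaleR has_derivative_inner_left g A')
	hence "((%q. A q (g q)) has_derivative
	(%h. SUM i:Basis. (g p \<bullet> i) *\<^sub>R A' i h + (g' h \<bullet> i) *\<^sub>R A p i)) (at p)"
	by (rule hd_transform[OF _ assms(1,2)]) (rule linear_sum_Basis[OF lin,symmetric])
	moreover have "(SUM i:Basis. (g p \<bullet> i) *\<^sub>R A' i h + (g' h \<bullet> i) *\<^sub>R A p i) = A' (g p) h + A p (g' h)" for h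
	unfolding sum.distrib fixed[unfolded v_def] linear_sum_Basis[OF lin[OF assms(2)],of "g' h",symmetric] ..
	ultimately show ?thesis by simp
qed

lemma norm_proj_le:
	assumes "subspace S"
	shows "norm (proj S x) <= norm x"
proof -
	have "(x - proj S x) \<bullet> proj S x = 0" using proj_orthogonal[OF assms proj_in[OF assms]] .
	hence "(norm x)\<^sup>2 = (norm (x - proj S x))\<^sup>2 + (norm (proj S x))\<^sup>2"
	by (simp add:power2_norm_eq_inner inner_diff_left inner_diff_right inner_commute)
	hence "(norm (proj S x))\<^sup>2 <= (norm x)\<^sup>2" by simp
	thus ?thesis by (rule power2_le_imp_le) simp
qed

lemma stays_in_subspace:
	fixes q :: "real => 'e::euclidean_space"
	assumes "subspace L" "!!t. t : {a..b} ==> (q has_vector_derivative q' t) (at t within {a..b})"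
	and "!!t. t : {a..b} ==> q' t : L" "s : {a..b}" "t : {a..b}"
	shows "q t - q s : L"
proof -
	have l:"linear (%x. x - proj L x)"
	using linear_proj[OF assms(1)] by (simp add:linear_compose_sub linear_id[unfolded id_def])
	hence "bounded_linear (%x. x - proj L x)" by (simp add:linear_conv_bounded_linear)
	note bl = bounded_linear.has_vector_derivative[OF this assms(2)]
	have "((%t. q t - proj L (q t)) has_derivative (%h. 0)) (at t within {a..b})" if "t : {a..b}" for t
	using bl[OF that] proj_id[OF assms(1) assms(3)[OF that]] by (simp add:has_vector_derivative_def)
	hence "q t - proj L (q t) = q s - proj L (q s)"
	by (rule has_derivative_zero_unique[OF convex_real_interval(5)]) (use assms in auto)
	hence "q t - q s = proj L (q t) - proj L (q s)" by (simp add:algebra_simps)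
	also have "... = proj L (q t - q s)" by (rule linear_diff[OF linear_proj[OF assms(1)],symmetric])
	finally have "q t - q s = proj L (q t - q s)" .
	thus ?thesis using proj_eq_iff[OF assms(1),of "q t - q s"] by simp
qed

text \<open>Flowing back for time 1 recovers the starting point; this uses that solutions exist from
  time -1 on.\<close>

lemma (in smooth_flow) flow_injective:
	assumes "flow W x 1 = flow W y 1"
	shows "x = y"
proof -
	have *: "flow W (flow W x 1) (-1) = x" for x
	proof -
	have "(%s. flow W x (1 + s)) (-1) = flow W ((%s. flow W x (1 + s)) 0) (-1)"
	proof (rule flow_unique[where a = "-1" and b = 0])
	fix t :: real assume t:"t : {-1..0}"
	have "(flow W x has_vector_derivative W (flow W x (1 + t))) (at (1 + t) within (+) 1 ` {-1..0})"
	using t by (intro flow_deriv_within) auto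
	moreover have "((+) 1 has_vector_derivative 1) (at t within {-1..0})"
	by (auto intro!:derivative_eq_intros simp:has_vector_derivative_def)
	ultimately have "(flow W x o (+) 1 has_vector_derivative 1 *\<^sub>R W (flow W x (1 + t))) (at t within {-1..0})"
	by (rule vector_diff_chain_within[rotated])
	thus "((%s. flow W x (1 + s)) has_vector_derivative W (flow W x (1 + t))) (at t within {-1..0})"
	by (simp add:comp_def)
	qed auto
	thus ?thesis by (simp add:flow_0)
	qed
	have "x = flow W (flow W x 1) (-1)" by (rule *[symmetric])
	also have "... = flow W (flow W y 1) (-1)" by (simp only: assms)
	also have "... = y" by (rule *)
	finally show ?thesis .
qed

text \<open>The picture in a slice chart: \<open>Q\<close> is the image of the chart,
  \<open>w\<close> the symplectic form in coordinates, and the points of \<open>Q\<close> in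
  \<open>L\<close> are those of the coisotropic submanifold, on which \<open>w\<close> restricts to
  a presymplectic form.\<close>

locale presymplectic =
	fixes Q :: "'e::euclidean_space set" and w :: "'e => 'e => 'e => real" and L :: "'e set"
	assumes open_Q:"open Q" and bil:"!!p. p : Q ==> bilinear (w p)" and alt:"!!p v. p : Q ==> w p v v = 0"
	and nondeg:"!!p a. p : Q ==> (!!b. w p a b = 0) ==> a = 0"
	and smooth_w:"!!a b. smooth_on Q (%p. w p a b)"
	and closed:"!!p u v x. p : Q ==>
	fder (%q. w q v x) p u + fder (%q. w q x u) p v + fder (%q. w q u v) p x = 0"
	and L:"subspace L" and coisotropic:"!!p a. p : Q ==> p : L ==> (!!b. b : L ==> w p a b = 0) ==> a : L"
begin

text \<open>Taken at all points of \<open>Q\<close> and not only at those in \<open>L\<close>, so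
  that a frame of it can be smooth on an open set.\<close>

definition ker :: "'e => 'e set" where "ker p = {a. ALL b:L. w p a b = 0}"

lemma linear_left:"p : Q ==> linear (%a. w p a b)" and linear_right:"p : Q ==> linear (w p a)"
	using bil by (auto simp:bilinear_def)

lemma anti:"p : Q ==> w p x y = - w p y x"
	using alt[of p "x + y"] alt[of p x] alt[of p y]
	by (simp add:bilinear_ladd[OF bil] bilinear_radd[OF bil])

lemma subspace_ker:"p : Q ==> subspace (ker p)"
	by (auto simp:ker_def subspace_def linear_0[OF linear_left] linear_add[OF linear_left] linear_scale[OF linear_left])

lemma ker_subset:"p : Q ==> p : L ==> ker p \<subseteq> L"
	using coisotropic by (auto simp:ker_def)

text \<open>By nondegeneracy the kernel near \<open>z\<close> is a graph over \<open>ker z\<close>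
  that varies smoothly: \<open>X p v\<close> is the element of \<open>ker p\<close> with the same
  orthogonal projection to \<open>ker z\<close> as \<open>v\<close>. It is found by inverting an
  operator \<open>B p\<close> close to the identity.\<close>

lemma frame_exists:
	assumes z:"z : Q"
	shows "EX r X. r > 0 & ball z r \<subseteq> Q & (ALL v. smooth_on (ball z r) (%p. X p v)) &
	(ALL p:ball z r. linear (X p) & (ALL v. X p v : ker p & X p (proj (ker z) v) = X p v &
	proj (ker z) (X p v) = proj (ker z) v) & (ALL a:ker p. X p a = a))"
proof -
	define E where "E = ker z"
	have E:"subspace E" unfolding E_def by (rule subspace_ker[OF z])
	\<comment> \<open>The functional \<open>w p x\<close> on \<open>L\<close> turned into a vector of
	  \<open>L\<close>; thus \<open>ker p\<close> is the null space of \<open>T p\<close>.\<close>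
	define T where "T p x = (SUM i:Basis. w p x (proj L i) *\<^sub>R i)" for p x
	have Tb:"T p x \<bullet> b = w p x (proj L b)" if p:"p : Q" for p x b
	proof -
	have l:"linear (%b. w p x (proj L b))"
	using linear_compose[OF linear_proj[OF L] linear_right[OF p]] by (simp add:comp_def)
	have "T p x \<bullet> b = (SUM i:Basis. (b \<bullet> i) *\<^sub>R w p x (proj L i))"
	unfolding T_def inner_sum_left by (rule sum.cong) (simp_all add:inner_commute[of b])
	also have "... = w p x (proj L b)" by (rule linear_sum_Basis[OF l,symmetric])
	finally show ?thesis .
	qed
	have linT:"linear (T p)" if p:"p : Q" for p
	unfolding T_def by (rule linearI)
	(simp_all add:linear_add[OF linear_left[OF p]] linear_scale[OF linear_left[OF p]] scaleR_add_left sum.distrib scaleR_sum_right)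
	have T0:"T p x = 0 \<longleftrightarrow> x : ker p" if p:"p : Q" for p x
	proof
	assume "T p x = 0"
	hence *: "w p x (proj L b) = 0" for b using Tb[OF p,of x b] by simp
	have "w p x b = 0" if "b : L" for b using *[of b] proj_id[OF L that] by simp
	thus "x : ker p" by (simp add:ker_def)
	next
	assume "x : ker p"
	thus "T p x = 0" using proj_in[OF L] by (simp add:T_def ker_def)
	qed
	have TL:"T p x : L" if p:"p : Q" for p x
	proof -
	define d where "d = T p x - proj L (T p x)"
	have "proj L d = 0" unfolding d_def using linear_diff[OF linear_proj[OF L]] proj_id[OF L proj_in[OF L]] by simp
	hence "T p x \<bullet> d = 0" using Tb[OF p,of x d] linear_0[OF linear_right[OF p]] by simp
	moreover have "proj L (T p x) \<bullet> d = 0"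
	using proj_orthogonal[OF L proj_in[OF L]] by (simp add:d_def inner_commute)
	ultimately have "d \<bullet> d = 0" by (simp add:d_def inner_diff_left)
	hence "T p x = proj L (T p x)" by (simp add:d_def)
	thus ?thesis using proj_in[OF L] by metis
	qed
	define C where "C = {x. ALL y:E. x \<bullet> y = 0}"
	have C:"subspace C" by (auto simp:C_def subspace_def inner_add_left)
	have "inj_on (T z) C"
	proof (subst linear_inj_on_iff_eq_0[OF linT[OF z] C],intro ballI impI)
	fix x assume "x : C" "T z x = 0"
	hence "x \<bullet> x = 0" using T0[OF z] by (auto simp:C_def E_def)
	thus "x = 0" by simp
	qed
	then obtain V where V:"V ` UNIV \<subseteq> C" "linear V" "!!x. x : C ==> V (T z x) = x"
	using linear_exists_left_inverse_on[OF linT[OF z] C] by blast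
	have inC:"x - proj E x : C" for x using proj_orthogonal[OF E] by (simp add:C_def)
	have TzE:"T z (proj E x) = 0" for x using T0[OF z] proj_in[OF E] by (simp add:E_def)
	have VT:"V (T z x) = x - proj E x" for x
	using V(3)[OF inC[of x]] linear_diff[OF linT[OF z],of x "proj E x"] TzE by simp
	\<comment> \<open>Nondegeneracy makes \<open>T z\<close> onto \<open>L\<close>, and this makes
	  \<open>V\<close> injective on \<open>L\<close>.\<close>
	have surj:"EX x. T z x = l" if l:"l : L" for l
	proof -
	define R where "R = range (T z)"
	have R:"subspace R" unfolding R_def by (rule linear_subspace_image[OF linT[OF z] subspace_UNIV])
	define d where "d = l - proj R l"
	have "R \<subseteq> L" using TL[OF z] by (auto simp:R_def)
	hence dL:"d : L" unfolding d_def using l proj_in[OF R] L by (blast intro:subspace_diff)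
	have "w z x d = 0" for x
	proof -
	have "T z x \<bullet> d = 0" using proj_orthogonal[OF R,of "T z x" l] by (simp add:d_def R_def inner_commute)
	thus ?thesis using Tb[OF z,of x d] proj_id[OF L dL] by simp
	qed
	hence "w z d x = 0" for x using anti[OF z,of d x] by simp
	hence "d = 0" using nondeg[OF z] by blast
	hence "l : R" using proj_in[OF R,of l] by (simp add:d_def)
	thus ?thesis by (auto simp:R_def)
	qed
	have Vinj:"l = 0" if l:"l : L" "V l = 0" for l
	proof -
	obtain x where x:"T z x = l" using surj[OF l(1)] by blast
	hence "x = proj E x" using VT[of x] l(2) by simp
	with x TzE[of x] show ?thesis by simp
	qed
	have projC:"proj E x = 0" if "x : C" for x
	proof -
	have "(x - proj E x) \<bullet> proj E x = 0" using proj_orthogonal[OF E proj_in[OF E]] .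
	moreover have "x \<bullet> proj E x = 0" using that proj_in[OF E] by (simp add:C_def)
	ultimately show ?thesis by (simp add:inner_diff_left)
	qed
	\<comment> \<open>\<open>B z\<close> is the identity, so \<open>B p\<close> is invertible near
	  \<open>z\<close>. Where \<open>B p x = proj E x\<close>, the injectivity of \<open>V\<close> on
	  \<open>L\<close> gives \<open>T p x = 0\<close>, so that \<open>x\<close> lies in
	  \<open>ker p\<close>.\<close>
	define B where "B p x = proj E x + V (T p x)" for p x
	have linB:"linear (B p)" if "p : Q" for p
	unfolding B_def using linear_compose_add[OF linear_proj[OF E] linear_compose[OF linT[OF that] V(2)]] by (simp add:comp_def)
	have smoothB:"smooth_on Q (%p. B p x)" for x
	unfolding B_def T_def
	by (intro sm_add[OF open_Q sm_const] sm_linear_compose[OF open_Q V(2)] sm_sum[OF open_Q]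
	sm_scaleR[OF open_Q] smooth_w sm_const)
	have Bz:"B z x = x" for x by (simp add:B_def VT)
	have "((%p. SUM i:Basis. norm (B p i - i)) \<longlongrightarrow> (SUM i:Basis. norm (B z i - i))) (at z)"
	using sm_cont[OF smoothB] open_Q z
	by (intro tendsto_sum tendsto_norm tendsto_diff tendsto_const) (simp add:continuous_on_eq_continuous_at isCont_def)
	hence "((%p. SUM i:Basis. norm (B p i - i)) \<longlongrightarrow> 0) (at z)" by (simp add:Bz)
	hence "\<forall>\<^sub>F p in at z. (SUM i:Basis. norm (B p i - i)) < 1" by (rule order_tendstoD) simp
	then obtain r1 where r1:"r1 > 0" "!!p. p ~= z ==> dist p z < r1 ==> (SUM i:Basis. norm (B p i - i)) < 1"
	unfolding eventually_at by blast
	obtain r2 where r2:"r2 > 0" "ball z r2 \<subseteq> Q" using open_Q z open_contains_ball by blast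
	define r where "r = min r1 r2"
	have r:"r > 0" "ball z r \<subseteq> Q" using r1 r2 by (auto simp:r_def)
	have bijB:"bij (B p)" if p:"p : ball z r" for p
	proof -
	have s:"(SUM i:Basis. norm (B p i - i)) < 1"
	using r1(2)[of p] p by (cases "p = z") (auto simp:Bz r_def dist_commute)
	have pQ:"p : Q" using r(2) p by blast
	have "x = 0" if "B p x = 0" for x
	proof (rule ccontr)
	assume "x ~= 0"
	have "norm x * 1 <= norm x * (SUM i:Basis. norm (B p i - i))"
	using norm_linear_diff_le[OF linB[OF pQ] linear_id,of x] that by simp
	with s \<open>x ~= 0\<close> show False by simp
	qed
	hence "inj (B p)" using linear_injective_0[OF linB[OF pQ]] by blast
	thus ?thesis using linear_injective_imp_surjective[OF linB[OF pQ]] by (simp add:bij_def)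
	qed
	define X where "X p v = inv (B p) (proj E v)" for p v
	have BX:"B p (X p v) = proj E v" if "p : ball z r" for p v
	unfolding X_def using bijB[OF that] by (simp add:bij_is_surj surj_f_inv_f)
	have "smooth_on (ball z r) (%p. X p v)" for v
	unfolding X_def
	by (rule sm_inv_operator[OF open_ball linB bijB sm_subset[OF smoothB r(2)]]) (use r(2) in auto)
	moreover have "linear (X p)" if p:"p : ball z r" for p
	proof -
	have "linear (inv (B p))"
	using linB[of p] bijB[OF p] p r(2) by (intro inj_linear_imp_inv_linear) (auto simp:bij_is_inj)
	from linear_compose[OF linear_proj[OF E] this] show ?thesis by (simp add:X_def[abs_def] comp_def)
	qed
	moreover have "proj E (X p v) = proj E v & X p v : ker p" if p:"p : ball z r" for p v
	proof -
	have pQ:"p : Q" using r(2) p by blast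
	have e:"proj E (X p v) + V (T p (X p v)) = proj E v" using BX[OF p,of v] by (simp add:B_def)
	have VC:"V y : C" for y using V(1) by blast
	have "proj E (proj E (X p v) + V (T p (X p v))) = proj E (proj E v)" using e by simp
	hence p1:"proj E (X p v) = proj E v"
	using linear_add[OF linear_proj[OF E]] projC[OF VC] proj_id[OF E proj_in[OF E]] by simp
	hence "V (T p (X p v)) = 0" using e by simp
	from Vinj[OF TL[OF pQ] this] show ?thesis using p1 T0[OF pQ] by simp
	qed
	moreover have "X p a = a" if p:"p : ball z r" and a:"a : ker p" for p a
	proof -
	have "B p a = proj E a" using T0[of p a] a p r(2) linear_0[OF V(2)] by (auto simp:B_def)
	thus ?thesis unfolding X_def using bijB[OF p] by (metis bij_inv_eq_iff)
	qed
	moreover have "X p (proj E v) = X p v" for p v by (simp add:X_def proj_id[OF E proj_in[OF E]])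
	ultimately show ?thesis using r unfolding E_def by (intro exI[of _ r] exI[of _ X]) simp
qed

end

locale kernel_frame = presymplectic +
	fixes z r X
	assumes z:"z : Q" "z : L" and r:"r > 0" "ball z r \<subseteq> Q"
	and smooth_X:"!!v. smooth_on (ball z r) (%p. X p v)"
	and linear_X:"!!p. p : ball z r ==> linear (X p)"
	and X_ker:"!!p v. p : ball z r ==> X p v : ker p"
	and X_proj:"!!p v. p : ball z r ==> X p (proj (ker z) v) = X p v"
	and proj_X:"!!p v. p : ball z r ==> proj (ker z) (X p v) = proj (ker z) v"
	and X_id:"!!p a. p : ball z r ==> a : ker p ==> X p a = a"
begin

abbreviation "pj == proj (ker z)"

lemma E:"subspace (ker z)" by (rule subspace_ker[OF z(1)])

lemma inQ:"p : ball z r ==> p : Q" using r(2) by blast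

lemma X_L:"p : ball z r ==> p : L ==> X p v : L"
	using X_ker ker_subset inQ by blast

lemma X_eq_0:
	assumes p:"p : ball z r" and a:"a : ker p" "pj a = 0"
	shows "a = 0"
	using X_id[OF p a(1)] X_proj[OF p,of a] a(2) linear_0[OF linear_X[OF p]] by simp

lemma X_has_derivative:"p : ball z r ==> ((%q. X q v) has_derivative fder (%q. X q v) p) (at p)"
	by (rule sm_hd[OF open_ball smooth_X])

lemma line_in_ball:"p : ball z r ==> \<forall>\<^sub>F s in at 0. p + s *\<^sub>R l : ball z r"
proof -
	assume p:"p : ball z r"
	have "((%s. p + s *\<^sub>R l) \<longlongrightarrow> p + 0 *\<^sub>R l) (at 0)" by (intro tendsto_intros)
	thus ?thesis using topological_tendstoD[of "%s. p + s *\<^sub>R l" "p + 0 *\<^sub>R l" "at 0" "ball z r"] p by simp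
qed

text \<open>The graph frame commutes: closedness puts the bracket into the kernel, and its \<open>pj\<close>-component
	vanishes because \<open>pj (X p v)\<close> does not depend on \<open>p\<close>.\<close>
lemma involutive:
	assumes p:"p \<in> ball z r" "p \<in> L"
	shows "fder (\<lambda>q. X q v) p (X p u) = fder (\<lambda>q. X q u) p (X p v)"
proof -
	define w' where "w' a b h = fder (\<lambda>q. w q a b) p h" for a b h
	define dX where "dX v h = fder (\<lambda>q. X q v) p h" for v h
	have pQ:"p \<in> Q" by (rule inQ[OF p(1)])
	have w':"((\<lambda>q. w q a b) has_derivative w' a b) (at p)" for a b
	using sm_hd[OF open_Q smooth_w pQ] by (simp add:w'_def[abs_def])
	have dX:"((\<lambda>q. X q v) has_derivative dX v) (at p)" for v
	using X_has_derivative[OF p(1)] by (simp add:dX_def[abs_def])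
	\<comment> \<open>From differentiating \<open>w q (X q v) l = 0\<close>, which holds on the whole
	  ball, in an arbitrary direction.\<close>
	have a:"w' (X p v) l h + w p (dX v h) l = 0" if l:"l \<in> L" for v l h
	proof -
	have "((\<lambda>q. w q (X q v) l) has_derivative (\<lambda>h. w' (X p v) l h + w p (dX v h) l + w p (X p v) 0)) (at p)"
	by (rule has_derivative_bilinear_family[OF open_Q pQ bil w' dX has_derivative_const])
	moreover have "((\<lambda>q. w q (X q v) l) has_derivative (\<lambda>h. 0)) (at p)"
	by (rule hd_transform[OF has_derivative_const[of 0] open_ball p(1)])
	(use X_ker l in \<open>simp add:ker_def\<close>)
	ultimately have "(\<lambda>h. w' (X p v) l h + w p (dX v h) l + w p (X p v) 0) = (\<lambda>h. 0)"
	by (rule has_derivative_unique)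
	from fun_cong[OF this,of h] show ?thesis using linear_0[OF linear_right[OF pQ]] by simp
	qed
	have dL:"dX v l \<in> L" if l:"l \<in> L" for v l
	proof (rule has_vector_derivative_in_subspace[of "\<lambda>s. X (p + s *\<^sub>R l) v" _ 0 UNIV])
	show "((\<lambda>s. X (p + s *\<^sub>R l) v) has_vector_derivative dX v l) (at 0)"
	by (rule has_vector_derivative_chain[OF has_vector_derivative_line]) (simp add:dX)
	show "\<forall>\<^sub>F s in at 0. X (p + s *\<^sub>R l) v - X (p + 0 *\<^sub>R l) v \<in> L"
	using line_in_ball[OF p(1),of l]
	by eventually_elim (use p l L X_L in \<open>auto intro!:subspace_diff subspace_add subspace_scale\<close>)
	qed (use L in auto)
	have b:"w' (X p u) (X p v) l = 0" if l:"l \<in> L" for l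
	proof -
	have "((\<lambda>q. w q (X q u) (X q v)) has_derivative
	(\<lambda>h. w' (X p u) (X p v) h + w p (dX u h) (X p v) + w p (X p u) (dX v h))) (at p)"
	by (rule has_derivative_bilinear_family[OF open_Q pQ bil w' dX dX])
	hence "((\<lambda>q. w q (X q u) (X q v)) has_derivative
	(\<lambda>h. w' (X p u) (X p v) h + w p (dX u h) (X p v) + w p (X p u) (dX v h))) (at (p + 0 *\<^sub>R l))" by simp
	from has_vector_derivative_chain[OF has_vector_derivative_line this]
	have "((\<lambda>s. w (p + s *\<^sub>R l) (X (p + s *\<^sub>R l) u) (X (p + s *\<^sub>R l) v)) has_vector_derivative
	(w' (X p u) (X p v) l + w p (dX u l) (X p v) + w p (X p u) (dX v l))) (at 0)" .
	moreover have "((\<lambda>s. w (p + s *\<^sub>R l) (X (p + s *\<^sub>R l) u) (X (p + s *\<^sub>R l) v)) has_vector_derivative 0) (at 0)"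
	proof -
	have z0:"w (p + s *\<^sub>R l) (X (p + s *\<^sub>R l) u) (X (p + s *\<^sub>R l) v) = 0" if "p + s *\<^sub>R l \<in> ball z r" for s
	using X_ker[OF that] X_L[OF that] L l p(2) by (auto simp:ker_def subspace_add subspace_scale)
	have c:"((\<lambda>s. 0::real) has_derivative (\<lambda>h. h *\<^sub>R 0)) (at 0)" by simp
	show ?thesis unfolding has_vector_derivative_def
	by (rule has_derivative_transform_eventually[OF c])
	(use line_in_ball[OF p(1),of l] z0 z0[of 0] p(1) in \<open>auto elim: eventually_mono\<close>)
	qed
	ultimately have "w' (X p u) (X p v) l + w p (dX u l) (X p v) + w p (X p u) (dX v l) = 0"
	by (rule vector_derivative_unique_at)
	moreover have "w p (X p v) (dX u l) = 0" "w p (X p u) (dX v l) = 0"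
	using X_ker[OF p(1)] dL[OF l] by (auto simp:ker_def)
	ultimately show ?thesis using anti[OF pQ,of "dX u l" "X p v"] by simp
	qed
	have neg:"w' l (X p u) h = - w' (X p u) l h" for l h
	proof -
	have "((\<lambda>q. - w q (X p u) l) has_derivative (\<lambda>h. - w' (X p u) l h)) (at p)"
	by (rule has_derivative_minus[OF w'])
	hence "((\<lambda>q. w q l (X p u)) has_derivative (\<lambda>h. - w' (X p u) l h)) (at p)"
	by (rule hd_transform[OF _ open_Q pQ]) (rule anti[symmetric])
	from fun_cong[OF has_derivative_unique[OF w' this],of h] show ?thesis .
	qed
	\<comment> \<open>The Lie bracket of the two frame fields at \<open>p\<close>.\<close>
	define d where "d = dX v (X p u) - dX u (X p v)"
	have "w p d l = 0" if l:"l \<in> L" for l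
	proof -
	have "w' (X p v) l (X p u) + w' l (X p u) (X p v) + w' (X p u) (X p v) l = 0"
	using closed[OF pQ,of "X p v" l "X p u"] by (simp add:w'_def)
	hence "w' (X p v) l (X p u) = w' (X p u) l (X p v)" using b[OF l] neg[of l "X p v"] by simp
	thus ?thesis
	using a[OF l,of v "X p u"] a[OF l,of u "X p v"] linear_diff[OF linear_left[OF pQ]] by (simp add:d_def)
	qed
	hence "d \<in> ker p" by (simp add:ker_def)
	moreover have "pj (dX v h) = 0" for v h
	proof -
	have "((\<lambda>q. pj (X q v)) has_derivative (\<lambda>h. pj (dX v h))) (at p)"
	by (rule bounded_linear.has_derivative[OF _ dX]) (use linear_proj[OF E] linear_conv_bounded_linear in blast)
	moreover have "((\<lambda>q. pj (X q v)) has_derivative (\<lambda>h. 0)) (at p)"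
	by (rule hd_transform[OF has_derivative_const open_ball p(1)]) (simp add:proj_X)
	ultimately have "(\<lambda>h. pj (dX v h)) = (\<lambda>h. 0)" by (rule has_derivative_unique)
	from fun_cong[OF this,of h] show ?thesis .
	qed
	hence "pj d = 0" unfolding d_def using linear_diff[OF linear_proj[OF E]] by simp
	ultimately have "d = 0" by (rule X_eq_0[OF p(1)])
	thus ?thesis by (simp add:d_def dX_def)
qed

end

section \<open>Flows along the kernel and the first integral that they define\<close>

context kernel_frame
begin

text \<open>The frame field with its direction as an additional variable, so that a single flow
  handles all directions and depends smoothly on them. The point enters through
  \<open>proj L\<close>, which fixes \<open>L\<close> and does not leave balls around
  \<open>z\<close>; the cut-offs make the support compact.\<close>

definition field0 :: "'a \<times> 'a => 'a" where
	"field0 x = (bump 0 1 (fst x) * bump z (r / 4) (snd x)) *\<^sub>R X (proj L (snd x)) (fst x)"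

lemma dist_proj_L:"dist (proj L p) z <= dist p z"
proof -
	have "proj L p - z = proj L (p - z)"
	using linear_diff[OF linear_proj[OF L],of p z] proj_id[OF L z(2)] by simp
	thus ?thesis using norm_proj_le[OF L,of "p - z"] by (simp add:dist_norm)
qed

lemma smooth_field0:"smooth_on UNIV field0"
proof (rule sm_local)
	fix x :: "'a \<times> 'a"
	define U where "U = {x :: 'a \<times> 'a. snd x : ball z r}"
	define V where "V = {x :: 'a \<times> 'a. r / 2 < dist (snd x) z}"
	have U:"open U" unfolding U_def using open_vimage_snd[OF open_ball[of z r]] by (simp add:vimage_def)
	have V:"open V" unfolding V_def by (intro open_Collect_less continuous_intros)
	have lin:"linear fst" "linear (snd :: 'a \<times> 'a => 'a)" by (simp_all add:linear_iff)
	have "smooth_on U field0"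
	proof -
	have A:"smooth_on U (%x. X (proj L (snd x)) v)" for v
	proof (rule sm_compose[OF U open_ball _ smooth_X])
	show "smooth_on U (%x. proj L (snd x))"
	using sm_linear[OF linear_compose[OF lin(2) linear_proj[OF L]]] by (simp add:comp_def)
	show "(%x. proj L (snd x)) ` U \<subseteq> ball z r"
	proof (rule image_subsetI)
	fix x assume "x : U"
	thus "proj L (snd x) : ball z r" using dist_proj_L[of "snd x"] by (simp add:U_def dist_commute)
	qed
	qed
	have "smooth_on U (%x. X (proj L (snd x)) (fst x))"
	proof (rule sm_apply_linear[of U "%x. X (proj L (snd x))" fst,OF U _ A sm_linear[OF lin(1)]])
	fix x assume "x : U"
	thus "linear (X (proj L (snd x)))"
	using dist_proj_L[of "snd x"] by (intro linear_X) (simp add:U_def dist_commute)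
	qed
	moreover have "smooth_on U (%x. bump 0 1 (fst x) * bump z (r / 4) (snd x))"
	by (intro sm_mult[OF U] sm_compose[OF U open_UNIV sm_linear[OF lin(1)] sm_bump]
	sm_compose[OF U open_UNIV sm_linear[OF lin(2)] sm_bump]) auto
	ultimately have "smooth_on U (%x. (bump 0 1 (fst x) * bump z (r / 4) (snd x)) *\<^sub>R X (proj L (snd x)) (fst x))"
	by (rule sm_scaleR[OF U,rotated])
	thus ?thesis by (simp only: field0_def[abs_def])
	qed
	moreover have "smooth_on V field0"
	by (rule sm_cong[OF V _ sm_const[of V 0]]) (use r(1) in \<open>simp add:V_def field0_def bump_eq_0\<close>)
	moreover have "x : U | x : V" using r(1) by (simp add:U_def V_def dist_commute) linarith
	ultimately show "EX U. open U & x : U & smooth_on U field0" using U V by blast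
qed

text \<open>Scales the Lipschitz constant to at most 1/12 and the speed to at most
  \<open>r / 24\<close>. Orbits then move by at most \<open>3 * r / 24 = r / 8\<close>, so from
  distance \<open>r / 8\<close> they remain in the region of radius \<open>r / 4\<close> where the
  cut-off is 1.\<close>

definition ka :: real where
	"ka = (SOME k. k > 0 & (EX B>0. k * B <= 1/12 & k * B <= r / 24 & (ALL x. norm (field0 x) <= B) &
	(ALL x v. norm (fder field0 x v) <= B * norm v)))"

lemma ka:"ka > 0 & (EX B>0. ka * B <= 1/12 & ka * B <= r / 24 & (ALL x. norm (field0 x) <= B) &
	(ALL x v. norm (fder field0 x v) <= B * norm v))"
proof -
	have out:"field0 x = 0" if "x ~: cball 0 2 \<times> cball z (r / 2)" for x
	using that r(1) bump_eq_0[of 1 "fst x" 0] bump_eq_0[of "r / 4" "snd x" z]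
	by (cases "fst x : cball 0 2") (auto simp:field0_def mem_Times_iff dist_commute)
	have "EX B>0. (ALL x. norm (field0 x) <= B) & (ALL x v. norm (fder field0 x v) <= B * norm v)"
	proof (rule compact_support_bounds[OF smooth_field0 compact_Times[OF compact_cball compact_cball] out])
	fix B :: real
	assume "B > 0" "!!x. norm (field0 x) <= B" "!!x v. norm (fder field0 x v) <= B * norm v"
	thus ?thesis by blast
	qed
	then obtain B where B:"B > 0" "ALL x. norm (field0 x) <= B" "ALL x v. norm (fder field0 x v) <= B * norm v" by blast
	define k where "k = min (1/12) (r / 24) / B"
	have "k > 0" "k * B <= 1/12" "k * B <= r / 24" using B(1) r(1) by (auto simp:k_def)
	thus ?thesis unfolding ka_def by (intro someI_ex[of "%k. k > 0 & _ k"] exI[of _ k]) (use B in blast)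
qed

definition field :: "'a \<times> 'a => 'a \<times> 'a" where "field x = (0,ka *\<^sub>R field0 x)"

lemma field_props:"EX K. smooth_flow field (cball 0 2 \<times> cball z (r / 2)) K & (ALL x. norm (field x) <= r / 24)"
proof -
	obtain B where B:"B > 0" "ka * B <= 1/12" "ka * B <= r / 24" "ALL x. norm (field0 x) <= B"
	"ALL x v. norm (fder field0 x v) <= B * norm v" using ka by blast
	have k:"ka > 0" using ka by blast
	have "(field has_derivative (%v. (0,ka *\<^sub>R fder field0 x v))) (at x)" for x
	unfolding field_def[abs_def]
	by (intro has_derivative_Pair has_derivative_const has_derivative_scaleR_right
	sm_hd[OF open_UNIV smooth_field0]) simp
	hence fd:"fder field x = (%v. (0,ka *\<^sub>R fder field0 x v))" for x
	by (rule frechet_derivative_at[symmetric])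
	have kb:"ka * norm y <= ka * B * c" if "norm y <= B * c" for y :: 'a and c
	using mult_left_mono[OF that,of ka] k by (simp add:mult.assoc)
	have "smooth_flow field (cball 0 2 \<times> cball z (r / 2)) (ka * B)"
	proof
	show "smooth_on UNIV field" unfolding field_def[abs_def]
	by (intro smooth_on_Pair[OF open_UNIV sm_const] sm_scaleR[OF open_UNIV sm_const smooth_field0])
	show "compact (cball (0 :: 'a) 2 \<times> cball z (r / 2))" by (rule compact_Times[OF compact_cball compact_cball])
	show "field x = 0" if "x ~: cball 0 2 \<times> cball z (r / 2)" for x
	using that r(1) bump_eq_0[of 1 "fst x" 0] bump_eq_0[of "r / 4" "snd x" z]
	by (cases "fst x : cball 0 2") (auto simp:field_def field0_def mem_Times_iff dist_commute zero_prod_def)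
	show "norm (fder field x v) <= ka * B * norm v" for x v
	proof -
	have "norm (fder field x v) = ka * norm (fder field0 x v)" using k unfolding fd norm_Pair by simp
	thus ?thesis using kb[OF B(5)[rule_format,of x v]] by (simp only:)
	qed
	qed (use B k in auto)
	moreover have "norm (field x) <= r / 24" for x
	proof -
	have "norm (field x) = ka * norm (field0 x)" using k unfolding field_def norm_Pair by simp
	thus ?thesis using kb[of "field0 x" 1] B(3) B(4)[rule_format,of x] by linarith
	qed
	ultimately show ?thesis by blast
qed

definition KF :: real where
	"KF = (SOME K. smooth_flow field (cball 0 2 \<times> cball z (r / 2)) K & (ALL x. norm (field x) <= r / 24))"

lemma KF:"smooth_flow field (cball 0 2 \<times> cball z (r / 2)) KF & (ALL x. norm (field x) <= r / 24)"
	unfolding KF_def by (rule someI_ex[OF field_props])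

sublocale F: smooth_flow field "cball 0 2 \<times> cball z (r / 2)" KF using KF by blast

lemma kpos:"ka > 0" using ka by blast

lemma field_eq:
	assumes "norm v <= 1" "dist p z <= r / 4" "p : L"
	shows "field (v,p) = (0,ka *\<^sub>R X p v)"
	using assms r(1) bump_eq_1[of 1 v 0] bump_eq_1[of "r / 4" p z] proj_id[OF L assms(3)]
	by (simp add:field_def field0_def)

text \<open>The motion from \<open>p\<close> along the kernel with constant \<open>pj\<close>-velocity \<open>ka *\<^sub>R v\<close>.\<close>
definition move :: "'a \<Rightarrow> 'a \<Rightarrow> real \<Rightarrow> 'a" where "move v p t = snd (flow field (v,p) t)"

lemma flow_eq_move:"t : {-1..2} ==> flow field (v,p) t = (v,move v p t)"
proof -
	assume t:"t : {-1..2}"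
	have "((%t. fst (flow field (v,p) t)) has_derivative (%h. 0)) (at t within {-1..2})" if "t : {-1..2}" for t
	using bounded_linear.has_vector_derivative[OF bounded_linear_fst F.flow_deriv[OF that,of "(v,p)"]]
	by (simp add:has_vector_derivative_def field_def)
	hence "fst (flow field (v,p) t) = fst (flow field (v,p) 0)"
	by (rule has_derivative_zero_unique[OF convex_real_interval(5)]) (use t in auto)
	thus "flow field (v,p) t = (v,move v p t)" by (simp add:move_def F.flow_0 prod_eq_iff)
qed

lemma move_0:"move v p 0 = p" by (simp add:move_def F.flow_0)

lemma move_deriv_field:
	assumes "t : {-1..2}"
	shows "(move v p has_vector_derivative snd (field (v,move v p t))) (at t within {-1..2})"
	using bounded_linear.has_vector_derivative[OF bounded_linear_snd F.flow_deriv[OF assms,of "(v,p)"]]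
	unfolding flow_eq_move[OF assms] by (simp add:move_def[abs_def])

lemma move_dist:"t : {-1..2} ==> norm (move v p t - p) <= 3 * norm (field (v,p))"
proof -
	assume t:"t : {-1..2}"
	have "norm (move v p t - p) <= norm (flow field (v,p) t - (v,p))"
	using norm_snd_le[of "snd (flow field (v,p) t - (v,p))" "fst (flow field (v,p) t - (v,p))"] unfolding prod.collapse by (simp add:move_def)
	also have "... <= 3 * norm (field (v,p))" by (rule F.flow_displacement[OF t])
	finally show ?thesis .
qed

lemma move_near:
	assumes "t : {-1..2}" "dist p z < r / 8"
	shows "dist (move v p t) z < r / 4"
proof -
	have "norm (field (v,p)) <= r / 24" using KF by blast
	hence "dist (move v p t) p <= r / 8" using move_dist[OF assms(1),of v p] by (simp add:dist_norm)
	thus ?thesis using dist_triangle[of "move v p t" z p] assms(2) by linarith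
qed

lemma move_L:
	assumes "t : {-1..2}" "dist p z < r / 8" "p : L"
	shows "move v p t : L"
proof -
	have f:"snd (field (v,q)) : L" if "dist q z < r / 4" for q
	proof -
	have "proj L q : ball z r" using that dist_proj_L[of q] r(1) by (simp add:dist_commute)
	hence "X (proj L q) v : L" using X_L[OF _ proj_in[OF L]] by blast
	thus ?thesis using L by (simp add:field_def field0_def subspace_scale)
	qed
	have "move v p t - move v p 0 : L"
	by (rule stays_in_subspace[OF L move_deriv_field]) (use assms(1) f move_near[OF _ assms(2)] in auto)
	thus ?thesis using assms(3) L by (metis move_0 diff_add_cancel subspace_add)
qed

lemma move_deriv:
	assumes "t : {-1..2}" "norm v <= 1" "dist p z < r / 8" "p : L"
	shows "(move v p has_vector_derivative ka *\<^sub>R X (move v p t) v) (at t within {-1..2})"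
	using move_deriv_field[OF assms(1),of v p] field_eq[OF assms(2) less_imp_le[OF move_near[OF assms(1,3)]] move_L[OF assms(1,3,4)],of v]
	by simp

lemma move_ball:
	assumes "t : {-1..2}" "dist p z < r / 8"
	shows "move v p t : ball z r"
	using move_near[OF assms,of v] r(1) by (simp add:dist_commute)

lemma proj_move:
	assumes t:"t : {-1..2}" and "norm v <= 1" "dist p z < r / 8" "p : L"
	shows "pj (move v p t) = pj p + (t * ka) *\<^sub>R pj v"
proof -
	have bl:"bounded_linear pj" using linear_proj[OF E] linear_conv_bounded_linear by blast
	have "((%t. pj (move v p t) - (t * ka) *\<^sub>R pj v) has_derivative (%h. 0)) (at t within {-1..2})" if t:"t : {-1..2}" for t
	proof -
	have "((%t. pj (move v p t)) has_vector_derivative pj (ka *\<^sub>R X (move v p t) v)) (at t within {-1..2})"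
	by (rule bounded_linear.has_vector_derivative[OF bl move_deriv[OF t assms(2-4)]])
	hence "((%t. pj (move v p t)) has_vector_derivative ka *\<^sub>R pj v) (at t within {-1..2})"
	using linear_scale[OF linear_proj[OF E]] proj_X[OF move_ball[OF t assms(3)]] by simp
	moreover have "((%t. (t * ka) *\<^sub>R pj v) has_vector_derivative ka *\<^sub>R pj v) (at t within {-1..2})"
	by (auto intro!:derivative_eq_intros)
	ultimately have "((%t. pj (move v p t) - (t * ka) *\<^sub>R pj v) has_vector_derivative ka *\<^sub>R pj v - ka *\<^sub>R pj v) (at t within {-1..2})"
	by (rule has_vector_derivative_diff)
	thus ?thesis by (simp add:has_vector_derivative_def)
	qed
	hence "pj (move v p t) - (t * ka) *\<^sub>R pj v = pj (move v p 0) - (0 * ka) *\<^sub>R pj v"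
	by (rule has_derivative_zero_unique[OF convex_real_interval(5)]) (use t in auto)
	thus ?thesis by (simp add:move_0 algebra_simps)
qed

text \<open>In directions whose point component lies in \<open>L\<close> the inner
  \<open>proj L\<close> acts as the identity, so the derivative of the extended field is that of the
  frame.\<close>

lemma fder_field:
	assumes v:"norm v < 1" and q:"dist q z < r / 4" "q : L" and h:"snd h : L"
	shows "fder field (v,q) h = (0,ka *\<^sub>R (fder (%p. X p v) q (snd h) + X q (fst h)))"
proof -
	define S where "S = {x :: 'a \<times> 'a. norm (fst x) < 1 & dist (snd x) z < r / 4}"
	have S:"open S" unfolding S_def
	by (intro open_Collect_conj open_Collect_less continuous_intros)
	have xS:"(v,q) : S" using v q by (simp add:S_def)
	have pS:"proj L (snd x) : ball z r" if "x : S" for x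
	using that dist_proj_L[of "snd x"] r(1) by (simp add:S_def dist_commute)
	have qb:"q : ball z r" using q(1) r(1) by (simp add:dist_commute)
	have lin:"bounded_linear (%x :: 'a \<times> 'a. proj L (snd x))"
	using bounded_linear_compose[OF linear_proj[OF L,unfolded linear_conv_bounded_linear] bounded_linear_snd] .
	have A:"((%x. X (proj L (snd x)) u) has_derivative (%h. fder (%p. X p u) q (proj L (snd h)))) (at (v,q))" for u
	proof (rule has_derivative_compose[OF bounded_linear_imp_has_derivative[OF lin]])
	show "((%p. X p u) has_derivative fder (%p. X p u) q) (at (proj L (snd (v,q))))"
	using X_has_derivative[OF qb] proj_id[OF L q(2)] by simp
	qed
	have "((%x. X (proj L (snd x)) (fst x)) has_derivative
	(%h. fder (%p. X p (fst (v,q))) q (proj L (snd h)) + X (proj L (snd (v,q))) (fst h))) (at (v,q))"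
	by (rule has_derivative_linear_family[of S "(v,q)" "%x. X (proj L (snd x))",OF S xS linear_X[OF pS] A bounded_linear_imp_has_derivative[OF bounded_linear_fst]])
	hence "((%x. X (proj L (snd x)) (fst x)) has_derivative
	(%h. fder (%p. X p v) q (proj L (snd h)) + X q (fst h))) (at (v,q))"
	by (simp add:proj_id[OF L q(2)])
	hence "((%x. (0 :: 'a,ka *\<^sub>R X (proj L (snd x)) (fst x))) has_derivative
	(%h. (0,ka *\<^sub>R (fder (%p. X p v) q (proj L (snd h)) + X q (fst h))))) (at (v,q))"
	by (intro has_derivative_Pair has_derivative_const has_derivative_scaleR_right)
	hence "(field has_derivative
	(%h. (0,ka *\<^sub>R (fder (%p. X p v) q (proj L (snd h)) + X q (fst h))))) (at (v,q))"
	by (rule hd_transform[OF _ S xS])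
	(use r(1) in \<open>auto simp:S_def field_def field0_def bump_eq_1\<close>)
	from fder_eq[OF this,of h] show ?thesis
	using proj_id[OF L h] by simp
qed

text \<open>The bound \<open>ka / 2\<close> allows two points of the ball to be joined in
  \<open>same_plaque\<close> with a velocity of norm at most 1, where the cut-off in the direction
  is 1.\<close>

definition rh :: real where "rh = min (ka / 2) (r / 8)"

lemma rh:"rh > 0" "rh <= r / 8" "rh <= ka / 2" "ball z rh \<subseteq> ball z r"
	using kpos r(1) by (auto simp:rh_def)

text \<open>For \<open>p\<close> in \<open>L\<close> this moves \<open>p\<close> along the kernel
  onto the transversal \<open>pj = pj z\<close>; the point of arrival labels the plaque of
  \<open>p\<close>.\<close>

definition first_integral :: "'a => 'a" where
	"first_integral p = move ((- 1 / ka) *\<^sub>R pj (p - z)) p 1"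

lemma back_velocity:"p : ball z rh ==> norm ((- 1 / ka) *\<^sub>R pj (p - z)) < 1"
proof -
	assume p:"p : ball z rh"
	have "norm (pj (p - z)) <= norm (p - z)" by (rule norm_proj_le[OF E])
	also have "... < ka" using p rh(3) kpos by (simp add:dist_norm norm_minus_commute)
	finally show ?thesis using kpos by simp
qed

text \<open>The core of Frobenius' theorem. If \<open>p\<close> is displaced by \<open>a\<close> in
  \<open>ker p\<close>, the velocity of the motion to the transversal changes accordingly, and the
  arrival point should not move to first order. That the predicted variation of the orbit does solve
  the linearised equation is where \<open>involutive\<close> enters.\<close>

lemma first_integral_deriv:
	assumes p:"p : ball z rh" "p : L"
	shows "EX b'. (first_integral has_derivative b') (at p) & (ALL a:ker p. b' a = 0)"
proof -
	define v where "v = (- 1 / ka) *\<^sub>R pj (p - z)"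
	have v:"norm v < 1" "norm v <= 1" using back_velocity[OF p(1)] by (auto simp:v_def)
	have pz:"dist p z < r / 8" using p(1) rh(2) by (simp add:dist_commute)
	define Ph where "Ph p = ((- 1 / ka) *\<^sub>R pj (p - z),p)" for p
	have bl:"bounded_linear pj" using linear_proj[OF E] linear_conv_bounded_linear by blast
	have "((%p. p - z) has_derivative (%h. h)) (at p)" by (auto intro!:derivative_eq_intros)
	hence Ph:"(Ph has_derivative (%h. ((- 1 / ka) *\<^sub>R pj h,h))) (at p)"
	unfolding Ph_def by (intro has_derivative_Pair has_derivative_scaleR_right bounded_linear.has_derivative[OF bl] has_derivative_ident)
	obtain D where D:"ALL t:{-1..2}. ((%x. flow field x t) has_derivative (%h. D h t)) (at (Ph p))" "ALL h. D h 0 = h"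
	"ALL h. ALL t:{-1..2}. (D h has_vector_derivative fder field (flow field (Ph p) t) (D h t)) (at t within {-1..2})"
	using F.flow_has_derivative[of "Ph p"] by blast
	have D1:"((%x. flow field x 1) has_derivative (%h. D h 1)) (at (Ph p))" using D(1) by simp
	have "((%p. snd (flow field (Ph p) 1)) has_derivative (%h. snd (D ((- 1 / ka) *\<^sub>R pj h,h) 1))) (at p)"
	by (rule bounded_linear.has_derivative[OF bounded_linear_snd has_derivative_compose[OF Ph D1]])
	hence fi:"(first_integral has_derivative (%h. snd (D ((- 1 / ka) *\<^sub>R pj h,h) 1))) (at p)"
	by (simp add:first_integral_def[abs_def] move_def Ph_def)
	have "snd (D ((- 1 / ka) *\<^sub>R pj a,a) 1) = 0" if a:"a : ker p" for a
	proof -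
	define h where "h = ((- 1 / ka) *\<^sub>R pj a,a)"
	define q where "q = move v p"
	\<comment> \<open>The expected variation: it starts as the given displacement and decreases
	  linearly along the frame to 0 at time 1.\<close>
	define \<zeta> where "\<zeta> t = ((- 1 / ka) *\<^sub>R pj a,(1 - t) *\<^sub>R X (q t) a)" for t
	have Php:"Ph p = (v,p)" by (simp add:Ph_def v_def)
	have q:"q t : ball z r" "q t : L" "dist (q t) z < r / 4" if "t : {0..1}" for t
	using that move_ball[OF _ pz] move_L[OF _ pz p(2)] move_near[OF _ pz] by (auto simp:q_def)
	have "norm (D h 1 - \<zeta> 1) <= 2 * norm (D h 0 - \<zeta> 0) + 3 * 0"
	proof (rule ode_stability[where W = "%t. fder field (v,q t)" and K = KF and a = 0 and b = 1
	and g = "%t. fder field (v,q t) (\<zeta> t)"])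
	show "norm (fder field (v,q t) y - fder field (v,q t) y') <= KF * norm (y - y')" for t y y'
	using F.bound[of "(v,q t)" "y - y'"] by (simp add:linear_diff[OF F.linear_fder])
	fix t :: real assume t:"t : {0..1}"
	have t':"t : {-1..2}" "{0..1} \<subseteq> {-1..2::real}" using t by auto
	have "(D h has_vector_derivative fder field (flow field (Ph p) t) (D h t)) (at t within {-1..2})"
	using D(3) t'(1) by blast
	thus "(D h has_vector_derivative fder field (v,q t) (D h t)) (at t within {0..1})"
	unfolding Php flow_eq_move[OF t'(1)] q_def by (rule has_vector_derivative_within_subset[OF _ t'(2)])
	have qd:"(q has_vector_derivative ka *\<^sub>R X (q t) v) (at t within {0..1})"
	unfolding q_def by (rule has_vector_derivative_within_subset[OF move_deriv[OF t'(1) v(2) pz p(2)] t'(2)])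
	have "((%t. X (q t) a) has_vector_derivative fder (%p. X p a) (q t) (ka *\<^sub>R X (q t) v)) (at t within {0..1})"
	by (rule has_vector_derivative_chain[OF qd X_has_derivative[OF q(1)[OF t]]])
	hence "((%t. (1 - t) *\<^sub>R X (q t) a) has_vector_derivative
	((1 - t) *\<^sub>R fder (%p. X p a) (q t) (ka *\<^sub>R X (q t) v) + (- 1) *\<^sub>R X (q t) a)) (at t within {0..1})"
	by (intro has_vector_derivative_scaleR) (auto intro!:derivative_eq_intros)
	hence "(\<zeta> has_vector_derivative
	(0,(1 - t) *\<^sub>R fder (%p. X p a) (q t) (ka *\<^sub>R X (q t) v) + (- 1) *\<^sub>R X (q t) a)) (at t within {0..1})"
	unfolding \<zeta>_def by (intro has_vector_derivative_Pair has_vector_derivative_const)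
	moreover have "fder field (v,q t) (\<zeta> t) =
	(0,(1 - t) *\<^sub>R fder (%p. X p a) (q t) (ka *\<^sub>R X (q t) v) + (- 1) *\<^sub>R X (q t) a)"
	proof -
	have l:"linear (fder (%p. X p u) (q t))" for u
	by (rule sm_linear_fder[OF open_ball smooth_X q(1)[OF t]])
	have "snd (\<zeta> t) : L" using X_L[OF q(1,2)[OF t]] L by (simp add:\<zeta>_def subspace_scale)
	hence "fder field (v,q t) (\<zeta> t) =
	(0,ka *\<^sub>R (fder (%p. X p v) (q t) ((1 - t) *\<^sub>R X (q t) a) + X (q t) ((- 1 / ka) *\<^sub>R pj a)))"
	using fder_field[OF v(1) q(3,2)[OF t]] by (simp add:\<zeta>_def)
	moreover have "X (q t) ((- 1 / ka) *\<^sub>R pj a) = (- 1 / ka) *\<^sub>R X (q t) a"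
	using linear_scale[OF linear_X[OF q(1)[OF t]]] X_proj[OF q(1)[OF t]] by metis
	moreover have "fder (%p. X p v) (q t) ((1 - t) *\<^sub>R X (q t) a) = (1 - t) *\<^sub>R fder (%p. X p a) (q t) (X (q t) v)"
	using linear_scale[OF l] involutive[OF q(1,2)[OF t]] by simp
	ultimately show ?thesis using kpos linear_scale[OF l]
	by (simp add:scaleR_add_right mult.commute)
	qed
	ultimately show "(\<zeta> has_vector_derivative fder field (v,q t) (\<zeta> t)) (at t within {0..1})" by simp
	qed (use F.K in auto)
	moreover have "\<zeta> 0 = h" using X_id[of p a] a p(1) rh(4) by (auto simp:\<zeta>_def h_def q_def move_0)
	ultimately have "D h 1 = \<zeta> 1" using D(2) by simp
	thus ?thesis by (simp add:h_def \<zeta>_def)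
	qed
	thus ?thesis using fi by blast
qed

text \<open>Points with equal \<open>pj\<close> are moved with the same velocity, and the flow is
  injective. So \<open>pj\<close> and the label together separate the points of the ball.\<close>

lemma first_integral_injective:
	assumes "p : ball z rh" "p' : ball z rh" "pj p = pj p'" "first_integral p = first_integral p'"
	shows "p = p'"
proof -
	have "pj (p - z) = pj (p' - z)" using assms(3) linear_diff[OF linear_proj[OF E]] by simp
	then obtain v where "first_integral p = move v p 1" "first_integral p' = move v p' 1"
	unfolding first_integral_def by auto
	hence "flow field (v,p) 1 = flow field (v,p') 1" using assms(4) by (simp add:flow_eq_move)
	from F.flow_injective[OF this] show ?thesis by simp
qed

text \<open>The motion from \<open>p\<close> with velocity \<open>pj (p' - p) / ka\<close> keeps the
  label and arrives at the \<open>pj\<close> of \<open>p'\<close>, hence at \<open>p'\<close>. The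
  open set \<open>U\<close> will be the overlap with a second box, which the joining curve must not
  leave.\<close>

lemma same_plaque:
	assumes p:"p : ball z rh" "p : L" and U:"open U" "p : U"
	shows "EX de>0. ALL p':ball p de. p' : L --> p' : ball z rh --> first_integral p' = first_integral p -->
	(EX y y'. y 0 = p & y 1 = p' & (ALL t:{0..1}. y t : L & y t : ball z rh & y t : U &
	(y has_vector_derivative y' t) (at t within {0..1}) & y' t : ker (y t)))"
proof -
	have pr:"p : ball z r" and pz:"dist p z < r / 8" using p(1) rh(2) r(1) by (auto simp:dist_commute)
	obtain c where c:"c > 0" "!!v. norm (X p v) <= c * norm v"
	using bounded_linear.pos_bounded[OF linear_X[OF pr,unfolded linear_conv_bounded_linear]] by (metis mult.commute)
	obtain e where e:"e > 0" "ball p e \<subseteq> U Int ball z rh"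
	proof -
	have "open (U Int ball z rh)" "p : U Int ball z rh" using U p(1) by auto
	thus ?thesis using that open_contains_ball by blast
	qed
	define de where "de = e / (3 * c)"
	have "EX y y'. y 0 = p & y 1 = p' & (ALL t:{0..1}. y t : L & y t : ball z rh & y t : U &
	(y has_vector_derivative y' t) (at t within {0..1}) & y' t : ker (y t))"
	if p':"p' : ball p de" "p' : L" "p' : ball z rh" "first_integral p' = first_integral p" for p'
	proof -
	define v where "v = (1 / ka) *\<^sub>R pj (p' - p)"
	have n:"norm v <= norm (p' - p) / ka"
	using norm_proj_le[OF E,of "p' - p"] kpos by (simp add:v_def divide_right_mono)
	have "norm (p' - p) <= dist p' z + dist p z" using dist_triangle2[of p' p z] by (simp add:dist_norm)
	also have "... <= ka" using p(1) p'(3) rh(3) by (simp add:dist_commute)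
	finally have "norm (p' - p) / ka <= 1" using kpos by simp
	hence v1:"norm v <= 1" using n by linarith
	have "field (v,p) = (0,ka *\<^sub>R X p v)" using pz by (intro field_eq[OF v1 _ p(2)]) (use r(1) in linarith)
	hence "norm (field (v,p)) = ka * norm (X p v)" using kpos by (simp add:norm_Pair)
	also have "... <= ka * (c * (norm (p' - p) / ka))"
	using kpos c(1) n by (intro mult_left_mono order_trans[OF c(2)[of v]]) auto
	also have "... = c * norm (p' - p)" using kpos by simp
	finally have f:"3 * norm (field (v,p)) <= 3 * c * norm (p' - p)" by simp
	also have "... < e" using p'(1) c(1) by (simp add:de_def dist_norm norm_minus_commute field_simps)
	finally have fe:"3 * norm (field (v,p)) < e" .
	define y where "y = move v p"
	have y:"y t : U Int ball z rh" if "t : {0..1}" for t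
	proof -
	have "dist p (y t) < e" using move_dist[of t v p] fe that by (simp add:y_def dist_norm norm_minus_commute)
	thus ?thesis using e(2) by auto
	qed
	have yL:"y t : L" if "t : {0..1}" for t using move_L[OF _ pz p(2),of t v] that by (simp add:y_def)
	have yd:"(y has_vector_derivative ka *\<^sub>R X (y t) v) (at t within {0..1})" if "t : {0..1}" for t
	unfolding y_def by (rule has_vector_derivative_within_subset[OF move_deriv[OF _ v1 pz p(2)]]) (use that in auto)
	have yk:"ka *\<^sub>R X (y t) v : ker (y t)" if "t : {0..1}" for t
	proof -
	have "y t : ball z r" using y[OF that] rh(4) by blast
	thus ?thesis using X_ker subspace_ker[OF inQ] by (blast intro:subspace_scale)
	qed
	have "((%t. first_integral (y t)) has_derivative (%h. 0)) (at t within {0..1})" if t:"t : {0..1}" for t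
	proof -
	have "y t : ball z rh" using y[OF t] by blast
	then obtain b' where b':"(first_integral has_derivative b') (at (y t))" "ALL a:ker (y t). b' a = 0"
	using first_integral_deriv yL[OF t] by blast
	from has_vector_derivative_chain[OF yd[OF t] b'(1)] show ?thesis
	using b'(2) yk[OF t] by (simp add:has_vector_derivative_def)
	qed
	hence "first_integral (y 1) = first_integral (y 0)"
	by (rule has_derivative_zero_unique[OF convex_real_interval(5)]) auto
	moreover have "pj (y 1) = pj p'"
	proof -
	have "pj v = v" unfolding v_def using linear_scale[OF linear_proj[OF E]] proj_id[OF E proj_in[OF E]] by simp
	thus ?thesis using proj_move[OF _ v1 pz p(2),of 1] kpos
	by (simp add:y_def v_def linear_diff[OF linear_proj[OF E]])
	qed
	ultimately have "y 1 = p'"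
	using first_integral_injective[OF _ p'(3)] y[of 1] p'(4) by (simp add:y_def move_0)
	thus ?thesis using y yL yd yk
	by (intro exI[of _ y] exI[of _ "%t. ka *\<^sub>R X (y t) v"]) (simp add:y_def move_0)
	qed
	moreover have "de > 0" using e(1) c(1) by (simp add:de_def)
	ultimately show ?thesis by blast
qed

text \<open>The factor \<open>et\<close> shortens \<open>a\<close> to norm at most 1, where the
  cut-off in the direction is 1; together with \<open>ka\<close> it makes up the factor
  \<open>s\<close>.\<close>

lemma kernel_curve:
	assumes a:"a : ker z"
	shows "EX s>0. EX y. smooth_on {-1<..<2::real} y & y 0 = z & (ALL t:{-1<..<2}. y t : L & y t : ball z r &
	fder y t 1 : ker (y t)) & fder y 0 1 = s *\<^sub>R a"
proof -
	define et where "et = 1 / (norm a + 1)"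
	have et:"et > 0" "norm (et *\<^sub>R a) <= 1" by (auto simp:et_def add_nonneg_pos intro!:divide_le_eq_1[THEN iffD2])
	define y where "y = move (et *\<^sub>R a) z"
	have zz:"dist z z < r / 8" using r(1) by simp
	have "smooth_on {-1<..<2} y"
	unfolding y_def move_def[abs_def] by (rule sm_linear_compose[OF _ _ F.flow_smooth]) (auto simp:linear_iff)
	moreover have fd:"fder y t 1 = ka *\<^sub>R X (y t) (et *\<^sub>R a)" if t:"t : {-1<..<2}" for t
	proof -
	have "(y has_vector_derivative ka *\<^sub>R X (y t) (et *\<^sub>R a)) (at t within {-1<..<2})"
	unfolding y_def
	by (rule has_vector_derivative_within_subset[OF move_deriv[OF _ et(2) zz z(2)]]) (use t in auto)
	hence "(y has_derivative (%h. h *\<^sub>R (ka *\<^sub>R X (y t) (et *\<^sub>R a)))) (at t)"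
	using t at_within_open[of t "{-1<..<2}"] by (simp add:has_vector_derivative_def)
	from fder_eq[OF this,of 1] show ?thesis by simp
	qed
	have yb:"y t : ball z r" "y t : L" if "t : {-1<..<2}" for t
	using that move_ball[OF _ zz] move_L[OF _ zz z(2)] by (auto simp:y_def)
	moreover have "fder y t 1 : ker (y t)" if t:"t : {-1<..<2}" for t
	unfolding fd[OF t] using X_ker[OF yb(1)[OF t]] subspace_ker[OF inQ[OF yb(1)[OF t]]] by (blast intro:subspace_scale)
	moreover have "fder y 0 1 = (ka * et) *\<^sub>R a"
	proof -
	have "X z (et *\<^sub>R a) = et *\<^sub>R a" using r(1) a subspace_ker[OF z(1)] by (intro X_id) (auto intro:subspace_scale)
	thus ?thesis using fd[of 0] by (simp add:y_def move_0)
	qed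
	moreover have "y 0 = z" by (simp add:y_def move_0)
	moreover have "ka * et > 0" using kpos et(1) by simp
	ultimately show ?thesis by (intro exI[of _ "ka * et"] conjI exI[of _ y]) blast+
qed

end

section \<open>Coisotropic submanifolds in charts\<close>

lemma sm_bilinear_family:
	fixes w :: "'p::euclidean_space => 'a::euclidean_space => 'b::euclidean_space => real"
	assumes "open S" and bil:"!!q. q : S ==> bilinear (w q)"
	and w:"!!a b. smooth_on S (%q. w q a b)" and X:"smooth_on S X" and Y:"smooth_on S Y"
	shows "smooth_on S (%q. w q (X q) (Y q))"
proof (rule sm_cong[OF assms(1)])
	show "(SUM i:Basis. SUM j:Basis. ((X q \<bullet> i) * (Y q \<bullet> j)) *\<^sub>R w q i j) = w q (X q) (Y q)" if "q : S" for q
	by (rule bilinear_sum_Basis[OF bil[OF that],symmetric])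
	have "smooth_on S (%q. ((X q \<bullet> i) * (Y q \<bullet> j)) *\<^sub>R w q i j)" for i j
	using sm_scaleR[OF assms(1) sm_mult[OF assms(1) sm_inner[OF assms(1) X sm_const]
	sm_inner[OF assms(1) Y sm_const]] w] .
	thus "smooth_on S (%q. SUM i:Basis. SUM j:Basis. ((X q \<bullet> i) * (Y q \<bullet> j)) *\<^sub>R w q i j)"
	by (intro sm_sum[OF assms(1)])
qed

lemma smooth_mfdI:"smooth_manifold M ==> smooth_mfd M"
	by unfold_locales (auto simp:smooth_manifold_def)

lemma local_rep_compose:
	assumes r:"local_rep c S ga (be t) W h" and be:"smooth_on UNIV be" "be ` S' \<subseteq> S"
	shows "local_rep c S' (%y. ga (be y)) t (be -` W) (%y. h (be y))"
proof -
	have W:"open W" "be t : W" "smooth_on W h" "h ` W \<subseteq> snd c ` fst c" "ALL y:W Int S. ga y = chart_inv c (h y)"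
	using r by (auto simp:local_rep_def)
	have o:"open (be -` W)" by (rule open_vimage[OF W(1) sm_cont[OF be(1)]])
	have "smooth_on (be -` W) (%y. h (be y))"
	by (rule sm_compose[OF o W(1) sm_subset[OF be(1)] W(3)]) auto
	thus ?thesis unfolding local_rep_def using o W(2,4,5) be(2) by auto
qed

lemma local_rep_eq:
	assumes r:"local_rep c S ga t W h" and T:"open T" "t : T" and eq:"!!y. y : T ==> y : S ==> ga' y = ga y"
	shows "local_rep c S ga' t (W Int T) h"
	using assms unfolding local_rep_def by (auto intro:sm_subset)

text \<open>By second countability: every point has a basis element on which \<open>f\<close> is
  constant, so \<open>f\<close> factors through a countable set.\<close>

lemma countable_locally_constant_image:
	fixes T :: "'e::euclidean_space set"
	assumes "!!p. p : T ==> EX de>0. ALL p':ball p de Int T. f p' = f p"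
	shows "countable (f ` T)"
proof -
	obtain \<B> :: "'e set set" where \<B>:"countable \<B>" "topological_basis \<B>" using ex_countable_basis by blast
	have "EX B:\<B>. p : B & (ALL p':B Int T. f p' = f p)" if p:"p : T" for p
	proof -
	obtain de where de:"de > 0" "ALL p':ball p de Int T. f p' = f p" using assms[OF p] by blast
	obtain B where "B : \<B>" "p : B" "B \<subseteq> ball p de"
	using topological_basisE[OF \<B>(2) open_ball,of p p de] de(1) by auto
	thus ?thesis using de(2) by blast
	qed
	then obtain g where g:"!!p. p : T ==> g p : \<B> & p : g p & (ALL p':g p Int T. f p' = f p)" by metis
	define F where "F B = f (SOME p. p : T & g p = B)" for B
	have "f p = F (g p)" if p:"p : T" for p
	proof -
	have "EX q. q : T & g q = g p" using p by blast
	from someI_ex[OF this] have q:"(SOME q. q : T & g q = g p) : T & g (SOME q. q : T & g q = g p) = g p" .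
	thus ?thesis unfolding F_def using g[of "SOME q. q : T & g q = g p"] g[OF p] p by (metis IntI)
	qed
	hence "f ` T \<subseteq> F ` \<B>" using g by blast
	thus ?thesis by (rule countable_subset[OF _ countable_image[OF \<B>(1)]])
qed

text \<open>Quantifies the frame away; later only the label \<open>b\<close>, the joining curves and
  the curves in kernel directions are used.\<close>

lemma (in presymplectic) box_exists:
	assumes "z : Q" "z : L"
	shows "EX rh (b :: 'e => 'e). rh > 0 & ball z rh \<subseteq> Q &
	(ALL p:ball z rh Int L. EX b'. (b has_derivative b') (at p) & (ALL a:ker p. b' a = 0)) &
	(ALL p:ball z rh. ALL p':ball z rh. proj (ker z) p = proj (ker z) p' --> b p = b p' --> p = p') &
	(ALL p:ball z rh Int L. ALL U. open U --> p : U --> (EX de>0. ALL p':ball p de. p' : L --> p' : ball z rh --> b p' = b p -->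
	(EX y y'. y 0 = p & y 1 = p' & (ALL t:{0..1}. y t : L & y t : ball z rh & y t : U &
	(y has_vector_derivative y' t) (at t within {0..1}) & y' t : ker (y t)))))"
	and "ALL a:ker z. EX s>0. EX y. smooth_on {-1<..<2::real} y & y 0 = z & (ALL t:{-1<..<2}. y t : L & y t : Q &
	fder y t 1 : ker (y t)) & fder y 0 1 = s *\<^sub>R a"
proof -
	obtain r X where rX:"r > 0" "ball z r \<subseteq> Q" "ALL v. smooth_on (ball z r) (%p. X p v)"
	"ALL p:ball z r. linear (X p) & (ALL v. X p v : ker p & X p (proj (ker z) v) = X p v &
	proj (ker z) (X p v) = proj (ker z) v) & (ALL a:ker p. X p a = a)"
	using frame_exists[OF assms(1)] by blast
	interpret kernel_frame Q w L z r X
	by (rule kernel_frame.intro[OF presymplectic_axioms kernel_frame_axioms.intro]) (use assms rX in auto)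
	show "EX rh (b :: 'e => 'e). rh > 0 & ball z rh \<subseteq> Q &
	(ALL p:ball z rh Int L. EX b'. (b has_derivative b') (at p) & (ALL a:ker p. b' a = 0)) &
	(ALL p:ball z rh. ALL p':ball z rh. proj (ker z) p = proj (ker z) p' --> b p = b p' --> p = p') &
	(ALL p:ball z rh Int L. ALL U. open U --> p : U --> (EX de>0. ALL p':ball p de. p' : L --> p' : ball z rh --> b p' = b p -->
	(EX y y'. y 0 = p & y 1 = p' & (ALL t:{0..1}. y t : L & y t : ball z rh & y t : U &
	(y has_vector_derivative y' t) (at t within {0..1}) & y' t : ker (y t)))))"
	proof -
	have A:"ball z rh \<subseteq> Q" using rh(4) r(2) by blast
	have B:"ALL p:ball z rh Int L. EX b'. (first_integral has_derivative b') (at p) & (ALL a:ker p. b' a = 0)"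
	using first_integral_deriv by simp
	have C:"ALL p:ball z rh. ALL p':ball z rh. proj (ker z) p = proj (ker z) p' --> first_integral p = first_integral p' --> p = p'"
	using first_integral_injective by simp
	have D:"ALL p:ball z rh Int L. ALL U. open U --> p : U --> (EX de>0. ALL p':ball p de. p' : L --> p' : ball z rh -->
	first_integral p' = first_integral p -->
	(EX y y'. y 0 = p & y 1 = p' & (ALL t:{0..1}. y t : L & y t : ball z rh & y t : U &
	(y has_vector_derivative y' t) (at t within {0..1}) & y' t : ker (y t))))"
	by (intro ballI allI impI same_plaque) auto
	show ?thesis
	by (rule exI[of _ rh],rule exI[of _ first_integral]) (intro conjI rh(1) A B C D)
	qed
	show "ALL a:ker z. EX s>0. EX y. smooth_on {-1<..<2::real} y & y 0 = z & (ALL t:{-1<..<2}. y t : L & y t : Q &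
	fder y t 1 : ker (y t)) & fder y 0 1 = s *\<^sub>R a"
	proof
	fix a assume "a : ker z"
	then obtain s y where "s > 0" "smooth_on {-1<..<2::real} y" "y 0 = z"
	"ALL t:{-1<..<2}. y t : L & y t : ball z r & fder y t 1 : ker (y t)" "fder y 0 1 = s *\<^sub>R a"
	using kernel_curve by blast
	thus "EX s>0. EX y. smooth_on {-1<..<2::real} y & y 0 = z & (ALL t:{-1<..<2}. y t : L & y t : Q &
	fder y t 1 : ker (y t)) & fder y 0 1 = s *\<^sub>R a"
	by (intro exI[of _ s] conjI exI[of _ y]) (use inQ in auto)
	qed
qed

locale coisotropic_mfd = smooth_mfd M for M :: "('a,'e::euclidean_space) manifold" +
	fixes om :: "'a => 'e => 'e => real" and N :: "'a set"
	assumes symplectic:"symplectic_form M om" and coisotropic:"coisotropic M om N"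
begin

abbreviation slice where "slice == slice_chart M N"
abbreviation perp where "perp == tangent_perp M om N"
abbreviation form where "form == form_in_chart M om"
abbreviation img where "img c == snd c ` fst c"

lemma N_subset:"N \<subseteq> points M"
	using coisotropic by (simp add:coisotropic_def submanifold_def)

lemma exists_slice:"x : N ==> EX c L. slice c L & x : fst c"
	using coisotropic unfolding coisotropic_def submanifold_def by blast

lemma slice_smooth:"slice c L ==> smooth_chart M c" and slice_subspace:"slice c L ==> subspace L"
	by (auto simp:slice_chart_def)

lemma slice_iff:"slice c L ==> x : fst c ==> x : N \<longleftrightarrow> snd c x : L"
proof -
	assume s:"slice c L" and x:"x : fst c"
	have e:"snd c ` (fst c Int N) = img c Int L" using s by (simp add:slice_chart_def)
	have "inj_on (snd c) (fst c)" using chart_inj[OF is_chart[OF slice_smooth[OF s]]] .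
	hence "snd c x : snd c ` (fst c Int N) \<longleftrightarrow> x : N" using x by (auto dest:inj_onD)
	thus ?thesis unfolding e using x by blast
qed

lemma slice_inv_N:"slice c L ==> p : img c ==> p : L ==> chart_inv c p : N"
	using slice_iff chart_inv_into chart_chart_inv by metis

lemma form_eq:
	assumes "smooth_chart M c" "x : fst c"
	shows "form c (snd c x) a b = om x (chart_deriv M c x a) (chart_deriv M c x b)"
	using inv_chart[OF assms] by (simp add:form_in_chart_def chart_deriv_def Let_def)

lemma curve_velocity:
	assumes "smooth_chart M c" "local_rep c S ga t W h" "open S" "t : S"
	shows "velocity M ga t = chart_deriv M c (ga t) (fder h t 1)"
proof -
	have W:"open (W Int S)" "t : W Int S" "smooth_on W h" using assms by (auto simp:local_rep_def)
	have "local_rep c UNIV (%s. chart_inv c (h s)) t W h" using assms(2) by (auto simp:local_rep_def)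
	from local_rep_velocity(1,3)[OF assms(1) this] have
	r:"((%s. snd c (chart_inv c (h s))) has_vector_derivative fder h t 1) (at t)" "\<forall>\<^sub>F s in at t. chart_inv c (h s) : fst c"
	by auto
	have eq:"ga s = chart_inv c (h s)" if "s : W Int S" for s using assms(2) that by (auto simp:local_rep_def)
	have ev:"\<forall>\<^sub>F s in at t. s : W Int S" using W(1,2) eventually_at_topological by blast
	show ?thesis
	proof (rule velocity_chart[OF assms(1)])
	show "ga t : fst c" using local_rep_value(1)[OF assms(2)] W by blast
	show "\<forall>\<^sub>F s in at t. ga s : fst c" using ev r(2) by eventually_elim (simp add:eq)
	show "((%s. snd c (ga s)) has_vector_derivative fder h t 1) (at t)"
	using r(1) unfolding has_vector_derivative_def
	by (rule has_derivative_transform_eventually) (use ev eq W(2) in \<open>auto elim!: eventually_mono\<close>)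
	qed auto
qed

text \<open>Maps the whole space into the ball of radius \<open>r\<close>, preserves subspaces and
  is the identity near 0. Curves and families that make sense only near a point become globally
  defined, with unchanged derivatives at 0.\<close>

definition squash :: "real => 'v::euclidean_space => 'v" where
	"squash r v = bump 0 (r / 2) v *\<^sub>R v"

lemma smooth_squash:"smooth_on UNIV (squash r)"
	unfolding squash_def[abs_def] by (rule sm_scaleR[OF open_UNIV sm_bump sm_id])

lemma squash_norm:"r > 0 ==> norm (squash r v) < r"
proof (cases "norm v < r")
	case True
	have "norm (squash r v) <= 1 * norm v" unfolding squash_def norm_scaleR
	by (rule mult_right_mono) (use bump_bounds[of 0 "r / 2" v] in auto)
	thus ?thesis using True by simp
next
	case False
	assume "r > 0"
	thus ?thesis using False bump_eq_0[of "r / 2" v 0] by (simp add:squash_def)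
qed

lemma squash_id:"r > 0 ==> norm v <= r / 2 ==> squash r v = v"
	using bump_eq_1[of "r / 2" v 0] by (simp add:squash_def)

lemma squash_in:"subspace L ==> v : L ==> squash r v : L"
	by (simp add:squash_def subspace_scale)

lemma squash_deriv:"r > 0 ==> (squash r has_derivative (%h. h)) (at 0)"
	by (rule hd_transform[OF has_derivative_ident open_ball[of 0 "r / 2"]])
	(auto simp:squash_id)

lemma tangent_space_slice:
	assumes c:"slice c L" and x:"x : fst c" "x : N"
	shows "tangent_space M N x = chart_deriv M c x ` L"
proof (intro equalityI subsetI)
	note cs = slice_smooth[OF c] and L = slice_subspace[OF c]
	fix v assume "v : tangent_space M N x"
	then obtain ga where ga:"smooth_map_on euc M {-1<..<1} ga" "ga ` {-1<..<1} \<subseteq> N" "ga 0 = x" "v = velocity M ga 0"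
	by (auto simp:tangent_space_def curve_through_def)
	obtain W h where r:"local_rep c {-1<..<1} ga 0 W h"
	using smooth_map_on_local_rep[OF ga(1) _ cs] x ga(3) by force
	have W:"open W" "0 : W" "smooth_on W h" using r by (auto simp:local_rep_def)
	have ev:"\<forall>\<^sub>F s in at 0. s : W Int {-1<..<1}"
	using W(1,2) by (intro eventually_at_topological[THEN iffD2] exI[of _ "W Int {-1<..<1}"]) auto
	have hL:"h s : L" if "s : W Int {-1<..<1}" for s
	proof -
	have "ga s : N" using that ga(2) by blast
	thus ?thesis using local_rep_value[OF r,of s] that slice_iff[OF c,of "ga s"] by simp
	qed
	have "fder h 0 1 : L"
	proof (rule has_vector_derivative_in_subspace[of h _ 0 UNIV])
	have "local_rep c W (%s. chart_inv c (h s)) 0 W h" using r by (auto simp:local_rep_def)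
	show "(h has_vector_derivative fder h 0 1) (at 0)"
	proof -
	have d:"(h has_derivative fder h 0) (at 0)" by (rule sm_hd[OF W(1,3,2)])
	have "fder h 0 = (%s. s *\<^sub>R fder h 0 1)"
	proof
	fix s :: real
	show "fder h 0 s = s *\<^sub>R fder h 0 1" using linear_scale[OF has_derivative_linear[OF d],of s 1] by simp
	qed
	thus ?thesis using d by (simp add:has_vector_derivative_def)
	qed
	show "\<forall>\<^sub>F s in at 0. h s - h 0 : L"
	using ev by eventually_elim (use hL hL[of 0] W(2) L in \<open>auto intro:subspace_diff\<close>)
	qed (use L in auto)
	moreover have "v = chart_deriv M c x (fder h 0 1)" using curve_velocity[OF cs r] ga by simp
	ultimately show "v : chart_deriv M c x ` L" by blast
next
	note cs = slice_smooth[OF c] and L = slice_subspace[OF c]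
	fix v assume "v : chart_deriv M c x ` L"
	then obtain l where l:"l : L" "v = chart_deriv M c x l" by blast
	obtain r where r:"r > 0" "ball (snd c x) r \<subseteq> img c"
	using img_open[OF cs] x(1) open_contains_ball by blast
	\<comment> \<open>The coordinate line in direction \<open>l\<close>, squashed so that it stays in
	  the chart for all times.\<close>
	define h where "h s = snd c x + squash r (s *\<^sub>R l)" for s :: real
	have "smooth_on UNIV (%s :: real. s *\<^sub>R l)" by (rule sm_scaleR[OF open_UNIV sm_id sm_const])
	hence "smooth_on UNIV (%s :: real. squash r (s *\<^sub>R l))"
	by (rule sm_compose[OF open_UNIV open_UNIV _ smooth_squash]) simp
	hence sh:"smooth_on UNIV h" unfolding h_def[abs_def] by (rule sm_add[OF open_UNIV sm_const])
	have himg:"h s : img c" for s using r(2) squash_norm[OF r(1),of "s *\<^sub>R l"] by (auto simp:h_def dist_norm)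
	have hL:"h s : L" for s
	using l(1) L slice_iff[OF c x(1)] x(2) by (simp add:h_def subspace_add squash_in subspace_scale)
	have rep:"local_rep c {-1<..<1} (%s. chart_inv c (h s)) t UNIV h" for t
	using sh himg by (auto simp:local_rep_def)
	have "smooth_map_on euc M {-1<..<1} (%s. chart_inv c (h s))"
	by (rule smooth_map_on_if_local_rep) (use rep cs in blast)
	moreover have "chart_inv c (h 0) = x" by (simp add:h_def squash_def inv_chart[OF cs x(1)])
	ultimately have "curve_through M N x (%s. chart_inv c (h s))"
	using slice_inv_N[OF c himg hL] by (auto simp:curve_through_def)
	moreover have "fder h 0 1 = l"
	proof -
	have "((%s. squash r (s *\<^sub>R l)) has_vector_derivative l) (at 0)"
	by (rule has_vector_derivative_chain[of "%s. s *\<^sub>R l" l 0 UNIV "squash r" "%h. h"])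
	(auto simp:squash_deriv[OF r(1)] intro!:derivative_eq_intros)
	hence "(h has_vector_derivative l) (at 0)" unfolding h_def[abs_def] by (auto intro!:derivative_eq_intros)
	hence "(h has_derivative (%s. s *\<^sub>R l)) (at 0)" by (simp add:has_vector_derivative_def)
	from fder_eq[OF this,of 1] show ?thesis by simp
	qed
	hence "velocity M (%s. chart_inv c (h s)) 0 = v"
	using curve_velocity[OF cs rep[of 0]] \<open>chart_inv c (h 0) = x\<close> l(2) by simp
	ultimately show "v : tangent_space M N x" unfolding tangent_space_def by blast
qed

lemma om_props:
	assumes "x : points M"
	shows "bilinear (om x)" "om x v v = 0" "(!!w. om x v w = 0) ==> v = 0"
	using symplectic assms unfolding symplectic_form_def by blast+

lemma form_transition:
	assumes c:"smooth_chart M c" and d:"smooth_chart M d" and p:"p : snd c ` (fst c Int fst d)"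
	shows "form c p a b = form d (snd d (chart_inv c p)) (fder (%p. snd d (chart_inv c p)) p a) (fder (%p. snd d (chart_inv c p)) p b)"
proof -
	obtain x where x:"x : fst c" "x : fst d" "p = snd c x" using p by blast
	show ?thesis unfolding x(3) inv_chart[OF c x(1)] form_eq[OF c x(1)] form_eq[OF d x(2)]
	chart_deriv_chain[OF c d x(1,2)] ..
qed

lemma bilinear_form:
	assumes c:"smooth_chart M c" and p:"p : img c"
	shows "bilinear (form c p)"
proof -
	obtain x where x:"x : fst c" "p = snd c x" using p by blast
	have l:"linear (chart_deriv M c x)" by (rule linear_chart_deriv[OF c x(1)])
	have b:"bilinear (om x)" using om_props(1) chart_subset[OF c] x(1) by blast
	show ?thesis unfolding bilinear_def x(2) form_eq[OF c x(1)]
	using linear_compose[OF l] b by (auto simp:bilinear_def comp_def)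
qed

text \<open>Smoothness and closedness are assumed in atlas charts; here and in
  \<open>closed_form\<close> they are carried to a smooth chart through an atlas chart around each
  point.\<close>

lemma smooth_form:
	assumes c:"smooth_chart M c"
	shows "smooth_on (img c) (%p. form c p a b)"
proof (rule sm_local)
	fix p assume "p : img c"
	then obtain x where x:"x : fst c" "p = snd c x" by blast
	obtain d where d:"d : atlas M" "x : fst d" using exists_atlas_chart chart_subset[OF c] x(1) by blast
	have ds:"smooth_chart M d" by (rule atlas_smooth_chart[OF d(1)])
	define S where "S = snd c ` (fst c Int fst d)"
	define ta where "ta p = snd d (chart_inv c p)" for p
	have S:"open S" unfolding S_def by (rule overlap_open[OF c ds])
	have ta:"smooth_on S ta" unfolding S_def ta_def[abs_def] by (rule transition_smooth[OF c ds])
	have taS:"ta ` S \<subseteq> img d" by (auto simp:S_def ta_def inv_chart[OF c])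
	have "smooth_on (img d) (%q. form d q a b)" for a b
	using symplectic d(1) by (auto simp:symplectic_form_def)
	from sm_compose[OF S img_open[OF ds] ta this taS]
	have "smooth_on S (%q. form d (ta q) a b)" for a b .
	note fs = this
	have "smooth_on S (%q. form d (ta q) (fder ta q a) (fder ta q b))"
	by (rule sm_bilinear_family[of S "%q. form d (ta q)" "%q. fder ta q a" "%q. fder ta q b",
	OF S bilinear_form[OF ds] fs sm_fder[OF ta] sm_fder[OF ta]]) (use taS in blast)
	hence "smooth_on S (%p. form c p a b)"
	by (rule sm_cong[OF S,rotated]) (simp add:form_transition[OF c ds] S_def ta_def[abs_def])
	thus "EX U. open U & p : U & smooth_on U (%p. form c p a b)" using S x d(2) by (auto simp:S_def)
qed

lemma closed_form:
	assumes c:"smooth_chart M c" and p:"p : img c"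
	shows "fder (%q. form c q v x) p u + fder (%q. form c q x u) p v + fder (%q. form c q u v) p x = 0"
proof -
	obtain y where y:"y : fst c" "p = snd c y" using p by blast
	obtain d where d:"d : atlas M" "y : fst d" using exists_atlas_chart chart_subset[OF c] y(1) by blast
	have ds:"smooth_chart M d" by (rule atlas_smooth_chart[OF d(1)])
	have al:"form d q v v = 0" if "q : img d" for q v
	using that form_eq[OF ds] om_props(2) chart_subset[OF ds] by auto
	show ?thesis
	proof (rule closed_form_pullback[OF overlap_open[OF c ds] img_open[OF ds] transition_smooth[OF c ds],
	where w = "form d" and si = "form c"])
	show "(%p. snd d (chart_inv c p)) ` snd c ` (fst c Int fst d) \<subseteq> img d" by (auto simp:inv_chart[OF c])
	show "smooth_on (img d) (%q. form d q a b)" for a b by (rule smooth_form[OF ds])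
	show "p : snd c ` (fst c Int fst d)" using y d(2) by blast
	qed (use symplectic d(1) al bilinear_form[OF ds] form_transition[OF c ds] in \<open>auto simp:symplectic_form_def\<close>)
qed

lemma perp_chart:
	assumes c:"slice c L" and x:"x : fst c" "x : N"
	shows "chart_deriv M c x a : perp x \<longleftrightarrow> (ALL b:L. form c (snd c x) a b = 0)"
	unfolding tangent_perp_def tangent_space_slice[OF assms] form_eq[OF slice_smooth[OF c] x(1)] by auto

lemma presymplectic_slice:
	assumes c:"slice c L"
	shows "presymplectic (img c) (form c) L"
proof
	note cs = slice_smooth[OF c]
	show "open (img c)" by (rule img_open[OF cs])
	show "bilinear (form c p)" if "p : img c" for p by (rule bilinear_form[OF cs that])
	show "form c p v v = 0" if "p : img c" for p v
	using that form_eq[OF cs] om_props(2) chart_subset[OF cs] by auto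
	show "a = 0" if p:"p : img c" and a:"!!b. form c p a b = 0" for p a
	proof -
	obtain x where x:"x : fst c" "p = snd c x" using p by blast
	have b:"bij (chart_deriv M c x)" by (rule bij_chart_deriv[OF cs x(1)])
	have "om x (chart_deriv M c x a) w = 0" for w
	using a[of "inv (chart_deriv M c x) w"] form_eq[OF cs x(1)] b by (simp add:x(2) bij_is_surj surj_f_inv_f)
	hence "chart_deriv M c x a = chart_deriv M c x 0"
	using om_props(3)[of x] chart_subset[OF cs] x(1) linear_0[OF linear_chart_deriv[OF cs x(1)]] by auto
	thus ?thesis using b by (simp add:bij_is_inj inj_eq)
	qed
	show "smooth_on (img c) (%p. form c p a b)" for a b by (rule smooth_form[OF cs])
	show "fder (%q. form c q v x) p u + fder (%q. form c q x u) p v + fder (%q. form c q u v) p x = 0"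
	if "p : img c" for p u v x by (rule closed_form[OF cs that])
	show "subspace L" by (rule slice_subspace[OF c])
	show "a : L" if p:"p : img c" "p : L" and a:"!!b. b : L ==> form c p a b = 0" for p a
	proof -
	obtain x where x:"x : fst c" "p = snd c x" using p(1) by blast
	have xN:"x : N" using slice_iff[OF c x(1)] p(2) x(2) by simp
	have "chart_deriv M c x a : perp x" using perp_chart[OF c x(1) xN] a x(2) by simp
	hence "chart_deriv M c x a : chart_deriv M c x ` L"
	using coisotropic xN unfolding coisotropic_def tangent_space_slice[OF c x(1) xN,symmetric] by blast
	thus ?thesis using bij_chart_deriv[OF cs x(1)] by (auto simp:bij_is_inj inj_eq)
	qed
qed

end

section \<open>Isotropic leaves\<close>

context coisotropic_mfd
begin

section \<open>Curves along the kernel, and leaves as classes of an equivalence relation\<close>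

definition kern :: "('a,'e) chart => 'e set => 'e => 'e set" where
	"kern c L p = {a. ALL b:L. form c p a b = 0}"

lemma ker_eq_kern:
	assumes "slice c L"
	shows "presymplectic.ker (form c) L p = kern c L p"
	unfolding presymplectic.ker_def[OF presymplectic_slice[OF assms]] kern_def ..

lemma subspace_kern:
	assumes "slice c L" "p : img c"
	shows "subspace (kern c L p)"
	using presymplectic.subspace_ker[OF presymplectic_slice[OF assms(1)] assms(2)] unfolding ker_eq_kern[OF assms(1)] .

lemma perp_iff_kern:
	assumes "slice c L" "x : fst c" "x : N"
	shows "chart_deriv M c x a : perp x \<longleftrightarrow> a : kern c L (snd c x)"
	unfolding perp_chart[OF assms] kern_def by simp

lemma transition_kern:
	assumes c:"slice c L" and d:"slice d L'" and x:"x : fst c" "x : fst d" "x : N" and a:"a : kern c L (snd c x)"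
	shows "fder (%p. snd d (chart_inv c p)) (snd c x) a : kern d L' (snd d x)"
	using a unfolding perp_iff_kern[OF c x(1,3),symmetric] perp_iff_kern[OF d x(2,3),symmetric]
	chart_deriv_chain[OF slice_smooth[OF c] slice_smooth[OF d] x(1,2)] .

text \<open>Equivalent to the condition on curves in \<open>leaf\<close>, but phrased with two-sided
  derivatives of coordinate expressions, whose charts may vary along the path. This is convenient
  for reparametrising and concatenating.\<close>

definition leaf_path :: "(real => 'a) => bool" where
	"leaf_path ga \<longleftrightarrow> ga ` {0..1} \<subseteq> N &
	(ALL t:{0..1}. EX c L W h. slice c L & local_rep c {0..1} ga t W h & fder h t 1 : kern c L (h t))"

lemma leaf_path_smooth:"leaf_path ga ==> smooth_map_on euc M {0..1} ga"
	by (rule smooth_map_on_if_local_rep) (use slice_smooth in \<open>unfold leaf_path_def,blast\<close>)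

lemma leaf_path_N:"leaf_path ga ==> t : {0..1} ==> ga t : N"
	by (auto simp:leaf_path_def)

lemma leaf_path_velocity:
	assumes g:"leaf_path ga" and t:"t : {0..1}"
	shows "velocity_within M {0..1} ga t : perp (ga t)"
proof -
	obtain c L W h where r:"slice c L" "local_rep c {0..1} ga t W h" "fder h t 1 : kern c L (h t)"
	using g t unfolding leaf_path_def by blast
	have tW:"t : W" using r(2) by (simp add:local_rep_def)
	have v:"ga t : fst c" "snd c (ga t) = h t" using local_rep_value[OF r(2) tW t] by auto
	have "velocity_within M {0..1} ga t = chart_deriv M c (ga t) (fder h t 1)"
	by (rule local_rep_velocity(2)[OF slice_smooth[OF r(1)] r(2) t at_unit_interval_nontrivial[OF t]])
	thus ?thesis using perp_iff_kern[OF r(1) v(1) leaf_path_N[OF g t]] r(3) v(2) by simp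
qed

lemma velocity_kern:
	assumes c:"slice c L" and r:"local_rep c {0..1} ga s W h" and t:"t : W" "t : {0..1}" and N:"ga t : N"
	shows "velocity_within M {0..1} ga t : perp (ga t) \<longleftrightarrow> fder h t 1 : kern c L (h t)"
proof -
	have r':"local_rep c {0..1} ga t W h" using r t(1) by (simp add:local_rep_def)
	have v:"ga t : fst c" "snd c (ga t) = h t" using local_rep_value[OF r' t] by auto
	have "velocity_within M {0..1} ga t = chart_deriv M c (ga t) (fder h t 1)"
	by (rule local_rep_velocity(2)[OF slice_smooth[OF c] r' t(2) at_unit_interval_nontrivial[OF t(2)]])
	thus ?thesis using perp_iff_kern[OF c v(1) N] v(2) by simp
qed

lemma leaf_path_rep:
	assumes g:"leaf_path ga" and t:"t : {0..1}" and c:"slice c L" "ga t : fst c"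
	shows "EX W h. local_rep c {0..1} ga t W h & (ALL s:W Int {0..1}. fder h s 1 : kern c L (h s))"
proof -
	obtain W h where r:"local_rep c {0..1} ga t W h"
	using smooth_map_on_local_rep[OF leaf_path_smooth[OF g] t slice_smooth[OF c(1)] c(2)] by blast
	have "fder h s 1 : kern c L (h s)" if "s : W" "s : {0..1}" for s
	using velocity_kern[OF c(1) r that leaf_path_N[OF g that(2)]] leaf_path_velocity[OF g that(2)] by simp
	thus ?thesis using r by blast
qed

lemma leaf_eq:"leaf M om N x = {ga 1 | ga. leaf_path ga & ga 0 = x}"
proof (intro equalityI subsetI)
	fix y assume "y : leaf M om N x"
	then obtain ga where ga:"y = ga 1" "smooth_map_on euc M {0..1} ga" "ga ` {0..1} \<subseteq> N" "ga 0 = x"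
	"ALL t:{0..1}. velocity_within M {0..1} ga t : perp (ga t)" unfolding leaf_def by blast
	have "EX c L W h. slice c L & local_rep c {0..1} ga t W h & fder h t 1 : kern c L (h t)" if t:"t : {0..1}" for t
	proof -
	have tN:"ga t : N" using ga(3) t by blast
	obtain c L where c:"slice c L" "ga t : fst c" using exists_slice[OF tN] by blast
	obtain W h where r:"local_rep c {0..1} ga t W h"
	using smooth_map_on_local_rep[OF ga(2) t slice_smooth[OF c(1)] c(2)] by blast
	have "t : W" using r by (simp add:local_rep_def)
	thus ?thesis using velocity_kern[OF c(1) r _ t tN] ga(5) t c(1) r by blast
	qed
	hence "leaf_path ga" using ga(3) by (simp add:leaf_path_def)
	thus "y : {ga 1 | ga. leaf_path ga & ga 0 = x}" using ga(1,4) by blast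
next
	fix y assume "y : {ga 1 | ga. leaf_path ga & ga 0 = x}"
	then obtain ga where ga:"y = ga 1" "leaf_path ga" "ga 0 = x" by blast
	have "ga ` {0..1} \<subseteq> N" using ga(2) by (simp add:leaf_path_def)
	thus "y : leaf M om N x"
	unfolding leaf_def using ga leaf_path_smooth[OF ga(2)] leaf_path_velocity[OF ga(2)] by blast
qed

lemma leaf_path_compose:
	assumes g:"leaf_path ga" and be:"smooth_on UNIV be" "be ` {0..1} \<subseteq> {0..1}"
	shows "leaf_path (%t. ga (be t))"
proof -
	have "EX c L W h. slice c L & local_rep c {0..1} (%t. ga (be t)) t W h & fder h t 1 : kern c L (h t)" if t:"t : {0..1}" for t :: real
	proof -
	have bt:"be t : {0..1}" using be(2) t by blast
	obtain c L W h where r:"slice c L" "local_rep c {0..1} ga (be t) W h" "fder h (be t) 1 : kern c L (h (be t))"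
	using g bt unfolding leaf_path_def by blast
	have W:"open W" "smooth_on W h" "be t : W" "h (be t) : img c" using r(2) by (auto simp:local_rep_def)
	have "(be has_derivative fder be t) (at t)" by (rule sm_hd[OF open_UNIV be(1)]) simp
	from has_derivative_compose[OF this sm_hd[OF W(1,2,3)]]
	have "((%t. h (be t)) has_derivative (%s. fder h (be t) (fder be t s))) (at t)" .
	from fder_eq[OF this,of 1]
	have "fder (%t. h (be t)) t 1 = fder h (be t) (fder be t 1 *\<^sub>R 1)" by simp
	also have "... = fder be t 1 *\<^sub>R fder h (be t) 1" by (rule linear_scale[OF sm_linear_fder[OF W(1,2,3)]])
	finally have "fder (%t. h (be t)) t 1 : kern c L (h (be t))"
	using r(3) subspace_kern[OF r(1) W(4)] by (simp add:subspace_scale)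
	thus ?thesis using r(1) local_rep_compose[OF r(2) be] by blast
	qed
	thus ?thesis using g be(2) unfolding leaf_path_def by blast
qed

lemma leaf_path_local:
	assumes "!!t. t : {0..1} ==> EX T ga'. open T & t : T & leaf_path ga' & (ALL y:T Int {0..1}. ga y = ga' y)"
	shows "leaf_path ga"
proof -
	have "EX c L W h. slice c L & local_rep c {0..1} ga t W h & fder h t 1 : kern c L (h t)" if t:"t : {0..1}" for t
	proof -
	obtain T ga' where T:"open T" "t : T" "leaf_path ga'" "ALL y:T Int {0..1}. ga y = ga' y" using assms[OF t] by blast
	obtain c L W h where r:"slice c L" "local_rep c {0..1} ga' t W h" "fder h t 1 : kern c L (h t)"
	using T(3) t unfolding leaf_path_def by blast
	have "local_rep c {0..1} ga t (W Int T) h" by (rule local_rep_eq[OF r(2) T(1,2)]) (use T(4) in blast)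
	thus ?thesis using r by blast
	qed
	moreover have "ga t : N" if t:"t : {0..1}" for t
	using assms[OF t] leaf_path_N t by force
	ultimately show ?thesis unfolding leaf_path_def by blast
qed

lemma leaf_refl: assumes "x : N" shows "x : leaf M om N x"
proof -
	obtain c L where c:"slice c L" "x : fst c" using exists_slice[OF assms] by blast
	have "local_rep c {0..1} (%_. x) t UNIV (%_. snd c x)" for t :: real
	using c inv_chart[OF slice_smooth[OF c(1)] c(2)] by (auto simp:local_rep_def sm_const)
	moreover have "0 : kern c L (snd c x)" using subspace_kern[OF c(1)] c(2) by (simp add:subspace_0)
	ultimately have "leaf_path (%_. x)"
	unfolding leaf_path_def using assms c(1)
	by (intro conjI ballI image_subsetI assms,intro exI[of _ c],intro exI[of _ L],intro exI[of _ UNIV],intro exI[of _ "%_. snd c x"])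
	simp
	thus ?thesis unfolding leaf_eq by (intro CollectI exI[of _ "%_. x"]) simp
qed

lemma leaf_subset:"leaf M om N x \<subseteq> N"
	unfolding leaf_eq using leaf_path_N by auto

lemma leaf_sym: assumes "y : leaf M om N x" shows "x : leaf M om N y"
proof -
	obtain ga where ga:"leaf_path ga" "ga 0 = x" "ga 1 = y" using assms unfolding leaf_eq by blast
	have "smooth_on UNIV (%t::real. 1 - t)" by (rule sm_diff[OF open_UNIV sm_const sm_id])
	hence "leaf_path (%t. ga (1 - t))" by (rule leaf_path_compose[OF ga(1)]) auto
	thus ?thesis unfolding leaf_eq using ga by (intro CollectI exI[of _ "%t. ga (1 - t)"]) simp
qed

text \<open>Reparametrised by \<open>smooth_step\<close>, both paths rest at the common point for
  times between 1/3 and 2/3, so the concatenation at 1/2 is smooth.\<close>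

lemma leaf_trans: assumes "y : leaf M om N x" "w : leaf M om N y" shows "w : leaf M om N x"
proof -
	obtain ga where ga:"leaf_path ga" "ga 0 = x" "ga 1 = y" using assms(1) unfolding leaf_eq by blast
	obtain et where et:"leaf_path et" "et 0 = y" "et 1 = w" using assms(2) unfolding leaf_eq by blast
	have lin:"smooth_on UNIV (%t::real. 3 * t - a)" for a
	by (rule sm_diff[OF open_UNIV sm_mult[OF open_UNIV sm_const sm_id] sm_const])
	have s:"smooth_on UNIV (%t. smooth_step (3 * t - a))" for a
	by (rule sm_compose[OF open_UNIV open_UNIV lin sm_smooth_step]) simp
	have p:"leaf_path (%t. ga (smooth_step (3 * t - 0)))" "leaf_path (%t. et (smooth_step (3 * t - 2)))"
	by (rule leaf_path_compose[OF ga(1) s] leaf_path_compose[OF et(1) s]; use smooth_step_bounds in auto)+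
	define \<zeta> where "\<zeta> t = (if t <= 1/2 then ga (smooth_step (3 * t - 0)) else et (smooth_step (3 * t - 2)))" for t
	have "leaf_path \<zeta>"
	proof (rule leaf_path_local)
	fix t :: real assume "t : {0..1}"
	show "EX T ga'. open T & t : T & leaf_path ga' & (ALL y:T Int {0..1}. \<zeta> y = ga' y)"
	proof (cases "t < 2/3")
	case True
	thus ?thesis
	by (intro exI[of _ "{..<2/3}"] exI[of _ "%t. ga (smooth_step (3 * t - 0))"])
	(use p in \<open>auto simp:\<zeta>_def smooth_step_simps ga et\<close>)
	next
	case False
	thus ?thesis
	by (intro exI[of _ "{1/3<..}"] exI[of _ "%t. et (smooth_step (3 * t - 2))"])
	(use p in \<open>auto simp:\<zeta>_def smooth_step_simps ga et\<close>)
	qed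
	qed
	moreover have "\<zeta> 0 = x" "\<zeta> 1 = w" by (auto simp:\<zeta>_def smooth_step_simps ga et)
	ultimately show ?thesis unfolding leaf_eq by blast
qed

text \<open>A foliation box: an open set with a label of its plaques. The label is constant along
  the kernel, and close points of N with equal label are joined by kernel curves inside any given
  neighbourhood. The chart is hidden in the existential so that boxes in different charts can be put
  into one finite cover.\<close>

definition is_box :: "'a set => ('a => 'e) => bool" where
	"is_box U B \<longleftrightarrow> (EX c L z rh b. slice c L & ball z rh \<subseteq> img c & U = {y : fst c. snd c y : ball z rh} &
	B = (%y. b (snd c y)) &
	(ALL p:ball z rh Int L. EX b'. (b has_derivative b') (at p) & (ALL a:kern c L p. b' a = 0)) &
	(ALL p:ball z rh Int L. ALL U. open U --> p : U --> (EX de>0. ALL p':ball p de. p' : L --> p' : ball z rh --> b p' = b p -->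
	(EX y y'. y 0 = p & y 1 = p' & (ALL t:{0..1}. y t : L & y t : ball z rh & y t : U &
	(y has_vector_derivative y' t) (at t within {0..1}) & y' t : kern c L (y t))))))"

lemma box_at:
	assumes c:"slice c L" and x:"x : fst c" "x : N"
	shows "EX rh b. rh > 0 & ball (snd c x) rh \<subseteq> img c & is_box {y : fst c. snd c y : ball (snd c x) rh} (%y. b (snd c y)) &
	(ALL p:ball (snd c x) rh. ALL p':ball (snd c x) rh. proj (kern c L (snd c x)) p = proj (kern c L (snd c x)) p' --> (b p :: 'e) = b p' --> p = p')"
proof -
	have z:"snd c x : img c" "snd c x : L" using x slice_iff[OF c x(1)] by auto
	from presymplectic.box_exists(1)[OF presymplectic_slice[OF c] z,unfolded ker_eq_kern[OF c]]
	obtain rh and b :: "'e => 'e" where rh:"rh > 0" "ball (snd c x) rh \<subseteq> img c"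
	and 1:"ALL p:ball (snd c x) rh Int L. EX b'. (b has_derivative b') (at p) & (ALL a:kern c L p. b' a = 0)"
	and 2:"ALL p:ball (snd c x) rh. ALL p':ball (snd c x) rh. proj (kern c L (snd c x)) p = proj (kern c L (snd c x)) p' --> b p = b p' --> p = p'"
	and 3:"ALL p:ball (snd c x) rh Int L. ALL U. open U --> p : U --> (EX de>0. ALL p':ball p de. p' : L --> p' : ball (snd c x) rh --> b p' = b p -->
	(EX y y'. y 0 = p & y 1 = p' & (ALL t:{0..1}. y t : L & y t : ball (snd c x) rh & y t : U &
	(y has_vector_derivative y' t) (at t within {0..1}) & y' t : kern c L (y t))))"
	by (elim exE conjE)
	have "is_box {y : fst c. snd c y : ball (snd c x) rh} (%y. b (snd c y))"
	unfolding is_box_def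
	by (rule exI[of _ c],rule exI[of _ L],rule exI[of _ "snd c x"],rule exI[of _ rh],rule exI[of _ b])
	(intro conjI c rh(2) refl 1 3)
	with rh 2 show ?thesis by (intro exI[of _ rh] exI[of _ b] conjI) assumption+
qed

lemma box_open:"is_box U B ==> openin (mtop M) U"
proof -
	assume "is_box U B"
	then obtain c L z rh where c:"slice c L" and U:"U = {y : fst c. snd c y : ball z rh}"
	unfolding is_box_def by (elim exE conjE) (rule that,assumption+)
	show "openin (mtop M) U" unfolding U by (rule chart_preimage_open[OF is_chart[OF slice_smooth[OF c]] open_ball])
qed

text \<open>The derivative of the label kills the velocity of a leaf path, so the label can change
  only where the path leaves the box.\<close>

lemma box_constant:
	assumes box:"is_box U B" and g:"leaf_path ga" and t:"t : {0..1}" "ga t : U"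
	shows "\<forall>\<^sub>F s in at t within {0..1}. ga s : U & B (ga s) = B (ga t)"
proof -
	obtain c L z rh b where c:"slice c L" and U:"U = {y : fst c. snd c y : ball z rh}" and B:"B = (%y. b (snd c y))"
	and d:"ALL p:ball z rh Int L. EX b'. (b has_derivative b') (at p) & (ALL a:kern c L p. b' a = 0)"
	using box unfolding is_box_def by (elim exE conjE) (rule that,assumption+)
	obtain W h where r:"local_rep c {0..1} ga t W h" and k:"ALL s:W Int {0..1}. fder h s 1 : kern c L (h s)"
	using leaf_path_rep[OF g t(1) c] t(2) U by blast
	have W:"open W" "t : W" "smooth_on W h" using r by (auto simp:local_rep_def)
	have v:"ga s : fst c" "snd c (ga s) = h s" if "s : W" "s : {0..1}" for s using local_rep_value[OF r that] by auto
	have "open (W Int h -` ball z rh)" by (rule continuous_open_preimage[OF sm_cont[OF W(3)] W(1) open_ball])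
	moreover have "t : W Int h -` ball z rh" using t v[OF W(2) t(1)] W(2) U by auto
	ultimately obtain e where e:"e > 0" "ball t e \<subseteq> W Int h -` ball z rh" using open_contains_ball by blast
	define J where "J = {0..1} Int ball t e"
	have J:"s : W" "s : {0..1}" "h s : ball z rh" if "s : J" for s using that e(2) by (auto simp:J_def)
	have "((%s. b (snd c (ga s))) has_derivative (%h. 0)) (at s within J)" if s:"s : J" for s
	proof -
	have "h s : L" using slice_iff[OF c v(1)[OF J(1,2)[OF s]]] leaf_path_N[OF g J(2)[OF s]] v(2)[OF J(1,2)[OF s]] by simp
	then obtain b' where b':"(b has_derivative b') (at (h s))" "ALL a:kern c L (h s). b' a = 0" using d J(3)[OF s] by blast
	have rs:"local_rep c {0..1} ga s W h" using r J(1)[OF s] by (simp add:local_rep_def)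
	have "((%s. snd c (ga s)) has_vector_derivative fder h s 1) (at s within J)"
	by (rule has_vector_derivative_within_subset[OF local_rep_velocity(1)[OF slice_smooth[OF c] rs J(2)[OF s] at_unit_interval_nontrivial[OF J(2)[OF s]]]])
	(auto simp:J_def)
	moreover have "(b has_derivative b') (at (snd c (ga s)))" using b'(1) v(2)[OF J(1,2)[OF s]] by simp
	ultimately have "((%s. b (snd c (ga s))) has_vector_derivative b' (fder h s 1)) (at s within J)"
	by (rule has_vector_derivative_chain)
	moreover have "b' (fder h s 1) = 0" using b'(2) k J(1,2)[OF s] by blast
	ultimately show ?thesis by (simp add:has_vector_derivative_def)
	qed
	moreover have "convex J" unfolding J_def by (intro convex_Int convex_ball) simp
	moreover have tJ:"t : J" using t(1) e(1) by (simp add:J_def)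
	ultimately have eqs:"b (snd c (ga s)) = b (snd c (ga t))" if "s : J" for s
	using has_derivative_zero_unique[of J "%s. b (snd c (ga s))" s t] that by blast
	have "ga s : U & B (ga s) = B (ga t)" if "s : J" for s
	proof
	show "ga s : U" using v[OF J(1,2)[OF that]] J(3)[OF that] by (simp add:U)
	show "B (ga s) = B (ga t)" unfolding B by (rule eqs[OF that])
	qed
	moreover have "\<forall>\<^sub>F s in at t within {0..1}. s : J"
	unfolding eventually_at_topological J_def using e(1) by (intro exI[of _ "ball t e"]) auto
	ultimately show ?thesis by (auto elim: eventually_mono)
qed

text \<open>On the plaque \<open>B = s\<close> the second label is locally constant, since close
  points are joined by kernel curves that stay in both boxes; a locally constant function takes only
  countably many values.\<close>

lemma box_countable:
	assumes box:"is_box U B" and box':"is_box U' B'"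
	shows "countable (B' ` {y : N. y : U & y : U' & B y = s})"
proof -
	obtain c L z rh b where c:"slice c L" and U:"U = {y : fst c. snd c y : ball z rh}" and B:"B = (%y. b (snd c y))"
	and sp:"ALL p:ball z rh Int L. ALL U. open U --> p : U --> (EX de>0. ALL p':ball p de. p' : L --> p' : ball z rh --> b p' = b p -->
	(EX y y'. y 0 = p & y 1 = p' & (ALL t:{0..1}. y t : L & y t : ball z rh & y t : U &
	(y has_vector_derivative y' t) (at t within {0..1}) & y' t : kern c L (y t))))"
	using box unfolding is_box_def by (elim exE conjE) (rule that,assumption+)
	obtain d L' z' rh' b' where d:"slice d L'" and U':"U' = {y : fst d. snd d y : ball z' rh'}" and B':"B' = (%y. b' (snd d y))"
	and db:"ALL p:ball z' rh' Int L'. EX b''. (b' has_derivative b'') (at p) & (ALL a:kern d L' p. b'' a = 0)"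
	using box' unfolding is_box_def by (elim exE conjE) (rule that,assumption+)
	note cs = slice_smooth[OF c] and ds = slice_smooth[OF d]
	define S where "S = {y : N. y : U & y : U' & B y = s}"
	define T where "T = snd c ` S"
	define f where "f p = B' (chart_inv c p)" for p
	have inv:"chart_inv c (snd c y) = y" if "y : U" for y using inv_chart[OF cs] that U by blast
	have "f (snd c y) = B' y" if "y : S" for y using inv[of y] that by (simp add:f_def S_def)
	hence "B' ` S = f ` T" by (auto simp:T_def image_image)
	moreover have "countable (f ` T)"
	proof (rule countable_locally_constant_image)
	fix p assume "p : T"
	then obtain x where x:"x : S" "p = snd c x" by (auto simp:T_def)
	have xc:"x : fst c" "p : ball z rh" "x : N" "x : U" "x : U'" using x by (auto simp:S_def U)
	have pL:"p : L" using slice_iff[OF c xc(1)] xc(3) x(2) by simp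
	define V where "V = snd c ` (U Int U')"
	have "openin (mtop M) (U Int U')" using box_open[OF box] box_open[OF box'] by blast
	hence V:"open V" unfolding V_def by (rule chart_open_map[OF is_chart[OF cs]]) (auto simp:U)
	have pV:"p : V" using x(2) xc by (auto simp:V_def)
	obtain de where de:"de > 0" "ALL p':ball p de. p' : L --> p' : ball z rh --> b p' = b p -->
	(EX y y'. y 0 = p & y 1 = p' & (ALL t:{0..1}. y t : L & y t : ball z rh & y t : V &
	(y has_vector_derivative y' t) (at t within {0..1}) & y' t : kern c L (y t)))"
	using sp pL xc(2) V pV by blast
	have "f p' = f p" if p':"p' : ball p de Int T" for p'
	proof -
	obtain x' where x':"x' : S" "p' = snd c x'" using p' by (auto simp:T_def)
	have "p' : L" "p' : ball z rh" "b p' = b p"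
	using x' x slice_iff[OF c,of x'] by (auto simp:S_def U B)
	then obtain y y' where y:"y 0 = p" "y 1 = p'" "ALL t:{0..1}. y t : L & y t : ball z rh & y t : V &
	(y has_vector_derivative y' t) (at t within {0..1}) & y' t : kern c L (y t)" using de(2) p' by blast
	have "((%t. f (y t)) has_derivative (%h. 0)) (at t within {0..1})" if t:"t : {0..1}" for t :: real
	proof -
	have yt:"y t : L" "y t : V" "(y has_vector_derivative y' t) (at t within {0..1})" "y' t : kern c L (y t)"
	using y(3) t by auto
	obtain w where w:"y t = snd c w" "w : U" "w : U'" using yt(2) by (auto simp:V_def)
	have wc:"w : fst c" "w : fst d" "snd d w : ball z' rh'" using w by (auto simp:U U')
	have wN:"w : N" using slice_iff[OF c wc(1)] yt(1) w(1) by simp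
	obtain b'' where b'':"(b' has_derivative b'') (at (snd d w))" "ALL a:kern d L' (snd d w). b'' a = 0"
	using db wc(3) slice_iff[OF d wc(2)] wN by blast
	have "((%t. snd d (chart_inv c (y t))) has_vector_derivative
	fder (%p. snd d (chart_inv c p)) (y t) (y' t)) (at t within {0..1})"
	by (rule has_vector_derivative_chain[OF yt(3)]) (unfold w(1),rule transition_derivative[OF cs ds wc(1,2)])
	moreover have "(b' has_derivative b'') (at (snd d (chart_inv c (y t))))"
	using b''(1) inv[OF w(2)] w(1) by simp
	ultimately have "((%t. b' (snd d (chart_inv c (y t)))) has_vector_derivative
	b'' (fder (%p. snd d (chart_inv c p)) (y t) (y' t))) (at t within {0..1})"
	by (rule has_vector_derivative_chain)
	moreover have "b'' (fder (%p. snd d (chart_inv c p)) (y t) (y' t)) = 0"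
	using b''(2) transition_kern[OF c d wc(1,2) wN] yt(4) w(1) by simp
	ultimately show ?thesis by (simp add:f_def B' has_vector_derivative_def)
	qed
	hence "f (y 1) = f (y 0)" by (rule has_derivative_zero_unique[OF convex_real_interval(5)]) auto
	thus ?thesis by (simp add:y)
	qed
	thus "EX de>0. ALL p':ball p de Int T. f p' = f p" using de(1) by blast
	qed
	ultimately show ?thesis by (simp add:S_def)
qed

text \<open>A leaf meets only countably many of the plaques of finitely many boxes: they are reached by finite
	chains of intersecting plaques, and a plaque of one box meets countably many plaques of another.\<close>
lemma leaf_countable:
	assumes fin:"finite \<F>" and box:"\<And>be. be \<in> \<F> \<Longrightarrow> is_box (fst be) (snd be)" and cover:"N \<subseteq> (\<Union>be\<in>\<F>. fst be)"
	and x:"x \<in> N" and be:"be \<in> \<F>"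
	shows "countable (snd be ` (leaf M om N x \<inter> fst be))"
proof -
	\<comment> \<open>A plaque is encoded as a box together with a label; \<open>step\<close> adds all
	  plaques that intersect a given one.\<close>
	define A0 where "A0 = (\<lambda>be. (be,snd be x)) ` \<F>"
	define step where "step A = (\<Union>a\<in>A \<inter> \<F> \<times> UNIV. \<Union>be\<in>\<F>.
	Pair be ` snd be ` {y \<in> N. y \<in> fst (fst a) \<and> y \<in> fst be \<and> snd (fst a) y = snd a})" for A
	define A where "A n = (step ^^ n) A0" for n
	have cA:"countable (A n)" for n
	proof (induction n)
	case 0
	show ?case using fin by (simp add:A_def A0_def countable_finite)
	next
	case (Suc n)
	have "countable (step (A n))" unfolding step_def
	proof (rule countable_UN)
	show "countable (A n \<inter> \<F> \<times> UNIV)" by (rule countable_subset[OF _ Suc.IH]) blast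
	fix a assume a:"a \<in> A n \<inter> \<F> \<times> UNIV"
	show "countable (\<Union>be\<in>\<F>. Pair be ` snd be ` {y \<in> N. y \<in> fst (fst a) \<and> y \<in> fst be \<and> snd (fst a) y = snd a})"
	proof (rule countable_UN[OF countable_finite[OF fin]])
	fix be assume "be \<in> \<F>"
	thus "countable (Pair be ` snd be ` {y \<in> N. y \<in> fst (fst a) \<and> y \<in> fst be \<and> snd (fst a) y = snd a})"
	using a by (intro countable_image[OF box_countable] box) auto
	qed
	qed
	thus ?case by (simp add:A_def)
	qed
	define R where "R = (\<Union>n. A n)"
	have cR:"countable R" unfolding R_def by (rule countable_UN[OF _ cA]) simp
	have stepR:"(be',snd be' y) \<in> R" if h:"be \<in> \<F>" "be' \<in> \<F>" "y \<in> N" "y \<in> fst be" "y \<in> fst be'" "(be,snd be y) \<in> R" for be be' y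
	proof -
	obtain n where "(be,snd be y) \<in> A n" using h(6) by (auto simp:R_def)
	hence "(be',snd be' y) \<in> step (A n)" unfolding step_def using h by force
	hence "(be',snd be' y) \<in> A (Suc n)" by (simp add:A_def)
	thus ?thesis unfolding R_def by blast
	qed
	have "(be,snd be y) \<in> R" if y:"y \<in> leaf M om N x" "y \<in> fst be" for y
	proof -
	obtain ga where ga:"leaf_path ga" "ga 0 = x" "ga 1 = y" using y(1) unfolding leaf_eq by blast
	\<comment> \<open>While \<open>ga\<close> stays in one plaque of a box, every other plaque through
	  the current point is one step away from it. So \<open>P\<close> says whether that plaque is
	  reachable and is locally constant in time.\<close>
	define P where "P t \<longleftrightarrow> (\<forall>be\<in>\<F>. ga t \<in> fst be \<longrightarrow> (be,snd be (ga t)) \<in> R)" for t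
	have "P 0 = P 1"
	proof (rule connected_local_const[of "{0..1}" 0 1 P])
	show "\<forall>t\<in>{0..1}. \<forall>\<^sub>F s in at t within {0..1}. P t = P s"
	proof
	fix t :: real assume t:"t \<in> {0..1}"
	obtain be' where b':"be' \<in> \<F>" "ga t \<in> fst be'" using cover leaf_path_N[OF ga(1) t] by blast
	have e1:"\<forall>\<^sub>F s in at t within {0..1}. ga s \<in> fst be' \<and> snd be' (ga s) = snd be' (ga t)"
	by (rule box_constant[OF box[OF b'(1)] ga(1) t b'(2)])
	have e2:"\<forall>\<^sub>F s in at t within {0..1}. s \<in> {0..1}" by (simp add:eventually_at_filter)
	have Piff:"P s \<longleftrightarrow> (be',snd be' (ga s)) \<in> R" if "ga s \<in> fst be'" "s \<in> {0..1}" for s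
	unfolding P_def using stepR[OF b'(1) _ leaf_path_N[OF ga(1) that(2)] that(1)] b'(1) that(1) by blast
	show "\<forall>\<^sub>F s in at t within {0..1}. P t = P s"
	using e1 e2 by eventually_elim (use Piff b'(2) t in simp)
	qed
	qed auto
	moreover have "P 0"
	proof -
	have "A0 = A 0" by (simp add:A_def)
	hence "(be,snd be x) \<in> R" if "be \<in> \<F>" for be using that unfolding R_def A0_def by blast
	thus ?thesis by (simp add:P_def ga(2))
	qed
	ultimately show ?thesis using ga(3) y(2) be by (simp add:P_def)
	qed
	hence "snd be ` (leaf M om N x \<inter> fst be) \<subseteq> snd ` R" by force
	thus ?thesis by (rule countable_subset[OF _ countable_image[OF cR]])
qed

text \<open>The equivalence holds for any two points of N in the chart domain, so a leaf meets the
  domain in a single plaque and cannot return to it elsewhere. Holonomy of loops is trivial for this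
  reason.\<close>

definition plaque_chart :: "('a,'e) chart => 'e set => 'e set => bool" where
	"plaque_chart c L G \<longleftrightarrow> slice c L & subspace G & G \<subseteq> L &
	(ALL x:N Int fst c. ALL y:N Int fst c. y : leaf M om N x \<longleftrightarrow> snd c x - snd c y : G)"

text \<open>Along a kernel curve from \<open>x\<close> all points lie in the leaf of
  \<open>x\<close>, so coordinate increments lie in \<open>G\<close>, and so does the velocity; up
  to a positive factor every kernel vector is such a velocity.\<close>

lemma kern_subset_plaque:
	assumes p:"plaque_chart c L G" and x:"x : fst c" "x : N"
	shows "kern c L (snd c x) \<subseteq> G"
proof
	fix a assume a:"a : kern c L (snd c x)"
	have c:"slice c L" and G:"subspace G"
	and leaf:"!!y. y : N ==> y : fst c ==> y : leaf M om N x \<longleftrightarrow> snd c x - snd c y : G"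
	using p x by (auto simp:plaque_chart_def)
	have z:"snd c x : img c" "snd c x : L" using x slice_iff[OF c x(1)] by auto
	obtain s y where s:"s > 0" and y:"smooth_on {-1<..<2::real} y" "y 0 = snd c x"
	"ALL t:{-1<..<2}. y t : L & y t : img c & fder y t 1 : kern c L (y t)" "fder y 0 1 = s *\<^sub>R a"
	using presymplectic.box_exists(2)[OF presymplectic_slice[OF c] z,unfolded ker_eq_kern[OF c]] a by blast
	define ga where "ga t = chart_inv c (y t)" for t
	have r:"local_rep c {0..1} ga t {-1<..<2} y" if "t : {0..1}" for t
	using that y by (auto simp:local_rep_def ga_def)
	have "leaf_path ga" unfolding leaf_path_def
	proof (intro conjI ballI image_subsetI)
	fix t :: real assume t:"t : {0..1}"
	hence t':"t : {-1<..<2}" by simp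
	show "ga t : N" unfolding ga_def using slice_inv_N[OF c] y(3) t' by blast
	show "EX c L W h. slice c L & local_rep c {0..1} ga t W h & fder h t 1 : kern c L (h t)"
	using c r[OF t] y(3) t' by blast
	qed
	have yG:"y t - y 0 : G" if t:"t : {0..1}" for t
	proof -
	have "smooth_on UNIV (%s. t * s)" by (rule sm_mult[OF open_UNIV sm_const sm_id])
	hence lp:"leaf_path (%s. ga (t * s))"
	by (rule leaf_path_compose[OF \<open>leaf_path ga\<close>]) (use t in \<open>auto intro:mult_le_one\<close>)
	have g0:"ga 0 = x" using y(2) inv_chart[OF slice_smooth[OF c] x(1)] by (simp add:ga_def)
	have "ga t : leaf M om N x"
	unfolding leaf_eq by (intro CollectI exI[of _ "%s. ga (t * s)"]) (simp add:lp g0)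
	moreover have "ga t : N" by (rule leaf_path_N[OF \<open>leaf_path ga\<close> t])
	moreover have "ga t : fst c" "snd c (ga t) = y t"
	using y(3) t by (auto simp:ga_def chart_inv_into chart_chart_inv)
	ultimately have "y 0 - y t : G" using leaf[of "ga t"] y(2) by simp
	from subspace_neg[OF G this] show ?thesis by simp
	qed
	have 0:"(0::real) : {0..1}" by simp
	have "((%t. snd c (ga t)) has_vector_derivative fder y 0 1) (at 0 within {0..1})"
	by (rule local_rep_velocity(1)[OF slice_smooth[OF c] r[OF 0] 0 at_unit_interval_nontrivial[OF 0]])
	hence "fder y 0 1 : G"
	proof (rule has_vector_derivative_in_subspace[OF _ G _ at_unit_interval_nontrivial[OF 0] 0])
	have sy:"snd c (ga t) = y t" if "t : {0..1}" for t using y(3) that by (auto simp:ga_def chart_chart_inv)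
	have "\<forall>\<^sub>F s in at 0 within {0..1}. s : {0..1::real}" by (simp add:eventually_at_filter)
	thus "\<forall>\<^sub>F s in at 0 within {0..1}. snd c (ga s) - snd c (ga 0) : G"
	by eventually_elim (use yG sy sy[OF 0] in simp)
	qed
	hence "(1 / s) *\<^sub>R (s *\<^sub>R a) : G" unfolding y(4) using G by (blast intro:subspace_scale)
	thus "a : G" using s by simp
qed

text \<open>If \<open>G\<close> were larger than the kernel, a segment in a direction
  \<open>a'\<close> of \<open>G\<close> orthogonal to the kernel would lie in one leaf and yet meet
  uncountably many plaques of a box, contrary to \<open>leaf_countable\<close>. Compactness of N
  supplies the finite cover by boxes.\<close>

lemma plaque_kern:
	assumes comp:"compactin (mtop M) N" and p:"plaque_chart c L G" and x:"x : fst c" "x : N"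
	shows "kern c L (snd c x) = G"
proof (rule equalityI[OF kern_subset_plaque[OF p x]],rule subsetI,rule ccontr)
	fix a assume a:"a : G" "a ~: kern c L (snd c x)"
	have c:"slice c L" and G:"subspace G" "G \<subseteq> L"
	and leaf:"!!y. y : N ==> y : fst c ==> y : leaf M om N x \<longleftrightarrow> snd c x - snd c y : G"
	using p x by (auto simp:plaque_chart_def)
	define K where "K = kern c L (snd c x)"
	have K:"subspace K" unfolding K_def using subspace_kern[OF c] x(1) by blast
	\<comment> \<open>The part of \<open>a\<close> orthogonal to the kernel; it remains in
	  \<open>G\<close> because the kernel is contained in \<open>G\<close>.\<close>
	define a' where "a' = a - proj K a"
	have a':"a' : G" unfolding a'_def using a(1) proj_in[OF K,of a] kern_subset_plaque[OF p x] G(1)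
	by (auto simp:K_def intro:subspace_diff)
	have "a' ~= 0" using a(2) proj_in[OF K,of a] by (auto simp:a'_def K_def)
	have pa:"proj K a' = 0" unfolding a'_def using linear_diff[OF linear_proj[OF K]] proj_id[OF K proj_in[OF K]] by simp
	obtain rh and b :: "'e => 'e" where b:"rh > 0" "ball (snd c x) rh \<subseteq> img c"
	"is_box {y : fst c. snd c y : ball (snd c x) rh} (%y. b (snd c y))"
	"ALL p:ball (snd c x) rh. ALL p':ball (snd c x) rh. proj K p = proj K p' --> b p = b p' --> p = p'"
	using box_at[OF c x] unfolding K_def by blast
	define be where "be = ({y : fst c. snd c y : ball (snd c x) rh},%y. b (snd c y))"
	have "EX U B. is_box U B & y : U" if y:"y : N" for y
	proof -
	obtain d L' where d:"slice d L'" "y : fst d" using exists_slice[OF y] by blast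
	obtain r and b' :: "'e => 'e" where "r > 0" "is_box {w : fst d. snd d w : ball (snd d y) r} (%w. b' (snd d w))"
	using box_at[OF d y] by blast
	thus ?thesis using d(2)
	by (intro exI[of _ "{w : fst d. snd d w : ball (snd d y) r}"] exI[of _ "%w. b' (snd d w)"]) simp
	qed
	then obtain U B where UB:"!!y. y : N ==> is_box (U y) (B y) & y : U y" by metis
	have "EX \<U>. finite \<U> & \<U> \<subseteq> U ` N & N \<subseteq> \<Union>\<U>"
	proof -
	have 1:"ALL V:U ` N. openin (mtop M) V" using UB box_open by blast
	have 2:"N \<subseteq> \<Union>(U ` N)" using UB by blast
	show ?thesis using comp 1 2 unfolding compactin_def by (elim conjE) (erule allE[of _ "U ` N"],blast)
	qed
	then obtain \<U> where \<U>:"finite \<U>" "\<U> \<subseteq> U ` N" "N \<subseteq> \<Union>\<U>" by blast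
	obtain X where X:"X \<subseteq> N" "finite X" "\<U> = U ` X" using finite_subset_image[OF \<U>(1,2)] by blast
	define \<F> where "\<F> = insert be ((%y. (U y,B y)) ` X)"
	have "countable (snd be ` (leaf M om N x Int fst be))"
	proof (rule leaf_countable[of \<F>])
	show "finite \<F>" using X(2) by (simp add:\<F>_def)
	show "is_box (fst be) (snd be)" if "be : \<F>" for be
	using that b(3) UB X(1) by (auto simp:\<F>_def be_def)
	show "N \<subseteq> (UN be:\<F>. fst be)" using \<U>(3) X(3) by (force simp:\<F>_def)
	qed (use x(2) in \<open>auto simp:\<F>_def\<close>)
	define e where "e = rh / norm a'"
	have e:"e > 0" using b(1) \<open>a' ~= 0\<close> by (simp add:e_def)
	define q where "q t = snd c x + t *\<^sub>R a'" for t
	have qb:"q t : ball (snd c x) rh" if "t : {0<..<e}" for t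
	using that \<open>a' ~= 0\<close> by (simp add:q_def dist_norm e_def field_simps)
	have qimg:"q t : img c" if "t : {0<..<e}" for t using qb[OF that] b(2) by blast
	\<comment> \<open>Along the segment the projection to the kernel is constant; since it separates
	  points together with the label, the label must vary injectively.\<close>
	have "inj_on (%t. b (q t)) {0<..<e}"
	proof (rule inj_onI)
	fix s t assume st:"s : {0<..<e}" "t : {0<..<e}" "b (q s) = b (q t)"
	have "proj K (q s) = proj K (q t)"
	using linear_add[OF linear_proj[OF K]] linear_scale[OF linear_proj[OF K]] pa by (simp add:q_def)
	hence "q s = q t" using b(4) qb[OF st(1)] qb[OF st(2)] st(3) by blast
	thus "s = t" using \<open>a' ~= 0\<close> by (simp add:q_def)
	qed
	moreover have "(%t. b (q t)) ` {0<..<e} \<subseteq> snd be ` (leaf M om N x Int fst be)"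
	proof (rule image_subsetI)
	fix t assume t:"t : {0<..<e}"
	define y where "y = chart_inv c (q t)"
	have y:"y : fst c" "snd c y = q t" using qimg[OF t] by (auto simp:y_def chart_inv_into chart_chart_inv)
	have "q t : L" using slice_iff[OF c x(1)] x(2) a' G(2) slice_subspace[OF c]
	by (auto simp:q_def intro!:subspace_add subspace_scale)
	hence yN:"y : N" using slice_iff[OF c y(1)] y(2) by simp
	have "snd c x - snd c y = (- t) *\<^sub>R a'" by (simp add:y(2) q_def)
	hence "snd c x - snd c y : G" using subspace_scale[OF G(1) a',of "- t"] by (simp only:)
	hence "y : leaf M om N x" using leaf[OF yN y(1)] by blast
	moreover have "y : fst be" using y qb[OF t] by (simp add:be_def)
	moreover have "b (q t) = snd be y" using y(2) by (simp add:be_def)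
	ultimately show "b (q t) : snd be ` (leaf M om N x Int fst be)" by blast
	qed
	ultimately have "countable {0<..<e}"
	using \<open>countable (snd be ` _)\<close> countable_image_inj_on countable_subset by blast
	thus False using uncountable_open_interval[of 0 e] e by simp
qed

end

section \<open>Plaque charts\<close>

lemma is_chartI:
	assumes U:"openin X U" and inj:"inj_on ph U"
	and pre:"!!T. open T ==> openin X {x : U. ph x : T}" and im:"!!W. openin X W ==> W \<subseteq> U ==> open (ph ` W)"
	shows "is_chart X (U,ph)"
proof -
	have ts:"topspace (subtopology X U) = U" using openin_subset[OF U] by auto
	have oU:"open (ph ` U)" by (rule im[OF U order_refl])
	have "homeomorphic_map (subtopology X U) (top_of_set (ph ` U)) ph"
	proof (rule bijective_open_imp_homeomorphic_map)
	show "continuous_map (subtopology X U) (top_of_set (ph ` U)) ph"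
	unfolding continuous_map_def ts
	proof (intro conjI allI impI)
	fix V assume "openin (top_of_set (ph ` U)) V"
	hence "open V" using openin_open_trans[OF _ oU] by blast
	have "openin (subtopology X U) {x : U. ph x : V}"
	unfolding openin_subtopology by (rule exI[of _ "{x : U. ph x : V}"]) (use pre[OF \<open>open V\<close>] in auto)
	thus "openin (subtopology X U) {x : U. ph x : V}" .
	qed auto
	show "open_map (subtopology X U) (top_of_set (ph ` U)) ph"
	unfolding open_map_def
	proof (intro allI impI)
	fix W assume W:"openin (subtopology X U) W"
	hence "openin X W" using openin_trans_full[OF W U] by blast
	moreover have "W \<subseteq> U" using openin_subset[OF W] ts by simp
	ultimately have "open (ph ` W)" "ph ` W \<subseteq> ph ` U" using im by auto
	thus "openin (top_of_set (ph ` U)) (ph ` W)" by (rule open_subset[rotated])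
	qed
	qed (use inj ts in auto)
	thus ?thesis using U oU by (simp add:is_chart_def)
qed

section \<open>Product charts and charts composed with diffeomorphisms\<close>

definition prod_chart :: "('a,'e) chart => ('b,'f) chart => ('a \<times> 'b,'e \<times> 'f) chart" where
	"prod_chart c d = (fst c \<times> fst d,map_prod (snd c) (snd d))"

lemma prod_chart_simps:"fst (prod_chart c d) = fst c \<times> fst d" "snd (prod_chart c d) = map_prod (snd c) (snd d)"
	by (simp_all add:prod_chart_def)

lemma prod_chart_image:"snd (prod_chart c d) ` (A \<times> B) = (snd c ` A) \<times> (snd d ` B)"
	by (auto simp:prod_chart_simps map_prod_def)

lemma is_chart_prod:
	fixes c :: "('a,'e::euclidean_space) chart" and d :: "('b,'f::euclidean_space) chart"
	assumes c:"is_chart X c" and d:"is_chart Y d"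
	shows "is_chart (prod_topology X Y) (prod_chart c d)"
	unfolding prod_chart_def
proof (rule is_chartI)
	show "openin (prod_topology X Y) (fst c \<times> fst d)"
	using chart_openin[OF c] chart_openin[OF d] by (simp add:openin_prod_Times_iff)
	show "inj_on (map_prod (snd c) (snd d)) (fst c \<times> fst d)"
	by (rule map_prod_inj_on[OF chart_inj[OF c] chart_inj[OF d]])
	show "openin (prod_topology X Y) {x : fst c \<times> fst d. map_prod (snd c) (snd d) x : T}" if "open T" for T
	unfolding openin_prod_topology_alt
	proof (intro allI impI)
	fix x y assume xy:"(x,y) : {x : fst c \<times> fst d. map_prod (snd c) (snd d) x : T}"
	then obtain A B where AB:"open A" "open B" "(snd c x,snd d y) : A \<times> B" "A \<times> B \<subseteq> T"
	using \<open>open T\<close> unfolding open_prod_def by auto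
	show "EX U V. openin X U & openin Y V & x : U & y : V & U \<times> V \<subseteq> {x : fst c \<times> fst d. map_prod (snd c) (snd d) x : T}"
	by (rule exI[of _ "{x : fst c. snd c x : A}"],rule exI[of _ "{y : fst d. snd d y : B}"])
	(use chart_preimage_open[OF c AB(1)] chart_preimage_open[OF d AB(2)] AB xy in auto)
	qed
	show "open (map_prod (snd c) (snd d) ` W)" if W:"openin (prod_topology X Y) W" "W \<subseteq> fst c \<times> fst d" for W
	unfolding open_prod_def
	proof (rule ballI)
	fix p assume "p : map_prod (snd c) (snd d) ` W"
	then obtain x y where xy:"(x,y) : W" "p = (snd c x,snd d y)" by auto
	obtain U V where UV:"openin X U" "openin Y V" "x : U" "y : V" "U \<times> V \<subseteq> W"
	using W(1)[unfolded openin_prod_topology_alt,rule_format,OF xy(1)] by (elim exE conjE) (rule that,assumption+)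
	have sub:"U \<subseteq> fst c" "V \<subseteq> fst d" using UV W(2) by auto
	have "snd c ` U \<times> snd d ` V \<subseteq> map_prod (snd c) (snd d) ` W"
	proof clarify
	fix u v assume "u : U" "v : V"
	hence "(u,v) : W" using UV(5) by blast
	thus "(snd c u,snd d v) : map_prod (snd c) (snd d) ` W" by (metis image_eqI map_prod_simp)
	qed
	thus "EX A B. open A & open B & p : A \<times> B & A \<times> B \<subseteq> map_prod (snd c) (snd d) ` W"
	using chart_open_map[OF c UV(1) sub(1)] chart_open_map[OF d UV(2) sub(2)] UV(3,4) xy(2)
	by (intro exI[of _ "snd c ` U"] exI[of _ "snd d ` V"]) auto
	qed
qed

lemma chart_inv_prod:
	assumes c:"is_chart X c" and d:"is_chart Y d" and p:"p : snd c ` fst c" and q:"q : snd d ` fst d"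
	shows "chart_inv (prod_chart c d) (p,q) = (chart_inv c p,chart_inv d q)"
proof -
	have "chart_inv (prod_chart c d) (snd (prod_chart c d) (chart_inv c p,chart_inv d q)) = (chart_inv c p,chart_inv d q)"
	by (rule chart_inv_chart[OF is_chart_prod[OF c d]]) (simp add:prod_chart_simps chart_inv_into[OF p] chart_inv_into[OF q])
	thus ?thesis using chart_chart_inv[OF p] chart_chart_inv[OF q] by (simp add:prod_chart_simps)
qed

lemma smooth_transition_prod:
	fixes c :: "('a,'e::euclidean_space) chart" and d :: "('b,'f::euclidean_space) chart"
	assumes c:"is_chart X c" and d:"is_chart Y d" and c':"is_chart X c'" and d':"is_chart Y d'"
	and cc:"smooth_transition c c'" and dd:"smooth_transition d d'"
	shows "smooth_transition (prod_chart c d) (prod_chart c' d')"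
proof -
	define A where "A = snd c ` (fst c Int fst c')"
	define B where "B = snd d ` (fst d Int fst d')"
	have A:"open A" unfolding A_def by (rule chart_open_map[OF c openin_Int[OF chart_openin[OF c] chart_openin[OF c']]]) auto
	have B:"open B" unfolding B_def by (rule chart_open_map[OF d openin_Int[OF chart_openin[OF d] chart_openin[OF d']]]) auto
	have set:"snd (prod_chart c d) ` (fst (prod_chart c d) Int fst (prod_chart c' d')) = A \<times> B"
	unfolding A_def B_def prod_chart_image[symmetric] by (simp add:prod_chart_simps Times_Int_Times)
	have AB:"open (A \<times> B)" by (rule open_Times[OF A B])
	have lin:"linear (fst :: 'e \<times> 'f => 'e)" "linear (snd :: 'e \<times> 'f => 'f)" by (simp_all add:linear_iff)
	have 1:"smooth_on (A \<times> B) (%x. snd c' (chart_inv c (fst x)))"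
	by (rule sm_compose[OF AB A sm_linear[OF lin(1)]])
	(use cc in \<open>auto simp:smooth_transition_def A_def comp_def\<close>)
	have 2:"smooth_on (A \<times> B) (%x. snd d' (chart_inv d (snd x)))"
	by (rule sm_compose[OF AB B sm_linear[OF lin(2)]])
	(use dd in \<open>auto simp:smooth_transition_def B_def comp_def\<close>)
	have "smooth_on (A \<times> B) (%x. snd (prod_chart c' d') (chart_inv (prod_chart c d) x))"
	proof (rule sm_cong[OF AB _ smooth_on_Pair[OF AB 1 2]])
	fix x assume x:"x : A \<times> B"
	have "fst x : snd c ` fst c" "snd x : snd d ` fst d" using x by (auto simp:A_def B_def)
	from chart_inv_prod[OF c d this]
	show "(snd c' (chart_inv c (fst x)),snd d' (chart_inv d (snd x))) = snd (prod_chart c' d') (chart_inv (prod_chart c d) x)"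
	by (simp add:prod_chart_simps)
	qed
	thus ?thesis unfolding smooth_transition_def set comp_def .
qed

lemma mtop_prod:"mtop (prod_manifold M M') = prod_topology (mtop M) (mtop M')"
	and atlas_prod:"atlas (prod_manifold M M') = {prod_chart c d | c d. c : atlas M & d : atlas M'}"
	by (simp_all add:prod_manifold_def prod_chart_def)

lemma smooth_mfd_prod:
	assumes "smooth_mfd M" "smooth_mfd M'"
	shows "smooth_mfd (prod_manifold M M')"
proof -
	interpret M: smooth_mfd M by fact
	interpret M': smooth_mfd M' by fact
	show ?thesis
	proof
	have "(UN c:atlas (prod_manifold M M'). fst c) = (UN c:atlas M. fst c) \<times> (UN d:atlas M'. fst d)"
	proof (intro equalityI subsetI)
	fix x assume "x : (UN c:atlas (prod_manifold M M'). fst c)"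
	then obtain c d where "c : atlas M" "d : atlas M'" "x : fst (prod_chart c d)" unfolding atlas_prod by blast
	thus "x : (UN c:atlas M. fst c) \<times> (UN d:atlas M'. fst d)" by (auto simp:prod_chart_simps)
	next
	fix x assume "x : (UN c:atlas M. fst c) \<times> (UN d:atlas M'. fst d)"
	then obtain c d where cd:"c : atlas M" "d : atlas M'" "x : fst c \<times> fst d" by auto
	hence "prod_chart c d : atlas (prod_manifold M M')" "x : fst (prod_chart c d)"
	unfolding atlas_prod prod_chart_simps by blast+
	thus "x : (UN c:atlas (prod_manifold M M'). fst c)" by blast
	qed
	thus "(UN c:atlas (prod_manifold M M'). fst c) = points (prod_manifold M M')"
	using M.atlas_cover M'.atlas_cover by (simp add:mtop_prod)
	next
	fix c assume "c : atlas (prod_manifold M M')"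
	then obtain c1 c2 where c:"c = prod_chart c1 c2" "c1 : atlas M" "c2 : atlas M'" unfolding atlas_prod by blast
	show "is_chart (mtop (prod_manifold M M')) c"
	unfolding c(1) mtop_prod by (rule is_chart_prod[OF M.atlas_chart[OF c(2)] M'.atlas_chart[OF c(3)]])
	next
	fix c d assume "c : atlas (prod_manifold M M')" "d : atlas (prod_manifold M M')"
	then obtain c1 c2 d1 d2 where cd:"c = prod_chart c1 c2" "d = prod_chart d1 d2" "c1 : atlas M" "c2 : atlas M'"
	"d1 : atlas M" "d2 : atlas M'" unfolding atlas_prod by blast
	show "smooth_transition c d" unfolding cd(1,2)
	by (rule smooth_transition_prod[OF M.atlas_chart[OF cd(3)] M'.atlas_chart[OF cd(4)] M.atlas_chart[OF cd(5)]
	M'.atlas_chart[OF cd(6)] M.atlas_transition[OF cd(3,5)] M'.atlas_transition[OF cd(4,6)]])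
	qed
qed

lemma smooth_chart_prod:
	assumes "smooth_mfd M" "smooth_mfd M'" and c:"smooth_chart M c" and d:"smooth_chart M' d"
	shows "smooth_chart (prod_manifold M M') (prod_chart c d)"
proof -
	interpret M: smooth_mfd M by fact
	interpret M': smooth_mfd M' by fact
	show ?thesis unfolding smooth_chart_def
	proof (intro conjI ballI)
	show "is_chart (mtop (prod_manifold M M')) (prod_chart c d)"
	unfolding mtop_prod by (rule is_chart_prod[OF M.is_chart[OF c] M'.is_chart[OF d]])
	fix e assume "e : atlas (prod_manifold M M')"
	then obtain e1 e2 where e:"e = prod_chart e1 e2" "e1 : atlas M" "e2 : atlas M'" unfolding atlas_prod by blast
	note e1 = M.atlas_chart[OF e(2)] and e2 = M'.atlas_chart[OF e(3)]
	show "smooth_transition (prod_chart c d) e" unfolding e(1)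
	by (rule smooth_transition_prod[OF M.is_chart[OF c] M'.is_chart[OF d] e1 e2])
	(use c d e in \<open>auto simp:smooth_chart_def\<close>)
	show "smooth_transition e (prod_chart c d)" unfolding e(1)
	by (rule smooth_transition_prod[OF e1 e2 M.is_chart[OF c] M'.is_chart[OF d]])
	(use c d e in \<open>auto simp:smooth_chart_def\<close>)
	qed
qed

lemma (in smooth_mfd) smooth_chart_compose:
	assumes c:"smooth_chart M c" and S:"open S" "S \<subseteq> snd c ` fst c" and V:"open V" and h:"homeomorphism S V ps g"
	and ps:"smooth_on S ps" and g:"smooth_on V g"
	shows "smooth_chart M ({x : fst c. snd c x : S},%x. ps (snd c x))" (is "smooth_chart M ?c")
	and "(%x. ps (snd c x)) ` {x : fst c. snd c x : S} = V"
proof -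
	define U where "U = {x : fst c. snd c x : S}"
	note ci = is_chart[OF c]
	have hs:"ps ` S = V" "g ` V = S" "!!x. x : S ==> g (ps x) = x" "!!y. y : V ==> ps (g y) = y"
	"continuous_on V g" "continuous_on S ps"
	using h by (auto simp:homeomorphism_def)
	have Uo:"openin (mtop M) U" unfolding U_def by (rule chart_preimage_open[OF ci S(1)])
	have cU:"snd c ` U = S" unfolding U_def using S(2) by auto
	show im:"(%x. ps (snd c x)) ` {x : fst c. snd c x : S} = V"
	using hs(1) cU unfolding U_def[symmetric] image_image[symmetric,of ps "snd c"] by simp
	have chart:"is_chart (mtop M) (U,%x. ps (snd c x))"
	proof (rule is_chartI[OF Uo])
	show "inj_on (%x. ps (snd c x)) U"
	proof (rule inj_onI)
	fix x y assume "x : U" "y : U" "ps (snd c x) = ps (snd c y)"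
	hence "snd c x = snd c y" using hs(3) by (metis (mono_tags,lifting) U_def mem_Collect_eq)
	thus "x = y" using chart_inj[OF ci] \<open>x : U\<close> \<open>y : U\<close> by (auto simp:U_def dest:inj_onD)
	qed
	show "openin (mtop M) {x : U. ps (snd c x) : T}" if "open T" for T
	proof -
	have "open (S Int ps -` T)" by (rule continuous_open_preimage[OF hs(6) S(1) that])
	from chart_preimage_open[OF ci this] show ?thesis by (rule back_subst[of "openin _"]) (auto simp:U_def)
	qed
	show "open ((%x. ps (snd c x)) ` W)" if W:"openin (mtop M) W" "W \<subseteq> U" for W
	proof -
	have "open (snd c ` W)" by (rule chart_open_map[OF ci W(1)]) (use W(2) in \<open>auto simp:U_def\<close>)
	from continuous_open_preimage[OF hs(5) V this] have "open (V Int g -` snd c ` W)" .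
	moreover have "snd c ` W \<subseteq> S" using W(2) by (auto simp:U_def)
	hence "ps ` snd c ` W = V Int g -` snd c ` W"
	using hs(1,3,4) by (auto simp:image_iff)
	ultimately show ?thesis by (simp add:image_image)
	qed
	qed
	have inv:"chart_inv (U,%x. ps (snd c x)) p = chart_inv c (g p)" if p:"p : V" for p
	proof -
	have gp:"g p : S" using hs(2) p by blast
	have 1:"snd c (chart_inv c (g p)) = g p" "chart_inv c (g p) : fst c" using gp S(2) by (auto simp:chart_chart_inv chart_inv_into)
	have "chart_inv (U,%x. ps (snd c x)) (snd (U,%x. ps (snd c x)) (chart_inv c (g p))) = chart_inv c (g p)"
	by (rule chart_inv_chart[OF chart]) (use 1 gp in \<open>auto simp:U_def\<close>)
	thus ?thesis using 1 hs(4)[OF p] by simp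
	qed
	show "smooth_chart M ?c" unfolding U_def[symmetric] smooth_chart_def
	proof (intro conjI ballI chart)
	fix d assume d:"d : atlas M"
	have ds:"smooth_chart M d" by (rule atlas_smooth_chart[OF d])
	define A where "A = (%x. ps (snd c x)) ` (U Int fst d)"
	have A:"open A" unfolding A_def using chart_open_map[OF chart,of "U Int fst d"] Uo chart_openin[OF is_chart[OF ds]] by auto
	have AV:"A \<subseteq> V" using im by (auto simp:A_def U_def)
	have "smooth_on A (%p. snd d (chart_inv c (g p)))"
	proof (rule sm_compose[OF A overlap_open[OF c ds] sm_subset[OF g AV] transition_smooth[OF c ds]])
	show "g ` A \<subseteq> snd c ` (fst c Int fst d)" using hs(3) by (auto simp:A_def U_def)
	qed
	hence "smooth_on A (%p. snd d (chart_inv (U,%x. ps (snd c x)) p))"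
	by (rule sm_cong[OF A,rotated]) (use inv AV in auto)
	thus "smooth_transition (U,%x. ps (snd c x)) d"
	by (simp add:smooth_transition_def A_def comp_def)
	define B where "B = snd d ` (fst d Int U)"
	have B:"open B" unfolding B_def using chart_open_map[OF is_chart[OF ds],of "fst d Int U"] Uo chart_openin[OF is_chart[OF ds]] by auto
	have "smooth_on B (%p. snd c (chart_inv d p))"
	by (rule sm_subset[OF transition_smooth[OF ds c]]) (auto simp:B_def U_def)
	hence "smooth_on B (%p. ps (snd c (chart_inv d p)))"
	by (rule sm_compose[OF B S(1) _ ps]) (auto simp:B_def U_def inv_chart[OF ds])
	thus "smooth_transition d (U,%x. ps (snd c x))"
	by (simp add:smooth_transition_def B_def comp_def)
	qed
qed

section \<open>Straightening an equivalence relation\<close>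

lemma inverse_derivative:
	fixes f g :: "'e::euclidean_space => 'e"
	assumes h:"homeomorphism U V f g" and U:"open U" "x : U" and f:"(f has_derivative f') (at x)"
	and g:"(g has_derivative g') (at (f x))"
	shows "g' (f' v) = v"
proof -
	have "((%x. g (f x)) has_derivative (%v. g' (f' v))) (at x)" by (rule has_derivative_compose[OF f g])
	moreover have "((%x. g (f x)) has_derivative (%v. v)) (at x)"
	by (rule hd_transform[OF has_derivative_ident U]) (use h in \<open>simp add:homeomorphism_def\<close>)
	ultimately have "(%v. g' (f' v)) = (%v. v)" by (rule has_derivative_unique)
	from fun_cong[OF this,of v] show ?thesis .
qed

lemma eventually_line_in:
	fixes p :: "'v::real_normed_vector"
	assumes "open S" "p : S"
	shows "\<forall>\<^sub>F s in at (0::real). p + s *\<^sub>R v : S"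
proof -
	have "((%s. p + s *\<^sub>R v) \<longlongrightarrow> p + 0 *\<^sub>R v) (at 0)" by (intro tendsto_intros)
	thus ?thesis using topological_tendstoD[of "%s. p + s *\<^sub>R v" "p + 0 *\<^sub>R v" "at 0" S] assms by simp
qed

text \<open>A local form of Godement's theorem: an equivalence relation that is a submanifold near
  \<open>(z,z)\<close> is given near \<open>z\<close> by the fibres of a submersion. Here it is
  \<open>b\<close>, which sends \<open>q\<close> to the unique equivalent point near
  \<open>z\<close> on the transversal \<open>proj G = proj G z\<close>. Reflexivity controls the
  tangent space of \<open>R\<close>, while symmetry and transitivity show that \<open>b\<close>
  separates classes.\<close>

lemma plaque_structure:
	fixes R :: "('e::euclidean_space \<times> 'e) set" and Th :: "'e \<times> 'e => 'e \<times> 'e"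
	assumes L:"subspace L" and z:"z : Q" "z : L"
	and R:"R \<subseteq> (Q Int L) \<times> (Q Int L)" and refl:"!!p. p : Q ==> p : L ==> (p,p) : R"
	and sym:"!!p q. (p,q) : R ==> (q,p) : R" and trans:"!!p q r. (p,q) : R ==> (q,r) : R ==> (p,r) : R"
	and \<Omega>:"open \<Omega>" "(z,z) : \<Omega>" "\<Omega> \<subseteq> Q \<times> Q" and Th:"smooth_on \<Omega> Th" and inj:"inj (fder Th (z,z))"
	and K:"subspace K" and RTh:"!!x. x : \<Omega> ==> x : R \<longleftrightarrow> Th x : K"
	shows "EX S V ps g G. open S & z : S & S \<subseteq> Q & open V & homeomorphism S V ps g & smooth_on S ps & smooth_on V g &
	subspace G & G \<subseteq> L & (ALL p:S. ps p : L \<longleftrightarrow> p : L) &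
	(ALL p:S Int L. ALL q:S Int L. (p,q) : R \<longleftrightarrow> ps p - ps q : G)"
proof -
	define D where "D = fder Th (z,z)"
	have dD:"(Th has_derivative D) (at (z,z))" unfolding D_def by (rule sm_hd[OF \<Omega>(1) Th \<Omega>(2)])
	have linD:"linear D" using has_derivative_linear[OF dD] .
	have bijD:"bij D" using linear_injective_imp_surjective[OF linD] inj by (simp add:bij_def D_def)
	have linDi:"linear (inv D)" using bijD linD by (simp add:inj_linear_imp_inv_linear bij_is_inj)
	\<comment> \<open>The tangent space of \<open>R\<close> at \<open>(z,z)\<close>, read off from the
	  straightening map \<open>Th\<close>.\<close>
	define T where "T = {x. D x : K}"
	have T:"subspace T" unfolding T_def using K linD
	by (auto simp:subspace_def linear_0 linear_add linear_scale)
	have LL:"subspace (L \<times> L)" by (rule subspace_Times[OF L L])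
	have zzR:"(z,z) : R" by (rule refl[OF z])
	have TL:"T \<subseteq> L \<times> L"
	proof
	fix x assume x:"x : T"
	obtain U0 V0 g0 where g0:"open U0" "U0 \<subseteq> \<Omega>" "(z,z) : U0" "open V0" "Th (z,z) : V0" "homeomorphism U0 V0 Th g0" "smooth_on V0 g0"
	by (rule smooth_inverse_function[OF \<Omega>(1) Th \<Omega>(2) inj]) (rule that; assumption)
	have dg:"(g0 has_derivative fder g0 (Th (z,z))) (at (Th (z,z)))" by (rule sm_hd[OF g0(4,7,5)])
	have "((%s. g0 (Th (z,z) + s *\<^sub>R D x)) has_vector_derivative fder g0 (Th (z,z)) (D x)) (at 0)"
	by (rule has_vector_derivative_chain[OF has_vector_derivative_line]) (use dg in simp)
	hence "((%s. g0 (Th (z,z) + s *\<^sub>R D x)) has_vector_derivative x) (at 0)"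
	unfolding inverse_derivative[OF g0(6,1,3) dD dg] .
	thus "x : L \<times> L"
	proof (rule has_vector_derivative_in_subspace[OF _ LL])
	have inR:"g0 (Th (z,z) + s *\<^sub>R D x) : R" if "Th (z,z) + s *\<^sub>R D x : V0" for s
	proof -
	have g:"g0 (Th (z,z) + s *\<^sub>R D x) : U0" "Th (g0 (Th (z,z) + s *\<^sub>R D x)) = Th (z,z) + s *\<^sub>R D x"
	using g0(6) that by (auto simp:homeomorphism_def)
	have "Th (z,z) + s *\<^sub>R D x : K" using RTh[OF \<Omega>(2)] zzR x K by (auto simp:T_def intro!:subspace_add subspace_scale)
	thus ?thesis using RTh[of "g0 (Th (z,z) + s *\<^sub>R D x)"] g g0(2) by auto
	qed
	have sub:"R \<subseteq> L \<times> L" using R by blast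
	have "Th (z,z) + 0 *\<^sub>R D x : V0" using g0(5) by simp
	note i0 = inR[OF this]
	show "\<forall>\<^sub>F s in at 0. g0 (Th (z,z) + s *\<^sub>R D x) - g0 (Th (z,z) + 0 *\<^sub>R D x) : L \<times> L"
	proof (rule eventually_mono[OF eventually_line_in[OF g0(4,5),of "D x"]])
	fix s assume "Th (z,z) + s *\<^sub>R D x : V0"
	from inR[OF this] show "g0 (Th (z,z) + s *\<^sub>R D x) - g0 (Th (z,z) + 0 *\<^sub>R D x) : L \<times> L"
	using i0 sub by (intro subspace_diff[OF LL]) blast+
	qed
	qed auto
	qed
	\<comment> \<open>Reflexivity makes the diagonal of \<open>L\<close> tangent to \<open>R\<close>.
	  Hence \<open>T\<close> consists of the vectors \<open>(v, v + w)\<close> with \<open>v\<close> in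
	  \<open>L\<close> and \<open>w\<close> in the subspace \<open>G\<close> introduced next.\<close>
	have diag:"(v,v) : T" if v:"v : L" for v
	proof -
	have "((%s. Th ((z,z) + s *\<^sub>R (v,v))) has_vector_derivative D (v,v)) (at 0)"
	by (rule has_vector_derivative_chain[OF has_vector_derivative_line]) (use dD in simp)
	hence "D (v,v) : K"
	proof (rule has_vector_derivative_in_subspace[OF _ K])
	have inK:"Th ((z,z) + s *\<^sub>R (v,v)) : K" if s:"(z,z) + s *\<^sub>R (v,v) : \<Omega>" for s
	proof -
	have "z + s *\<^sub>R v : Q" using s \<Omega>(3) by auto
	hence "(z + s *\<^sub>R v,z + s *\<^sub>R v) : R" using v z(2) L by (intro refl) (auto intro!:subspace_add subspace_scale)
	thus ?thesis using RTh[OF s] by simp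
	qed
	have "(z,z) + 0 *\<^sub>R (v,v) : \<Omega>" using \<Omega>(2) by simp
	note i0 = inK[OF this]
	show "\<forall>\<^sub>F s in at 0. Th ((z,z) + s *\<^sub>R (v,v)) - Th ((z,z) + 0 *\<^sub>R (v,v)) : K"
	by (rule eventually_mono[OF eventually_line_in[OF \<Omega>(1,2),of "(v,v)"]]) (rule subspace_diff[OF K inK i0])
	qed auto
	thus ?thesis by (simp add:T_def)
	qed
	define G where "G = {w. (0,w) : T}"
	have G:"subspace G" unfolding G_def
	proof (rule subspaceI)
	show "0 : {w. (0,w) : T}" using subspace_0[OF T] by (simp add:zero_prod_def)
	show "x + y : {w. (0,w) : T}" if "x : {w. (0,w) : T}" "y : {w. (0,w) : T}" for x y
	using subspace_add[OF T,of "(0,x)" "(0,y)"] that by simp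
	show "c *\<^sub>R x : {w. (0,w) : T}" if "x : {w. (0,w) : T}" for c x
	using subspace_scale[OF T,of "(0,x)" c] that by simp
	qed
	have GL:"G \<subseteq> L" using TL by (auto simp:G_def)
	note lp = linear_add[OF linear_proj[OF L]] linear_add[OF linear_proj[OF G]] linear_scale[OF linear_proj[OF L]]
	linear_scale[OF linear_proj[OF G]] linear_diff[OF linear_proj[OF L]] linear_diff[OF linear_proj[OF G]]
	define P where "P y = proj L y - proj G y" for y
	have linP:"linear P" unfolding P_def using linear_compose_sub[OF linear_proj[OF L] linear_proj[OF G]] .
	have PL:"P y : L" for y unfolding P_def using proj_in[OF L] proj_in[OF G] GL L by (blast intro:subspace_diff)
	have GP:"proj G (proj L y) = proj G y" for y
	proof -
	define d where "d = proj G y - proj G (proj L y)"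
	have dG:"d : G" unfolding d_def using proj_in[OF G] G by (blast intro:subspace_diff)
	have "(y - proj L y) \<bullet> d = 0" using proj_orthogonal[OF L] dG GL by blast
	moreover have "(y - proj G y) \<bullet> d = 0" "(proj L y - proj G (proj L y)) \<bullet> d = 0" using proj_orthogonal[OF G dG] by auto
	ultimately have "d \<bullet> d = 0" by (simp add:d_def inner_diff_left)
	thus ?thesis by (simp add:d_def)
	qed
	have PG:"proj G (P y) = 0" for y by (simp add:P_def lp GP proj_id[OF G proj_in[OF G]])
	have PP:"P (P y) = P y" for y using PG PL proj_id[OF L PL] by (simp add:P_def[of "P y"])
	\<comment> \<open>A projection onto \<open>T\<close> adapted to the question: it keeps the part
	  along \<open>G\<close> of the first point and the part along \<open>L\<close> of the second, the
	  two quantities that are going to be prescribed.\<close>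
	define mu where "mu x = (P (snd x) + proj G (fst x),proj L (snd x))" for x
	have linmu:"linear mu" unfolding mu_def by (rule linearI) (simp_all add:linear_add[OF linP] linear_scale[OF linP] lp scaleR_add_right)
	have muT:"mu x : T" for x
	proof -
	define v where "v = P (snd x) + proj G (fst x)"
	have "v : L" unfolding v_def using PL proj_in[OF G] GL L by (blast intro:subspace_add)
	moreover have "proj L (snd x) - v = proj G (snd x) - proj G (fst x)" by (simp add:v_def P_def)
	hence "proj L (snd x) - v : G" using proj_in[OF G] G by (simp add:subspace_diff)
	hence "(0,proj L (snd x) - v) : T" by (simp add:G_def)
	ultimately have "(v,v) + (0,proj L (snd x) - v) : T" using diag T by (blast intro:subspace_add)
	thus ?thesis by (simp add:mu_def v_def)
	qed
	have muid:"mu x = x" if x:"x : T" for x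
	proof -
	have xL:"fst x : L" "snd x : L" using x TL by auto
	have "x - (fst x,fst x) : T" using x diag[OF xL(1)] T by (blast intro:subspace_diff)
	hence "snd x - fst x : G" by (simp add:G_def minus_prod_def)
	from proj_id[OF G this] have "proj G (snd x) - proj G (fst x) = snd x - fst x" by (simp add:lp)
	hence "P (snd x) + proj G (fst x) = fst x" using proj_id[OF L xL(2)] by (simp add:P_def algebra_simps)
	thus ?thesis using proj_id[OF L xL(2)] by (simp add:mu_def prod_eq_iff)
	qed
	define Th' where "Th' x = inv D (Th x)" for x
	have TTh:"Th' x : T \<longleftrightarrow> Th x : K" for x using bijD by (simp add:T_def Th'_def bij_is_surj surj_f_inv_f)
	\<comment> \<open>A chart near \<open>(z,z)\<close> with the identity as derivative:
	  \<open>R\<close> is still described by \<open>T\<close>, but on \<open>R\<close> the chart is now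
	  the explicit linear map \<open>mu\<close>.\<close>
	define Ph where "Ph x = mu x + (Th' x - mu (Th' x))" for x
	have smoothTh':"smooth_on \<Omega> Th'" unfolding Th'_def[abs_def] by (rule sm_linear_compose[OF \<Omega>(1) linDi Th])
	have smoothPh:"smooth_on \<Omega> Ph" unfolding Ph_def[abs_def]
	by (rule sm_add[OF \<Omega>(1) sm_linear[OF linmu] sm_diff[OF \<Omega>(1) smoothTh' sm_linear_compose[OF \<Omega>(1) linmu smoothTh']]])
	have bl:"bounded_linear mu" "bounded_linear (inv D)" using linmu linDi by (simp_all add:linear_conv_bounded_linear)
	have "(Th' has_derivative (%h. h)) (at (z,z))"
	using bounded_linear.has_derivative[OF bl(2) dD] bijD by (simp add:Th'_def[abs_def] bij_is_inj)
	hence dPh:"(Ph has_derivative (%h. mu h + (h - mu h))) (at (z,z))"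
	unfolding Ph_def[abs_def]
	by (intro has_derivative_add has_derivative_diff bounded_linear_imp_has_derivative[OF bl(1)] bounded_linear.has_derivative[OF bl(1)])
	hence dPh:"(Ph has_derivative (%h. h)) (at (z,z))" by simp
	have "inj (fder Ph (z,z))" using frechet_derivative_at[OF dPh] by (metis inj_on_id2)
	from smooth_inverse_function[OF \<Omega>(1) smoothPh \<Omega>(2) this]
	obtain U V g where g:"open U" "U \<subseteq> \<Omega>" "(z,z) : U" "open V" "Ph (z,z) : V" "homeomorphism U V Ph g" "smooth_on V g" by metis
	have gU:"g y : U" "Ph (g y) = y" if "y : V" for y using g(6) that by (auto simp:homeomorphism_def)
	have gid:"g (Ph x) = x" if "x : U" for x using g(6) that by (auto simp:homeomorphism_def)
	have RPh:"Ph x = mu x" if "x : R" "x : U" for x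
	proof -
	have "Th' x : T" using RTh[of x] TTh[of x] that g(2) by blast
	from muid[OF this] show ?thesis by (simp add:Ph_def)
	qed
	have PhR:"x : R" if x:"Ph x : T" "x : U" for x
	proof -
	have "mu (Ph x) = mu x" unfolding Ph_def linear_add[OF linmu] linear_diff[OF linmu] by (simp add:muid[OF muT])
	hence "Ph x = mu x" using muid[OF x(1)] by simp
	hence "Th' x = mu (Th' x)" by (simp add:Ph_def)
	hence "Th' x : T" using muT by metis
	thus ?thesis using TTh RTh x(2) g(2) by blast
	qed
	have Phz:"Ph (z,z) = (z,z)" using RPh[OF zzR g(3)] muid[OF diag[OF z(2)]] by simp
	\<comment> \<open>This is \<open>mu (z,q)\<close>, the value of \<open>Ph\<close> at a pair in
	  \<open>R\<close> whose second point is \<open>q\<close> and whose first point lies on the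
	  transversal.\<close>
	define m where "m q = (P q + proj G z,proj L q)" for q
	have Pz:"P z + proj G z = z" using proj_id[OF L z(2)] by (simp add:P_def)
	have mz:"m z = (z,z)" using Pz proj_id[OF L z(2)] by (simp add:m_def)
	have smooth_m:"smooth_on UNIV m" unfolding m_def[abs_def]
	by (intro smooth_on_Pair sm_add sm_const sm_linear linP linear_proj[OF L] open_UNIV)
	define S1 where "S1 = m -` V"
	have S1:"open S1" unfolding S1_def by (rule open_vimage[OF g(4) sm_cont[OF smooth_m]])
	define b where "b q = fst (g (m q))" for q
	have smooth_b:"smooth_on S1 b" unfolding b_def[abs_def]
	by (rule sm_linear_compose[OF S1 _ sm_compose[OF S1 g(4) sm_subset[OF smooth_m] g(7)]])
	(auto simp:S1_def linear_iff)
	have mT:"m q : T" if "q : L" for q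
	proof -
	have "mu (z,q) = m q" by (simp add:mu_def m_def)
	thus ?thesis using muT by metis
	qed
	have bR:"(b q,q) : R" "(b q,q) : U" "proj G (b q) = proj G z" if q:"q : S1" "q : L" for q
	proof -
	obtain x y where xy:"g (m q) = (x,y)" by (cases "g (m q)")
	have mV:"m q : V" using q(1) by (simp add:S1_def)
	have U:"(x,y) : U" "Ph (x,y) = m q" using gU[OF mV] xy by auto
	have xyR:"(x,y) : R" by (rule PhR[OF _ U(1)]) (use U(2) mT[OF q(2)] in simp)
	have yL:"y : L" using xyR R by blast
	have e:"m q = mu (x,y)" using RPh[OF xyR U(1)] U(2) by simp
	hence "y = q" using proj_id[OF L yL] proj_id[OF L q(2)] by (simp add:m_def mu_def)
	thus "(b q,q) : R" "(b q,q) : U" "proj G (b q) = proj G z"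
	using xyR U xy e by (auto simp:b_def m_def mu_def)
	qed
	have uniq:"x = b q" if "(x,q) : R" "(x,q) : U" "proj G x = proj G z" for x q
	proof -
	have "Ph (x,q) = m q" using RPh[OF that(1,2)] that(3) by (simp add:mu_def m_def)
	thus ?thesis using gid[OF that(2)] by (simp add:b_def)
	qed
	obtain A B where AB:"open A" "open B" "(z,z) : A \<times> B" "A \<times> B \<subseteq> U"
	using bspec[OF g(1)[unfolded open_prod_def] g(3)] by (elim exE conjE) (rule that,assumption+)
	have zS1:"z : S1" using mz g(5) Phz by (simp add:S1_def)
	have bz:"b z = z" using gid[OF g(3)] by (simp add:b_def mz Phz)
	define S2 where "S2 = (S1 Int b -` A) Int B"
	have S2:"open S2" unfolding S2_def
	by (rule open_Int[OF continuous_open_preimage[OF sm_cont[OF smooth_b] S1 AB(1)] AB(2)])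
	have zS2:"z : S2" using zS1 bz AB(3) by (simp add:S2_def)
	have S2Q:"S2 \<subseteq> Q" using AB(3,4) g(2) \<Omega>(3) by (auto simp:S2_def)
	have same:"(p,q) : R \<longleftrightarrow> b p = b q" if pq:"p : S2" "p : L" "q : S2" "q : L" for p q
	proof
	assume "(p,q) : R"
	hence "(b p,q) : R" using trans bR(1)[of p] pq by (auto simp:S2_def)
	moreover have "(b p,q) : U" using pq AB(4) by (auto simp:S2_def)
	ultimately show "b p = b q" using uniq bR(3)[of p] pq by (auto simp:S2_def)
	next
	assume e:"b p = b q"
	have "p : S1" "q : S1" using pq by (auto simp:S2_def)
	hence "(p,b p) : R" "(b p,q) : R" using sym[OF bR(1)[of p]] bR(1)[of q] pq e by simp_all
	thus "(p,q) : R" by (rule trans)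
	qed
	\<comment> \<open>Keeps the parts of \<open>q\<close> along \<open>G\<close> and normal to
	  \<open>L\<close>, and replaces the remaining part by that of \<open>b q\<close>. As
	  \<open>b q\<close> is constant on classes, these become parallel to \<open>G\<close>; the
	  derivative at \<open>z\<close> is the identity.\<close>
	define ps where "ps q = proj G q + P (b q) + (q - proj L q)" for q
	have smoothps:"smooth_on S2 ps" unfolding ps_def[abs_def]
	by (intro sm_add[OF S2] sm_diff[OF S2] sm_id sm_linear linear_proj G L
	sm_linear_compose[OF S2 linP] sm_subset[OF smooth_b]) (auto simp:S2_def)
	have db:"(b has_derivative (%h. P h)) (at z)"
	proof -
	have "(m has_derivative (%h. (P h,proj L h))) (at z)"
	proof -
	have 1:"bounded_linear P" "bounded_linear (proj L)" using linP linear_proj[OF L] by (simp_all add:linear_conv_bounded_linear)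
	have "(m has_derivative (%h. (P h + 0,proj L h))) (at z)" unfolding m_def[abs_def]
	by (intro has_derivative_Pair has_derivative_add has_derivative_const bounded_linear_imp_has_derivative 1)
	thus ?thesis by simp
	qed
	moreover have dg:"(g has_derivative fder g (z,z)) (at (z,z))"
	by (rule sm_hd[OF g(4,7)]) (use g(5) Phz in simp)
	hence "fder g (z,z) v = v" for v
	using inverse_derivative[OF g(6,1,3) dPh,of "fder g (z,z)" v] Phz by simp
	hence "fder g (z,z) = (%v. v)" by (rule ext)
	hence "(g has_derivative (%v. v)) (at (m z))" using dg mz by simp
	ultimately have "((%q. g (m q)) has_derivative (%h. (P h,proj L h))) (at z)" by (rule has_derivative_compose)
	from bounded_linear.has_derivative[OF bounded_linear_fst this] show ?thesis by (simp add:b_def[abs_def])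
	qed
	have "(ps has_derivative (%h. proj G h + P (P h) + (h - proj L h))) (at z)"
	proof -
	have 1:"bounded_linear P" "bounded_linear (proj L)" "bounded_linear (proj G)"
	using linP linear_proj[OF L] linear_proj[OF G] by (simp_all add:linear_conv_bounded_linear)
	show ?thesis unfolding ps_def[abs_def]
	by (intro has_derivative_add has_derivative_diff has_derivative_ident bounded_linear_imp_has_derivative 1(2,3)
	bounded_linear.has_derivative[OF 1(1) db])
	qed
	hence dps:"(ps has_derivative (%h. h)) (at z)" by (simp add:PP) (simp add:P_def)
	have "inj (fder ps z)" using frechet_derivative_at[OF dps] by (metis inj_on_id2)
	from smooth_inverse_function[OF S2 smoothps zS2 this]
	obtain S W k where k:"open S" "S \<subseteq> S2" "z : S" "open W" "homeomorphism S W ps k" "smooth_on W k" by metis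
	have fL:"ps p : L \<longleftrightarrow> p : L" for p
	proof -
	have 1:"proj G p + P (b p) : L" using proj_in[OF G] GL PL L by (blast intro:subspace_add)
	have c:"u + v : L \<longleftrightarrow> v : L" if "u : L" for u v
	using subspace_add[OF L that,of v] subspace_diff[OF L _ that,of "u + v"] by auto
	have "ps p : L \<longleftrightarrow> p - proj L p : L" unfolding ps_def by (rule c[OF 1])
	also have "... \<longleftrightarrow> p : L" using c[OF proj_in[OF L,of p],of "p - proj L p"] by simp
	finally show ?thesis .
	qed
	have fR:"(p,q) : R \<longleftrightarrow> ps p - ps q : G" if pq:"p : S" "p : L" "q : S" "q : L" for p q
	proof -
	have S:"p : S2" "q : S2" "p : S1" "q : S1" using pq k(2) by (auto simp:S2_def)
	have bL:"b p : L" "b q : L" using bR(1)[OF S(3) pq(2)] bR(1)[OF S(4) pq(4)] R by auto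
	have Pb:"P (b p) = b p - proj G z" "P (b q) = b q - proj G z"
	using bR(3)[OF S(3) pq(2)] bR(3)[OF S(4) pq(4)] proj_id[OF L bL(1)] proj_id[OF L bL(2)] by (auto simp:P_def)
	have e:"ps p - ps q = proj G (p - q) + (b p - b q)"
	using proj_id[OF L pq(2)] proj_id[OF L pq(4)] by (simp add:ps_def Pb lp)
	have pb:"proj G (b p - b q) = 0" using bR(3)[OF S(3) pq(2)] bR(3)[OF S(4) pq(4)] by (simp add:lp)
	have "ps p - ps q : G \<longleftrightarrow> b p - b q : G"
	unfolding e using subspace_add[OF G proj_in[OF G],of "b p - b q" "p - q"]
	subspace_diff[OF G _ proj_in[OF G],of "proj G (p - q) + (b p - b q)" "p - q"] by auto
	also have "... \<longleftrightarrow> b p = b q" using pb proj_id[OF G,of "b p - b q"] subspace_0[OF G] by auto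
	finally show ?thesis using same S pq by blast
	qed
	have f1:"ALL p:S. ps p : L \<longleftrightarrow> p : L" using fL by blast
	have f2:"ALL p:S Int L. ALL q:S Int L. (p,q) : R \<longleftrightarrow> ps p - ps q : G" using fR by blast
	show ?thesis
	by (rule exI[of _ S],rule exI[of _ W],rule exI[of _ ps],rule exI[of _ k],rule exI[of _ G])
	(intro conjI k(1,3,4,5,6) G GL f1 f2 sm_subset[OF smoothps k(2)] order_trans[OF k(2) S2Q])
qed

context coisotropic_mfd
begin

text \<open>Regularity gives a slice chart \<open>C\<close> of the leaf relation at
  \<open>(x,x)\<close>. The transition to it from the product chart is the straightening map of
  \<open>plaque_structure\<close>, and the new coordinates are composed with
  \<open>ps\<close>.\<close>

lemma plaque_exists:
	assumes reg:"regular M om N" and x:"x : N"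
	shows "EX c L G. plaque_chart c L G & x : fst c"
proof -
	obtain c L where c:"slice c L" "x : fst c" using exists_slice[OF x] by blast
	note cs = slice_smooth[OF c(1)] and L = slice_subspace[OF c(1)]
	define P where "P = prod_manifold M M"
	define LR where "LR = leaf_relation M om N"
	have LR:"(a,b) : LR \<longleftrightarrow> a : N & b : N & b : leaf M om N a" for a b
	by (simp add:LR_def leaf_relation_def)
	have "(x,x) : LR" using x leaf_refl[OF x] by (simp add:LR)
	then obtain C K where C:"slice_chart P LR C K" "(x,x) : fst C"
	using reg unfolding regular_def submanifold_def P_def[symmetric] LR_def[symmetric] by blast
	have Cs:"smooth_chart P C" and K:"subspace K" and CK:"snd C ` (fst C Int LR) = snd C ` fst C Int K"
	using C(1) by (auto simp:slice_chart_def)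
	interpret PP: smooth_mfd P unfolding P_def by (rule smooth_mfd_prod[OF smooth_mfd_axioms smooth_mfd_axioms])
	define cc where "cc = prod_chart c c"
	have ccs:"smooth_chart P cc" unfolding P_def cc_def by (rule smooth_chart_prod[OF smooth_mfd_axioms smooth_mfd_axioms cs cs])
	have xcc:"(x,x) : fst cc" using c(2) by (simp add:cc_def prod_chart_simps)
	define \<Omega> where "\<Omega> = snd cc ` (fst cc Int fst C)"
	define Th where "Th p = snd C (chart_inv cc p)" for p
	define z where "z = snd c x"
	have zz:"snd cc (x,x) = (z,z)" by (simp add:cc_def prod_chart_simps z_def)
	define R where "R = {(p,q). p : img c Int L & q : img c Int L & chart_inv c q : leaf M om N (chart_inv c p)}"
	have z:"z : img c" "z : L" using slice_iff[OF c] x c(2) by (auto simp:z_def)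
	have inN:"chart_inv c p : N" if "p : img c" "p : L" for p using slice_inv_N[OF c(1) that] .
	have inj:"inj (fder Th (z,z))"
	proof (rule inj_on_inverseI)
	fix v
	have "fder (%p. snd cc (chart_inv cc p)) (snd cc (x,x)) =
	(%v. fder (%p. snd cc (chart_inv C p)) (snd C (x,x)) (fder (%p. snd C (chart_inv cc p)) (snd cc (x,x)) v))"
	by (rule PP.transition_chain[OF ccs Cs ccs xcc C(2) xcc])
	from fun_cong[OF this,of v]
	show "fder (%p. snd cc (chart_inv C p)) (snd C (x,x)) (fder Th (z,z) v) = v"
	unfolding PP.transition_id[OF ccs xcc] unfolding zz Th_def[abs_def] by (rule sym)
	qed
	have "EX S V ps g G. open S & z : S & S \<subseteq> img c & open V & homeomorphism S V ps g & smooth_on S ps & smooth_on V g &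
	subspace G & G \<subseteq> L & (ALL p:S. ps p : L \<longleftrightarrow> p : L) &
	(ALL p:S Int L. ALL q:S Int L. (p,q) : R \<longleftrightarrow> ps p - ps q : G)"
	proof (rule plaque_structure[OF L z,where \<Omega> = \<Omega> and Th = Th and K = K])
	show "R \<subseteq> (img c Int L) \<times> (img c Int L)" by (auto simp:R_def)
	show "(p,p) : R" if "p : img c" "p : L" for p using that leaf_refl[OF inN[OF that]] by (simp add:R_def)
	show "(q,p) : R" if "(p,q) : R" for p q using that leaf_sym unfolding R_def by blast
	show "(p,r) : R" if "(p,q) : R" "(q,r) : R" for p q r using that leaf_trans unfolding R_def by blast
	show "open \<Omega>" unfolding \<Omega>_def by (rule PP.overlap_open[OF ccs Cs])
	show "(z,z) : \<Omega>" unfolding \<Omega>_def zz[symmetric] using xcc C(2) by blast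
	show "\<Omega> \<subseteq> img c \<times> img c" unfolding \<Omega>_def by (auto simp:cc_def prod_chart_simps)
	show "smooth_on \<Omega> Th" unfolding \<Omega>_def Th_def[abs_def] by (rule PP.transition_smooth[OF ccs Cs])
	show "p : R \<longleftrightarrow> Th p : K" if pO:"p : \<Omega>" for p
	proof -
	obtain a b where ab:"(a,b) : fst cc" "(a,b) : fst C" "p = snd cc (a,b)" using pO by (auto simp:\<Omega>_def)
	have abc:"a : fst c" "b : fst c" "p = (snd c a,snd c b)" using ab by (auto simp:cc_def prod_chart_simps)
	have "Th p = snd C (a,b)" using PP.inv_chart[OF ccs ab(1)] by (simp add:Th_def ab(3))
	moreover have "snd C (a,b) : K \<longleftrightarrow> (a,b) : LR"
	proof
	assume "snd C (a,b) : K"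
	hence "snd C (a,b) : snd C ` (fst C Int LR)" unfolding CK using ab(2) by blast
	then obtain y where y:"y : fst C" "y : LR" "snd C (a,b) = snd C y" by blast
	have "(a,b) = y" using chart_inj[OF PP.is_chart[OF Cs]] ab(2) y(1,3) by (auto dest:inj_onD)
	thus "(a,b) : LR" using y(2) by simp
	next
	assume "(a,b) : LR"
	hence "snd C (a,b) : snd C ` (fst C Int LR)" using ab(2) by blast
	thus "snd C (a,b) : K" unfolding CK by blast
	qed
	moreover have "p : R \<longleftrightarrow> (a,b) : LR"
	using slice_iff[OF c(1) abc(1)] slice_iff[OF c(1) abc(2)] abc inv_chart[OF cs] by (auto simp:R_def LR)
	ultimately show ?thesis by simp
	qed
	qed (rule inj K)+
	then obtain S V ps g G where S:"open S" "z : S" "S \<subseteq> img c" "open V" "homeomorphism S V ps g" "smooth_on S ps" "smooth_on V g"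
	and G:"subspace G" "G \<subseteq> L" and ps:"ALL p:S. ps p : L \<longleftrightarrow> p : L" and rel:"ALL p:S Int L. ALL q:S Int L. (p,q) : R \<longleftrightarrow> ps p - ps q : G"
	by (elim exE conjE) (rule that,assumption+)
	define c' where "c' = ({x : fst c. snd c x : S},%x. ps (snd c x))"
	have c's:"smooth_chart M c'" and im:"snd c' ` fst c' = V"
	using smooth_chart_compose[OF cs S(1,3,4,5,6,7)] by (simp_all add:c'_def)
	have sl:"slice c' L" unfolding slice_chart_def
	proof (intro conjI c's L)
	have "y : N \<longleftrightarrow> snd c' y : L" if "y : fst c'" for y
	using that slice_iff[OF c(1),of y] ps by (auto simp:c'_def)
	thus "snd c' ` (fst c' Int N) = img c' Int L" by blast
	qed
	have "plaque_chart c' L G" unfolding plaque_chart_def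
	proof (intro conjI ballI sl G)
	fix a b assume ab:"a : N Int fst c'" "b : N Int fst c'"
	hence abc:"a : fst c" "b : fst c" "snd c a : S" "snd c b : S" "snd c a : L" "snd c b : L"
	using slice_iff[OF c(1),of a] slice_iff[OF c(1),of b] by (auto simp:c'_def)
	have "b : leaf M om N a \<longleftrightarrow> (snd c a,snd c b) : R"
	using abc inv_chart[OF cs] by (simp add:R_def)
	also have "... \<longleftrightarrow> ps (snd c a) - ps (snd c b) : G" using rel abc by blast
	finally show "b : leaf M om N a \<longleftrightarrow> snd c' a - snd c' b : G" by (simp add:c'_def)
	qed
	moreover have "x : fst c'" using c(2) S(2) by (simp add:c'_def z_def)
	ultimately show ?thesis by blast
qed

end

section \<open>Linear holonomy along loops\<close>

lemma (in smooth_mfd) smooth_map_on_compose: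
	assumes ga:"smooth_map_on euc M S ga" and be:"smooth_on UNIV be" "be ` S' \<subseteq> S"
	and pts:"ga ` S \<subseteq> points M"
	shows "smooth_map_on euc M S' (%y. ga (be y))"
proof (rule smooth_map_on_if_local_rep)
	fix t assume t:"t : S'"
	have bt:"be t : S" using be(2) t by blast
	then obtain c where c:"c : atlas M" "ga (be t) : fst c" using exists_atlas_chart pts by blast
	obtain W h where "local_rep c S ga (be t) W h"
	using smooth_map_on_local_rep[OF ga bt atlas_smooth_chart[OF c(1)] c(2)] by blast
	from local_rep_compose[OF this be] show "EX c W h. smooth_chart M c & local_rep c S' (%y. ga (be y)) t W h"
	using atlas_smooth_chart[OF c(1)] by blast
qed

lemma (in smooth_mfd) chart_inv_eq:
	"smooth_chart M c ==> x : fst c ==> snd c x = p ==> chart_inv c p = x"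
	using inv_chart by blast

lemma coset_eq_iff:
	fixes S :: "'e::real_vector set"
	assumes "subspace S"
	shows "(+) a ` S = (+) b ` S \<longleftrightarrow> a - b : S"
proof
	assume e:"(+) a ` S = (+) b ` S"
	have "a + 0 : (+) a ` S" using subspace_0[OF assms] by blast
	then obtain s where "s : S" "a = b + s" unfolding e by auto
	thus "a - b : S" by simp
next
	assume d:"a - b : S"
	show "(+) a ` S = (+) b ` S"
	proof (intro equalityI subsetI)
	fix x assume "x : (+) a ` S"
	then obtain s where s:"s : S" "x = a + s" by blast
	have "x = b + ((a - b) + s)" by (simp add:s)
	thus "x : (+) b ` S" using subspace_add[OF assms d s(1)] by blast
	next
	fix x assume "x : (+) b ` S"
	then obtain s where s:"s : S" "x = b + s" by blast
	have "x = a + (s - (a - b))" by (simp add:s)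
	thus "x : (+) a ` S" using subspace_diff[OF assms s(1) d] by blast
	qed
qed

locale regular_coisotropic = coisotropic_mfd M om N
	for M :: "('a,'e::euclidean_space) manifold" and om N +
	assumes compact_N:"compactin (mtop M) N" and regular:"regular M om N"
begin

lemma plaque_slice:"plaque_chart c L G ==> slice c L"
	and plaque_subspace:"plaque_chart c L G ==> subspace G"
	and plaque_subset:"plaque_chart c L G ==> G \<subseteq> L"
	and plaque_leaf:"plaque_chart c L G ==> x : N ==> x : fst c ==> y : N ==> y : fst c ==>
	y : leaf M om N x \<longleftrightarrow> snd c x - snd c y : G"
	by (auto simp:plaque_chart_def)

lemma perp_plaque:
	assumes "plaque_chart c L G" "x : fst c" "x : N"
	shows "perp x = chart_deriv M c x ` G"
proof -
	have b:"bij (chart_deriv M c x)" by (rule bij_chart_deriv[OF slice_smooth[OF plaque_slice[OF assms(1)]] assms(2)])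
	have "chart_deriv M c x a : perp x \<longleftrightarrow> a : G" for a
	using perp_iff_kern[OF plaque_slice[OF assms(1)] assms(2,3)] plaque_kern[OF compact_N assms] by simp
	note e = this
	have s:"chart_deriv M c x (inv (chart_deriv M c x) v) = v" for v by (rule surj_f_inv_f[OF bij_is_surj[OF b]])
	show ?thesis
	proof (intro equalityI subsetI)
	fix v assume "v : perp x"
	hence "inv (chart_deriv M c x) v : G" using e[of "inv (chart_deriv M c x) v"] unfolding s by blast
	from imageI[OF this,of "chart_deriv M c x"] show "v : chart_deriv M c x ` G" unfolding s .
	next
	fix v assume "v : chart_deriv M c x ` G"
	thus "v : perp x" using e by (elim imageE) simp
	qed
qed

lemma subspace_perp:
	assumes "x : N"
	shows "subspace (perp x)"
proof -
	obtain c L G where p:"plaque_chart c L G" "x : fst c" using plaque_exists[OF regular assms] by blast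
	show ?thesis unfolding perp_plaque[OF p assms]
	by (rule linear_subspace_image[OF linear_chart_deriv[OF slice_smooth[OF plaque_slice[OF p(1)]] p(2)] plaque_subspace[OF p(1)]])
qed

text \<open>The maps \<open>u (0, \<cdot>)\<close> and \<open>u (1, \<cdot>)\<close> both take
  values near the base point, in one plaque chart, and pairwise in the same leaf, so their
  coordinates differ by \<open>G\<close>. Their velocities agree modulo the kernel however the loop
  winds, and \<open>T\<close> is a section.\<close>

lemma holonomy_loop_unique:
	assumes d:"holonomy_data M om N x T u" and x:"x 0 : N" "x 1 = x 0" and v:"v : tangent_space M N (x 0)"
	shows "quot_proj M om N (x 0) (velocity M (%s. u (1,quot_proj M om N (x 0) (s *\<^sub>R v))) 0) = quot_proj M om N (x 0) v"
proof -
	define pr where "pr = quot_proj M om N (x 0)"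
	define TN where "TN = tangent_space M N (x 0)"
	note d' = d[unfolded holonomy_data_def Let_def pr_def[symmetric] TN_def[symmetric]]
	have sec:"linear_section M om N (x 0) T" and sm:"smooth_map_on euc M ({0..1} \<times> TN) (%(t,v). u (t,pr v))"
	and uN:"ALL t:{0..1}. ALL v:TN. u (t,pr v) : N" and u0:"ALL t:{0..1}. u (t,pr 0) = x t"
	and ul:"ALL t:{0..1}. ALL v:TN. u (t,pr v) : leaf M om N (u (0,pr v))"
	and uT:"ALL v:TN. velocity M (%s. u (0,pr (s *\<^sub>R v))) 0 = T (pr v)" using d' by auto
	obtain c L G where p:"plaque_chart c L G" "x 0 : fst c" using plaque_exists[OF regular x(1)] by blast
	note sl = plaque_slice[OF p(1)] and cs = slice_smooth[OF plaque_slice[OF p(1)]] and G = plaque_subspace[OF p(1)]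
	have TNe:"TN = chart_deriv M c (x 0) ` L" unfolding TN_def by (rule tangent_space_slice[OF sl p(2) x(1)])
	have TNs:"subspace TN" unfolding TNe by (rule linear_subspace_image[OF linear_chart_deriv[OF cs p(2)] slice_subspace[OF sl]])
	have vTN:"s *\<^sub>R v : TN" for s using v TNs by (simp add:TN_def[symmetric] subspace_scale)
	have smt:"smooth_map_on euc M UNIV (%s. u (t,pr (s *\<^sub>R v)))" if t:"t : {0..1}" for t
	proof -
	have "smooth_on UNIV (%s :: real. (t,s *\<^sub>R v))"
	by (rule smooth_on_Pair[OF open_UNIV sm_const sm_scaleR[OF open_UNIV sm_id sm_const]])
	from smooth_map_on_compose[OF sm this,of UNIV] show ?thesis
	using t vTN uN N_subset by (auto simp:image_subset_iff)
	qed
	have rep:"EX W h. local_rep c UNIV (%s. u (t,pr (s *\<^sub>R v))) 0 W h" if "t : {0,1}" for t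
	using smooth_map_on_local_rep[OF smt _ cs,of t 0] that u0 p(2) x(2) by auto
	obtain W0 h0 where r0:"local_rep c UNIV (%s. u (0,pr (s *\<^sub>R v))) 0 W0 h0" using rep[of 0] by blast
	obtain W1 h1 where r1:"local_rep c UNIV (%s. u (1,pr (s *\<^sub>R v))) 0 W1 h1" using rep[of 1] by blast
	have pt:"u (0,pr (0 *\<^sub>R v)) = x 0" "u (1,pr (0 *\<^sub>R v)) = x 0" using u0 x(2) by auto
	have v0:"velocity M (%s. u (0,pr (s *\<^sub>R v))) 0 = chart_deriv M c (x 0) (fder h0 0 1)"
	and v1:"velocity M (%s. u (1,pr (s *\<^sub>R v))) 0 = chart_deriv M c (x 0) (fder h1 0 1)"
	using local_rep_velocity(2)[OF cs r0] local_rep_velocity(2)[OF cs r1] pt by auto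
	have "fder h1 0 1 - fder h0 0 1 : G"
	proof (rule has_vector_derivative_in_subspace[OF _ G,of "%s. snd c (u (1,pr (s *\<^sub>R v))) - snd c (u (0,pr (s *\<^sub>R v)))" _ 0 UNIV])
	show "((%s. snd c (u (1,pr (s *\<^sub>R v))) - snd c (u (0,pr (s *\<^sub>R v)))) has_vector_derivative fder h1 0 1 - fder h0 0 1) (at 0)"
	by (rule has_vector_derivative_diff[OF local_rep_velocity(1)[OF cs r1] local_rep_velocity(1)[OF cs r0]]) auto
	have e0:"\<forall>\<^sub>F s in at 0. u (0,pr (s *\<^sub>R v)) : fst c" and e1:"\<forall>\<^sub>F s in at 0. u (1,pr (s *\<^sub>R v)) : fst c"
	using local_rep_velocity(3)[OF cs r0] local_rep_velocity(3)[OF cs r1] by auto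
	show "\<forall>\<^sub>F s in at 0. snd c (u (1,pr (s *\<^sub>R v))) - snd c (u (0,pr (s *\<^sub>R v))) -
	(snd c (u (1,pr (0 *\<^sub>R v))) - snd c (u (0,pr (0 *\<^sub>R v)))) : G"
	using e0 e1
	proof eventually_elim
	case (elim s)
	have "u (1,pr (s *\<^sub>R v)) : leaf M om N (u (0,pr (s *\<^sub>R v)))" using ul vTN by simp
	hence "snd c (u (0,pr (s *\<^sub>R v))) - snd c (u (1,pr (s *\<^sub>R v))) : G"
	using plaque_leaf[OF p(1) _ elim(1) _ elim(2)] uN vTN by simp
	from subspace_neg[OF G this] show ?case unfolding pt by simp
	qed
	qed auto
	hence "chart_deriv M c (x 0) (fder h1 0 1 - fder h0 0 1) : perp (x 0)"
	unfolding perp_plaque[OF p x(1)] by blast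
	hence "pr (velocity M (%s. u (1,pr (s *\<^sub>R v))) 0) = pr (T (pr v))"
	using v0 v1 uT v linear_diff[OF linear_chart_deriv[OF cs p(2)]]
	unfolding pr_def quot_proj_def by (subst coset_eq_iff[OF subspace_perp[OF x(1)]]) (simp add:TN_def)
	also have "... = pr v" using sec v unfolding linear_section_def pr_def by blast
	finally show ?thesis by (simp add:pr_def)
qed

text \<open>A smooth family of motions in the leaves that starts on the disc through
  \<open>x 0\<close> which is orthogonal to \<open>G\<close> in coordinates and has \<open>x\<close>
  at its centre. The final time is a parameter, so that time 1 can be reached by
  connectedness.\<close>

definition transport :: "('a,'e) chart => 'e set => 'e set => (real => 'a) => real => bool" where
	"transport c L G x ta \<longleftrightarrow> (EX r>0. EX U. smooth_map_on euc M ({0..ta} \<times> ball 0 r) U &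
	(ALL t:{0..ta}. U (t,0) = x t) &
	(ALL w:ball 0 r. snd c (x 0) + (proj L w - proj G w) : img c & U (0,w) = chart_inv c (snd c (x 0) + (proj L w - proj G w))) &
	(ALL t:{0..ta}. ALL w:ball 0 r. U (t,w) : leaf M om N (U (0,w))))"

lemma transport_0:
	assumes p:"plaque_chart c L G" and x:"x 0 : fst c" "x 0 : N"
	shows "transport c L G x 0"
proof -
	note sl = plaque_slice[OF p] and cs = slice_smooth[OF plaque_slice[OF p]] and G = plaque_subspace[OF p]
	note L = slice_subspace[OF sl]
	define k where "k w = snd c (x 0) + (proj L w - proj G w)" for w
	have sk:"smooth_on UNIV k" unfolding k_def[abs_def]
	by (intro sm_add sm_diff sm_const sm_linear linear_proj L G open_UNIV)
	have k0:"k 0 = snd c (x 0)" using linear_0[OF linear_proj[OF L]] linear_0[OF linear_proj[OF G]] by (simp add:k_def)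
	have "open (k -` img c)" by (rule open_vimage[OF img_open[OF cs] sm_cont[OF sk]])
	moreover have "0 : k -` img c" using x(1) by (simp add:k0)
	ultimately obtain r where r:"r > 0" "ball 0 r \<subseteq> k -` img c" using open_contains_ball by blast
	have kL:"k w : L" for w
	using slice_iff[OF sl x(1)] x(2) proj_in[OF L] proj_in[OF G] plaque_subset[OF p] L unfolding k_def
	by (blast intro:subspace_add subspace_diff)
	have kN:"chart_inv c (k w) : N" if "w : ball 0 r" for w using slice_inv_N[OF sl _ kL] r(2) that by blast
	have lin:"linear (snd :: real \<times> 'e => 'e)" by (simp add:linear_iff)
	define U where "U y = chart_inv c (k (snd y))" for y :: "real \<times> 'e"
	have "smooth_map_on euc M ({0..0} \<times> ball 0 r) U"
	proof (rule smooth_map_on_if_local_rep)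
	fix t :: "real \<times> 'e" assume t:"t : {0..0} \<times> ball 0 r"
	have o:"open (snd -` ball 0 r :: (real \<times> 'e) set)" by (rule open_vimage_snd[OF open_ball])
	have "smooth_on (snd -` ball 0 r) (%y :: real \<times> 'e. k (snd y))"
	by (rule sm_compose[OF o open_UNIV sm_linear[OF lin] sk]) simp
	hence "local_rep c ({0..0} \<times> ball 0 r) U t (snd -` ball 0 r) (%y. k (snd y))"
	unfolding local_rep_def using o t r(2) by (auto simp:U_def)
	thus "EX c W h. smooth_chart M c & local_rep c ({0..0} \<times> ball 0 r) U t W h" using cs by blast
	qed
	moreover have "U (0,0) = x 0" by (simp add:U_def k0 inv_chart[OF cs x(1)])
	ultimately show ?thesis unfolding transport_def k_def[symmetric]
	using r leaf_refl[OF kN] by (intro exI[of _ r] conjI exI[of _ U]) (auto simp:U_def)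
qed

text \<open>In a plaque chart \<open>d\<close> the family is continued explicitly, by translating
  its disc at time \<open>ta\<close> parallel to \<open>x\<close>. For smoothness in time the old
  family is blended into the translated one before \<open>ta\<close>. Both differ from the disc at
  time \<open>ta\<close> by elements of \<open>G'\<close>, and so do their convex combinations, so
  leaves are respected.\<close>

lemma transport_extend:
	assumes p:"plaque_chart c L G" and x:"smooth_map_on euc M {0..1} x" "ALL t:{0..1}. x t : leaf M om N (x 0)"
	and ta0:"ta0 : {0..1}"
	shows "EX ep>0. ALL ta:{0..1} Int ball ta0 ep. ALL ta':{0..1} Int ball ta0 ep. ta <= ta' --> transport c L G x ta --> transport c L G x ta'"
proof -
	have xN:"x t : N" if "t : {0..1}" for t using x(2) that leaf_subset by blast
	obtain d L' G' where q:"plaque_chart d L' G'" "x ta0 : fst d" using plaque_exists[OF regular xN[OF ta0]] by blast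
	note dl = plaque_slice[OF q(1)] and ds = slice_smooth[OF plaque_slice[OF q(1)]] and G' = plaque_subspace[OF q(1)]
	obtain W h where r:"local_rep d {0..1} x ta0 W h" using smooth_map_on_local_rep[OF x(1) ta0 ds q(2)] by blast
	have W:"open W" "ta0 : W" "smooth_on W h" using r by (auto simp:local_rep_def)
	have hv:"x t : fst d" "snd d (x t) = h t" if "t : W" "t : {0..1}" for t using local_rep_value[OF r that] by auto
	define a where "a = h ta0"
	have "a : img d" unfolding a_def using r by (auto simp:local_rep_def)
	then obtain rh where rh:"rh > 0" "ball a rh \<subseteq> img d" using img_open[OF ds] open_contains_ball by blast
	\<comment> \<open>A third of \<open>rh\<close>, because the translate \<open>h3\<close> deviates
	  from \<open>a\<close> by a sum of three such terms.\<close>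
	have "open (W Int h -` ball a (rh / 3))" by (rule continuous_open_preimage[OF sm_cont[OF W(3)] W(1) open_ball])
	moreover have "ta0 : W Int h -` ball a (rh / 3)" using W(2) rh(1) by (simp add:a_def)
	ultimately obtain ep where ep:"ep > 0" "ball ta0 ep \<subseteq> W Int h -` ball a (rh / 3)" using open_contains_ball by blast
	have "transport c L G x ta'" if ta:"ta : {0..1}" "ta : ball ta0 ep" and ta':"ta' : {0..1}" "ta' : ball ta0 ep" and le:"ta <= ta'"
	and tr:"transport c L G x ta" for ta ta'
	proof -
	obtain s U where s:"s > 0" and U:"smooth_map_on euc M ({0..ta} \<times> ball 0 s) U"
	"ALL t:{0..ta}. U (t,0) = x t"
	"ALL w:ball 0 s. snd c (x 0) + (proj L w - proj G w) : img c & U (0,w) = chart_inv c (snd c (x 0) + (proj L w - proj G w))"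
	"ALL t:{0..ta}. ALL w:ball 0 s. U (t,w) : leaf M om N (U (0,w))"
	using tr unfolding transport_def by (elim exE conjE) (rule that,assumption+)
	have UN:"U (t,w) : N" if "t : {0..ta}" "w : ball 0 s" for t w using U(4) that leaf_subset by blast
	have taW:"ta : W" using ta(2) ep(2) by blast
	have Uta:"U (ta,0) = x ta" "U (ta,0) : fst d" using U(2) ta(1) hv[OF taW ta(1)] by auto
	obtain X k where rk:"local_rep d ({0..ta} \<times> ball 0 s) U (ta,0) X k"
	using smooth_map_on_local_rep[OF U(1) _ ds Uta(2)] ta(1) s by auto
	have X:"open X" "(ta,0) : X" "smooth_on X k" using rk by (auto simp:local_rep_def)
	have kv:"U (t,w) : fst d" "snd d (U (t,w)) = k (t,w)" if "(t,w) : X" "t : {0..ta}" "w : ball 0 s" for t w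
	using local_rep_value[OF rk that(1)] that by auto
	have k0:"k (ta,0) = h ta" using kv[OF X(2)] ta(1) s hv[OF taW ta(1)] Uta(1) by simp
	have "open (X Int k -` ball a (rh / 3))" by (rule continuous_open_preimage[OF sm_cont[OF X(3)] X(1) open_ball])
	moreover have "(ta,0) : X Int k -` ball a (rh / 3)" using X(2) k0 ta(2) ep(2) by auto
	ultimately obtain A B where AB:"open A" "open B" "(ta,0) : A \<times> B" "A \<times> B \<subseteq> X Int k -` ball a (rh / 3)"
	by (rule open_prod_elim)
	obtain et1 where et1:"et1 > 0" "ball ta et1 \<subseteq> A Int ball ta0 ep"
	by (rule openE[OF open_Int[OF AB(1) open_ball[of ta0 ep]],of ta]) (use AB(3) ta(2) in auto)
	obtain s1 where s1:"s1 > 0" "ball 0 s1 \<subseteq> B" by (rule openE[OF AB(2),of 0]) (use AB(3) in auto)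
	\<comment> \<open>At \<open>ta = 0\<close> there is no earlier family to blend with. Otherwise
	  \<open>et \<le> ta\<close> keeps the blending at positive times, so that the initial disc is
	  unchanged.\<close>
	define et where "et = (if ta = 0 then et1 else min et1 ta)"
	have et:"et > 0" "et <= et1" "ta = 0 | et <= ta" using et1(1) ta(1) by (auto simp:et_def)
	define s' where "s' = min s s1"
	have s':"s' > 0" "ball 0 s' \<subseteq> ball 0 s" "ball 0 s' \<subseteq> B" using s s1 by (auto simp:s'_def)
	\<comment> \<open>The weight is 0 up to \<open>ta - 2 * et / 3\<close> and 1 from
	  \<open>ta - et / 3\<close> on; the blending is finished before \<open>ta\<close>, the last time
	  at which \<open>U\<close> is known.\<close>
	define be where "be t = smooth_step ((t - (ta - 2 * et / 3)) * (3 / et))" for t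
	have be0:"be t = 0" if "t <= ta - 2 * et / 3" for t
	unfolding be_def by (rule smooth_step_simps(1),rule mult_nonpos_nonneg) (use that et(1) in auto)
	have be1:"be t = 1" if "t >= ta - et / 3" for t
	proof -
	have "(et / 3) * (3 / et) <= (t - (ta - 2 * et / 3)) * (3 / et)" using that et(1) by (intro mult_right_mono) auto
	thus ?thesis unfolding be_def using et(1) by (intro smooth_step_simps(2)) simp
	qed
	have beb:"0 <= be t" "be t <= 1" for t unfolding be_def by (rule smooth_step_bounds)+
	\<comment> \<open>The disc at time \<open>ta\<close>, translated along the coordinate path of
	  \<open>x\<close>.\<close>
	define h3 where "h3 y = h (fst y) + (k (ta,snd y) - h ta)" for y
	define kk where "kk y = (1 - be (fst y)) *\<^sub>R k y + be (fst y) *\<^sub>R h3 y" for y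
	define V where "V y = (if fst y < ta then kk y else h3 y)" for y
	define U' where "U' y = (if fst y <= ta - 2 * et / 3 then U y else chart_inv d (V y))" for y
	have box:"(t,w) : X" "k (t,w) : ball a (rh / 3)" if "t : ball ta et" "w : ball 0 s'" for t w
	proof -
	have "t : A" "w : B" using that et1(2) et(2) s'(3) by auto
	hence "(t,w) : X Int k -` ball a (rh / 3)" using AB(4) by blast
	thus "(t,w) : X" "k (t,w) : ball a (rh / 3)" by auto
	qed
	have h3img:"h3 (t,w) : ball a rh" if "t : ball ta0 ep" "w : ball 0 s'" for t w
	proof -
	have "norm (h t - a) < rh / 3" "norm (h ta - a) < rh / 3" "norm (k (ta,w) - a) < rh / 3"
	using ep(2) that(1) ta(2) box(2)[of ta w] that(2) et(1) by (auto simp:dist_norm norm_minus_commute)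
	moreover have e:"h3 (t,w) - a = (h t - a) + ((k (ta,w) - a) - (h ta - a))" by (simp add:h3_def)
	ultimately have "norm (h3 (t,w) - a) < rh" unfolding e
	using norm_triangle_ineq[of "h t - a" "(k (ta,w) - a) - (h ta - a)"] norm_triangle_ineq4[of "k (ta,w) - a" "h ta - a"] by linarith
	thus ?thesis by (simp add:dist_norm norm_minus_commute)
	qed
	have etep:"t : ball ta0 ep" if "t : ball ta et" for t
	proof -
	have "t : ball ta et1" using that et(2) by auto
	thus ?thesis using et1(2) by blast
	qed
	have kkimg:"kk (t,w) : ball a rh" if tw:"t : ball ta et" "w : ball 0 s'" for t w
	unfolding kk_def fst_conv
	by (rule convexD_alt[OF convex_ball _ h3img[OF etep[OF tw(1)] tw(2)] beb]) (use box(2)[OF tw] rh(1) in auto)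
	have kkh3:"kk y = h3 y" if "fst y >= ta - et / 3" for y using be1[OF that] by (simp add:kk_def)
	have Vkk:"V y = kk y" if "fst y : ball ta et" for y using kkh3[of y] et(1) by (auto simp:V_def)
	have Vh3:"V y = h3 y" if "fst y >= ta - et / 3" for y using kkh3[OF that] by (simp add:V_def)
	have mid:"ta : ball ta et" using et(1) by simp
	have t01:"t : {0..1} & t : ball ta0 ep" if "t : {0..ta'}" "t > ta - et" for t
	proof (cases "t <= ta")
	case True
	thus ?thesis using etep[of t] that ta(1) by (simp add:dist_real_def)
	next
	case False
	thus ?thesis using ta ta' that by (auto simp:dist_real_def abs_if split: if_splits)
	qed
	have hG:"h t - h ta : G'" if "t : {0..1}" "t : ball ta0 ep" for t
	proof -
	have tW:"t : W" using that ep(2) by blast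
	have "x ta : leaf M om N (x t)" by (rule leaf_trans[OF leaf_sym]) (use x(2) that ta(1) in blast)+
	thus ?thesis
	using plaque_leaf[OF q(1) xN[OF that(1)] hv(1)[OF tW that(1)] xN[OF ta(1)] hv(1)[OF taW ta(1)]] hv(2)[OF tW that(1)] hv(2)[OF taW ta(1)] by simp
	qed
	have kG:"k (t,w) - k (ta,w) : G'" if t:"t : {0..ta}" "t : ball ta et" and w:"w : ball 0 s'" for t w
	proof -
	have ws:"w : ball 0 s" using w s'(2) by blast
	have tata:"ta : {0..ta}" using ta(1) by simp
	have "U (ta,w) : leaf M om N (U (t,w))" by (rule leaf_trans[OF leaf_sym]) (use U(4) t(1) tata ws in blast)+
	thus ?thesis
	using plaque_leaf[OF q(1) UN[OF t(1) ws] kv(1)[OF box(1)[OF t(2) w] t(1) ws] UN[OF tata ws] kv(1)[OF box(1)[OF mid w] tata ws]]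
	kv(2)[OF box(1)[OF t(2) w] t(1) ws] kv(2)[OF box(1)[OF mid w] tata ws] by simp
	qed
	have VG:"V (t,w) - k (ta,w) : G'" "V (t,w) : ball a rh" if t:"t : {0..ta'}" "t > ta - et" and w:"w : ball 0 s'" for t w
	proof -
	note tt = t01[OF t]
	have h3G:"h3 (t,w) - k (ta,w) : G'" using hG[of t] tt by (simp add:h3_def)
	show "V (t,w) - k (ta,w) : G'"
	proof (cases "t < ta")
	case True
	have tb:"t : ball ta et" using True t(2) by (simp add:dist_real_def)
	have "V (t,w) - k (ta,w) = (1 - be t) *\<^sub>R (k (t,w) - k (ta,w)) + be t *\<^sub>R (h3 (t,w) - k (ta,w))"
	using True by (simp add:V_def kk_def algebra_simps)
	thus ?thesis using kG[OF _ tb w] True t(1) h3G G' by (auto intro!:subspace_add subspace_scale)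
	qed (use h3G in \<open>simp add:V_def\<close>)
	show "V (t,w) : ball a rh"
	using kkimg[of t w] h3img[of t w] tt w t(2) by (auto simp:V_def dist_real_def)
	qed
	have U'leaf:"U' (t,w) : leaf M om N (U (0,w))" if t:"t : {0..ta'}" and w:"w : ball 0 s'" for t w
	proof (cases "t <= ta - 2 * et / 3")
	case True
	have "w : ball 0 s" using w s'(2) by blast
	thus ?thesis using U(4) t et(1) True by (simp add:U'_def)
	next
	case False
	hence t':"t > ta - et" using et(1) by simp
	have ws:"w : ball 0 s" using w s'(2) by blast
	have tata:"ta : {0..ta}" using ta(1) by simp
	have Vimg:"V (t,w) : img d" using VG(2)[OF t t' w] rh(2) by blast
	have kd:"U (ta,w) : fst d" "snd d (U (ta,w)) = k (ta,w)" "U (ta,w) : N"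
	using kv[OF box(1)[OF mid w] tata ws] UN[OF tata ws] by auto
	have "k (ta,w) : L'" using slice_iff[OF dl kd(1)] kd by simp
	hence "(V (t,w) - k (ta,w)) + k (ta,w) : L'"
	using VG(1)[OF t t' w] plaque_subset[OF q(1)] slice_subspace[OF dl] by (blast intro:subspace_add)
	hence VL:"V (t,w) : L'" by simp
	define y where "y = chart_inv d (V (t,w))"
	have y:"y : fst d" "snd d y = V (t,w)" "y : N"
	using Vimg slice_inv_N[OF dl Vimg VL] by (auto simp:y_def chart_inv_into chart_chart_inv)
	have "U (ta,w) : leaf M om N y"
	using plaque_leaf[OF q(1) y(3,1) kd(3,1)] VG(1)[OF t t' w] y(2) kd(2) by simp
	hence "y : leaf M om N (U (0,w))" using leaf_trans[OF _ leaf_sym] U(4) tata ws by blast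
	thus ?thesis using False by (simp add:U'_def y_def)
	qed
	have U'x:"U' (t,0) = x t" if t:"t : {0..ta'}" for t
	proof (cases "t <= ta - 2 * et / 3")
	case True
	thus ?thesis using U(2) t et(1) by (auto simp:U'_def)
	next
	case False
	hence t':"t > ta - et" using et(1) by simp
	have tW:"t : W" "t : {0..1}" using t01[OF t t'] ep(2) by auto
	have h3:"h3 (t,0) = h t" by (simp add:h3_def k0)
	have "V (t,0) = h t"
	proof (cases "t < ta")
	case True
	have tb:"t : ball ta et" using True t' by (simp add:dist_real_def)
	have "k (t,0) = h t"
	using kv[OF box(1)[OF tb,of 0]] s'(1) s True t U(2) hv[OF tW] by auto
	thus ?thesis using True h3 by (simp add:V_def kk_def algebra_simps)
	qed (simp add:V_def h3)
	thus ?thesis using False chart_inv_eq[OF ds hv(1)[OF tW] hv(2)[OF tW]] by (simp add:U'_def)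
	qed
	have U'0:"U' (0,w) = U (0,w)" if w:"w : ball 0 s'" for w
	proof (cases "ta = 0")
	case True
	have ws:"w : ball 0 s" using w s'(2) by blast
	have "V (0,w) = k (ta,w)" using True by (simp add:V_def h3_def)
	moreover have "chart_inv d (k (ta,w)) = U (ta,w)"
	using chart_inv_eq[OF ds] kv[OF box(1)[OF mid w] _ ws] True by simp
	ultimately show ?thesis using True et(1) by (simp add:U'_def)
	next
	case False
	hence "0 <= ta - 2 * et / 3" using et by auto
	thus ?thesis by (simp add:U'_def)
	qed
	have lin:"linear (fst :: real \<times> 'e => real)" "linear (snd :: real \<times> 'e => 'e)" by (simp_all add:linear_iff)
	have smooth_h3:"smooth_on S h3" if S:"open S" "S \<subseteq> ball ta0 ep \<times> ball 0 s'" for S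
	proof -
	have 1:"smooth_on S (%y. h (fst y))"
	by (rule sm_compose[OF S(1) W(1) sm_linear[OF lin(1)] W(3)]) (use S(2) ep(2) in auto)
	have "linear (%y :: real \<times> 'e. (0 :: real,snd y))" by (simp add:linear_iff)
	from sm_add[OF S(1) sm_const[of S "(ta,0)"] sm_linear[OF this]]
	have "smooth_on S (%y. (ta,snd y))" by simp
	hence 2:"smooth_on S (%y. k (ta,snd y))"
	by (rule sm_compose[OF S(1) X(1) _ X(3)]) (use S(2) box(1)[OF mid] in auto)
	show ?thesis unfolding h3_def[abs_def]
	by (rule sm_add[OF S(1) 1 sm_diff[OF S(1) 2 sm_const]])
	qed
	have "smooth_map_on euc M ({0..ta'} \<times> ball 0 s') U'"
	proof (rule smooth_map_on_if_local_rep)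
	fix y assume y:"y : {0..ta'} \<times> ball (0 :: 'e) s'"
	then obtain t w where tw:"y = (t,w)" "t : {0..ta'}" "w : ball 0 s'" by blast
	consider "t < ta - 2 * et / 3" | "t : ball ta et" | "t > ta - et / 3"
	using et(1) by (auto simp:dist_real_def) linarith
	thus "EX c W h. smooth_chart M c & local_rep c ({0..ta'} \<times> ball 0 s') U' y W h"
	proof cases
	case 1
	define S where "S = {..<ta - 2 * et / 3} \<times> ball (0 :: 'e) s'"
	have S:"open S" "y : S" unfolding S_def using 1 tw by (auto intro:open_Times)
	have "w : ball 0 s" using tw(3) s'(2) by blast
	hence yU:"y : {0..ta} \<times> ball 0 s" using 1 tw et(1) by auto
	have "U y : points M" using UN[of t w] yU tw(1) N_subset by auto
	then obtain e where e:"e : atlas M" "U y : fst e" using exists_atlas_chart by blast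
	obtain Z f where "local_rep e ({0..ta} \<times> ball 0 s) U y Z f"
	using smooth_map_on_local_rep[OF U(1) yU atlas_smooth_chart[OF e(1)] e(2)] by blast
	hence "local_rep e ({0..ta'} \<times> ball 0 s') U' y (Z Int S) f"
	unfolding local_rep_def using S et(1) s'(2) by (auto intro:sm_subset simp:S_def U'_def)
	thus ?thesis using atlas_smooth_chart[OF e(1)] by blast
	next
	case 2
	define S where "S = ball ta et \<times> ball (0 :: 'e) s'"
	have S:"open S" "y : S" unfolding S_def using 2 tw by (auto intro:open_Times)
	have SX:"S \<subseteq> X" using box(1) by (auto simp:S_def)
	have s3:"smooth_on S h3" by (rule smooth_h3[OF S(1)]) (use etep in \<open>auto simp:S_def\<close>)
	have sb:"smooth_on S (%y. be (fst y))" unfolding be_def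
	by (rule sm_compose[OF S(1) open_UNIV sm_mult[OF S(1) sm_diff[OF S(1) sm_linear[OF lin(1)] sm_const] sm_const]
	sm_smooth_step]) simp
	have "smooth_on S kk" unfolding kk_def[abs_def]
	by (rule sm_add[OF S(1) sm_scaleR[OF S(1) sm_diff[OF S(1) sm_const sb] sm_subset[OF X(3) SX]]
	sm_scaleR[OF S(1) sb s3]])
	moreover have "kk ` S \<subseteq> img d" using kkimg rh(2) by (force simp:S_def)
	moreover have "U' u = chart_inv d (kk u)" if u:"u : S" "u : {0..ta'} \<times> ball 0 s'" for u
	proof (cases "fst u <= ta - 2 * et / 3")
	case True
	obtain t' w' where u':"u = (t',w')" by (cases u)
	have w':"t' : ball ta et" "w' : ball 0 s'" "t' : {0..ta}"
	using u u' True et(1) by (auto simp:S_def)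
	have "w' : ball 0 s" using w'(2) s'(2) by blast
	with w' have "chart_inv d (k u) = U u" using chart_inv_eq[OF ds] kv[OF box(1)] u' by simp
	thus ?thesis using True be0[OF True] by (simp add:U'_def kk_def)
	next
	case False
	thus ?thesis using Vkk[of u] u(1) by (simp add:U'_def S_def mem_Times_iff)
	qed
	ultimately have "local_rep d ({0..ta'} \<times> ball 0 s') U' y S kk" unfolding local_rep_def using S by blast
	thus ?thesis using ds by blast
	next
	case 3
	define S where "S = ({ta - et / 3<..} Int ball ta0 ep) \<times> ball (0 :: 'e) s'"
	have S:"open S" "y : S" unfolding S_def using 3 tw t01[OF tw(2)] et(1) by (auto intro!:open_Times)
	have "smooth_on S h3" by (rule smooth_h3[OF S(1)]) (auto simp:S_def)
	moreover have "h3 ` S \<subseteq> img d" using h3img rh(2) by (force simp:S_def)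
	moreover have "U' u = chart_inv d (h3 u)" if "u : S" for u
	using that Vh3[of u] et(1) by (auto simp:U'_def S_def)
	ultimately have "local_rep d ({0..ta'} \<times> ball 0 s') U' y S h3" unfolding local_rep_def using S by blast
	thus ?thesis using ds by blast
	qed
	qed
	moreover have "snd c (x 0) + (proj L w - proj G w) : img c & U' (0,w) = chart_inv c (snd c (x 0) + (proj L w - proj G w))"
	if "w : ball 0 s'" for w using U(3) U'0[OF that] subsetD[OF s'(2) that] by simp
	ultimately show ?thesis unfolding transport_def using s'(1) U'x U'leaf U'0
	by (intro exI[of _ s'] conjI exI[of _ U'] ballI) simp_all
	qed
	thus ?thesis using ep(1) by (intro exI[of _ ep]) blast
qed

end

lemma smooth_map_on_subset:
	assumes "smooth_map_on M M' S f" "T \<subseteq> S"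
	shows "smooth_map_on M M' T f"
	unfolding smooth_map_on_def
proof
	fix x assume "x : T"
	hence "x : S" using assms(2) by blast
	with assms(1) obtain c d W g where h:"c : atlas M" "d : atlas M'" "openin (mtop M) W" "x : W" "W \<subseteq> fst c"
	"g ` W \<subseteq> fst d" "smooth_on (snd c ` W) (snd d o g o chart_inv c)" "ALL y:W Int S. g y = f y"
	unfolding smooth_map_on_def by (elim ballE[of S _ x] bexE exE conjE) (rule that,assumption+,simp)
	have "ALL y:W Int T. g y = f y" using h(8) assms(2) by blast
	with h show "EX c:atlas M. EX d:atlas M'. EX W g. openin (mtop M) W & x : W & W \<subseteq> fst c & g ` W \<subseteq> fst d &
	smooth_on (snd c ` W) (snd d o g o chart_inv c) & (ALL y:W Int T. g y = f y)"
	by (intro bexI[of _ c] bexI[of _ d] exI[of _ W] exI[of _ g] conjI)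
qed

context regular_coisotropic
begin

lemma transport_restrict:
	assumes "transport c L G x ta'" "0 <= ta" "ta <= ta'"
	shows "transport c L G x ta"
proof -
	obtain r U where U:"r > 0" "smooth_map_on euc M ({0..ta'} \<times> ball 0 r) U" "ALL t:{0..ta'}. U (t,0) = x t"
	"ALL w:ball 0 r. snd c (x 0) + (proj L w - proj G w) : img c & U (0,w) = chart_inv c (snd c (x 0) + (proj L w - proj G w))"
	"ALL t:{0..ta'}. ALL w:ball 0 r. U (t,w) : leaf M om N (U (0,w))"
	using assms(1) unfolding transport_def by (elim exE conjE) (rule that,assumption+)
	have "smooth_map_on euc M ({0..ta} \<times> ball 0 r) U"
	by (rule smooth_map_on_subset[OF U(2)]) (use assms in auto)
	thus ?thesis unfolding transport_def
	using U assms by (intro exI[of _ r] conjI exI[of _ U]) auto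
qed

text \<open>Extension forwards and restriction backwards make the existence of a transport locally
  constant in the final time, and {0..1} is connected.\<close>

lemma transport_1:
	assumes p:"plaque_chart c L G" and x:"smooth_map_on euc M {0..1} x" "ALL t:{0..1}. x t : leaf M om N (x 0)"
	and x0:"x 0 : fst c" "x 0 : N"
	shows "transport c L G x 1"
proof -
	have "transport c L G x 0 = transport c L G x 1"
	proof (rule connected_local_const[of "{0..1::real}"])
	show "ALL a:{0..1}. \<forall>\<^sub>F b in at a within {0..1}. transport c L G x a = transport c L G x b"
	proof
	fix a :: real assume a:"a : {0..1}"
	obtain ep where ep:"ep > 0" and ext:"ALL ta:{0..1} Int ball a ep. ALL ta':{0..1} Int ball a ep. ta <= ta' --> transport c L G x ta --> transport c L G x ta'"
	using transport_extend[OF p x a] by (elim exE conjE)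
	have "transport c L G x a = transport c L G x b" if b:"b : {0..1}" "dist b a < ep" for b
	proof (cases "a <= b")
	case True
	thus ?thesis using ext[rule_format,of a b] a b ep transport_restrict[of c L G x b a] by (auto simp:dist_commute)
	next
	case False
	thus ?thesis using ext[rule_format,of b a] a b ep transport_restrict[of c L G x a b] by (auto simp:dist_commute)
	qed
	thus "\<forall>\<^sub>F b in at a within {0..1}. transport c L G x a = transport c L G x b"
	unfolding eventually_at using ep by blast
	qed
	qed auto
	thus ?thesis using transport_0[of c L G x,OF p x0] by simp
qed

text \<open>Since \<open>linear_holonomy\<close> is a definite description, uniqueness alone would
  not determine its value. \<open>T\<close> picks the representative orthogonal to \<open>G\<close>
  in coordinates, and \<open>u\<close> is the transport along \<open>x\<close>, made global in the
  vector by \<open>squash\<close>.\<close>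

lemma holonomy_data_exists:
	assumes x:"smooth_map_on euc M {0..1} x" "ALL t:{0..1}. x t : leaf M om N (x 0)" and x0:"x 0 : N"
	shows "EX T u. holonomy_data M om N x T u"
proof -
	obtain c L G where p:"plaque_chart c L G" "x 0 : fst c" using plaque_exists[OF regular x0] by blast
	note sl = plaque_slice[OF p(1)] and cs = slice_smooth[OF plaque_slice[OF p(1)]] and G = plaque_subspace[OF p(1)]
	note L = slice_subspace[OF sl]
	define pr where "pr = quot_proj M om N (x 0)"
	define TN where "TN = tangent_space M N (x 0)"
	define D where "D = chart_deriv M c (x 0)"
	have linD:"linear D" and bijD:"bij D" unfolding D_def by (rule linear_chart_deriv[OF cs p(2)],rule bij_chart_deriv[OF cs p(2)])
	have TNe:"TN = D ` L" unfolding TN_def D_def by (rule tangent_space_slice[OF sl p(2) x0])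
	have perpe:"perp (x 0) = D ` G" unfolding D_def by (rule perp_plaque[OF p x0])
	have Dinv:"inv D (D a) = a" "D (inv D v) = v" for a v
	using bijD by (auto simp:bij_def surj_f_inv_f)
	have lini:"linear (inv D)"
	proof (rule linearI)
	fix a b and r :: real
	have "inv D (D (inv D a + inv D b)) = inv D a + inv D b" by (rule Dinv)
	thus "inv D (a + b) = inv D a + inv D b" by (simp add:linear_add[OF linD,of "inv D a" "inv D b"] Dinv)
	have "inv D (D (r *\<^sub>R inv D a)) = r *\<^sub>R inv D a" by (rule Dinv)
	thus "inv D (r *\<^sub>R a) = r *\<^sub>R inv D a" by (simp add:linear_scale[OF linD,of r "inv D a"] Dinv)
	qed
	\<comment> \<open>The part of \<open>v\<close> along \<open>L\<close> and orthogonal to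
	  \<open>G\<close>, in coordinates; it depends only on the class of \<open>v\<close>.\<close>
	define q where "q v = proj L (inv D v) - proj G (inv D v)" for v
	have linq:"linear q" unfolding q_def[abs_def]
	by (intro linear_compose_sub linear_compose[OF lini linear_proj[OF L],unfolded comp_def] linear_compose[OF lini linear_proj[OF G],unfolded comp_def])
	have qG:"q (D a) = 0" if "a : G" for a
	using that plaque_subset[OF p(1)] proj_id[OF G] proj_id[OF L] by (auto simp:q_def Dinv)
	have qL:"q v : L" for v unfolding q_def
	using proj_in[OF L] proj_in[OF G] plaque_subset[OF p(1)] by (blast intro:subspace_diff[OF L])
	have qq:"proj L (q v) - proj G (q v) = q v" if "v : TN" for v
	proof -
	have "inv D v : L" using that by (auto simp:TNe Dinv)
	hence e:"q v = inv D v - proj G (inv D v)" by (simp add:q_def proj_id[OF L])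
	have "proj G (q v) = 0" unfolding e linear_diff[OF linear_proj[OF G]] by (simp add:proj_id[OF G proj_in[OF G]])
	thus ?thesis by (simp add:proj_id[OF L qL])
	qed
	\<comment> \<open>Elements of the quotient are cosets, and any representative gives the same value
	  of \<open>q\<close>.\<close>
	define th where "th Y = q (SOME v. v : Y)" for Y
	have th:"th (pr v) = q v" for v
	proof -
	have "v + 0 : pr v" unfolding pr_def quot_proj_def using subspace_0[OF subspace_perp[OF x0]] by blast
	hence "(SOME v'. v' : pr v) : pr v" by (rule someI)
	then obtain a where "a : G" "(SOME v'. v' : pr v) = v + D a" unfolding pr_def quot_proj_def perpe by blast
	thus ?thesis using linear_add[OF linq,of v "D a"] qG by (simp add:th_def)
	qed
	have DL:"D (q v) : TN" for v unfolding TNe using qL by blast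
	have "linear_section M om N (x 0) (%Y. D (th Y))"
	unfolding linear_section_def pr_def[symmetric] TN_def[symmetric] th
	proof (intro conjI ballI allI)
	fix v assume v:"v : TN"
	show "D (q v) : TN" by (rule DL)
	have "inv D v : L" using v by (auto simp:TNe Dinv)
	hence "D (q v) - v = D (- proj G (inv D v))"
	using linear_diff[OF linD,of "q v" "inv D v"] by (simp add:Dinv q_def proj_id[OF L])
	hence "D (q v) - v : perp (x 0)" unfolding perpe using subspace_neg[OF G proj_in[OF G]] by auto
	thus "pr (D (q v)) = pr v" unfolding pr_def quot_proj_def by (simp add:coset_eq_iff[OF subspace_perp[OF x0]])
	next
	fix v w show "D (q (v + w)) = D (q v) + D (q w)" by (simp add:linear_add[OF linq,of v w] linear_add[OF linD,of "q v" "q w"])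
	next
	fix a :: real and v show "D (q (a *\<^sub>R v)) = a *\<^sub>R D (q v)" by (simp add:linear_scale[OF linq,of a v] linear_scale[OF linD,of a "q v"])
	qed
	moreover
	obtain r U where U:"r > 0" "smooth_map_on euc M ({0..1} \<times> ball 0 r) U" "ALL t:{0..1}. U (t,0) = x t"
	"ALL w:ball 0 r. snd c (x 0) + (proj L w - proj G w) : img c & U (0,w) = chart_inv c (snd c (x 0) + (proj L w - proj G w))"
	"ALL t:{0..1}. ALL w:ball 0 r. U (t,w) : leaf M om N (U (0,w))"
	using transport_1[OF p(1) x p(2) x0] unfolding transport_def by (elim exE conjE) (rule that,assumption+)
	define u where "u y = U (fst y,squash r (th (snd y)))" for y
	have upr:"u (t,pr v) = U (t,squash r (q v))" for t v by (simp add:u_def th)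
	have sq:"squash r w : ball 0 r" for w using squash_norm[OF U(1),of w] by simp
	have sq0:"squash r 0 = 0" by (simp add:squash_def)
	have q0:"q 0 = 0" by (rule linear_0[OF linq])
	have sqq:"smooth_on UNIV (%v. squash r (q v))"
	by (rule sm_compose[OF open_UNIV open_UNIV sm_linear[OF linq] smooth_squash]) simp
	have UN:"U (t,w) : N" if "t : {0..1}" "w : ball 0 r" for t w using U(5) that leaf_subset by blast
	have "smooth_map_on euc M ({0..1} \<times> TN) (%(t,v). u (t,pr v))"
	proof -
	have lin:"linear (fst :: real \<times> 'e => real)" "linear (snd :: real \<times> 'e => 'e)" by (simp_all add:linear_iff)
	have "smooth_on UNIV (%y :: real \<times> 'e. squash r (q (snd y)))"
	by (rule sm_compose[OF open_UNIV open_UNIV sm_linear[OF lin(2)] sqq]) simp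
	from smooth_on_Pair[OF open_UNIV sm_linear[OF lin(1)] this]
	have "smooth_map_on euc M ({0..1} \<times> TN) (%y. U (fst y,squash r (q (snd y))))"
	by (rule smooth_map_on_compose[OF U(2)]) (use sq UN N_subset in auto)
	thus ?thesis by (simp add:upr case_prod_beta')
	qed
	moreover have "ALL t:{0..1}. ALL v:TN. u (t,pr v) : N" unfolding upr using UN[OF _ sq] by blast
	moreover have "ALL t:{0..1}. u (t,pr 0) = x t" using U(3) by (simp add:upr q0 sq0)
	moreover have "ALL t:{0..1}. ALL v:TN. u (t,pr v) : leaf M om N (u (0,pr v))" unfolding upr using U(5) sq by blast
	moreover have "velocity M (%s. u (0,pr (s *\<^sub>R v))) 0 = D (th (pr v))" if v:"v : TN" for v
	proof -
	define h where "h s = snd c (x 0) + (proj L (squash r (s *\<^sub>R q v)) - proj G (squash r (s *\<^sub>R q v)))" for s :: real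
	have "smooth_on UNIV (%s :: real. s *\<^sub>R q v)" by (rule sm_scaleR[OF open_UNIV sm_id sm_const])
	hence s:"smooth_on UNIV (%s :: real. squash r (s *\<^sub>R q v))"
	by (rule sm_compose[OF open_UNIV open_UNIV _ smooth_squash]) simp
	have sp:"smooth_on UNIV (%s :: real. proj K (squash r (s *\<^sub>R q v)))" if "subspace K" for K
	by (rule sm_compose[OF open_UNIV open_UNIV s sm_linear[OF linear_proj[OF that]]]) simp
	have sh:"smooth_on UNIV h" unfolding h_def[abs_def]
	by (rule sm_add[OF open_UNIV sm_const sm_diff[OF open_UNIV sp[OF L] sp[OF G]]])
	have "local_rep c UNIV (%s. u (0,pr (s *\<^sub>R v))) 0 UNIV h"
	unfolding local_rep_def using sh bspec[OF U(4) sq] by (auto simp:upr h_def linear_scale[OF linq,of _ v])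
	from curve_velocity[OF cs this open_UNIV] have vel:"velocity M (%s. u (0,pr (s *\<^sub>R v))) 0 = chart_deriv M c (u (0,pr (0 *\<^sub>R v))) (fder h 0 1)" by simp
	define e where "e = r / 2 / (norm (q v) + 1)"
	have n:"norm (q v) + 1 > 0" using norm_ge_zero[of "q v"] by linarith
	hence e:"e > 0" using U(1) by (simp add:e_def)
	have heq:"h s = snd c (x 0) + s *\<^sub>R q v" if s:"s : ball 0 e" for s
	proof -
	have "norm (s *\<^sub>R q v) <= e * norm (q v)" using s e by (auto intro!:mult_right_mono)
	also have "... <= e * (norm (q v) + 1)" using e by (intro mult_left_mono) auto
	also have "... = r / 2" using nonzero_eq_divide_eq[of "norm (q v) + 1" e "r / 2"] n by (simp only: e_def) simp
	finally have "squash r (s *\<^sub>R q v) = s *\<^sub>R q v" by (rule squash_id[OF U(1)])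
	hence "h s = snd c (x 0) + s *\<^sub>R (proj L (q v) - proj G (q v))"
	by (simp add:h_def linear_scale[OF linear_proj[OF L],of s "q v"] linear_scale[OF linear_proj[OF G],of s "q v"] scaleR_diff_right)
	thus ?thesis by (simp add:qq[OF v])
	qed
	have "((%s. snd c (x 0) + s *\<^sub>R q v) has_derivative (%s. s *\<^sub>R q v)) (at 0)" by (auto intro!:derivative_eq_intros)
	hence "(h has_derivative (%s. s *\<^sub>R q v)) (at 0)"
	by (rule hd_transform[OF _ open_ball[of 0 e]]) (use e heq in auto)
	from fder_eq[OF this,of 1] have "fder h 0 1 = q v" by simp
	moreover have "u (0,pr (0 *\<^sub>R v)) = x 0" using U(3) by (simp add:upr q0 sq0)
	ultimately show ?thesis using vel by (simp add:th D_def)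
	qed
	ultimately have "holonomy_data M om N x (%Y. D (th Y)) u"
	unfolding holonomy_data_def Let_def pr_def[symmetric] TN_def[symmetric] by blast
	thus ?thesis by blast
qed

lemma linear_holonomy_loop:
	assumes x:"smooth_map_on euc M {0..1} x" "ALL t:{0..1}. x t : leaf M om N (x 0)" and x0:"x 0 : N"
	and loop:"x 1 = x 0" and v:"v : tangent_space M N (x 0)"
	shows "linear_holonomy M om N x (quot_proj M om N (x 0) v) = quot_proj M om N (x 0) v"
proof -
	obtain T u where d:"holonomy_data M om N x T u" using holonomy_data_exists[OF x x0] by blast
	show ?thesis unfolding linear_holonomy_def
	proof (rule the_equality)
	show "EX T u v'. holonomy_data M om N x T u & v' : tangent_space M N (x 0) &
	quot_proj M om N (x 0) v = quot_proj M om N (x 0) v' &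
	quot_proj M om N (x 0) v = quot_proj M om N (x 1) (velocity M (%s. u (1,quot_proj M om N (x 0) (s *\<^sub>R v'))) 0)"
	by (rule exI[of _ T],rule exI[of _ u],rule exI[of _ v])
	(use d v holonomy_loop_unique[OF d x0 loop v] in \<open>simp add:loop\<close>)
	next
	fix Z assume "EX T u v'. holonomy_data M om N x T u & v' : tangent_space M N (x 0) &
	quot_proj M om N (x 0) v = quot_proj M om N (x 0) v' &
	Z = quot_proj M om N (x 1) (velocity M (%s. u (1,quot_proj M om N (x 0) (s *\<^sub>R v'))) 0)"
	then obtain T u v' where d:"holonomy_data M om N x T u" "v' : tangent_space M N (x 0)"
	"quot_proj M om N (x 0) v = quot_proj M om N (x 0) v'"
	"Z = quot_proj M om N (x 1) (velocity M (%s. u (1,quot_proj M om N (x 0) (s *\<^sub>R v'))) 0)" by (elim exE conjE)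
	thus "Z = quot_proj M om N (x 0) v" using holonomy_loop_unique[OF d(1) x0 loop d(2)] by (simp add:loop)
	qed
qed

end

section \<open>Embedded manifolds and Hamiltonian vector fields\<close>

lemma bump_extend:
	fixes g :: "'v::euclidean_space => 'w::euclidean_space"
	assumes "r > 0" "smooth_on (ball a (3 * r)) g"
	shows "smooth_on UNIV (%y. bump a r y *\<^sub>R g y)"
proof (rule sm_local)
	fix x :: 'v
	show "EX U. open U & x : U & smooth_on U (%y. bump a r y *\<^sub>R g y)"
	proof (cases "dist a x < 3 * r")
	case True
	have "smooth_on (ball a (3 * r)) (%y. bump a r y *\<^sub>R g y)"
	by (rule sm_scaleR[OF open_ball sm_subset[OF sm_bump subset_UNIV] assms(2)])
	thus ?thesis using True by (intro exI[of _ "ball a (3 * r)"]) simp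
	next
	case False
	have o:"open (- cball a (2 * r))" by (simp add:open_Compl)
	have "0 = bump a r y *\<^sub>R g y" if "y : - cball a (2 * r)" for y
	using that bump_eq_0[OF assms(1),where y = y and a = a] by (simp add:dist_commute)
	from sm_cong[OF o this sm_const] have "smooth_on (- cball a (2 * r)) (%y. bump a r y *\<^sub>R g y)" .
	thus ?thesis using False assms(1) o by (intro exI[of _ "- cball a (2 * r)"]) auto
	qed
qed

text \<open>Replaces partitions of unity and uniform choices over a compact set: local data that can
  be combined for two sets are combined along a finite cover.\<close>

lemma compact_union_induct:
	assumes K:"compact K" and e:"Q {}" and un:"!!A B. Q A ==> Q B ==> Q (A Un B)"
	and mono:"!!A B. A \<subseteq> B ==> Q B ==> Q A" and loc:"ALL y:K. EX U. open U & y : U & Q U"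
	shows "Q K"
proof -
	obtain U where U:"ALL y:K. open (U y) & y : U y & Q (U y)" using bchoice[OF loc] by (elim exE)
	obtain D where D:"D \<subseteq> K" "finite D" "K \<subseteq> (UN y:D. U y)"
	by (rule compactE_image[OF K,of K U]) (use U in auto)
	have "Q (UN y:D. U y)" using D(2,1)
	proof (induction D)
	case empty
	show ?case using e by simp
	next
	case (insert a D)
	have "Q (U a Un (UN y:D. U y))" by (rule un) (use U insert in auto)
	thus ?case by simp
	qed
	thus ?thesis by (rule mono[OF D(3)])
qed

lemma linear_family_bounded:
	fixes A :: "'p::euclidean_space => 'v::euclidean_space => 'w::euclidean_space"
	assumes K:"compact K" and lin:"!!p. p : K ==> linear (A p)" and c:"!!i. i : Basis ==> continuous_on K (%p. A p i)"
	shows "EX C>0. ALL p:K. ALL v. norm (A p v) <= C * norm v"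
proof -
	have "continuous_on K (%p. SUM i:Basis. norm (A p i))" by (intro continuous_on_sum continuous_on_norm c)
	from compact_imp_bounded[OF compact_continuous_image[OF this K]]
	obtain C where C:"ALL p:K. (SUM i:Basis. norm (A p i)) <= C" unfolding bounded_iff by (auto simp:abs_le_iff)
	have "norm (A p v) <= (\<bar>C\<bar> + 1) * norm v" if p:"p : K" for p v
	proof -
	have "norm (A p v - 0) <= norm v * (SUM i:Basis. norm (A p i - 0))"
	by (rule norm_linear_diff_le[OF lin[OF p],of "%_. 0"]) (simp add:linear_iff)
	also have "... <= norm v * (\<bar>C\<bar> + 1)" by (rule mult_left_mono) (use C p in force)+
	finally show ?thesis by (simp add:mult.commute)
	qed
	thus ?thesis by (intro exI[of _ "\<bar>C\<bar> + 1"]) auto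
qed

section \<open>Derivatives of vector-valued maps in charts\<close>

context smooth_mfd
begin

lemma smooth_map_on_chart:
	fixes g :: "'a => 'w::euclidean_space"
	assumes g:"smooth_map_on M euc S g" and e:"smooth_chart M e" and x:"x : S" "x : fst e"
	shows "EX W F. open W & snd e x : W & W \<subseteq> snd e ` fst e & smooth_on W F & (ALL p:W. chart_inv e p : S --> F p = g (chart_inv e p))"
proof -
	have 1:"EX c:atlas M. EX d:{(UNIV,id)}. EX W g'. openin (mtop M) W & x : W & W \<subseteq> fst c & g' ` W \<subseteq> fst d &
	smooth_on (snd c ` W) (snd d o g' o chart_inv c) & (ALL y:W Int S. g' y = g y)"
	using bspec[OF g[unfolded smooth_map_on_def] x(1)] unfolding atlas_euclidean .
	obtain c d W0 g' where h0:"c : atlas M" "d : {(UNIV,id)}" "openin (mtop M) W0" "x : W0" "W0 \<subseteq> fst c"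
	"g' ` W0 \<subseteq> fst d" "smooth_on (snd c ` W0) (snd d o g' o chart_inv c)" "ALL y:W0 Int S. g' y = g y"
	using 1 by (elim bexE exE conjE) (rule that,assumption+)
	have c:"smooth_chart M c" by (rule atlas_smooth_chart[OF h0(1)])
	have sm:"smooth_on (snd c ` W0) (%p. g' (chart_inv c p))" using h0(2,7) by (simp add:comp_def)
	define W where "W = snd e ` (W0 Int fst e)"
	have W:"open W" unfolding W_def
	by (rule chart_open_map[OF is_chart[OF e] openin_Int[OF h0(3) chart_openin[OF is_chart[OF e]]] Int_lower2])
	have cW:"open (snd c ` W0)" by (rule chart_open_map[OF is_chart[OF c] h0(3,5)])
	have inv:"chart_inv e p : W0 Int fst e" if "p : W" for p using that inv_chart[OF e] unfolding W_def by auto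
	have sub:"W \<subseteq> snd e ` (fst e Int fst c)" using h0(5) unfolding W_def by blast
	have "smooth_on W (%p. g' (chart_inv c (snd c (chart_inv e p))))"
	by (rule sm_compose[OF W cW sm_subset[OF transition_smooth[OF e c] sub] sm]) (use inv in blast)
	hence "smooth_on W (%p. g' (chart_inv e p))"
	by (rule sm_cong[OF W,rotated]) (simp add:inv_chart[OF c subsetD[OF h0(5) IntD1[OF inv]]])
	thus ?thesis
	using W inv h0(4,8) x(2) by (intro exI[of _ W] exI[of _ "%p. g' (chart_inv e p)"]) (auto simp:W_def)
qed

lemma mderiv_chart:
	fixes g :: "'a => 'w::euclidean_space"
	assumes e:"smooth_chart M e" and x:"x : fst e" and g:"smooth_on (snd e ` fst e) (%p. g (chart_inv e p))"
	shows "mderiv M euc g x (chart_deriv M e x v) = fder (%p. g (chart_inv e p)) (snd e x) v"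
proof -
	have xp:"x : points M" using chart_subset[OF e] x by blast
	define a where "a = chart_at M x"
	have a:"smooth_chart M a" "x : fst a" using chart_at_smooth[OF xp] chart_at[OF xp] by (auto simp:a_def)
	have inva:"chart_inv a (snd a x) = x" by (rule inv_chart[OF a])
	have D:"((%p. g (chart_inv e p)) has_derivative fder (%p. g (chart_inv e p)) (snd e x)) (at (snd e x))"
	by (rule sm_hd[OF img_open[OF e] g]) (use x in blast)
	have "((%p. g (chart_inv e (snd e (chart_inv a p)))) has_derivative
	(%v. fder (%p. g (chart_inv e p)) (snd e x) (fder (%p. snd e (chart_inv a p)) (snd a x) v))) (at (snd a x))"
	by (rule has_derivative_compose[OF transition_derivative[OF a(1) e a(2) x]]) (use D in \<open>simp add:inva\<close>)
	hence "((%p. g (chart_inv a p)) has_derivative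
	(%v. fder (%p. g (chart_inv e p)) (snd e x) (fder (%p. snd e (chart_inv a p)) (snd a x) v))) (at (snd a x))"
	by (rule hd_transform[OF _ overlap_open[OF a(1) e]]) (use a x inv_chart[OF e] inv_chart[OF a(1)] in auto)
	from frechet_derivative_at[OF this] have 1:"mderiv M euc g x =
	(%v. fder (%p. g (chart_inv e p)) (snd e x) (fder (%p. snd e (chart_inv a p)) (snd a x) v))"
	by (simp add:mderiv_def chart_at_euclidean comp_def a_def)
	have "fder (%p. snd e (chart_inv a p)) (snd a x) (chart_deriv M e x v) = v"
	using fun_cong[OF transition_chain[OF e a(1) e x a(2) x],of v] transition_id[OF e x]
	by (simp add:chart_deriv_eq a_def)
	thus ?thesis by (simp add:1)
qed

text \<open>Every curve with velocity \<open>v\<close> yields the derivative of the coordinate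
  extension \<open>F\<close>, so the definite description is met. \<open>F\<close> has to represent
  \<open>g\<close> on \<open>S\<close> only.\<close>

lemma submanifold_deriv_chart:
	fixes g :: "'a => 'w::euclidean_space"
	assumes e:"smooth_chart M e" and x:"x : fst e" and W:"open W" "snd e x : W" "smooth_on W F"
	and F:"ALL p:W. chart_inv e p : S --> F p = g (chart_inv e p)"
	and v:"v : tangent_space M S x" "v = chart_deriv M e x l"
	shows "submanifold_deriv M S g x v = fder F (snd e x) l"
proof -
	have cur:"vector_derivative (g o ga) (at 0) = fder F (snd e x) l" if ga:"curve_through M S x ga" "velocity M ga 0 = v" for ga
	proof -
	have sm:"smooth_map_on euc M {-1<..<1} ga" and S:"ga ` {-1<..<1} \<subseteq> S" and 0:"ga 0 = x"
	using ga(1) by (auto simp:curve_through_def)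
	have "EX Z h. local_rep e {-1<..<1} ga 0 Z h" by (rule smooth_map_on_local_rep[OF sm _ e]) (use x 0 in auto)
	then obtain Z h where r:"local_rep e {-1<..<1} ga 0 Z h" by (elim exE)
	hence Z:"open Z" "0 : Z" "smooth_on Z h" by (auto simp:local_rep_def)
	have h:"ga t : fst e" "snd e (ga t) = h t" if "t : Z" "t : {-1<..<1}" for t using local_rep_value[OF r that] by auto
	have h0:"h 0 = snd e x" using h(2)[OF Z(2)] 0 by simp
	have "velocity M ga 0 = chart_deriv M e (ga 0) (fder h 0 1)"
	proof -
	have "((%s. snd e (ga s)) has_vector_derivative fder h 0 1) (at 0)"
	using local_rep_velocity(1)[OF e r,of ] at_within_open[of 0 "{-1<..<1::real}"] by simp
	moreover have "\<forall>\<^sub>F s in at 0. ga s : fst e"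
	using local_rep_velocity(3)[OF e r] at_within_open[of 0 "{-1<..<1::real}"] by simp
	ultimately show ?thesis by (intro velocity_chart[OF e]) (use 0 x in auto)
	qed
	hence l:"fder h 0 1 = l" using ga(2) v(2) 0 bij_is_inj[OF bij_chart_deriv[OF e x]] by (simp add:inj_eq)
	have hd:"(h has_derivative fder h 0) (at 0)" by (rule sm_hd[OF Z(1,3,2)])
	have Fd:"(F has_derivative fder F (snd e x)) (at (h 0))" unfolding h0 by (rule sm_hd[OF W(1,3,2)])
	have c:"((%s. F (h s)) has_derivative (%s. fder F (snd e x) (fder h 0 s))) (at 0)"
	by (rule has_derivative_compose[OF hd Fd])
	define T where "T = (Z Int h -` W) Int {-1<..<1}"
	have T:"open T" "0 : T" unfolding T_def
	using continuous_open_preimage[OF sm_cont[OF Z(3)] Z(1) W(1)] Z(2) W(2) by (auto simp:h0)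
	have "F (h s) = (g o ga) s" if s:"s : T" for s
	proof -
	have s':"s : Z" "s : {-1<..<1}" "h s : W" using s by (auto simp:T_def)
	have e1:"chart_inv e (h s) = ga s" using inv_chart[OF e h(1)[OF s'(1,2)]] h(2)[OF s'(1,2)] by simp
	have "ga s : S" using S s'(2) by blast
	thus ?thesis using bspec[OF F s'(3)] e1 by simp
	qed
	hence "((g o ga) has_derivative (%s. fder F (snd e x) (fder h 0 s))) (at 0)"
	by (rule hd_transform[OF c T])
	hence "((g o ga) has_vector_derivative fder F (snd e x) l) (at 0)"
	unfolding has_vector_derivative_def
	using linear_scale[OF sm_linear_fder[OF W(1,3,2)],of _ l] linear_scale[OF sm_linear_fder[OF Z(1,3,2)],of _ 1] l by simp
	thus ?thesis by (rule vector_derivative_at)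
	qed
	obtain ga where ga:"curve_through M S x ga" "velocity M ga 0 = v" using v(1) unfolding tangent_space_def by blast
	show ?thesis unfolding submanifold_deriv_def
	proof (rule the_equality)
	show "EX ga. curve_through M S x ga & velocity M ga 0 = v & fder F (snd e x) l = vector_derivative (g o ga) (at 0)"
	using ga cur[OF ga] by (intro exI[of _ ga]) simp
	qed (use cur in auto)
qed

end

section \<open>The symplectic form as an operator, and Hamiltonian vector fields in charts\<close>

context coisotropic_mfd
begin

text \<open>The musical isomorphism in coordinates, covectors being identified with vectors by the
  inner product. Nondegeneracy is its invertibility, to which the results on operator families
  apply.\<close>

definition flat_op :: "('a,'e) chart => 'e => 'e => 'e" where
	"flat_op c p v = (SUM b:Basis. form c p v b *\<^sub>R b)"

lemma flat_op:
	assumes c:"smooth_chart M c" and p:"p : img c"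
	shows flat_op_inner:"flat_op c p v \<bullet> w = form c p v w" and linear_flat_op:"linear (flat_op c p)" and bij_flat_op:"bij (flat_op c p)"
proof -
	note bil = bilinear_form[OF c p]
	have l1:"linear (%v. form c p v w)" and l2:"linear (form c p v)" for v w using bil by (auto simp:bilinear_def)
	show inner:"flat_op c p v \<bullet> w = form c p v w" for v w
	proof -
	have "form c p v w = (SUM i:Basis. (w \<bullet> i) *\<^sub>R form c p v i)" by (rule linear_sum_Basis[OF l2])
	thus ?thesis by (simp add:flat_op_def inner_sum_left inner_commute[of w] mult.commute)
	qed
	show lin:"linear (flat_op c p)"
	proof (rule linearI)
	fix a b and r :: real
	show "flat_op c p (a + b) = flat_op c p a + flat_op c p b"
	by (simp add:flat_op_def linear_add[OF l1,of a b] scaleR_left_distrib sum.distrib)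
	show "flat_op c p (r *\<^sub>R a) = r *\<^sub>R flat_op c p a"
	by (simp add:flat_op_def linear_scale[OF l1,of r a] scaleR_sum_right)
	qed
	have x:"chart_inv c p : fst c" "snd c (chart_inv c p) = p" using p by (auto simp:chart_inv_into chart_chart_inv)
	have xM:"chart_inv c p : points M" using chart_subset[OF c] x by blast
	note b = bij_chart_deriv[OF c x(1)]
	have "v = 0" if "flat_op c p v = 0" for v
	proof -
	have "form c p v a = 0" for a using inner[of v a] that by simp
	hence "om (chart_inv c p) (chart_deriv M c (chart_inv c p) v) (chart_deriv M c (chart_inv c p) a) = 0" for a
	using form_eq[OF c x(1)] x(2) by simp
	hence "om (chart_inv c p) (chart_deriv M c (chart_inv c p) v) w = 0" for w
	using surj_f_inv_f[OF bij_is_surj[OF b],of w] by metis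
	hence "chart_deriv M c (chart_inv c p) v = 0" by (rule om_props(3)[OF xM])
	thus ?thesis using linear_0[OF linear_chart_deriv[OF c x(1)]] bij_is_inj[OF b] by (metis injD)
	qed
	hence "inj (flat_op c p)" using linear_injective_0[OF lin] by blast
	thus "bij (flat_op c p)" using linear_injective_imp_surjective[OF lin] by (simp add:bij_def)
qed

lemma smooth_flat_op:"smooth_chart M c ==> smooth_on (img c) (%p. flat_op c p v)"
	unfolding flat_op_def
	by (rule sm_sum[OF chart_image_open[OF is_chart]],assumption,
	rule sm_scaleR[OF chart_image_open[OF is_chart] smooth_form sm_const])

text \<open>Both bounds come from compactness, applied to \<open>flat_op\<close> and to its inverse.
  The second one recovers the size of a vector from its pairings, so that a small differential
  forces a small Hamiltonian vector.\<close>

lemma form_bounds: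
	assumes c:"smooth_chart M c" and K:"compact K" "K \<subseteq> img c"
	shows "EX C>0. ALL p:K. (ALL v w. \<bar>form c p v w\<bar> <= C * norm v * norm w) &
	(ALL v. ALL m. (ALL w. \<bar>form c p v w\<bar> <= m * norm w) --> norm v <= C * m)"
proof -
	note o = img_open[OF c]
	have lin:"linear (flat_op c p)" "bij (flat_op c p)" if "p : img c" for p using flat_op[OF c that] by auto
	have lininv:"linear (inv (flat_op c p))" if "p : img c" for p
	proof (rule linearI)
	note b = lin(2)[OF that]
	note s = surj_f_inv_f[OF bij_is_surj[OF b]] and i = inv_f_f[OF bij_is_inj[OF b]]
	fix x y and r :: real
	have "inv (flat_op c p) (flat_op c p (inv (flat_op c p) x + inv (flat_op c p) y)) = inv (flat_op c p) x + inv (flat_op c p) y" by (rule i)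
	thus "inv (flat_op c p) (x + y) = inv (flat_op c p) x + inv (flat_op c p) y"
	by (simp add:linear_add[OF lin(1)[OF that],of "inv (flat_op c p) x" "inv (flat_op c p) y"] s)
	have "inv (flat_op c p) (flat_op c p (r *\<^sub>R inv (flat_op c p) x)) = r *\<^sub>R inv (flat_op c p) x" by (rule i)
	thus "inv (flat_op c p) (r *\<^sub>R x) = r *\<^sub>R inv (flat_op c p) x"
	by (simp add:linear_scale[OF lin(1)[OF that],of r "inv (flat_op c p) x"] s)
	qed
	have "EX C>0. ALL p:K. ALL v. norm (flat_op c p v) <= C * norm v"
	by (rule linear_family_bounded[OF K(1)]) (use lin K(2) sm_cont[OF sm_subset[OF smooth_flat_op[OF c] K(2)]] in blast)+
	then obtain C1 where C1:"C1 > 0" "ALL p:K. ALL v. norm (flat_op c p v) <= C1 * norm v" by blast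
	have "EX C>0. ALL p:K. ALL v. norm (inv (flat_op c p) v) <= C * norm v"
	proof (rule linear_family_bounded[OF K(1)])
	show "continuous_on K (%p. inv (flat_op c p) i)" for i
	by (rule continuous_on_subset[OF cont_inv_operator[OF o lin sm_cont[OF smooth_flat_op[OF c]]] K(2)])
	qed (use lininv K(2) in blast)
	then obtain C2 where C2:"C2 > 0" "ALL p:K. ALL v. norm (inv (flat_op c p) v) <= C2 * norm v" by blast
	have "\<bar>form c p v w\<bar> <= (C1 + C2) * norm v * norm w" if p:"p : K" for p v w
	proof -
	have "\<bar>form c p v w\<bar> <= norm (flat_op c p v) * norm w"
	using Cauchy_Schwarz_ineq2[of "flat_op c p v" w] flat_op_inner[OF c] p K(2) by auto
	also have "... <= (C1 * norm v) * norm w" by (rule mult_right_mono) (use C1 p in auto)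
	also have "... <= ((C1 + C2) * norm v) * norm w" by (intro mult_right_mono) (use C2 in auto)
	finally show ?thesis .
	qed
	moreover have "norm v <= (C1 + C2) * m" if p:"p : K" and m:"ALL w. \<bar>form c p v w\<bar> <= m * norm w" for p v m
	proof -
	have p':"p : img c" using p K(2) by blast
	have "norm (flat_op c p v) * norm (flat_op c p v) = \<bar>form c p v (flat_op c p v)\<bar>"
	using flat_op_inner[OF c p',of v "flat_op c p v"] by (metis abs_norm_cancel abs_mult norm_eq_sqrt_inner real_sqrt_mult_self abs_abs)
	also have "... <= m * norm (flat_op c p v)" using m by blast
	finally have 1:"norm (flat_op c p v) <= m | norm (flat_op c p v) = 0" by (metis mult_right_le_imp_le norm_ge_zero order_le_less)
	have m0:"m >= 0"
	proof -
	obtain b :: 'e where "b : Basis" using nonempty_Basis by blast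
	hence "\<bar>form c p v b\<bar> <= m" using m[rule_format,of b] by simp
	thus ?thesis by linarith
	qed
	have "norm v = norm (inv (flat_op c p) (flat_op c p v))" by (simp add:inv_f_f[OF bij_is_inj[OF lin(2)[OF p']]])
	also have "... <= C2 * norm (flat_op c p v)" using C2 p by blast
	also have "... <= C2 * m" using 1 m0 C2(1) by (intro mult_left_mono) auto
	also have "... <= (C1 + C2) * m" using C1(1) m0 by (intro mult_right_mono) auto
	finally show ?thesis .
	qed
	ultimately show ?thesis using C1(1) C2(1) by (intro exI[of _ "C1 + C2"]) simp
qed

lemma ham_field_chart:
	assumes c:"smooth_chart M c" and g:"smooth_on (img c) (%p. g (chart_inv c p))"
	shows "EX X. smooth_on (img c) X & (ALL p:img c. ALL w. form c p (X p) w = fder (%p. g (chart_inv c p)) p w) &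
	(ALL x:fst c. ham_vector_field M om g x = chart_deriv M c x (X (snd c x)))"
proof -
	note o = img_open[OF c]
	define D where "D p = fder (%p. g (chart_inv c p)) p" for p
	have lin:"linear (flat_op c p)" "bij (flat_op c p)" if "p : img c" for p using flat_op[OF c that] by auto
	define grad where "grad p = (SUM b:Basis. D p b *\<^sub>R b)" for p
	define X where "X p = inv (flat_op c p) (grad p)" for p
	have sgrad:"smooth_on (img c) grad" unfolding grad_def[abs_def] D_def
	by (rule sm_sum[OF o],rule sm_scaleR[OF o sm_fder[OF g] sm_const])
	have lininv:"linear (inv (flat_op c p))" if "p : img c" for p
	using linear_injective_isomorphism[OF lin(1)[OF that] bij_is_inj[OF lin(2)[OF that]]]
	inv_unique_comp[of "flat_op c p"] by (metis comp_def inv_equality)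
	have sX:"smooth_on (img c) X" unfolding X_def[abs_def]
	by (rule sm_apply_linear[OF o lininv sm_inv_operator[OF o lin smooth_flat_op[OF c]] sgrad])
	have fX:"form c p (X p) w = D p w" if p:"p : img c" for p w
	proof -
	have "form c p (X p) w = grad p \<bullet> w"
	by (simp add:flat_op_inner[OF c p,symmetric] X_def surj_f_inv_f[OF bij_is_surj[OF lin(2)[OF p]]])
	also have "... = D p w"
	using linear_sum_Basis[OF sm_linear_fder[OF o g p],of w] by (simp add:grad_def D_def inner_sum_left inner_commute[of w] mult.commute)
	finally show ?thesis .
	qed
	have "ham_vector_field M om g x = chart_deriv M c x (X (snd c x))" if x:"x : fst c" for x
	unfolding ham_vector_field_def
	proof (rule the_equality)
	have xM:"x : points M" using chart_subset[OF c] x by blast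
	have p:"snd c x : img c" using x by blast
	note b = bij_chart_deriv[OF c x]
	show e:"mderiv M euc g x = om x (chart_deriv M c x (X (snd c x)))"
	proof
	fix w
	define a where "a = inv (chart_deriv M c x) w"
	have w:"w = chart_deriv M c x a" by (simp add:a_def surj_f_inv_f[OF bij_is_surj[OF b]])
	show "mderiv M euc g x w = om x (chart_deriv M c x (X (snd c x))) w"
	unfolding w mderiv_chart[OF c x g] using fX[OF p,of a] form_eq[OF c x,of "X (snd c x)" a] by (simp add:D_def)
	qed
	fix Y assume Y:"mderiv M euc g x = om x Y"
	have l:"linear (%v. om x v w)" for w using om_props(1)[OF xM] by (simp add:bilinear_def)
	have "om x (Y - chart_deriv M c x (X (snd c x))) w = 0" for w
	using e Y linear_diff[OF l,of Y "chart_deriv M c x (X (snd c x))" w] by simp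
	from om_props(3)[OF xM this] show "Y = chart_deriv M c x (X (snd c x))" by simp
	qed
	thus ?thesis using sX fX by (intro exI[of _ X]) (auto simp:D_def)
qed

end

section \<open>Coordinates near an embedded manifold\<close>

locale embedded_mfd = smooth_mfd M
	for M :: "('a,'e::euclidean_space) manifold" +
	fixes io :: "'a => 'b::euclidean_space"
	assumes emb:"smooth_embedding M euc io"
begin

abbreviation rep :: "('a,'e) chart => 'e => 'b" where "rep e p == io (chart_inv e p)"
abbreviation dio :: "'a => 'e => 'b" where "dio x == mderiv M euc io x"

lemma rep_smooth:
	assumes e:"smooth_chart M e"
	shows "smooth_on (snd e ` fst e) (rep e)"
proof (rule sm_local)
	fix p assume "p : snd e ` fst e"
	then obtain x where x:"x : fst e" "p = snd e x" by blast
	have xM:"x : points M" using chart_subset[OF e] x by blast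
	have sm:"smooth_map_on M euc (points M) io" using emb by (simp add:smooth_embedding_def)
	obtain W F where W:"open W" "snd e x : W" "W \<subseteq> snd e ` fst e" "smooth_on W F" "ALL p:W. chart_inv e p : points M --> F p = io (chart_inv e p)"
	using smooth_map_on_chart[OF sm e xM x(1)] by (elim exE conjE) (rule that,assumption+)
	have "F q = rep e q" if "q : W" for q
	using W(5) that W(3) chart_inv_into[of q e] chart_subset[OF e] by blast
	hence "smooth_on W (rep e)" by (rule sm_cong[OF W(1) _ W(4)])
	thus "EX U. open U & p : U & smooth_on U (rep e)" using W(1,2) x(2) by blast
qed

lemma rep_deriv:"smooth_chart M e ==> x : fst e ==> dio x (chart_deriv M e x v) = fder (rep e) (snd e x) v"
	by (rule mderiv_chart[OF _ _ rep_smooth])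

lemma rep_has_derivative:"smooth_chart M e ==> x : fst e ==> (rep e has_derivative fder (rep e) (snd e x)) (at (snd e x))"
	by (rule sm_hd[OF chart_image_open[OF is_chart] rep_smooth]) auto

lemma inj_rep_deriv:
	assumes e:"smooth_chart M e" and x:"x : fst e"
	shows "inj (fder (rep e) (snd e x))"
proof (rule injI)
	fix v w assume "fder (rep e) (snd e x) v = fder (rep e) (snd e x) w"
	hence "dio x (chart_deriv M e x v) = dio x (chart_deriv M e x w)" by (simp add:rep_deriv[OF e x])
	moreover have "inj (dio x)" using emb chart_subset[OF e] x unfolding smooth_embedding_def by blast
	ultimately have "chart_deriv M e x v = chart_deriv M e x w" by (simp add:inj_eq)
	thus "v = w" using bij_is_inj[OF bij_chart_deriv[OF e x]] by (simp add:inj_eq)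
qed

lemma homeomorphic_io:"homeomorphic_map (mtop M) (top_of_set (io ` points M)) io"
	using emb unfolding smooth_embedding_def embedding_map_def atlas_euclidean by simp

lemma inj_io:"inj_on io (points M)"
	using homeomorphic_imp_injective_map[OF homeomorphic_io] .

lemma open_image:
	assumes "openin (mtop M) Z"
	shows "EX U. open U & io ` Z = io ` points M Int U"
	using homeomorphic_imp_open_map[OF homeomorphic_io] assms unfolding open_map_def openin_open by blast

text \<open>The coordinates of \<open>e\<close>, extended to an open set of the ambient space. The
  last condition also excludes parts of M outside the chart from coming back into
  \<open>U\<close>.\<close>

definition retr :: "('a,'e) chart => 'b set => ('b => 'e) => bool" where
	"retr e U r \<longleftrightarrow> open U & smooth_on U r & r ` U \<subseteq> snd e ` fst e & (ALL x:points M. io x : U --> x : fst e & r (io x) = snd e x)"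

text \<open>With \<open>P\<close> a left inverse of the derivative, \<open>P\<close> after
  \<open>rep e\<close> is a local diffeomorphism, and its inverse after \<open>P\<close> extends the
  coordinates. That the embedding is a homeomorphism onto its image keeps other parts of M out of
  \<open>U\<close>.\<close>

lemma retr_exists:
	assumes e:"smooth_chart M e" and x:"x : fst e"
	shows "EX U r. retr e U r & io x : U"
proof -
	note o = img_open[OF e]
	have p:"snd e x : snd e ` fst e" using x by blast
	have linD:"linear (fder (rep e) (snd e x))" by (rule sm_linear_fder[OF o rep_smooth[OF e] p])
	obtain P where P:"linear P" "P o fder (rep e) (snd e x) = id"
	using linear_injective_left_inverse[OF linD inj_rep_deriv[OF e x]] by blast
	define ta where "ta q = P (rep e q)" for q
	have sta:"smooth_on (snd e ` fst e) ta" unfolding ta_def[abs_def] by (rule sm_linear_compose[OF o P(1) rep_smooth[OF e]])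
	have "(ta has_derivative (%h. P (fder (rep e) (snd e x) h))) (at (snd e x))" unfolding ta_def[abs_def]
	by (rule has_derivative_compose[OF rep_has_derivative[OF e x] linear_imp_has_derivative[OF P(1)]])
	from frechet_derivative_at[OF this] have "fder ta (snd e x) = id" using P(2) by (simp add:comp_def)
	hence inj:"inj (fder ta (snd e x))" by simp
	obtain U' V g where g:"open U'" "U' \<subseteq> snd e ` fst e" "snd e x : U'" "open V" "ta (snd e x) : V" "homeomorphism U' V ta g" "smooth_on V g"
	by (rule smooth_inverse_function[OF o sta p inj]) (rule that; blast)
	define Z where "Z = {y : fst e. snd e y : U'}"
	have "openin (mtop M) Z" unfolding Z_def by (rule chart_preimage_open[OF is_chart[OF e] g(1)])
	then obtain O2 where O2:"open O2" "io ` Z = io ` points M Int O2" using open_image by blast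
	define U where "U = P -` V Int O2"
	define r where "r y = g (P y)" for y
	have oU:"open U" unfolding U_def
	by (rule open_Int[OF open_vimage[OF g(4) linear_continuous_on[OF linear_conv_bounded_linear[THEN iffD1,OF P(1)]]] O2(1)])
	have "smooth_on U r" unfolding r_def[abs_def]
	by (rule sm_compose[OF oU g(4) sm_linear[OF P(1)] g(7)]) (auto simp:U_def)
	moreover have "r ` U \<subseteq> snd e ` fst e" using g(2,6) unfolding U_def r_def homeomorphism_def by blast
	moreover have "y : fst e & r (io y) = snd e y" if y:"y : points M" "io y : U" for y
	proof -
	have "io y : io ` Z" using O2(2) y unfolding U_def by blast
	hence "y : Z" using inj_io y(1) chart_subset[OF e] unfolding Z_def by (auto dest!: inj_onD)
	hence "y : fst e" "snd e y : U'" by (auto simp:Z_def)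
	thus ?thesis using homeomorphism_apply1[OF g(6),of "snd e y"] by (simp add:r_def ta_def inv_chart[OF e])
	qed
	moreover have "io x : U" using g(3,5) O2(2) x chart_subset[OF e] by (auto simp:U_def Z_def ta_def inv_chart[OF e])
	ultimately show ?thesis using oU unfolding retr_def by blast
qed

lemma retr_deriv:
	assumes e:"smooth_chart M e" and r:"retr e U r" and x:"x : points M" "io x : U"
	shows "fder r (io x) (fder (rep e) (snd e x) v) = v"
proof -
	have xe:"x : fst e" using r x by (auto simp:retr_def)
	have U:"open U" "smooth_on U r" using r by (auto simp:retr_def)
	note o = img_open[OF e]
	have i:"rep e (snd e x) = io x" by (simp add:inv_chart[OF e xe])
	have "((%p. r (rep e p)) has_derivative (%v. fder r (io x) (fder (rep e) (snd e x) v))) (at (snd e x))"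
	by (rule has_derivative_compose[OF rep_has_derivative[OF e xe]]) (use sm_hd[OF U x(2)] i in simp)
	moreover have "open (snd e ` fst e Int rep e -` U)"
	by (rule continuous_open_preimage[OF sm_cont[OF rep_smooth[OF e]] o U(1)])
	moreover have "snd e x : snd e ` fst e Int rep e -` U" using xe x(2) i by simp
	moreover have "r (rep e p) = p" if p:"p : snd e ` fst e Int rep e -` U" for p
	proof -
	have "chart_inv e p : points M" using chart_inv_into[of p e] p chart_subset[OF e] by blast
	thus ?thesis using r p chart_chart_inv[of p e] unfolding retr_def by auto
	qed
	ultimately have "((%p. p) has_derivative (%v. fder r (io x) (fder (rep e) (snd e x) v))) (at (snd e x))"
	by (rule hd_transform)
	from has_derivative_unique[OF this has_derivative_ident] show ?thesis by (rule fun_cong)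
qed

text \<open>Near \<open>io x\<close> the image of M is filled by the compact image of a coordinate
  ball, because the embedding is open onto its image. This provides compact supports for the local
  pieces of the Hamiltonian.\<close>

lemma locally_compact_image:
	assumes x:"x : points M"
	shows "EX rh>0. compact (cball (io x) rh Int io ` points M)"
proof -
	obtain e where e':"e : atlas M" "x : fst e" using exists_atlas_chart[OF x] by blast
	note e = atlas_smooth_chart[OF e'(1)]
	note o = img_open[OF e]
	obtain si where si:"si > 0" "cball (snd e x) si \<subseteq> snd e ` fst e" using open_contains_cball o e'(2) by blast
	define Z where "Z = {y : fst e. snd e y : ball (snd e x) si}"
	have "openin (mtop M) Z" unfolding Z_def by (rule chart_preimage_open[OF is_chart[OF e] open_ball])
	then obtain U where U:"open U" "io ` Z = io ` points M Int U" using open_image by blast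
	have "io x : U" using U(2) x e'(2) si(1) by (auto simp:Z_def)
	then obtain rh where rh:"rh > 0" "cball (io x) rh \<subseteq> U" using open_contains_cball U(1) by blast
	have K:"compact (rep e ` cball (snd e x) si)"
	by (rule compact_continuous_image[OF continuous_on_subset[OF sm_cont[OF rep_smooth[OF e]] si(2)] compact_cball])
	have KM:"rep e ` cball (snd e x) si \<subseteq> io ` points M"
	by (intro image_subsetI imageI subsetD[OF chart_subset[OF e] chart_inv_into[OF subsetD[OF si(2)]]])
	have ZK:"io ` Z \<subseteq> rep e ` cball (snd e x) si"
	proof
	fix y assume "y : io ` Z"
	then obtain w where w:"w : fst e" "snd e w : ball (snd e x) si" "y = io w" by (auto simp:Z_def)
	hence "y = rep e (snd e w)" "snd e w : cball (snd e x) si" using inv_chart[OF e w(1)] by auto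
	thus "y : rep e ` cball (snd e x) si" by blast
	qed
	have "cball (io x) rh Int io ` points M = cball (io x) rh Int rep e ` cball (snd e x) si"
	proof (intro equalityI subsetI)
	fix y assume y:"y : cball (io x) rh Int io ` points M"
	hence "y : io ` points M Int U" using subsetD[OF rh(2)] by simp
	hence "y : io ` Z" unfolding U(2) .
	from subsetD[OF ZK this] y show "y : cball (io x) rh Int rep e ` cball (snd e x) si" by simp
	next
	fix y assume y:"y : cball (io x) rh Int rep e ` cball (snd e x) si"
	thus "y : cball (io x) rh Int io ` points M" using subsetD[OF KM,of y] by simp
	qed
	thus ?thesis using K rh(1) by (intro exI[of _ rh]) (simp add:compact_Int closed_cball Int_commute compact_Int_closed)
qed

end

section \<open>Extending the Morse function and its Hamiltonian vector field\<close>

text \<open>Equal to \<open>1 / s\<close> for \<open>s\<close> at least 2/3 and to 0 for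
  \<open>s\<close> at most 1/3: division by a sum of bump functions is exact where the sum is at
  least 1 and smooth everywhere.\<close>

definition cutoff_inverse :: "real => real" where "cutoff_inverse s = smooth_step (3 * s - 1) / s"

lemma cutoff_inverse_eq:"s >= 2 / 3 ==> cutoff_inverse s = 1 / s"
	by (simp add:cutoff_inverse_def smooth_step_simps(2))

lemma smooth_cutoff_inverse:"smooth_on UNIV cutoff_inverse"
proof (rule sm_local)
	fix x :: real
	show "EX U. open U & x : U & smooth_on U cutoff_inverse"
	proof (cases "x > 0")
	case True
	have "smooth_on {0<..} (%s::real. 3 * s - 1)"
	by (rule sm_diff[OF open_greaterThan sm_mult[OF open_greaterThan sm_const sm_id] sm_const])
	hence "smooth_on {0<..} (%s. smooth_step (3 * s - 1))"
	by (rule sm_compose[OF open_greaterThan open_UNIV _ sm_smooth_step]) simp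
	hence "smooth_on {0<..} cutoff_inverse" unfolding cutoff_inverse_def[abs_def]
	by (rule sm_divide[OF open_greaterThan _ sm_id]) simp
	thus ?thesis using True by (intro exI[of _ "{0<..}"]) simp
	next
	case False
	have "smooth_on {..<1 / 3} cutoff_inverse"
	by (rule sm_cong[OF open_lessThan _ sm_const[of _ 0]]) (simp add:cutoff_inverse_def smooth_step_simps(1))
	thus ?thesis using False by (intro exI[of _ "{..<1 / 3}"]) simp
	qed
qed

lemma fder_zero_on_open:
	assumes "open U" "x : U" "!!y. y : U ==> f y = 0"
	shows "fder f x = (%_. 0)"
proof -
	have "(f has_derivative (%_. 0)) (at x)"
	by (rule hd_transform[OF has_derivative_const[of 0] assms(1,2)]) (simp add:assms(3))
	from frechet_derivative_at[OF this] show ?thesis by simp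
qed

locale setting = regular_coisotropic M om N + embedded_mfd M io
	for M :: "('a,'e::euclidean_space) manifold" and om N and io :: "'a => 'b::euclidean_space" +
	fixes f :: "'a => real"
	assumes hausdorff:"Hausdorff_space (mtop M)" and morse:"morse_function M N f"
begin

abbreviation df :: "'a => 'e => real" where "df x == submanifold_deriv M N f x"

lemma smooth_f:"smooth_map_on M euc N f"
	using morse by (simp add:morse_function_def)

lemma compact_ioN:"compact (io ` N)"
proof -
	have "compactin (top_of_set (io ` points M)) (io ` N)"
	by (rule image_compactin[OF compact_N homeomorphic_imp_continuous_map[OF homeomorphic_io]])
	thus ?thesis by (simp add:compactin_subtopology)
qed

text \<open>The last condition, which passes to sums, says that the differential of \<open>T / S\<close> on \<open>N\<close> is controlled by its
	restriction to the tangent space of \<open>N\<close>.\<close>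
definition glue :: "'b set \<Rightarrow> ('b \<Rightarrow> real) \<Rightarrow> ('b \<Rightarrow> real) \<Rightarrow> 'b set \<Rightarrow> real \<Rightarrow> bool" where
	"glue A S T K0 C \<longleftrightarrow> smooth_on UNIV S \<and> smooth_on UNIV T \<and> compact K0 \<and> K0 \<subseteq> io ` points M \<and>
	(\<forall>x\<in>points M. io x \<notin> K0 \<longrightarrow> S (io x) = 0 \<and> T (io x) = 0) \<and> (\<forall>y. 0 \<le> S y) \<and> (\<forall>y\<in>A. 1 \<le> S y) \<and>
	(\<forall>x\<in>N. T (io x) = f x * S (io x)) \<and> 0 \<le> C \<and>
	(\<forall>x\<in>N. \<forall>m\<ge>0. (\<forall>w\<in>tangent_space M N x. \<bar>df x w\<bar> \<le> m * norm (dio x w)) \<longrightarrow>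
	(\<forall>u. \<bar>fder T (io x) u - f x * fder S (io x) u\<bar> \<le> C * m * norm u))"

lemma glue_union:
	assumes 1:"glue A1 S1 T1 K1 C1" and 2:"glue A2 S2 T2 K2 C2"
	shows "glue (A1 Un A2) (%y. S1 y + S2 y) (%y. T1 y + T2 y) (K1 Un K2) (C1 + C2)"
proof -
	have d:"fder (%y. g1 y + g2 y) y u = fder g1 y u + fder g2 y u"
	if "smooth_on UNIV g1" "smooth_on UNIV g2" for g1 g2 :: "'b => real" and y u
	proof -
	have "((%y. g1 y + g2 y) has_derivative (%u. fder g1 y u + fder g2 y u)) (at y)"
	by (rule has_derivative_add[OF sm_hd[OF open_UNIV that(1)] sm_hd[OF open_UNIV that(2)]]) auto
	from fder_eq[OF this,of u] show ?thesis by simp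
	qed
	note g1 = 1[unfolded glue_def] and g2 = 2[unfolded glue_def]
	have s:"smooth_on UNIV S1" "smooth_on UNIV T1" "smooth_on UNIV S2" "smooth_on UNIV T2" using g1 g2 by auto
	have "\<bar>fder (%y. T1 y + T2 y) (io x) u - f x * fder (%y. S1 y + S2 y) (io x) u\<bar> <= (C1 + C2) * m * norm u"
	if x:"x : N" "m >= 0" "ALL w:tangent_space M N x. \<bar>df x w\<bar> <= m * norm (dio x w)" for x m u
	proof -
	have "\<bar>fder T1 (io x) u - f x * fder S1 (io x) u\<bar> <= C1 * m * norm u" "\<bar>fder T2 (io x) u - f x * fder S2 (io x) u\<bar> <= C2 * m * norm u"
	using g1 g2 x by blast+
	thus ?thesis unfolding d[OF s(2,4)] d[OF s(1,3)] by (simp add:algebra_simps)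
	qed
	moreover have "1 <= S1 y + S2 y" if "y : A1 Un A2" for y
	proof -
	have "0 <= S1 y" "0 <= S2 y" "1 <= S1 y | 1 <= S2 y" using g1 g2 that by blast+
	thus ?thesis by linarith
	qed
	moreover have "ALL x:N. T1 (io x) + T2 (io x) = f x * (S1 (io x) + S2 (io x))" using g1 g2 by (simp add:distrib_left)
	ultimately show ?thesis unfolding glue_def
	using g1 g2 sm_add[OF open_UNIV s(1,3)] sm_add[OF open_UNIV s(2,4)] by (simp add:compact_Un)
qed

text \<open>The extension \<open>F (proj L (r y))\<close> of \<open>f\<close> depends only on the
  part of the coordinates along \<open>L\<close>. Its differential in the direction \<open>u\<close>
  is therefore df on a tangent vector of N whose image in the ambient space is
  \<open>fder ka (io x) u\<close>, of norm at most \<open>a * norm u\<close>. By the product rule,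
  \<open>fder T - f x * fder S\<close> is \<open>S\<close> times that differential.\<close>

lemma glue_local:
	assumes x0:"x0 : N"
	shows "EX rh>0. EX S T K0 C. glue (ball (io x0) rh) S T K0 C"
proof -
	have x0M:"x0 : points M" using x0 N_subset by blast
	obtain c L where sl:"slice c L" "x0 : fst c" using exists_slice[OF x0] by blast
	note cs = slice_smooth[OF sl(1)] and L = slice_subspace[OF sl(1)]
	obtain U r where r:"retr c U r" "io x0 : U" using retr_exists[OF cs sl(2)] by blast
	have U:"open U" "smooth_on U r" and rv:"!!x. x : points M ==> io x : U ==> x : fst c & r (io x) = snd c x"
	using r(1) by (auto simp:retr_def)
	obtain W F where W:"open W" "snd c x0 : W" "W \<subseteq> img c" "smooth_on W F" "ALL p:W. chart_inv c p : N --> F p = f (chart_inv c p)"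
	using smooth_map_on_chart[OF smooth_f cs x0 sl(2)] by blast
	have pr:"smooth_on U (%y. proj L (r y))" by (rule sm_linear_compose[OF U(1) linear_proj[OF L] U(2)])
	define U' where "U' = U Int (%y. proj L (r y)) -` W"
	have U':"open U'" unfolding U'_def by (rule continuous_open_preimage[OF sm_cont[OF pr] U(1) W(1)])
	have pN:"r (io x) = snd c x" "proj L (snd c x) = snd c x" "x : fst c" if "x : N" "io x : U" for x
	using rv[of x] that N_subset slice_iff[OF sl(1),of x] proj_id[OF L] by auto
	have "io x0 : U'" using r(2) pN[OF x0 r(2)] W(2) by (simp add:U'_def)
	then obtain rh1 where rh1:"rh1 > 0" "ball (io x0) rh1 \<subseteq> U'" using U' open_contains_ball by blast
	obtain rh2 where rh2:"rh2 > 0" "compact (cball (io x0) rh2 Int io ` points M)" using locally_compact_image[OF x0M] by blast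
	define rh where "rh = min (rh1 / 3) (rh2 / 2)"
	have rh:"rh > 0" "ball (io x0) (3 * rh) \<subseteq> U'" "2 * rh <= rh2" using rh1 rh2(1) by (auto simp:rh_def min_def)
	have pr':"smooth_on U' (%y. proj L (r y))" by (rule sm_subset[OF pr]) (auto simp:U'_def)
	define g where "g y = F (proj L (r y))" for y
	define ka where "ka y = rep c (proj L (r y))" for y
	have sg:"smooth_on U' g" unfolding g_def[abs_def] by (rule sm_compose[OF U' W(1) pr' W(4)]) (auto simp:U'_def)
	have ska:"smooth_on U' ka" unfolding ka_def[abs_def]
	by (rule sm_compose[OF U' img_open[OF cs] pr' rep_smooth[OF cs]]) (use W(3) in \<open>auto simp:U'_def\<close>)
	have cb:"cball (io x0) (2 * rh) \<subseteq> U'" using rh by (force simp:subset_iff)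
	obtain a where a:"a > 0" "!!y u. y : cball (io x0) (2 * rh) ==> norm (fder ka y u) <= a * norm u"
	by (rule fder_bounded_on_compact[OF U' ska compact_cball cb]) (rule that; blast)
	define S where "S y = bump (io x0) rh y" for y
	define T where "T y = S y * g y" for y
	have sS:"smooth_on UNIV S" unfolding S_def[abs_def] by (rule sm_bump)
	have sT:"smooth_on UNIV T" unfolding T_def[abs_def] S_def
	using bump_extend[OF rh(1) sm_subset[OF sg rh(2)]] by simp
	have S0:"S y = 0" if "y ~: cball (io x0) (2 * rh)" for y
	using that bump_eq_0[OF rh(1),where y = y and a = "io x0"] by (simp add:S_def dist_commute)
	have gx:"g (io x) = f x" "proj L (r (io x)) = snd c x" "x : fst c" "snd c x : W" if x:"x : N" "io x : cball (io x0) (2 * rh)" for x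
	proof -
	have y:"io x : U'" using x(2) cb by blast
	hence yU:"io x : U" by (simp add:U'_def)
	show e:"proj L (r (io x)) = snd c x" "x : fst c" using pN[OF x(1) yU] by auto
	show w:"snd c x : W" using y e by (simp add:U'_def)
	show "g (io x) = f x" using bspec[OF W(5) w] x(1) inv_chart[OF cs e(2)] by (simp add:g_def e)
	qed
	have "glue (ball (io x0) rh) S T (cball (io x0) (2 * rh) Int io ` points M) a"
	unfolding glue_def
	proof (intro conjI ballI allI impI)
	have "cball (io x0) (2 * rh) Int io ` points M = cball (io x0) (2 * rh) Int (cball (io x0) rh2 Int io ` points M)"
	using rh(3) by auto
	thus "compact (cball (io x0) (2 * rh) Int io ` points M)" using compact_Int[OF compact_cball rh2(2)] by simp
	show "0 <= S y" for y using bump_bounds by (simp add:S_def)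
	show "1 <= S y" if "y : ball (io x0) rh" for y
	using that bump_eq_1[OF rh(1),where y = y and a = "io x0"] by (simp add:S_def dist_commute)
	show "S (io x) = 0" "T (io x) = 0" if "x : points M" "io x ~: cball (io x0) (2 * rh) Int io ` points M" for x
	using S0[of "io x"] that by (auto simp:T_def)
	show "T (io x) = f x * S (io x)" if "x : N" for x
	using S0[of "io x"] gx(1)[OF that] by (cases "io x : cball (io x0) (2 * rh)") (auto simp:T_def)
	fix x m u assume x:"x : N" "m >= (0 :: real)" "ALL w:tangent_space M N x. \<bar>df x w\<bar> <= m * norm (dio x w)"
	show "\<bar>fder T (io x) u - f x * fder S (io x) u\<bar> <= a * m * norm u"
	proof (cases "io x : cball (io x0) (2 * rh)")
	case True
	note g = gx[OF x(1) True]
	have y:"io x : U'" using True cb by blast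
	hence yU:"io x : U" by (simp add:U'_def)
	have xp:"snd c x : L" using slice_iff[OF sl(1) g(3)] x(1) by blast
	have Sd:"(S has_derivative fder S (io x)) (at (io x))" by (rule sm_hd[OF open_UNIV sS]) simp
	have gd:"(g has_derivative fder g (io x)) (at (io x))" by (rule sm_hd[OF U' sg y])
	have "(T has_derivative (%u. S (io x) * fder g (io x) u + fder S (io x) u * g (io x))) (at (io x))"
	unfolding T_def[abs_def] by (rule has_derivative_mult[OF Sd gd])
	from fder_eq[OF this,of u,symmetric]
	have Td:"fder T (io x) u - f x * fder S (io x) u = S (io x) * fder g (io x) u" by (simp add:g(1))
	have qd:"((%y. proj L (r y)) has_derivative (%u. proj L (fder r (io x) u))) (at (io x))"
	by (rule has_derivative_compose[OF sm_hd[OF U yU] linear_imp_has_derivative[OF linear_proj[OF L]]])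
	define l where "l = proj L (fder r (io x) u)"
	have lL:"l : L" by (simp add:l_def proj_in[OF L])
	have "(g has_derivative (%u. fder F (snd c x) (proj L (fder r (io x) u)))) (at (io x))" unfolding g_def[abs_def]
	by (rule has_derivative_compose[OF qd]) (use sm_hd[OF W(1,4) g(4)] g(2) in simp)
	from fder_eq[OF this,of u] have gl:"fder g (io x) u = fder F (snd c x) l" by (simp add:l_def)
	have "(ka has_derivative (%u. fder (rep c) (snd c x) (proj L (fder r (io x) u)))) (at (io x))" unfolding ka_def[abs_def]
	by (rule has_derivative_compose[OF qd]) (use rep_has_derivative[OF cs g(3)] g(2) in simp)
	from fder_eq[OF this,of u] have kal:"fder ka (io x) u = fder (rep c) (snd c x) l" by (simp add:l_def)
	have t:"chart_deriv M c x l : tangent_space M N x" using tangent_space_slice[OF sl(1) g(3) x(1)] lL by blast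
	have "fder F (snd c x) l = df x (chart_deriv M c x l)"
	by (rule submanifold_deriv_chart[OF cs g(3) W(1) g(4) W(4,5) t refl,symmetric])
	hence "\<bar>fder g (io x) u\<bar> <= m * norm (dio x (chart_deriv M c x l))" using bspec[OF x(3) t] gl by simp
	also have "... = m * norm (fder ka (io x) u)" by (simp add:rep_deriv[OF cs g(3)] kal)
	also have "... <= m * (a * norm u)" by (rule mult_left_mono[OF a(2)[OF True] x(2)])
	finally have "\<bar>S (io x)\<bar> * \<bar>fder g (io x) u\<bar> <= 1 * (m * (a * norm u))"
	by (intro mult_mono) (use bump_bounds[of "io x0" rh "io x"] in \<open>auto simp:S_def\<close>)
	thus ?thesis unfolding Td abs_mult by (simp add:mult_ac)
	next
	case False
	have o:"open (- cball (io x0) (2 * rh))" by (simp add:open_Compl)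
	have "fder S (io x) = (%_. 0)" by (rule fder_zero_on_open[OF o]) (use False S0 in auto)
	moreover have "fder T (io x) = (%_. 0)" by (rule fder_zero_on_open[OF o]) (use False S0 in \<open>auto simp:T_def\<close>)
	ultimately show ?thesis using a(1) x(2) by simp
	qed
	qed (use sS sT a(1) in auto)
	thus ?thesis using rh(1) by blast
qed

text \<open>On N the quotient \<open>T / S\<close> is \<open>f\<close>, and its differential is
  \<open>fder T - f x * fder S\<close> divided by \<open>S\<close>, which is at least 1: exactly the
  combination that \<open>glue\<close> controls.\<close>

lemma hamiltonian_exists:
	"EX h K0 C. smooth_on UNIV h & compact K0 & K0 \<subseteq> io ` points M & (ALL x:points M. io x ~: K0 --> h (io x) = 0) &
	(ALL x:N. h (io x) = f x) & 0 <= C &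
	(ALL x:N. ALL m>=0. (ALL w:tangent_space M N x. \<bar>df x w\<bar> <= m * norm (dio x w)) --> (ALL u. \<bar>fder h (io x) u\<bar> <= C * m * norm u))"
proof -
	have "EX S T K0 C. glue (io ` N) S T K0 C"
	proof (rule compact_union_induct[OF compact_ioN,where Q = "%A. EX S T K0 C. glue A S T K0 C"])
	have "glue {} (%_. 0) (%_. 0) {} 0" by (simp add:glue_def sm_const)
	thus "EX S T K0 C. glue {} S T K0 C" by blast
	next
	fix A B assume "EX S T K0 C. glue A S T K0 C" "EX S T K0 C. glue B S T K0 C"
	thus "EX S T K0 C. glue (A Un B) S T K0 C" by (elim exE) (rule exI,rule exI,rule exI,rule exI,rule glue_union)
	next
	fix A B assume s:"A \<subseteq> B" and "EX S T K0 C. glue B S T K0 C"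
	then obtain S T K0 C where "glue B S T K0 C" by (elim exE)
	hence "glue A S T K0 C" unfolding glue_def using s by blast
	thus "EX S T K0 C. glue A S T K0 C" by blast
	next
	show "ALL y:io ` N. EX U. open U & y : U & (EX S T K0 C. glue U S T K0 C)"
	proof
	fix y assume "y : io ` N"
	then obtain x where x:"x : N" "y = io x" by blast
	obtain rh where "rh > 0" "EX S T K0 C. glue (ball (io x) rh) S T K0 C" using glue_local[OF x(1)] by blast
	thus "EX U. open U & y : U & (EX S T K0 C. glue U S T K0 C)" using x(2) by (intro exI[of _ "ball y rh"]) simp
	qed
	qed
	then obtain S T K0 C where g:"glue (io ` N) S T K0 C" by (elim exE)
	note g' = g[unfolded glue_def]
	have s:"smooth_on UNIV S" "smooth_on UNIV T" using g' by auto
	define h where "h y = T y * cutoff_inverse (S y)" for y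
	have "smooth_on UNIV (%y. cutoff_inverse (S y))"
	by (rule sm_compose[OF open_UNIV open_UNIV s(1) smooth_cutoff_inverse]) simp
	from sm_mult[OF open_UNIV s(2) this] have "smooth_on UNIV h" by (simp add:h_def[abs_def])
	moreover have S1:"1 <= S (io x)" "T (io x) = f x * S (io x)" if "x : N" for x using g' that by blast+
	moreover have "h (io x) = f x" if "x : N" for x using S1[OF that] by (simp add:h_def cutoff_inverse_eq)
	moreover have "\<bar>fder h (io x) u\<bar> <= C * m * norm u"
	if x:"x : N" "m >= 0" "ALL w:tangent_space M N x. \<bar>df x w\<bar> <= m * norm (dio x w)" for x m u
	proof -
	have Sd:"(S has_derivative fder S (io x)) (at (io x))" and Td:"(T has_derivative fder T (io x)) (at (io x))"
	by (rule sm_hd[OF open_UNIV s(1)],simp,rule sm_hd[OF open_UNIV s(2)],simp)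
	have ne:"S (io x) ~= 0" using S1(1)[OF x(1)] by simp
	have "((%y. T y / S y) has_derivative
	(%u. (fder T (io x) u * S (io x) - T (io x) * fder S (io x) u) / (S (io x) * S (io x)))) (at (io x))"
	by (rule has_derivative_divide'[OF Td Sd ne])
	moreover have "open (S -` {2 / 3<..})" by (rule open_vimage[OF open_greaterThan sm_cont[OF s(1)]])
	moreover have "io x : S -` {2 / 3<..}" using S1(1)[OF x(1)] by simp
	moreover have "T y / S y = h y" if "y : S -` {2 / 3<..}" for y using that by (simp add:h_def cutoff_inverse_eq)
	ultimately have "(h has_derivative
	(%u. (fder T (io x) u * S (io x) - T (io x) * fder S (io x) u) / (S (io x) * S (io x)))) (at (io x))"
	by (rule hd_transform)
	from fder_eq[OF this,of u]
	have "fder h (io x) u = (fder T (io x) u * S (io x) - T (io x) * fder S (io x) u) / (S (io x) * S (io x))" by simp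
	also have "... = (fder T (io x) u - f x * fder S (io x) u) / S (io x)" using ne S1(2)[OF x(1)] by (simp add:field_simps)
	finally have "\<bar>fder h (io x) u\<bar> = \<bar>fder T (io x) u - f x * fder S (io x) u\<bar> / S (io x)" using S1(1)[OF x(1)] by simp
	also have "... <= \<bar>fder T (io x) u - f x * fder S (io x) u\<bar> / 1" using S1(1)[OF x(1)] by (intro divide_left_mono) auto
	also have "... <= C * m * norm u" using g' x by simp
	finally show ?thesis .
	qed
	ultimately show ?thesis using g' by (intro exI[of _ h] exI[of _ K0] exI[of _ C]) (simp add:h_def)
qed

text \<open>Local extensions through \<open>retr\<close> are added up with weights \<open>S\<close>.
  Division by \<open>S\<close> is possible on \<open>K0\<close>, and elsewhere on M the field is 0,
  so the cut-off in \<open>cutoff_inverse\<close> does no harm. The Hamiltonian equation can now be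
  solved in the ambient space.\<close>

lemma extension_exists:
	assumes h:"smooth_on UNIV h" and K0:"compact K0" and h0:"ALL x:points M. io x ~: K0 --> h (io x) = 0"
	and K0M:"K0 \<subseteq> io ` points M"
	shows "EX V C0. smooth_on UNIV V & compact C0 & (ALL y. y ~: C0 --> V y = 0) &
	(ALL x:points M. V (io x) = dio x (ham_vector_field M om (%x. h (io x)) x)) & (ALL x:points M. io x ~: K0 --> V (io x) = 0)"
proof -
	define Y where "Y x = dio x (ham_vector_field M om (%x. h (io x)) x)" for x
	have hc:"smooth_on (img c) (%p. h (rep c p))" if "smooth_chart M c" for c
	by (rule sm_compose[OF img_open[OF that] open_UNIV rep_smooth[OF that] h]) simp
	\<comment> \<open>Off the closed set \<open>K0\<close> the function vanishes near \<open>x\<close>,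
	  so its differential is 0, and with it the Hamiltonian vector.\<close>
	have Y0:"Y x = 0" if x:"x : points M" "io x ~: K0" for x
	proof -
	obtain c where c:"c : atlas M" "x : fst c" using exists_atlas_chart[OF x(1)] by blast
	note cs = atlas_smooth_chart[OF c(1)]
	note o = img_open[OF cs]
	have p:"snd c x : img c" using c(2) by blast
	obtain X where X:"ALL p:img c. ALL w. form c p (X p) w = fder (%p. h (rep c p)) p w"
	"ALL x:fst c. ham_vector_field M om (%x. h (io x)) x = chart_deriv M c x (X (snd c x))"
	using ham_field_chart[OF cs hc[OF cs]] by blast
	have "open (- K0)" using compact_imp_closed[OF K0] by (simp add:open_Compl)
	hence "open (img c Int rep c -` (- K0))" by (rule continuous_open_preimage[OF sm_cont[OF rep_smooth[OF cs]] o])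
	moreover have "snd c x : img c Int rep c -` (- K0)" using p x(2) inv_chart[OF cs c(2)] by simp
	moreover have "h (rep c q) = 0" if "q : img c Int rep c -` (- K0)" for q
	using h0 that chart_inv_into[of q c] chart_subset[OF cs] by blast
	ultimately have "fder (%p. h (rep c p)) (snd c x) = (%_. 0)" by (rule fder_zero_on_open)
	hence z:"ALL w. \<bar>form c (snd c x) (X (snd c x)) w\<bar> <= 0 * norm w" using bspec[OF X(1) p] by simp
	have "EX C>0. ALL p:{snd c x}. (ALL v w. \<bar>form c p v w\<bar> <= C * norm v * norm w) & (ALL v. ALL m. (ALL w. \<bar>form c p v w\<bar> <= m * norm w) --> norm v <= C * m)"
	by (rule form_bounds[OF cs]) (use p in auto)
	then obtain C where "norm (X (snd c x)) <= C * 0" using z by blast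
	hence "ham_vector_field M om (%x. h (io x)) x = chart_deriv M c x 0" using X(2) c(2) by simp
	hence "Y x = dio x (chart_deriv M c x 0)" by (simp add:Y_def)
	also have "... = 0" unfolding rep_deriv[OF cs c(2)] by (rule linear_0[OF sm_linear_fder[OF o rep_smooth[OF cs] p]])
	finally show ?thesis .
	qed
	define Q where "Q A = (EX V S C0. smooth_on UNIV V & smooth_on UNIV S & compact C0 & (ALL y. y ~: C0 --> V y = (0 :: 'b)) &
	(ALL y. 0 <= S y) & (ALL y:A. 1 <= S y) & (ALL x:points M. V (io x) = S (io x) *\<^sub>R Y x))" for A
	have "Q K0"
	proof (rule compact_union_induct[OF K0,where Q = Q])
	show "Q {}" unfolding Q_def
	by (rule exI[of _ "%_. 0"],rule exI[of _ "%_. 0"],rule exI[of _ "{}"]) (simp add:sm_const)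
	next
	fix A B assume "Q A" "Q B"
	then obtain V1 S1 C1 V2 S2 C2 where 1:"smooth_on UNIV V1" "smooth_on UNIV S1" "compact C1" "ALL y. y ~: C1 --> V1 y = 0"
	"ALL y. 0 <= S1 y" "ALL y:A. 1 <= S1 y" "ALL x:points M. V1 (io x) = S1 (io x) *\<^sub>R Y x"
	and 2:"smooth_on UNIV V2" "smooth_on UNIV S2" "compact C2" "ALL y. y ~: C2 --> V2 y = 0"
	"ALL y. 0 <= S2 y" "ALL y:B. 1 <= S2 y" "ALL x:points M. V2 (io x) = S2 (io x) *\<^sub>R Y x"
	unfolding Q_def by (elim exE conjE) (rule that,assumption+)
	have "1 <= S1 y + S2 y" if "y : A Un B" for y
	proof -
	have "0 <= S1 y" "0 <= S2 y" "1 <= S1 y | 1 <= S2 y" using 1 2 that by blast+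
	thus ?thesis by linarith
	qed
	thus "Q (A Un B)" unfolding Q_def
	using 1 2 sm_add[OF open_UNIV 1(1) 2(1)] sm_add[OF open_UNIV 1(2) 2(2)]
	by (intro exI[of _ "%y. V1 y + V2 y"] exI[of _ "%y. S1 y + S2 y"] exI[of _ "C1 Un C2"]) (simp add:compact_Un scaleR_left_distrib)
	next
	fix A B assume s:"A \<subseteq> B" and "Q B"
	then obtain V S C0 where "smooth_on UNIV V" "smooth_on UNIV S" "compact C0" "ALL y. y ~: C0 --> V y = 0"
	"ALL y. 0 <= S y" "ALL y:B. 1 <= S y" "ALL x:points M. V (io x) = S (io x) *\<^sub>R Y x"
	unfolding Q_def by (elim exE conjE) (rule that,assumption+)
	thus "Q A" unfolding Q_def using s
	by (intro exI[of _ V] exI[of _ S] exI[of _ C0]) auto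
	next
	show "ALL y:K0. EX U. open U & y : U & Q U"
	proof
	fix y assume "y : K0"
	then obtain x0 where x0:"x0 : points M" "y = io x0" using K0M by blast
	obtain c where c:"c : atlas M" "x0 : fst c" using exists_atlas_chart[OF x0(1)] by blast
	note cs = atlas_smooth_chart[OF c(1)]
	note o = img_open[OF cs]
	obtain X where X:"smooth_on (img c) X" "ALL x:fst c. ham_vector_field M om (%x. h (io x)) x = chart_deriv M c x (X (snd c x))"
	using ham_field_chart[OF cs hc[OF cs]] by blast
	obtain U r where r:"retr c U r" "io x0 : U" using retr_exists[OF cs c(2)] by blast
	have U:"open U" "smooth_on U r" "r ` U \<subseteq> img c" using r(1) by (auto simp:retr_def)
	obtain rh1 where rh1:"rh1 > 0" "ball y rh1 \<subseteq> U" using U(1) r(2) x0(2) open_contains_ball by blast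
	define rh where "rh = rh1 / 3"
	have rh:"rh > 0" "ball y (3 * rh) \<subseteq> U" using rh1 by (auto simp:rh_def)
	define V where "V z = bump y rh z *\<^sub>R fder (rep c) (r z) (X (r z))" for z
	have "smooth_on U (%z. fder (rep c) (r z) (X (r z)))"
	by (rule sm_compose[OF U(1) o U(2) sm_fder_apply[OF o rep_smooth[OF cs] X(1)] U(3)])
	hence "smooth_on UNIV V" unfolding V_def[abs_def] by (intro bump_extend[OF rh(1)] sm_subset[OF _ rh(2)])
	moreover have b0:"bump y rh z = 0" if "z ~: cball y (2 * rh)" for z
	using that bump_eq_0[OF rh(1),where y = z and a = y] by (simp add:dist_commute)
	moreover have "V (io x) = bump y rh (io x) *\<^sub>R Y x" if x:"x : points M" for x
	proof (cases "io x : cball y (2 * rh)")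
	case True
	hence "io x : ball y (3 * rh)" using rh(1) by simp
	hence "x : fst c" "r (io x) = snd c x" using r(1) x rh(2) unfolding retr_def by blast+
	thus ?thesis using X(2) rep_deriv[OF cs] by (simp add:V_def Y_def)
	qed (simp add:V_def b0)
	moreover have "1 <= bump y rh z" if "z : ball y rh" for z
	using that bump_eq_1[OF rh(1),where y = z and a = y] by (simp add:dist_commute)
	ultimately have "Q (ball y rh)" unfolding Q_def
	using sm_bump[of y rh] bump_bounds(1)[of y rh]
	by (intro exI[of _ V] exI[of _ "bump y rh"] exI[of _ "cball y (2 * rh)"]) (simp add:V_def)
	thus "EX U. open U & y : U & Q U" using rh(1) by (intro exI[of _ "ball y rh"]) simp
	qed
	qed
	then obtain V S C0 where V:"smooth_on UNIV V" "smooth_on UNIV S" "compact C0" "ALL y. y ~: C0 --> V y = 0"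
	"ALL y:K0. 1 <= S y" "ALL x:points M. V (io x) = S (io x) *\<^sub>R Y x"
	unfolding Q_def by (elim exE conjE) (rule that,assumption+)
	have "smooth_on UNIV (%y. cutoff_inverse (S y))"
	by (rule sm_compose[OF open_UNIV open_UNIV V(2) smooth_cutoff_inverse]) simp
	hence "smooth_on UNIV (%y. cutoff_inverse (S y) *\<^sub>R V y)" by (rule sm_scaleR[OF open_UNIV _ V(1)])
	moreover have "cutoff_inverse (S (io x)) *\<^sub>R V (io x) = Y x" if x:"x : points M" for x
	proof (cases "io x : K0")
	case True
	hence "1 <= S (io x)" using V(5) by blast
	thus ?thesis using V(6) x by (simp add:cutoff_inverse_eq)
	next
	case False
	thus ?thesis using V(6) x Y0[OF x] by simp
	qed
	ultimately show ?thesis using V(3,4) Y0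
	by (intro exI[of _ "%y. cutoff_inverse (S y) *\<^sub>R V y"] exI[of _ C0]) (simp add:Y_def)
qed

end

section \<open>The Hamiltonian flow\<close>

lemma smooth_mfd_euclidean:"smooth_mfd (euc :: ('v::euclidean_space,'v) manifold)"
proof
	show "(UN c:atlas euc. fst c) = points (euc :: ('v,'v) manifold)" by (simp add:atlas_euclidean)
	show "is_chart (mtop euc) c" if "c : atlas euc" for c :: "('v,'v) chart"
	using that by (simp add:atlas_euclidean is_chart_def)
	show "smooth_transition c d" if "c : atlas euc" "d : atlas euc" for c d :: "('v,'v) chart"
	using that by (simp add:atlas_euclidean smooth_transition_def chart_inv_identity) (simp add:id_def sm_id)
qed

lemma euclidean_curve:
	fixes ga :: "real => 'v::euclidean_space"
	assumes "smooth_map_on euc euc {-1<..<1} ga"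
	shows "(ga has_vector_derivative velocity euc ga 0) (at 0)"
proof -
	interpret E: smooth_mfd "euc :: ('v,'v) manifold" by (rule smooth_mfd_euclidean)
	have c:"smooth_chart (euc :: ('v,'v) manifold) (UNIV,id)"
	by (rule E.atlas_smooth_chart) (simp add:atlas_euclidean)
	have "EX W h. local_rep (UNIV,id) {-1<..<1} ga 0 W h" by (rule E.smooth_map_on_local_rep[OF assms _ c]) auto
	then obtain W h where r:"local_rep (UNIV,id) {-1<..<1} ga 0 W h" by (elim exE)
	from E.local_rep_velocity(1)[OF c r] have "(ga has_vector_derivative fder h 0 1) (at 0)"
	by (simp add:at_within_open[of 0 "{-1<..<1::real}"])
	thus ?thesis using vector_derivative_at[of ga "fder h 0 1" 0] by (simp add:velocity_within_def chart_at_euclidean)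
qed

lemma (in smooth_flow) flow_add:
	assumes t:"t : {0..1}" and s:"s : {- t..1 - t}"
	shows "flow W x (t + s) = flow W (flow W x t) s"
proof -
	have "(%s. flow W x (t + s)) s = flow W ((%s. flow W x (t + s)) 0) s"
	proof (rule flow_unique[where a = "- t" and b = "1 - t"])
	fix u :: real assume u:"u : {- t..1 - t}"
	have "(flow W x has_vector_derivative W (flow W x (t + u))) (at (t + u) within (+) t ` {- t..1 - t})"
	using t u by (intro flow_deriv_within) auto
	moreover have "((+) t has_vector_derivative 1) (at u within {- t..1 - t})"
	by (auto intro!:derivative_eq_intros simp:has_vector_derivative_def)
	ultimately have "(flow W x o (+) t has_vector_derivative 1 *\<^sub>R W (flow W x (t + u))) (at u within {- t..1 - t})"
	by (rule vector_diff_chain_within[rotated])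
	thus "((%s. flow W x (t + s)) has_vector_derivative W (flow W x (t + u))) (at u within {- t..1 - t})"
	by (simp add:comp_def)
	qed (use t s in auto)
	thus ?thesis by simp
qed

lemma (in smooth_flow) flow_zero:
	assumes "W (flow W x t) = 0" "t : {0..1}"
	shows "flow W x t = x"
proof -
	have "flow W x 0 = flow W (flow W x t) (- t)" using flow_add[OF assms(2),of "- t" x] assms(2) by simp
	also have "... = flow W x t" by (rule flow_fixed[OF assms(1)]) (use assms(2) in auto)
	finally show ?thesis by (simp add:flow_0)
qed

locale ham_setting = setting M om N io f
	for M :: "('a,'e::euclidean_space) manifold" and om N and io :: "'a => 'b::euclidean_space" and f +
	fixes h :: "'b => real" and V :: "'b => 'b" and K0 C0 :: "'b set" and C B :: real
	assumes smooth_h:"smooth_on UNIV h" and compact_K0:"compact K0" and K0_subset:"K0 \<subseteq> io ` points M"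
	and h_outside:"ALL x:points M. io x ~: K0 --> h (io x) = 0"
	and h_f:"ALL x:N. h (io x) = f x" and C_nonneg:"0 <= C"
	and control:"ALL x:N. ALL m>=0. (ALL w:tangent_space M N x. \<bar>df x w\<bar> <= m * norm (dio x w)) -->
	(ALL u. \<bar>fder h (io x) u\<bar> <= C * m * norm u)"
	and smooth_V:"smooth_on UNIV V" and compact_C0:"compact C0" and V_outside:"ALL y. y ~: C0 --> V y = 0"
	and V_eq:"ALL x:points M. V (io x) = dio x (ham_vector_field M om (%x. h (io x)) x)"
	and V_K0:"ALL x:points M. io x ~: K0 --> V (io x) = 0"
	and B_pos:"0 < B" and V_bound:"!!y. norm (V y) <= B" and dV_bound:"!!y v. norm (fder V y v) <= B * norm v"
begin

lemma h_chart:"smooth_chart M c ==> smooth_on (img c) (%p. h (rep c p))"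
	by (rule sm_compose[OF chart_image_open[OF is_chart] open_UNIV rep_smooth smooth_h]) auto

lemma form_cancel:
	assumes "smooth_chart M c" "p : img c" "!!w. form c p v w = form c p v' w"
	shows "v = v'"
proof -
	have "flat_op c p v = flat_op c p v'" by (simp add:flat_op_def assms(3))
	thus ?thesis using bij_is_inj[OF bij_flat_op[OF assms(1,2)]] by (simp add:inj_eq)
qed

lemma chart_field:
	assumes c:"smooth_chart M c"
	shows "EX X. smooth_on (img c) X & (ALL p:img c. ALL w. form c p (X p) w = fder (%p. h (rep c p)) p w) &
	(ALL x:fst c. V (io x) = fder (rep c) (snd c x) (X (snd c x))) &
	(ALL x:fst c. ALL de. ham_vector_field M om (%x. de * h (io x)) x = chart_deriv M c x (de *\<^sub>R X (snd c x)))"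
proof -
	note o = img_open[OF c]
	obtain X where X:"smooth_on (img c) X" "ALL p:img c. ALL w. form c p (X p) w = fder (%p. h (rep c p)) p w"
	"ALL x:fst c. ham_vector_field M om (%x. h (io x)) x = chart_deriv M c x (X (snd c x))"
	using ham_field_chart[OF c h_chart[OF c]] by (elim exE conjE) (rule that,assumption+)
	have "V (io x) = fder (rep c) (snd c x) (X (snd c x))" if x:"x : fst c" for x
	using V_eq X(3) x chart_subset[OF c] rep_deriv[OF c x] by auto
	moreover have "ham_vector_field M om (%x. de * h (io x)) x = chart_deriv M c x (de *\<^sub>R X (snd c x))" if x:"x : fst c" for x de
	proof -
	have p:"snd c x : img c" using x by blast
	have "smooth_on (img c) (%p. de * h (rep c p))" by (rule sm_mult[OF o sm_const h_chart[OF c]])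
	from ham_field_chart[OF c,of "%x. de * h (io x)",OF this]
	obtain X' where X':"ALL p:img c. ALL w. form c p (X' p) w = fder (%p. de * h (rep c p)) p w"
	"ALL x:fst c. ham_vector_field M om (%x. de * h (io x)) x = chart_deriv M c x (X' (snd c x))"
	by (elim exE conjE) (rule that,assumption+)
	have "((%p. de * h (rep c p)) has_derivative (%w. de * fder (%p. h (rep c p)) (snd c x) w)) (at (snd c x))"
	by (rule has_derivative_mult_right[OF sm_hd[OF o h_chart[OF c] p]])
	from fun_cong[OF frechet_derivative_at[OF this]]
	have d:"fder (%p. de * h (rep c p)) (snd c x) w = de * fder (%p. h (rep c p)) (snd c x) w" for w by simp
	have l:"linear (%v. form c (snd c x) v w)" for w using bilinear_form[OF c p] by (simp add:bilinear_def)
	have "X' (snd c x) = de *\<^sub>R X (snd c x)"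
	by (rule form_cancel[OF c p]) (simp add:bspec[OF X'(1) p] bspec[OF X(2) p] d linear_scale[OF l,of de "X (snd c x)"])
	thus ?thesis using X'(2) x by simp
	qed
	ultimately show ?thesis using X(1,2) by (intro exI[of _ X]) blast
qed

end

section \<open>The ambient flow restricts to the Hamiltonian flow on M\<close>

locale ham_flow = ham_setting M om N io f h V K0 C0 C B
	for M :: "('a,'e::euclidean_space) manifold" and om N and io :: "'a => 'b::euclidean_space" and f h V K0 C0 C B +
	fixes de :: real
	assumes de:"0 < de" "de * B <= 1 / 12"
begin

abbreviation W :: "'b => 'b" where "W == %y. de *\<^sub>R V y"

lemma fder_W:"fder W y v = de *\<^sub>R fder V y v"
proof -
	have "(W has_derivative (%v. de *\<^sub>R fder V y v)) (at y)"
	by (rule has_derivative_scaleR_right[OF sm_hd[OF open_UNIV smooth_V]]) simp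
	from fder_eq[OF this,of v] show ?thesis by simp
qed

sublocale F: smooth_flow W C0 "de * B"
proof
	show "smooth_on UNIV W" by (rule sm_scaleR[OF open_UNIV sm_const smooth_V])
	show "norm (fder W x v) <= de * B * norm v" for x v
	using mult_left_mono[OF dV_bound[of x v],of de] de(1) by (simp add:fder_W mult.assoc)
qed (use compact_C0 V_outside de B_pos in auto)

text \<open>The equation is solved in a chart and the solution pushed forward; by uniqueness it is
  the ambient orbit, which therefore stays in the image of M for a short time.\<close>

lemma local_flow:
	assumes x:"x : points M"
	shows "EX ep>0. ALL s. \<bar>s\<bar> <= ep --> flow W (io x) s : io ` points M"
proof -
	obtain c where c':"c : atlas M" "x : fst c" using exists_atlas_chart[OF x] by blast
	note c = atlas_smooth_chart[OF c'(1)]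
	note o = img_open[OF c]
	obtain X where X:"smooth_on (img c) X" "ALL x:fst c. V (io x) = fder (rep c) (snd c x) (X (snd c x))"
	using chart_field[OF c] by (elim exE conjE) (rule that,assumption+)
	obtain si1 where si1:"si1 > 0" "ball (snd c x) si1 \<subseteq> img c" using open_contains_ball o c'(2) by blast
	define si where "si = si1 / 3"
	have si:"si > 0" "ball (snd c x) (3 * si) \<subseteq> img c" using si1 by (auto simp:si_def)
	define Z where "Z p = bump (snd c x) si p *\<^sub>R X p" for p
	have sZ:"smooth_on UNIV Z" unfolding Z_def[abs_def] by (rule bump_extend[OF si(1) sm_subset[OF X(1) si(2)]])
	have Z0:"Z p = 0" if "p ~: cball (snd c x) (2 * si)" for p
	using that bump_eq_0[OF si(1),where y = p and a = "snd c x"] by (simp add:Z_def dist_commute)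
	obtain Bx where Bx:"Bx > 0" "!!p. norm (Z p) <= Bx" "!!p v. norm (fder Z p v) <= Bx * norm v"
	by (rule compact_support_bounds[OF sZ compact_cball[of "snd c x" "2 * si"]],rule Z0,assumption) (rule that; blast)
	\<comment> \<open>Gives Lipschitz constant at most 1/12 and displacement at most \<open>si\<close>,
	  where the cut-off is 1. The chart flow thus runs at speed \<open>et\<close> instead of
	  \<open>de\<close>; the factor \<open>de / et\<close> in the time corrects this.\<close>
	define et where "et = min (1 / 12) (si / 3) / Bx"
	have et0:"et > 0" using Bx(1) si(1) by (simp add:et_def)
	have etn:"et ~= 0" using et0 by simp
	have "et * Bx = min (1 / 12) (si / 3)" using Bx(1) by (simp add:et_def)
	hence et:"et * Bx <= 1 / 12" "et * Bx <= si / 3" by auto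
	have fZ:"fder (%p. et *\<^sub>R Z p) p v = et *\<^sub>R fder Z p v" for p v
	proof -
	have "((%p. et *\<^sub>R Z p) has_derivative (%v. et *\<^sub>R fder Z p v)) (at p)"
	by (rule has_derivative_scaleR_right[OF sm_hd[OF open_UNIV sZ]]) simp
	from fder_eq[OF this,of v] show ?thesis by simp
	qed
	interpret G: smooth_flow "%p. et *\<^sub>R Z p" "cball (snd c x) (2 * si)" "et * Bx"
	proof
	show "smooth_on UNIV (%p. et *\<^sub>R Z p)" by (rule sm_scaleR[OF open_UNIV sm_const sZ])
	show "norm (fder (%p. et *\<^sub>R Z p) p v) <= et * Bx * norm v" for p v
	using mult_left_mono[OF Bx(3)[of p v],of et] et0 by (simp add:fZ mult.assoc)
	qed (use Z0 et et0 Bx(1) in auto)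
	define q where "q = flow (%p. et *\<^sub>R Z p) (snd c x)"
	have q:"q s : img c" "Z (q s) = X (q s)" if s:"s : {-1..2}" for s
	proof -
	have "norm (q s - snd c x) <= 3 * (et * norm (Z (snd c x)))" using G.flow_displacement[OF s,of "snd c x"] et0 by (simp add:q_def)
	also have "... <= 3 * (et * Bx)" using Bx(2)[of "snd c x"] et0 by (intro mult_left_mono) auto
	finally have d:"dist (q s) (snd c x) <= si" using et(2) by (simp add:dist_norm)
	thus "q s : img c" using si by (auto simp:dist_commute intro!:subsetD[OF si(2)])
	show "Z (q s) = X (q s)" using bump_eq_1[OF si(1) d] by (simp add:Z_def)
	qed
	define ep where "ep = min (et / de) 1"
	have ep:"ep > 0" "ep <= 1" using et0 de(1) by (auto simp:ep_def)
	have scale:"s * (de / et) : {-1..1}" if "s : {-ep..ep}" for s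
	proof -
	have "\<bar>s\<bar> * (de / et) <= (et / de) * (de / et)" using that et0 de(1) by (intro mult_right_mono) (auto simp:ep_def abs_le_iff)
	hence "\<bar>s * (de / et)\<bar> <= 1" using et0 de(1) by (simp add:abs_mult)
	thus ?thesis unfolding abs_le_iff atLeastAtMost_iff by linarith
	qed
	define z where "z s = rep c (q (s * (de / et)))" for s
	have zd:"(z has_vector_derivative W (z s)) (at s within {-ep..ep})" if s:"s : {-ep..ep}" for s
	proof -
	define S where "S = (%s. s * (de / et)) ` {-ep..ep}"
	have S:"S \<subseteq> {-1..2}" unfolding S_def using scale by force
	have m:"s * (de / et) : S" unfolding S_def using s by blast
	have qs:"q (s * (de / et)) : img c" "Z (q (s * (de / et))) = X (q (s * (de / et)))" using q[of "s * (de / et)"] scale[OF s] by auto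
	define y where "y = chart_inv c (q (s * (de / et)))"
	have y:"y : fst c" "snd c y = q (s * (de / et))" using qs(1) by (auto simp:y_def chart_inv_into chart_chart_inv)
	have 1:"(q has_vector_derivative et *\<^sub>R Z (q (s * (de / et)))) (at (s * (de / et)) within S)"
	unfolding q_def by (rule G.flow_deriv_within[OF m S])
	have 2:"((%s. s * (de / et)) has_vector_derivative de / et) (at s within {-ep..ep})"
	using etn unfolding has_vector_derivative_def by (auto intro!:derivative_eq_intros)
	have 3:"(q o (%s. s * (de / et)) has_vector_derivative (de / et) *\<^sub>R et *\<^sub>R Z (q (s * (de / et)))) (at s within {-ep..ep})"
	by (rule vector_diff_chain_within[OF 2 1[unfolded S_def]])
	have 4:"(rep c has_derivative fder (rep c) (q (s * (de / et)))) (at (q (s * (de / et))))" using rep_has_derivative[OF c y(1)] y(2) by simp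
	have "(rep c o (q o (%s. s * (de / et))) has_vector_derivative
	fder (rep c) (q (s * (de / et))) ((de / et) *\<^sub>R et *\<^sub>R Z (q (s * (de / et))))) (at s within {-ep..ep})"
	by (rule vector_derivative_diff_chain_within[OF 3],unfold comp_def,rule has_derivative_at_withinI[OF 4])
	moreover have "(de / et) *\<^sub>R et *\<^sub>R Z (q (s * (de / et))) = de *\<^sub>R X (q (s * (de / et)))"
	unfolding qs(2) scaleR_scaleR using etn by simp
	moreover have "fder (rep c) (q (s * (de / et))) (de *\<^sub>R X (q (s * (de / et)))) = W (z s)"
	using linear_scale[OF sm_linear_fder[OF o rep_smooth[OF c] qs(1)],of de "X (q (s * (de / et)))"] bspec[OF X(2) y(1)] y(2)
	by (simp add:z_def y_def)
	ultimately show ?thesis by (simp add:z_def[abs_def] comp_def)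
	qed
	have q0:"q 0 = snd c x" by (simp add:q_def G.flow_0)
	have z0:"z 0 = io x" by (simp add:z_def q0 inv_chart[OF c c'(2)])
	have "flow W (io x) s : io ` points M" if s:"\<bar>s\<bar> <= ep" for s
	proof -
	have s':"s : {-ep..ep}" using s by (auto simp:abs_le_iff)
	have "z s = flow W (io x) s" unfolding z0[symmetric] by (rule F.flow_unique[OF _ _ _ _ zd s']) (use ep in auto)
	moreover have m:"chart_inv c (q (s * (de / et))) : points M"
	by (rule subsetD[OF chart_subset[OF c] chart_inv_into[OF q(1)]]) (use scale[OF s'] in simp)
	ultimately show ?thesis using imageI[OF m,of io] unfolding z_def by simp
	qed
	thus ?thesis using ep(1) by blast
qed

text \<open>The image of M need not be closed. But a moving orbit that is in it lies in
  \<open>K0\<close>: outside \<open>K0\<close> the field on M vanishes, and an orbit that meets a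
  zero is constant. So the times spent in the image form a set that is closed as well as
  open.\<close>

lemma flow_in_image:
	assumes x:"x : points M" and t:"t : {0..1}"
	shows "flow W (io x) t : io ` points M"
proof (cases "V (io x) = 0")
	case True
	thus ?thesis using F.flow_fixed[of "io x" t] x t by simp
next
	case False
	define P where "P t = (flow W (io x) t : io ` points M)" for t
	have K:"flow W (io x) t : K0" if "t : {0..1}" "P t" for t
	proof (rule ccontr)
	assume "flow W (io x) t ~: K0"
	hence "V (flow W (io x) t) = 0" using that(2) V_K0 unfolding P_def by auto
	hence "flow W (io x) t = io x" using F.flow_zero[OF _ that(1)] by simp
	thus False using \<open>V (flow W (io x) t) = 0\<close> False by simp
	qed
	have cont:"continuous_on {0..1} (flow W (io x))"
	by (rule continuous_on_subset[OF sm_cont[OF F.flow_smooth]]) auto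
	have "closed ({0..1} Int flow W (io x) -` K0)"
	by (rule continuous_closed_preimage[OF cont closed_atLeastAtMost compact_imp_closed[OF compact_K0]])
	hence op:"open (- ({0..1} Int flow W (io x) -` K0))" by (rule open_Compl)
	have "P 0 = P t"
	proof (rule connected_local_const[of "{0..1::real}"])
	show "ALL a:{0..1}. \<forall>\<^sub>F b in at a within {0..1}. P a = P b"
	proof
	fix a :: real assume a:"a : {0..1}"
	show "\<forall>\<^sub>F b in at a within {0..1}. P a = P b"
	proof (cases "P a")
	case True
	then obtain y where y:"y : points M" "flow W (io x) a = io y" unfolding P_def by blast
	obtain ep where ep:"ep > 0" "ALL s. \<bar>s\<bar> <= ep --> flow W (io y) s : io ` points M" using local_flow[OF y(1)] by (elim exE conjE)
	have "P b" if "b : {0..1}" "dist b a < ep" for b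
	proof -
	have "flow W (io x) (a + (b - a)) = flow W (flow W (io x) a) (b - a)" by (rule F.flow_add[OF a]) (use that(1) in auto)
	thus ?thesis using ep(2)[rule_format,of "b - a"] that(2) by (simp add:P_def y(2) dist_real_def)
	qed
	thus ?thesis unfolding eventually_at using ep(1) True by blast
	next
	case False
	hence "a : - ({0..1} Int flow W (io x) -` K0)" using K0_subset unfolding P_def by blast
	then obtain ep where ep:"ep > 0" "ball a ep \<subseteq> - ({0..1} Int flow W (io x) -` K0)" using op open_contains_ball by blast
	have "~ P b" if "b : {0..1}" "dist b a < ep" for b
	using K[OF that(1)] ep(2) that by (auto simp:dist_commute)
	thus ?thesis unfolding eventually_at using ep(1) False by blast
	qed
	qed
	qed (use t in auto)
	moreover have "P 0" using x by (simp add:P_def F.flow_0)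
	ultimately show ?thesis by (simp add:P_def)
qed

definition ps :: "real => 'a => 'a" where "ps t x = inv_into (points M) io (flow W (io x) t)"

lemma ps:"x : points M ==> t : {0..1} ==> ps t x : points M" "x : points M ==> t : {0..1} ==> io (ps t x) = flow W (io x) t"
	unfolding ps_def using flow_in_image by (blast intro:inv_into_into f_inv_into_f)+

text \<open>Near a time \<open>t\<close> the coordinates of the curve are \<open>r\<close> of the
  ambient orbit. By \<open>retr_deriv\<close> the derivative of \<open>r\<close> cancels the
  push-forward in \<open>V\<close> and leaves the coordinate field.\<close>

lemma hamiltonian_flow:"hamiltonian_flow M om (%z. de * h (io (snd z))) ps"
	unfolding hamiltonian_flow_def
proof (intro ballI conjI)
	fix x assume x:"x : points M"
	show "ps 0 x = x" using inj_io x by (simp add:ps_def F.flow_0)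
	have rp:"EX Z q. local_rep c {0..1} (%t. ps t x) t Z q & fder q t 1 = de *\<^sub>R X (snd c (ps t x))"
	if t:"t : {0..1}" and c:"smooth_chart M c" "ps t x : fst c" and X:"ALL x:fst c. V (io x) = fder (rep c) (snd c x) (X (snd c x))" for t c X
	proof -
	obtain U r where r:"retr c U r" "io (ps t x) : U" using retr_exists[OF c] by blast
	have U:"open U" "smooth_on U r" "r ` U \<subseteq> img c" using r(1) by (auto simp:retr_def)
	define Z where "Z = {-1<..<2} Int flow W (io x) -` U"
	have Z:"open Z" unfolding Z_def
	by (rule continuous_open_preimage[OF sm_cont[OF F.flow_smooth] open_greaterThanLessThan U(1)])
	have tZ:"t : Z" using t r(2) ps(2)[OF x t] by (simp add:Z_def)
	have sf:"smooth_on Z (flow W (io x))" by (rule sm_subset[OF F.flow_smooth]) (simp add:Z_def)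
	have "smooth_on Z (%s. r (flow W (io x) s))" by (rule sm_compose[OF Z U(1) sf U(2)]) (auto simp:Z_def)
	moreover have "ps s x = chart_inv c (r (flow W (io x) s))" if "s : Z Int {0..1}" for s
	proof -
	have s:"s : {0..1}" "io (ps s x) : U" using that ps(2)[OF x] by (auto simp:Z_def)
	hence "ps s x : fst c" "r (io (ps s x)) = snd c (ps s x)" using r(1) ps(1)[OF x s(1)] unfolding retr_def by blast+
	thus ?thesis using inv_chart[OF c(1)] ps(2)[OF x s(1)] by simp
	qed
	ultimately have lr:"local_rep c {0..1} (%t. ps t x) t Z (%s. r (flow W (io x) s))"
	unfolding local_rep_def using Z tZ U(3) by (auto simp:Z_def)
	have "(flow W (io x) has_vector_derivative W (flow W (io x) t)) (at t)"
	using F.flow_deriv_within[of t "{-1<..<2}" "io x"] t by (simp add:at_within_open[of t "{-1<..<2::real}"] subset_iff)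
	moreover have "(r has_derivative fder r (io (ps t x))) (at (flow W (io x) t))"
	using sm_hd[OF U(1,2) r(2)] ps(2)[OF x t] by simp
	ultimately have "((%s. r (flow W (io x) s)) has_derivative (%s. fder r (io (ps t x)) (s *\<^sub>R W (flow W (io x) t)))) (at t)"
	unfolding has_vector_derivative_def by (rule has_derivative_compose)
	from fder_eq[OF this,of 1]
	have "fder (%s. r (flow W (io x) s)) t 1 = fder r (io (ps t x)) (W (io (ps t x)))" using ps(2)[OF x t] by simp
	also have "... = de *\<^sub>R fder r (io (ps t x)) (V (io (ps t x)))"
	by (rule linear_scale[OF sm_linear_fder[OF U(1,2) r(2)]])
	also have "... = de *\<^sub>R X (snd c (ps t x))" using retr_deriv[OF c(1) r(1) ps(1)[OF x t] r(2)] X c(2) by simp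
	finally show ?thesis using lr by blast
	qed
	show "smooth_map_on euc M {0..1} (%t. ps t x)"
	proof (rule smooth_map_on_if_local_rep)
	fix t :: real assume t:"t : {0..1}"
	obtain c where c:"c : atlas M" "ps t x : fst c" using exists_atlas_chart[OF ps(1)[OF x t]] by blast
	note cs = atlas_smooth_chart[OF c(1)]
	obtain X where X:"ALL x:fst c. V (io x) = fder (rep c) (snd c x) (X (snd c x))"
	using chart_field[OF cs] by (elim exE conjE)
	obtain Z q where "local_rep c {0..1} (%t. ps t x) t Z q" using rp[OF t cs c(2) X] by (elim exE conjE)
	thus "EX c W h. smooth_chart M c & local_rep c {0..1} (%t. ps t x) t W h" using cs by blast
	qed
	fix t :: real assume t:"t : {0..1}"
	obtain c where c:"c : atlas M" "ps t x : fst c" using exists_atlas_chart[OF ps(1)[OF x t]] by blast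
	note cs = atlas_smooth_chart[OF c(1)]
	obtain X where X:"ALL x:fst c. V (io x) = fder (rep c) (snd c x) (X (snd c x))"
	"ALL x:fst c. ALL de. ham_vector_field M om (%x. de * h (io x)) x = chart_deriv M c x (de *\<^sub>R X (snd c x))"
	using chart_field[OF cs] by (elim exE conjE) (rule that,assumption+)
	obtain Z q where r:"local_rep c {0..1} (%t. ps t x) t Z q" "fder q t 1 = de *\<^sub>R X (snd c (ps t x))"
	using rp[OF t cs c(2) X(1)] by (elim exE conjE)
	show "velocity_within M {0..1} (%s. ps s x) t = ham_vector_field M om (%y. de * h (io (snd (t,y)))) (ps t x)"
	using local_rep_velocity(2)[OF cs r(1) t at_unit_interval_nontrivial[OF t]] r(2) X(2) c(2) by simp
qed

lemma compact_support:"compactly_supported_hamiltonian M (%z. de * h (io (snd z)))"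
	unfolding compactly_supported_hamiltonian_def
proof
	interpret E: smooth_mfd "euc :: (real,real) manifold" by (rule smooth_mfd_euclidean)
	have idc:"(UNIV,id) : atlas (euc :: (real,real) manifold)" by (simp add:atlas_euclidean)
	show "smooth_map_on (prod_manifold euc M) euc ({0..1::real} \<times> points M) (%z. de * h (io (snd z)))"
	unfolding smooth_map_on_def
	proof
	fix z :: "real \<times> 'a" assume z:"z : {0..1} \<times> points M"
	hence "snd z : points M" by (simp add:mem_Times_iff)
	then obtain c where c:"c : atlas M" "snd z : fst c" using exists_atlas_chart by blast
	note cs = atlas_smooth_chart[OF c(1)]
	define pc :: "(real \<times> 'a,real \<times> 'e) chart" where "pc = prod_chart (UNIV,id) c"
	have pc:"pc : atlas (prod_manifold euc M)" unfolding pc_def atlas_prod using idc c(1) by blast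
	have fpc:"fst pc = UNIV \<times> fst c" by (simp add:pc_def prod_chart_simps)
	have im:"snd pc ` fst pc = UNIV \<times> img c" unfolding fpc unfolding pc_def prod_chart_image by simp
	have opn:"openin (mtop (prod_manifold euc M)) (fst pc)"
	unfolding mtop_prod fpc using chart_openin[OF is_chart[OF cs]] by (simp add:openin_prod_Times_iff atlas_euclidean)
	have lin:"linear (snd :: real \<times> 'e => 'e)" by (simp add:linear_iff)
	have o:"open (UNIV \<times> img c :: (real \<times> 'e) set)" by (rule open_Times[OF open_UNIV img_open[OF cs]])
	have "smooth_on (UNIV \<times> img c) (%q :: real \<times> 'e. h (rep c (snd q)))"
	by (rule sm_compose[OF o img_open[OF cs] sm_linear[OF lin] h_chart[OF cs]]) auto
	hence "smooth_on (UNIV \<times> img c) (%q :: real \<times> 'e. de * h (rep c (snd q)))" by (rule sm_mult[OF o sm_const])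
	moreover have "de * h (rep c (snd q)) = (id o (%z. de * h (io (snd z))) o chart_inv pc) q" if q:"q : UNIV \<times> img c" for q
	proof -
	obtain a b where ab:"q = (a,b)" "b : img c" using q by blast
	have "chart_inv pc (a,b) = (chart_inv (UNIV,id) a,chart_inv c b)"
	unfolding pc_def by (rule chart_inv_prod[OF E.atlas_chart[OF idc] is_chart[OF cs] _ ab(2)]) simp
	thus ?thesis by (simp add:ab(1))
	qed
	ultimately have sm:"smooth_on (snd pc ` fst pc) (id o (%z. de * h (io (snd z))) o chart_inv pc)"
	unfolding im by (rule sm_cong[OF o,rotated])
	show "EX c:atlas (prod_manifold euc M). EX d:atlas euc. EX W g.
	openin (mtop (prod_manifold euc M)) W & z : W & W \<subseteq> fst c & g ` W \<subseteq> fst d &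
	smooth_on (snd c ` W) (snd d o g o chart_inv c) & (ALL y:W Int {0..1} \<times> points M. g y = de * h (io (snd y)))"
	by (rule bexI[OF _ pc],rule bexI[OF _ idc],rule exI[of _ "fst pc"],rule exI[of _ "%z. de * h (io (snd z))"])
	(use opn sm c(2) in \<open>auto simp:fpc mem_Times_iff\<close>)
	qed
	define S where "S = {x : points M. io x : K0}"
	have "io ` S = K0" using K0_subset by (auto simp:S_def)
	hence "compactin (mtop M) S"
	using homeomorphic_map_compactness[OF homeomorphic_io,of S] compact_K0 K0_subset by (simp add:S_def compactin_subtopology)
	hence K:"compactin (prod_topology euclideanreal (mtop M)) ({0..1} \<times> S)" by (simp add:compactin_Times)
	\<comment> \<open>Here the Hausdorff property is used: a compact set containing the support is
	  closed, so it contains the closure too.\<close>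
	have "closedin (prod_topology euclideanreal (mtop M)) ({0..1} \<times> S)"
	by (rule compactin_imp_closedin[OF _ K]) (simp add:Hausdorff_space_prod_topology hausdorff)
	moreover have "{z : {0..1} \<times> points M. de * h (io (snd z)) ~= 0} \<subseteq> {0..1} \<times> S"
	using h_outside by (auto simp:S_def)
	ultimately have "prod_topology euclideanreal (mtop M) closure_of {z : {0..1} \<times> points M. de * h (io (snd z)) ~= 0} \<subseteq> {0..1} \<times> S"
	by (rule closure_of_minimal[rotated])
	thus "compactin (prod_topology euclideanreal (mtop M))
	(prod_topology euclideanreal (mtop M) closure_of {z : {0..1} \<times> points M. de * h (io (snd z)) ~= 0})"
	by (rule closed_compactin[OF K _ closedin_closure_of])
qed

lemma ps_Ham_c:"ps 1 : Ham_c M om"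
	unfolding Ham_c_def using compact_support hamiltonian_flow by blast

text \<open>The displacement and its derivative contribute \<open>3 * (de * B)\<close> each, by
  \<open>flow_displacement\<close> and the first bound of
  \<open>flow_derivative_first_order\<close>.\<close>

lemma C1_small:"C1_norm (io ` points M) (%y. io (ps 1 (inv_into (points M) io y)) - y) <= ennreal (6 * (de * B))"
proof -
	define G where "G y = io (ps 1 (inv_into (points M) io y)) - y" for y
	have G:"G y = flow W y 1 - y" if "y : io ` points M" for y
	using that ps(2)[of "inv_into (points M) io y" 1] by (simp add:G_def inv_into_into f_inv_into_f)
	have 1:"norm (G y) <= 3 * (de * B)" if "y : io ` points M" for y
	proof -
	have "norm (G y) <= 3 * norm (W y)" using F.flow_displacement[of 1 y] G[OF that] by simp
	moreover have "norm (W y) = de * norm (V y)" using de(1) by simp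
	moreover have "de * norm (V y) <= de * B" by (rule mult_left_mono[OF V_bound]) (use de(1) in simp)
	ultimately show ?thesis by linarith
	qed
	have 2:"norm (submanifold_deriv euc (io ` points M) G y v) <= 3 * (de * B)"
	if y:"y : io ` points M" and v:"v : tangent_space euc (io ` points M) y" "norm v <= 1" for y v
	proof -
	obtain D where "ALL t:{-1..2}. ((%x. flow W x t) has_derivative (%h. D h t)) (at y)" using F.flow_has_derivative[of y] by (elim exE conjE)
	hence D:"((%x. flow W x 1) has_derivative (%h. D h 1)) (at y)" by simp
	have cur:"vector_derivative (G o ga) (at 0) = D v 1 - v"
	if ga:"curve_through euc (io ` points M) y ga" "velocity euc ga 0 = v" for ga
	proof -
	have ga':"smooth_map_on euc euc {-1<..<1} ga" "ga ` {-1<..<1} \<subseteq> io ` points M" "ga 0 = y"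
	using ga(1) by (auto simp:curve_through_def)
	have d:"(ga has_derivative (%s. s *\<^sub>R v)) (at 0)" using euclidean_curve[OF ga'(1)] ga(2) by (simp add:has_vector_derivative_def)
	have "((%s. flow W (ga s) 1) has_derivative (%s. D (s *\<^sub>R v) 1)) (at 0)"
	by (rule has_derivative_compose[OF d]) (use D ga'(3) in simp)
	from has_derivative_diff[OF this d]
	have "((%s. flow W (ga s) 1 - ga s) has_derivative (%s. D (s *\<^sub>R v) 1 - s *\<^sub>R v)) (at 0)" .
	hence "((G o ga) has_derivative (%s. D (s *\<^sub>R v) 1 - s *\<^sub>R v)) (at 0)"
	by (rule hd_transform[OF _ open_greaterThanLessThan[of "-1" 1]]) (use G ga'(2) in \<open>auto simp:image_subset_iff\<close>)
	hence "((G o ga) has_vector_derivative D v 1 - v) (at 0)"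
	using linear_scale[OF has_derivative_linear[OF D],of _ v] by (simp add:has_vector_derivative_def scaleR_diff_right)
	thus ?thesis by (rule vector_derivative_at)
	qed
	obtain ga where ga:"curve_through euc (io ` points M) y ga" "velocity euc ga 0 = v"
	using v(1) unfolding tangent_space_def by blast
	have "submanifold_deriv euc (io ` points M) G y v = D v 1 - v" unfolding submanifold_deriv_def
	proof (rule the_equality)
	show "EX ga. curve_through euc (io ` points M) y ga & velocity euc ga 0 = v &
	D v 1 - v = vector_derivative (G o ga) (at 0)" using ga cur[OF ga] by (intro exI[of _ ga]) simp
	qed (use cur in auto)
	moreover have "norm (D v 1 - v) <= 3 * (de * B) * norm v" by (rule F.flow_derivative_first_order(1)[OF D])
	moreover have "3 * (de * B) * norm v <= 3 * (de * B) * 1" using v(2) de(1) B_pos by (intro mult_left_mono) auto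
	ultimately show ?thesis by simp
	qed
	have "C1_norm (io ` points M) G <= ennreal (3 * (de * B)) + ennreal (3 * (de * B))"
	unfolding C1_norm_def by (intro add_mono SUP_least) (use 1 2 in \<open>auto intro!:ennreal_leI\<close>)
	also have "... = ennreal (6 * (de * B))" using de(1) B_pos by (simp add:ennreal_plus[symmetric] del:ennreal_plus)
	finally show ?thesis unfolding G_def .
qed

end

section \<open>Leafwise fixed points and non-degeneracy\<close>

lemma deriv_along_line:
	fixes G g :: "'v::euclidean_space => real"
	assumes S:"open S" "smooth_on S G" "q : S" and g:"!!t. q + t *\<^sub>R w : S ==> g (q + t *\<^sub>R w) = G (q + t *\<^sub>R w)"
	shows "deriv (%t. g (q + t *\<^sub>R w)) 0 = fder G q w"
proof -
	have l:"((%t. q + t *\<^sub>R w) has_derivative (%t. t *\<^sub>R w)) (at 0)" by (auto intro!:derivative_eq_intros)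
	have "((%t. G (q + t *\<^sub>R w)) has_derivative (%t. fder G q (t *\<^sub>R w))) (at 0)"
	by (rule has_derivative_compose[OF l]) (use sm_hd[OF S] in simp)
	moreover have "open ((%t. q + t *\<^sub>R w) -` S)" by (rule open_vimage[OF S(1)]) (intro continuous_intros)
	moreover have "0 : (%t. q + t *\<^sub>R w) -` S" using S(3) by simp
	moreover have "G (q + t *\<^sub>R w) = g (q + t *\<^sub>R w)" if "t : (%t. q + t *\<^sub>R w) -` S" for t using g that by simp
	ultimately have "((%t. g (q + t *\<^sub>R w)) has_derivative (%t. fder G q (t *\<^sub>R w))) (at 0)"
	by (rule hd_transform)
	moreover have "(%t. fder G q (t *\<^sub>R w)) = (*) (fder G q w)"
	by (rule ext) (simp add:linear_scale[OF sm_linear_fder[OF S],of _ w])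
	ultimately have "((%t. g (q + t *\<^sub>R w)) has_real_derivative fder G q w) (at 0)"
	unfolding has_field_derivative_def by simp
	thus ?thesis by (rule DERIV_imp_deriv)
qed

context ham_setting
begin

abbreviation hrep :: "('a,'e) chart => 'e => real" where "hrep c p == h (rep c p)"

text \<open>The map \<open>ps 1\<close> of \<open>ham_flow\<close>, with \<open>de\<close> as an
  argument, so that thresholds for \<open>de\<close> can be quantified over.\<close>

definition ph :: "real => 'a => 'a" where
	"ph de x = inv_into (points M) io (flow (%y. de *\<^sub>R V y) (io x) 1)"

lemma df_chart:
	assumes sl:"slice c L" and x:"x : fst c" "x : N" and l:"l : L"
	shows "df x (chart_deriv M c x l) = fder (hrep c) (snd c x) l"
proof (rule submanifold_deriv_chart[OF slice_smooth[OF sl] x(1)])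
	note cs = slice_smooth[OF sl]
	show "open (img c)" by (rule img_open[OF cs])
	show "smooth_on (img c) (hrep c)" by (rule h_chart[OF cs])
	show "ALL p:img c. chart_inv c p : N --> hrep c p = f (chart_inv c p)" using h_f by blast
	show "chart_deriv M c x l : tangent_space M N x" using tangent_space_slice[OF sl x] l by blast
qed (use x in auto)

lemma Crit_chart:
	assumes sl:"slice c L" and x:"x : fst c" "x : N"
	shows "x : Crit M N f \<longleftrightarrow> (ALL l:L. fder (hrep c) (snd c x) l = 0)"
	unfolding Crit_def using x(2) tangent_space_slice[OF sl x] df_chart[OF sl x] by auto

lemma hrep_deriv:
	assumes c:"smooth_chart M c" and x:"x : fst c"
	shows "fder (hrep c) (snd c x) w = fder h (io x) (fder (rep c) (snd c x) w)"
proof -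
	have "(hrep c has_derivative (%w. fder h (io x) (fder (rep c) (snd c x) w))) (at (snd c x))"
	by (rule has_derivative_compose[OF rep_has_derivative[OF c x]])
	(use sm_hd[OF open_UNIV smooth_h] in \<open>simp add:inv_chart[OF c x]\<close>)
	from fder_eq[OF this,of w] show ?thesis by simp
qed

lemma form_0:"smooth_chart M c ==> p : img c ==> form c p 0 w = 0"
	using bilinear_form by (blast intro:bilinear_lzero)

text \<open>The case \<open>m = 0\<close> of \<open>control\<close>: at a critical point of
  \<open>f\<close> the whole differential of \<open>h\<close> vanishes, not only its restriction to
  TN, so the point is at rest under the flow.\<close>

lemma Crit_zero:
	assumes x:"x : Crit M N f"
	shows "V (io x) = 0" "ph de x = x | ~ (0 < de & de * B <= 1 / 12)"
proof -
	have xN:"x : N" using x by (simp add:Crit_def)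
	obtain c L where sl:"slice c L" "x : fst c" using exists_slice[OF xN] by blast
	note cs = slice_smooth[OF sl(1)]
	have p:"snd c x : img c" using sl(2) by blast
	obtain X where X:"ALL p:img c. ALL w. form c p (X p) w = fder (hrep c) p w" "ALL x:fst c. V (io x) = fder (rep c) (snd c x) (X (snd c x))"
	using chart_field[OF cs] by (elim exE conjE) (rule that,assumption+)
	have "ALL w:tangent_space M N x. \<bar>df x w\<bar> <= 0 * norm (dio x w)" using x by (simp add:Crit_def)
	hence "\<bar>fder h (io x) u\<bar> <= C * 0 * norm u" for u using bspec[OF control xN] by blast
	hence "fder h (io x) u = 0" for u by simp
	hence "X (snd c x) = 0"
	by (intro form_cancel[OF cs p]) (simp add:bspec[OF X(1) p] hrep_deriv[OF cs sl(2)] form_0[OF cs p])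
	thus V0:"V (io x) = 0"
	using X(2) sl(2) linear_0[OF sm_linear_fder[OF img_open[OF cs] rep_smooth[OF cs] p]] by simp
	show "ph de x = x | ~ (0 < de & de * B <= 1 / 12)"
	proof (cases "0 < de & de * B <= 1 / 12")
	case True
	then interpret H: ham_flow M om N io f h V K0 C0 C B de by unfold_locales auto
	show ?thesis using H.F.flow_fixed[of "io x" 1] V0 inj_io xN N_subset by (auto simp:ph_def)
	qed simp
qed

lemma fix_local:
	assumes x0:"x0 : N"
	shows "EX U de0. open U & io x0 : U & de0 > 0 & (ALL de. 0 < de & de * B <= 1 / 12 & de < de0 -->
	(ALL x:N. io x : U --> ph de x : leaf M om N x --> x : Crit M N f))"
proof -
	obtain c L G where p:"plaque_chart c L G" "x0 : fst c" using plaque_exists[OF regular x0] by blast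
	note sl = plaque_slice[OF p(1)] and cs = slice_smooth[OF plaque_slice[OF p(1)]] and G = plaque_subspace[OF p(1)]
	note o = img_open[OF cs]
	obtain X where X:"ALL p:img c. ALL w. form c p (X p) w = fder (hrep c) p w" "ALL x:fst c. V (io x) = fder (rep c) (snd c x) (X (snd c x))"
	using chart_field[OF cs] by (elim exE conjE) (rule that,assumption+)
	obtain U r where r:"retr c U r" "io x0 : U" using retr_exists[OF cs p(2)] by blast
	have U:"open U" "smooth_on U r" "r ` U \<subseteq> img c" and rv:"!!x. x : points M ==> io x : U ==> x : fst c & r (io x) = snd c x"
	using r(1) by (auto simp:retr_def)
	obtain rh1 where rh1:"rh1 > 0" "cball (io x0) rh1 \<subseteq> U" using U(1) r(2) open_contains_cball by blast
	define rh where "rh = rh1 / 2"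
	define Kc where "Kc = cball (io x0) (2 * rh)"
	have rh:"rh > 0" "Kc \<subseteq> U" using rh1 by (auto simp:rh_def Kc_def)
	have Kc:"compact Kc" "convex Kc" by (simp_all add:Kc_def)
	have Kp:"compact (r ` Kc)" "r ` Kc \<subseteq> img c"
	using compact_continuous_image[OF continuous_on_subset[OF sm_cont[OF U(2)] rh(2)] Kc(1)] U(3) rh(2) by auto
	\<comment> \<open>The coordinate expression of the Hamiltonian field, extended to a neighbourhood
	  in the ambient space.\<close>
	define xi where "xi y = fder r y (V y)" for y
	have sxi:"smooth_on U xi" unfolding xi_def[abs_def]
	by (rule sm_fder_apply[OF U(1,2) sm_subset[OF smooth_V subset_UNIV]])
	obtain Lx where Lx:"Lx > 0" "!!y y'. y : Kc ==> y' : Kc ==> norm (xi y - xi y') <= Lx * norm (y - y')"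
	by (rule Lipschitz_on_convex_compact[OF U(1) sxi Kc rh(2)]) (rule that; blast)
	obtain a3 where a3:"a3 > 0" "!!y v. y : Kc ==> norm (fder r y v) <= a3 * norm v"
	by (rule fder_bounded_on_compact[OF U(1,2) Kc(1) rh(2)]) (rule that; blast)
	obtain a4 where a4:"a4 > 0" "!!q v. q : r ` Kc ==> norm (fder (rep c) q v) <= a4 * norm v"
	by (rule fder_bounded_on_compact[OF o rep_smooth[OF cs] Kp]) (rule that; blast)
	obtain CF where CF:"CF > 0" "ALL p:r ` Kc. (ALL v w. \<bar>form c p v w\<bar> <= CF * norm v * norm w) &
	(ALL v. ALL m. (ALL w. \<bar>form c p v w\<bar> <= m * norm w) --> norm v <= CF * m)" using form_bounds[OF cs Kp] by (elim exE conjE)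
	\<comment> \<open>Collects the constants of the cycle of estimates from \<open>Xx\<close> to
	  \<open>E\<close>, to df, to dh, and back to \<open>Xx\<close>.\<close>
	define ka where "ka = CF * (C * (CF * (3 * Lx * a4) * a3) * a4)"
	have ka:"ka >= 0" using CF(1) C_nonneg Lx(1) a3(1) a4(1) by (simp add:ka_def)
	\<comment> \<open>The first term keeps orbits in \<open>Kc\<close> by bounding the displacement
	  \<open>3 * (de * B)\<close> by \<open>rh\<close>; the second one gives
	  \<open>ka * de < 1\<close>.\<close>
	define de0 where "de0 = min (rh / (3 * B)) (1 / (ka + 1))"
	have de0:"de0 > 0" using rh(1) B_pos ka by (simp add:de0_def)
	have "x : Crit M N f"
	if de:"0 < de" "de * B <= 1 / 12" "de < de0" and x:"x : N" "io x : ball (io x0) rh" and lf:"ph de x : leaf M om N x" for de x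
	proof -
	interpret H: ham_flow M om N io f h V K0 C0 C B de by unfold_locales (use de in auto)
	have xM:"x : points M" using x(1) N_subset by blast
	have phps:"ph de x = H.ps 1 x" by (simp add:ph_def H.ps_def)
	define y where "y = flow H.W (io x)"
	have disp:"norm (y t - io x) <= 3 * (de * norm (V (io x)))" if "t : {0..1}" for t
	using H.F.flow_displacement[of t "io x"] that de(1) by (simp add:y_def)
	have yK:"y t : Kc" if "t : {0..1}" for t
	proof -
	have "norm (y t - io x) <= 3 * (de * B)" using disp[OF that] mult_left_mono[OF V_bound[of "io x"],of de] de(1) by linarith
	also have "... <= rh"
	proof -
	have "de * (3 * B) <= (rh / (3 * B)) * (3 * B)" using de(3) B_pos by (intro mult_right_mono) (auto simp:de0_def)
	thus ?thesis using B_pos by simp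
	qed
	finally have "dist (io x) (y t) <= rh" by (simp add:dist_norm norm_minus_commute)
	thus ?thesis using x(2) dist_triangle[of "io x0" "y t" "io x"] by (simp add:Kc_def)
	qed
	have y0:"y 0 = io x" by (simp add:y_def H.F.flow_0)
	have xK:"io x : Kc" using yK[of 0] y0 by simp
	have xU:"io x : U" using xK rh(2) by blast
	have xc:"x : fst c" "r (io x) = snd c x" using rv[OF xM xU] by auto
	have pK:"snd c x : r ` Kc" using xK xc(2) by (metis imageI)
	have pI:"snd c x : img c" using xc(1) by blast
	define Xx where "Xx = X (snd c x)"
	have Vx:"V (io x) = fder (rep c) (snd c x) Xx" using X(2) xc(1) by (simp add:Xx_def)
	have xix:"xi (io x) = Xx" unfolding xi_def Vx by (rule retr_deriv[OF cs r(1) xM xU])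
	have Vn:"norm (V (io x)) <= a4 * norm Xx" unfolding Vx by (rule a4(2)[OF pK])
	\<comment> \<open>The defect of the difference quotient has a double role: it is small compared
	  with \<open>Xx\<close>, and on \<open>L\<close> it has the same pairings as \<open>Xx\<close>,
	  because the quotient itself lies in the kernel.\<close>
	define E where "E = Xx - (1 / de) *\<^sub>R (r (y 1) - r (y 0))"
	have En:"norm E <= 3 * Lx * a4 * de * norm Xx"
	proof -
	\<comment> \<open>With the linear part removed, the velocity is
	  \<open>de *\<^sub>R (xi (y t) - Xx)\<close>; it is of second order in \<open>de\<close>, since
	  the orbit moves by at most \<open>3 * (de * norm (V (io x)))\<close>.\<close>
	define k where "k t = r (y t) - t *\<^sub>R (de *\<^sub>R Xx)" for t
	have kd:"(k has_derivative (%s. s *\<^sub>R (de *\<^sub>R xi (y t) - de *\<^sub>R Xx))) (at t)" if t:"t : {-1<..<2}" "t : {0..1}" for t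
	proof -
	have yU:"y t : U" using yK[OF t(2)] rh(2) by blast
	have "(y has_vector_derivative H.W (y t)) (at t)" unfolding y_def
	using H.F.flow_deriv_within[of t "{-1<..<2}" "io x"] t(1) by (simp add:at_within_open[of t "{-1<..<2::real}"] subset_iff)
	hence "((%t. r (y t)) has_vector_derivative fder r (y t) (H.W (y t))) (at t)"
	by (rule has_vector_derivative_chain) (rule sm_hd[OF U(1,2) yU])
	moreover have "fder r (y t) (H.W (y t)) = de *\<^sub>R xi (y t)" unfolding xi_def
	by (rule linear_scale[OF sm_linear_fder[OF U(1,2) yU]])
	ultimately have "((%t. r (y t)) has_derivative (%s. s *\<^sub>R (de *\<^sub>R xi (y t)))) (at t)" by (simp add:has_vector_derivative_def)
	moreover have "((%t. t *\<^sub>R (de *\<^sub>R Xx)) has_derivative (%s. s *\<^sub>R (de *\<^sub>R Xx))) (at t)" by (auto intro!:derivative_eq_intros)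
	ultimately show ?thesis unfolding k_def[abs_def] scaleR_diff_right by (rule has_derivative_diff)
	qed
	have "EX t:{0<..<1::real}. norm (k 1 - k 0) <= norm ((%s. s *\<^sub>R (de *\<^sub>R xi (y t) - de *\<^sub>R Xx)) (1 - 0))"
	proof (rule mvt_general)
	show "continuous_on {0..1} k"
	proof (rule continuous_at_imp_continuous_on,rule ballI)
	fix t :: real assume "t : {0..1}"
	thus "isCont k t" using kd[of t] has_derivative_continuous by auto
	qed
	show "(k has_derivative (%s. s *\<^sub>R (de *\<^sub>R xi (y t) - de *\<^sub>R Xx))) (at t)" if "0 < t" "t < 1" for t by (rule kd) (use that in auto)
	qed simp
	then obtain t :: real where t:"t : {0<..<1}" "norm (k 1 - k 0) <= norm (de *\<^sub>R xi (y t) - de *\<^sub>R Xx)" by auto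
	have t':"t : {0..1}" using t(1) by simp
	have "norm (k 1 - k 0) <= de * norm (xi (y t) - xi (io x))" using t(2) de(1) by (simp add:xix scaleR_diff_right[symmetric])
	also have "... <= de * (Lx * (3 * (de * (a4 * norm Xx))))"
	proof (rule mult_left_mono)
	have "norm (y t - io x) <= 3 * (de * (a4 * norm Xx))" using disp[OF t'] mult_left_mono[OF Vn,of de] de(1) by linarith
	hence "Lx * norm (y t - io x) <= Lx * (3 * (de * (a4 * norm Xx)))" using Lx(1) by (intro mult_left_mono) auto
	thus "norm (xi (y t) - xi (io x)) <= Lx * (3 * (de * (a4 * norm Xx)))" using Lx(2)[OF yK[OF t'] xK] by linarith
	qed (use de(1) in simp)
	finally have 1:"norm (k 1 - k 0) <= de * (Lx * (3 * (de * (a4 * norm Xx))))" .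
	have "k 1 - k 0 = - (de *\<^sub>R E)" using de(1) by (simp add:k_def E_def scaleR_diff_right)
	hence "de * norm E = norm (k 1 - k 0)" using de(1) by simp
	with 1 have "de * norm E <= de * (3 * Lx * a4 * de * norm Xx)" by (simp add:mult_ac)
	thus ?thesis using de(1) by simp
	qed
	have x1:"ph de x : N" "ph de x : points M" using lf leaf_subset N_subset by blast+
	have iox1:"io (ph de x) = y 1" unfolding phps y_def by (rule H.ps(2)[OF xM]) simp
	have "io (ph de x) : U" using yK[of 1] rh(2) iox1 by auto
	hence x1c:"ph de x : fst c" "r (y 1) = snd c (ph de x)" using rv[OF x1(2)] iox1 by auto
	have "snd c x - snd c (ph de x) : G" using plaque_leaf[OF p(1) x(1) xc(1) x1(1) x1c(1)] lf by blast
	from subspace_scale[OF G this,of "- (1 / de)"] have "(1 / de) *\<^sub>R (r (y 1) - r (y 0)) : G"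
	by (simp add:x1c(2) y0 xc(2) scaleR_diff_right)
	hence "(1 / de) *\<^sub>R (r (y 1) - r (y 0)) : kern c L (snd c x)" unfolding plaque_kern[OF compact_N p(1) xc(1) x(1)] .
	hence k0:"form c (snd c x) ((1 / de) *\<^sub>R (r (y 1) - r (y 0))) l = 0" if "l : L" for l using that by (simp add:kern_def)
	have lin:"linear (%v. form c (snd c x) v w)" for w using bilinear_form[OF cs pI] by (simp add:bilinear_def)
	have fE:"form c (snd c x) Xx l = form c (snd c x) E l" if "l : L" for l
	using linear_diff[OF lin,of Xx "(1 / de) *\<^sub>R (r (y 1) - r (y 0))" l] k0[OF that] by (simp add:E_def)
	define m where "m = CF * norm E * a3"
	have m0:"m >= 0" using CF(1) a3(1) by (simp add:m_def)
	have "\<bar>df x w\<bar> <= m * norm (dio x w)" if w:"w : tangent_space M N x" for w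
	proof -
	obtain l where l:"l : L" "w = chart_deriv M c x l" using w unfolding tangent_space_slice[OF sl xc(1) x(1)] by blast
	have "norm l = norm (fder r (io x) (fder (rep c) (snd c x) l))" by (simp add:retr_deriv[OF cs r(1) xM xU])
	also have "... <= a3 * norm (dio x w)" unfolding l(2) rep_deriv[OF cs xc(1)] by (rule a3(2)[OF xK])
	finally have ln:"norm l <= a3 * norm (dio x w)" .
	have "\<bar>df x w\<bar> = \<bar>form c (snd c x) E l\<bar>" using df_chart[OF sl xc(1) x(1) l(1)] bspec[OF X(1) pI] fE[OF l(1)] l(2) by (simp add:Xx_def)
	also have "... <= CF * norm E * norm l" using CF(2) pK by blast
	also have "... <= CF * norm E * (a3 * norm (dio x w))" using CF(1) by (intro mult_left_mono[OF ln]) auto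
	finally show ?thesis by (simp add:m_def mult.assoc)
	qed
	hence ctrl:"\<bar>fder h (io x) u\<bar> <= C * m * norm u" for u using bspec[OF control x(1)] m0 by blast
	have "\<bar>form c (snd c x) Xx w\<bar> <= (C * m * a4) * norm w" for w
	proof -
	have "\<bar>form c (snd c x) Xx w\<bar> = \<bar>fder h (io x) (fder (rep c) (snd c x) w)\<bar>"
	using bspec[OF X(1) pI] hrep_deriv[OF cs xc(1)] by (simp add:Xx_def)
	also have "... <= C * m * norm (fder (rep c) (snd c x) w)" by (rule ctrl)
	also have "... <= C * m * (a4 * norm w)" using C_nonneg m0 by (intro mult_left_mono[OF a4(2)[OF pK]]) auto
	finally show ?thesis by (simp add:mult.assoc)
	qed
	hence "norm Xx <= CF * (C * m * a4)" using CF(2) pK by blast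
	also have "... <= CF * (C * (CF * (3 * Lx * a4 * de * norm Xx) * a3) * a4)" unfolding m_def
	using CF(1) C_nonneg a3(1) a4(1) by (intro mult_left_mono mult_right_mono En) auto
	also have "... = (ka * de) * norm Xx" by (simp add:ka_def mult_ac)
	finally have le:"norm Xx <= (ka * de) * norm Xx" .
	have "de < 1 / (ka + 1)" using de(3) by (simp add:de0_def)
	hence "de * (ka + 1) < 1" using ka by (simp add:pos_less_divide_eq)
	hence "ka * de < 1" using de(1) by (simp add:algebra_simps)
	hence "Xx = 0" using le by (metis mult_le_cancel_right1 norm_le_zero_iff not_le)
	hence "fder (hrep c) (snd c x) l = 0" for l using bspec[OF X(1) pI] form_0[OF cs pI,of l] by (simp add:Xx_def[symmetric])
	thus ?thesis using Crit_chart[OF sl xc(1) x(1)] by simp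
	qed
	hence key:"ALL de. 0 < de & de * B <= 1 / 12 & de < de0 -->
	(ALL x:N. io x : ball (io x0) rh --> ph de x : leaf M om N x --> x : Crit M N f)" by blast
	show ?thesis
	by (rule exI[of _ "ball (io x0) rh"],rule exI[of _ de0]) (intro conjI open_ball key de0,simp add:rh(1))
qed

text \<open>The union of two sets takes the smaller threshold, and compactness of the image of N
  does the rest. \<open>R\<close> stands for the statement on leafwise fixed points and for the one
  on the derivative.\<close>

lemma small_uniform:
	assumes "ALL x0:N. EX U de0. open U & io x0 : U & de0 > 0 & (ALL de. 0 < de & de * B <= 1 / 12 & de < de0 --> (ALL x:N. io x : U --> R de x))"
	shows "EX de0>0. ALL de. 0 < de & de * B <= 1 / 12 & de < de0 --> (ALL x:N. R de x)"
proof -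
	define Q where "Q A = (EX de0>0. ALL de. 0 < de & de * B <= 1 / 12 & de < de0 --> (ALL x:N. io x : A --> R de x))" for A
	have "Q (io ` N)"
	proof (rule compact_union_induct[OF compact_ioN])
	show "Q {}" unfolding Q_def by (rule exI[of _ 1]) simp
	show "Q (A Un A')" if QA:"Q A" "Q A'" for A A'
	proof -
	obtain d1 d2 where "d1 > 0" "ALL de. 0 < de & de * B <= 1 / 12 & de < d1 --> (ALL x:N. io x : A --> R de x)"
	"d2 > 0" "ALL de. 0 < de & de * B <= 1 / 12 & de < d2 --> (ALL x:N. io x : A' --> R de x)"
	using QA unfolding Q_def by (elim exE conjE) (rule that,assumption+)
	thus ?thesis unfolding Q_def by (intro exI[of _ "min d1 d2"]) auto
	qed
	show "Q A" if QA:"A \<subseteq> A'" "Q A'" for A A'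
	proof -
	obtain d where "d > 0" "ALL de. 0 < de & de * B <= 1 / 12 & de < d --> (ALL x:N. io x : A' --> R de x)"
	using QA(2) unfolding Q_def by (elim exE conjE)
	thus ?thesis unfolding Q_def using QA(1) by (intro exI[of _ d]) auto
	qed
	show "ALL y:io ` N. EX U. open U & y : U & Q U"
	proof
	fix y assume "y : io ` N"
	then obtain x0 where x0:"x0 : N" "y = io x0" by blast
	obtain U de0 where "open U" "io x0 : U" "de0 > 0" "ALL de. 0 < de & de * B <= 1 / 12 & de < de0 --> (ALL x:N. io x : U --> R de x)"
	using bspec[OF assms x0(1)] by (elim exE conjE)
	thus "EX U. open U & y : U & Q U" unfolding Q_def using x0(2) by (intro exI[of _ U]) auto
	qed
	qed
	thus ?thesis unfolding Q_def by auto
qed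

section \<open>The Hessian on a slice and isolated critical points\<close>

lemma second_deriv_hrep:
	assumes sl:"slice c L" and p:"p : img c" "p : L" and vw:"v : L" "w : L"
	shows "second_deriv (f o chart_inv c) p v w = fder (%q. fder (hrep c) q w) p v"
proof -
	note cs = slice_smooth[OF sl] and L = slice_subspace[OF sl]
	note o = img_open[OF cs]
	have eq:"(f o chart_inv c) q = hrep c q" if "q : img c" "q : L" for q
	using h_f slice_inv_N[OF sl that] by simp
	have 1:"deriv (%t. (f o chart_inv c) (q + t *\<^sub>R w)) 0 = fder (hrep c) q w" if "q : img c" "q : L" for q
	by (rule deriv_along_line[OF o h_chart[OF cs] that(1)],rule eq,assumption)
	(intro subspace_add[OF L] subspace_scale[OF L] that(2) vw(2))
	show ?thesis unfolding second_deriv_def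
	proof (rule deriv_along_line[OF o sm_fder[OF h_chart[OF cs]] p(1),where g = "%q. deriv (%t. (f o chart_inv c) (q + t *\<^sub>R w)) 0"])
	show "deriv (%t'. (f o chart_inv c) (p + t *\<^sub>R v + t' *\<^sub>R w)) 0 = fder (hrep c) (p + t *\<^sub>R v) w" if "p + t *\<^sub>R v : img c" for t
	by (rule 1[OF that]) (intro subspace_add[OF L] subspace_scale[OF L] p(2) vw(1))
	qed
qed

definition grad :: "('a,'e) chart => 'e => 'e" where
	"grad c p = (SUM b:Basis. fder (hrep c) p b *\<^sub>R b)"

lemma
	assumes c:"smooth_chart M c"
	shows smooth_grad:"smooth_on (img c) (grad c)"
	and grad_inner:"p : img c ==> grad c p \<bullet> w = fder (hrep c) p w"
	and grad_deriv_inner:"p : img c ==> fder (grad c) p v \<bullet> w = fder (%q. fder (hrep c) q w) p v"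
proof -
	note o = img_open[OF c]
	show s:"smooth_on (img c) (grad c)" unfolding grad_def[abs_def]
	by (rule sm_sum[OF o],rule sm_scaleR[OF o sm_fder[OF h_chart[OF c]] sm_const])
	show i:"grad c p \<bullet> w = fder (hrep c) p w" if p:"p : img c" for p w
	using linear_sum_Basis[OF sm_linear_fder[OF o h_chart[OF c] p],of w]
	by (simp add:grad_def inner_sum_left inner_commute[of w] mult.commute)
	show "fder (grad c) p v \<bullet> w = fder (%q. fder (hrep c) q w) p v" if p:"p : img c" for p
	proof -
	have "((%q. grad c q \<bullet> w) has_derivative (%v. fder (grad c) p v \<bullet> w)) (at p)"
	by (rule has_derivative_inner_left[OF sm_hd[OF o s p]])
	hence "((%q. fder (hrep c) q w) has_derivative (%v. fder (grad c) p v \<bullet> w)) (at p)"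
	by (rule hd_transform[OF _ o p]) (rule i)
	from fder_eq[OF this,of v] show ?thesis by simp
	qed
qed

lemma Crit_proj_grad:
	assumes sl:"slice c L" and x:"x : fst c" "x : Crit M N f"
	shows "proj L (grad c (snd c x)) = 0"
proof -
	note L = slice_subspace[OF sl]
	have xN:"x : N" using x(2) by (simp add:Crit_def)
	let ?g = "grad c (snd c x)"
	have "proj L ?g \<bullet> proj L ?g = ?g \<bullet> proj L ?g"
	using proj_orthogonal[OF L proj_in[OF L,of ?g],of ?g] by (simp add:inner_diff_left)
	also have "... = 0" using grad_inner[OF slice_smooth[OF sl],of "snd c x" "proj L ?g"] x Crit_chart[OF sl x(1) xN] proj_in[OF L,of ?g] by simp
	finally show ?thesis by simp
qed

text \<open>The Hessian on \<open>L\<close>, completed by the identity across \<open>L\<close>, is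
  an injective operator on the whole space by the Morse condition, and hence bounded below.\<close>

lemma hessian_bound:
	assumes x:"x : Crit M N f"
	shows "EX c L ka. slice c L & x : fst c & ka > 0 & (ALL v:L. ka * norm v <= norm (proj L (fder (grad c) (snd c x) v)))"
proof -
	have xN:"x : N" using x by (simp add:Crit_def)
	obtain c L where sl:"slice c L" "x : fst c"
	and nd:"ALL v:L. v ~= 0 --> (EX w:L. second_deriv (f o chart_inv c) (snd c x) v w ~= 0)"
	using bspec[OF conjunct2[OF morse[unfolded morse_function_def]] x] by (elim exE conjE)
	note cs = slice_smooth[OF sl(1)] and L = slice_subspace[OF sl(1)]
	note o = img_open[OF cs]
	have p:"snd c x : img c" "snd c x : L" using sl(2) slice_iff[OF sl] xN by auto
	define A where "A = fder (grad c) (snd c x)"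
	have linA:"linear A" unfolding A_def by (rule sm_linear_fder[OF o smooth_grad[OF cs] p(1)])
	define T where "T v = proj L (A (proj L v)) + (v - proj L v)" for v
	note P = linear_proj[OF L]
	have linT:"linear T"
	unfolding T_def[abs_def]
	by (intro linear_compose_add linear_compose_sub P linear_ident
	linear_compose[OF linear_compose[OF P linA] P,unfolded comp_def])
	have "v = 0" if T0:"T v = 0" for v
	proof -
	have "proj L (T v) = proj L (A (proj L v))"
	unfolding T_def linear_add[OF P] linear_diff[OF P] by (simp add:proj_id[OF L proj_in[OF L]])
	hence A0:"proj L (A (proj L v)) = 0" using T0 linear_0[OF P] by simp
	have "proj L v = 0"
	proof (rule ccontr)
	assume "proj L v ~= 0"
	then obtain w where w:"w : L" "second_deriv (f o chart_inv c) (snd c x) (proj L v) w ~= 0" using nd proj_in[OF L] by blast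
	have "A (proj L v) \<bullet> w = proj L (A (proj L v)) \<bullet> w"
	using proj_orthogonal[OF L w(1),of "A (proj L v)"] by (simp add:inner_diff_left)
	thus False
	using w A0 grad_deriv_inner[OF cs p(1)] second_deriv_hrep[OF sl(1) p proj_in[OF L] w(1)] by (simp add:A_def)
	qed
	thus ?thesis using T0 A0 by (simp add:T_def)
	qed
	hence "inj T" using linear_injective_0[OF linT] by blast
	then obtain ka where ka:"ka > 0" "!!v. ka * norm v <= norm (T v)" using linear_inj_bounded_below_pos[OF linT] by blast
	have "ka * norm v <= norm (proj L (A v))" if "v : L" for v using ka(2)[of v] proj_id[OF L that] by (simp add:T_def)
	thus ?thesis using sl ka(1) unfolding A_def by blast
qed

text \<open>The tangential gradient \<open>proj L (grad c p)\<close> vanishes at critical points,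
  and its derivative at \<open>x0\<close> is bounded below by \<open>ka\<close>. A second critical
  point close by would contradict the first-order expansion with error
  \<open>ka / 2\<close>.\<close>

lemma Crit_isolated:
	assumes x0:"x0 : Crit M N f"
	shows "EX U. open U & io x0 : U & (ALL x:Crit M N f. io x : U --> x = x0)"
proof -
	obtain c L ka where sl:"slice c L" "x0 : fst c" and ka:"ka > 0" "ALL v:L. ka * norm v <= norm (proj L (fder (grad c) (snd c x0) v))"
	using hessian_bound[OF x0] by (elim exE conjE)
	note cs = slice_smooth[OF sl(1)] and L = slice_subspace[OF sl(1)]
	note o = img_open[OF cs]
	have x0N:"x0 : N" using x0 by (simp add:Crit_def)
	have p0:"snd c x0 : img c" "snd c x0 : L" using sl(2) slice_iff[OF sl] x0N by auto
	obtain U r where r:"retr c U r" "io x0 : U" using retr_exists[OF cs sl(2)] by blast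
	have U:"open U" "smooth_on U r" and rv:"!!x. x : points M ==> io x : U ==> x : fst c & r (io x) = snd c x"
	using r(1) by (auto simp:retr_def)
	define g where "g p = proj L (grad c p)" for p
	have "(g has_derivative (%v. proj L (fder (grad c) (snd c x0) v))) (at (snd c x0))" unfolding g_def[abs_def]
	by (rule has_derivative_compose[OF sm_hd[OF o smooth_grad[OF cs] p0(1)] linear_imp_has_derivative[OF linear_proj[OF L]]])
	hence "ALL e>0. EX d>0. ALL p. norm (p - snd c x0) < d -->
	norm (g p - g (snd c x0) - proj L (fder (grad c) (snd c x0) (p - snd c x0))) <= e * norm (p - snd c x0)"
	unfolding has_derivative_at_alt by blast
	then obtain d where d:"d > 0" "ALL p. norm (p - snd c x0) < d -->
	norm (g p - g (snd c x0) - proj L (fder (grad c) (snd c x0) (p - snd c x0))) <= ka / 2 * norm (p - snd c x0)"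
	using half_gt_zero[OF ka(1)] by blast
	define U' where "U' = U Int r -` ball (snd c x0) d"
	have "open U'" unfolding U'_def by (rule continuous_open_preimage[OF sm_cont[OF U(2)] U(1) open_ball])
	moreover have "io x0 : U'" using r(2) rv[of x0] x0N N_subset d(1) by (auto simp:U'_def)
	moreover have "x = x0" if x:"x : Crit M N f" "io x : U'" for x
	proof -
	have xN:"x : N" using x(1) by (simp add:Crit_def)
	have xc:"x : fst c" "r (io x) = snd c x" using rv[of x] xN N_subset x(2) by (auto simp:U'_def)
	have near:"norm (snd c x - snd c x0) < d" using x(2) xc(2) by (simp add:U'_def dist_norm norm_minus_commute)
	have g0:"g (snd c x) = 0" "g (snd c x0) = 0" using Crit_proj_grad[OF sl(1) xc(1) x(1)] Crit_proj_grad[OF sl x0] by (simp_all add:g_def)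
	have vL:"snd c x - snd c x0 : L" using slice_iff[OF sl(1) xc(1)] xN p0(2) by (blast intro:subspace_diff[OF L])
	have "ka * norm (snd c x - snd c x0) <= ka / 2 * norm (snd c x - snd c x0)"
	using d(2)[rule_format,OF near] bspec[OF ka(2) vL] by (simp add:g0)
	hence "norm (snd c x - snd c x0) = 0" using ka(1) by simp
	hence e:"snd c x = snd c x0" by simp
	show ?thesis by (rule inj_onD[OF chart_inj[OF is_chart[OF cs]] e xc(1) sl(2)])
	qed
	ultimately show ?thesis by blast
qed

lemma noncrit_open:
	assumes x0:"x0 : N" "x0 ~: Crit M N f"
	shows "EX U. open U & io x0 : U & (ALL x:N. io x : U --> x ~: Crit M N f)"
proof -
	obtain c L where sl:"slice c L" "x0 : fst c" using exists_slice[OF x0(1)] by blast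
	note cs = slice_smooth[OF sl(1)]
	note o = img_open[OF cs]
	obtain l where l:"l : L" "fder (hrep c) (snd c x0) l ~= 0" using Crit_chart[OF sl x0(1)] x0(2) by blast
	obtain U r where r:"retr c U r" "io x0 : U" using retr_exists[OF cs sl(2)] by blast
	have U:"open U" "smooth_on U r" "r ` U \<subseteq> img c" and rv:"!!x. x : points M ==> io x : U ==> x : fst c & r (io x) = snd c x"
	using r(1) by (auto simp:retr_def)
	have "smooth_on U (%y. fder (hrep c) (r y) l)" by (rule sm_compose[OF U(1) o U(2) sm_fder[OF h_chart[OF cs]] U(3)])
	from continuous_open_preimage[OF sm_cont[OF this] U(1),of "- {0}"]
	have "open (U Int (%y. fder (hrep c) (r y) l) -` (- {0}))" by (simp add:open_Compl)
	moreover have "io x0 : U Int (%y. fder (hrep c) (r y) l) -` (- {0})" using r(2) rv[of x0] x0(1) N_subset l(2) by auto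
	moreover have "x ~: Crit M N f" if x:"x : N" "io x : U Int (%y. fder (hrep c) (r y) l) -` (- {0})" for x
	proof -
	have "x : fst c" "r (io x) = snd c x" using rv[of x] x N_subset by auto
	thus ?thesis using Crit_chart[OF sl(1) _ x(1)] l(1) x(2) by auto
	qed
	ultimately show ?thesis by blast
qed

text \<open>A rest point is its own image, so one reference chart serves on both sides of
  \<open>mderiv\<close>; the ambient derivative \<open>D\<close> is read in \<open>c\<close> through
  \<open>rep\<close> and \<open>retr\<close>.\<close>

lemma ph_mderiv:
	assumes de:"0 < de" "de * B <= 1 / 12" and c:"smooth_chart M c" and x:"x : fst c" "V (io x) = 0"
	and r:"retr c U r" "io x : U" and D:"((%y. flow (%y. de *\<^sub>R V y) y 1) has_derivative D) (at (io x))"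
	shows "mderiv M M (ph de) x (chart_deriv M c x l) = chart_deriv M c x (fder r (io x) (D (fder (rep c) (snd c x) l)))"
proof -
	interpret H: ham_flow M om N io f h V K0 C0 C B de by unfold_locales (use de in auto)
	have xM:"x : points M" using chart_subset[OF c] x(1) by blast
	have phps:"ph de = H.ps 1" by (rule ext) (simp add:ph_def H.ps_def)
	have fx:"flow H.W (io x) 1 = io x" by (rule H.F.flow_fixed) (simp_all add:x(2))
	have phx:"ph de x = x" using inj_io xM by (simp add:ph_def fx)
	have U:"open U" "smooth_on U r" and rv:"!!x. x : points M ==> io x : U ==> x : fst c & r (io x) = snd c x"
	using r(1) by (auto simp:retr_def)
	define a where "a = chart_at M x"
	have a:"smooth_chart M a" "x : fst a" using chart_at_smooth[OF xM] chart_at[OF xM] by (auto simp:a_def)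
	note oa = img_open[OF a(1)]
	have ra:"rep a (snd a x) = io x" by (simp add:inv_chart[OF a])
	have d1:"((%q. flow H.W (rep a q) 1) has_derivative (%v. D (fder (rep a) (snd a x) v))) (at (snd a x))"
	by (rule has_derivative_compose[OF rep_has_derivative[OF a]]) (use D in \<open>simp add:ra\<close>)
	have d2:"((%q. r (flow H.W (rep a q) 1)) has_derivative (%v. fder r (io x) (D (fder (rep a) (snd a x) v)))) (at (snd a x))"
	by (rule has_derivative_compose[OF d1]) (use sm_hd[OF U r(2)] in \<open>simp add:ra fx\<close>)
	have rx:"r (io x) = snd c x" using rv[OF xM r(2)] by simp
	have "((%q. snd a (chart_inv c (r (flow H.W (rep a q) 1)))) has_derivative
	(%v. fder (%p. snd a (chart_inv c p)) (snd c x) (fder r (io x) (D (fder (rep a) (snd a x) v))))) (at (snd a x))"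
	by (rule has_derivative_compose[OF d2]) (use transition_derivative[OF c a(1) x(1) a(2)] in \<open>simp add:ra fx rx\<close>)
	moreover
	have "continuous_on UNIV (%y. flow H.W y 1)"
	proof (rule continuous_at_imp_continuous_on,rule ballI)
	fix y
	obtain D' where "ALL t:{-1..2}. ((%x. flow H.W x t) has_derivative (%h. D' h t)) (at y)" using H.F.flow_has_derivative[of y] by (elim exE conjE)
	hence "((%x. flow H.W x 1) has_derivative (%h. D' h 1)) (at y)" by simp
	thus "isCont (%y. flow H.W y 1) y" by (rule has_derivative_continuous)
	qed
	from open_vimage[OF U(1) this] have "open (img a Int rep a -` ((%y. flow H.W y 1) -` U))"
	by (rule continuous_open_preimage[OF sm_cont[OF rep_smooth[OF a(1)]] oa])
	moreover have "snd a x : img a Int rep a -` ((%y. flow H.W y 1) -` U)" using a(2) r(2) by (simp add:ra fx)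
	moreover have "snd a (chart_inv c (r (flow H.W (rep a q) 1))) = (snd a o ph de o chart_inv a) q"
	if q:"q : img a Int rep a -` ((%y. flow H.W y 1) -` U)" for q
	proof -
	have qM:"chart_inv a q : points M" using q chart_inv_into[of q a] chart_subset[OF a(1)] by blast
	have "io (ph de (chart_inv a q)) = flow H.W (rep a q) 1" "ph de (chart_inv a q) : points M"
	unfolding phps using H.ps[OF qM,of 1] by auto
	thus ?thesis using rv[of "ph de (chart_inv a q)"] q inv_chart[OF c] by auto
	qed
	ultimately have "((snd a o ph de o chart_inv a) has_derivative
	(%v. fder (%p. snd a (chart_inv c p)) (snd c x) (fder r (io x) (D (fder (rep a) (snd a x) v))))) (at (snd a x))"
	by (rule hd_transform)
	from frechet_derivative_at[OF this,symmetric]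
	have m:"mderiv M M (ph de) x v = chart_deriv M c x (fder r (io x) (D (fder (rep a) (snd a x) v)))" for v
	by (simp add:mderiv_def phx chart_deriv_eq a_def)
	have "chart_deriv M a x v = v" for v using transition_id[OF a] by (simp add:chart_deriv_eq a_def)
	hence "fder (rep a) (snd a x) (chart_deriv M c x l) = fder (rep c) (snd c x) l"
	using rep_deriv[OF a,of "chart_deriv M c x l"] rep_deriv[OF c x(1),of l] by simp
	thus ?thesis by (simp add:m)
qed

text \<open>At a rest point the derivative of \<open>ph de\<close> minus the identity is
  \<open>de *\<^sub>R fder X p0\<close> up to second order in \<open>de\<close>, and
  \<open>fder X p0\<close> is the Hessian turned into a vector by the form. If the difference lay in
  the kernel for some \<open>l\<close> in \<open>L\<close>, its pairing with the tangential Hessian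
  vector of \<open>l\<close> would give \<open>ka \<le> mu * de\<close>.\<close>

lemma nondeg_at:
	assumes x:"x : Crit M N f"
	shows "EX de0>0. ALL de. 0 < de & de * B <= 1 / 12 & de < de0 -->
	(ALL v:tangent_space M N x. v ~= 0 --> mderiv M M (ph de) x v - v ~: perp x)"
proof -
	obtain c L ka where sl:"slice c L" "x : fst c" and ka:"ka > 0" "ALL v:L. ka * norm v <= norm (proj L (fder (grad c) (snd c x) v))"
	using hessian_bound[OF x] by (elim exE conjE)
	note cs = slice_smooth[OF sl(1)] and L = slice_subspace[OF sl(1)]
	note o = img_open[OF cs]
	have xN:"x : N" using x by (simp add:Crit_def)
	have xM:"x : points M" using xN N_subset by blast
	have p:"snd c x : img c" using sl(2) by blast
	define p0 where "p0 = snd c x"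
	obtain U r where r:"retr c U r" "io x : U" using retr_exists[OF cs sl(2)] by blast
	have U:"open U" "smooth_on U r" using r(1) by (auto simp:retr_def)
	obtain X where X:"smooth_on (img c) X" "ALL p:img c. ALL w. form c p (X p) w = fder (hrep c) p w"
	"ALL x:fst c. V (io x) = fder (rep c) (snd c x) (X (snd c x))"
	using chart_field[OF cs] by (elim exE conjE) (rule that,assumption+)
	have V0:"V (io x) = 0" by (rule Crit_zero(1)[OF x])
	have X0:"X p0 = 0" using retr_deriv[OF cs r(1) xM r(2),of "X p0"] X(3) sl(2) V0 linear_0[OF sm_linear_fder[OF U r(2)]]
	by (simp add:p0_def)
	have p0:"p0 : img c" using p by (simp add:p0_def)
	note DX = sm_hd[OF o X(1) p0]
	have Vq:"V (rep c q) = fder (rep c) q (X q)" if "q : img c" for q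
	using bspec[OF X(3) chart_inv_into[OF that]] chart_chart_inv[OF that] by simp
	\<comment> \<open>Because \<open>X p0 = 0\<close>, the second derivative of \<open>rep c\<close>
	  drops out of the product rule.\<close>
	have dV:"fder V (io x) (fder (rep c) p0 l) = fder (rep c) p0 (fder X p0 l)" for l
	proof -
	have "((%q. V (rep c q)) has_derivative (%l. fder V (io x) (fder (rep c) p0 l))) (at p0)" unfolding p0_def
	by (rule has_derivative_compose[OF rep_has_derivative[OF cs sl(2)]])
	(use sm_hd[OF open_UNIV smooth_V] in \<open>simp add:inv_chart[OF cs sl(2)]\<close>)
	hence "((%q. fder (rep c) q (X q)) has_derivative (%l. fder V (io x) (fder (rep c) p0 l))) (at p0)"
	by (rule hd_transform[OF _ o p0]) (rule Vq)
	moreover have "((%q. fder (rep c) q (X q)) has_derivative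
	(%l. fder (%q. fder (rep c) q (X p0)) p0 l + fder (rep c) p0 (fder X p0 l))) (at p0)"
	by (rule has_derivative_linear_family[OF o p0 sm_linear_fder[OF o rep_smooth[OF cs]]
	sm_hd[OF o sm_fder[OF rep_smooth[OF cs]] p0] DX])
	ultimately have "fder V (io x) (fder (rep c) p0 l) = fder (%q. fder (rep c) q (X p0)) p0 l + fder (rep c) p0 (fder X p0 l)"
	using has_derivative_unique by (metis (no_types,lifting))
	moreover have "fder (%q. fder (rep c) q (X p0)) p0 = (%_. 0)"
	by (rule fder_zero_on_open[OF o p0]) (simp add:X0 linear_0[OF sm_linear_fder[OF o rep_smooth[OF cs]]])
	ultimately show ?thesis by simp
	qed
	\<comment> \<open>For the same reason the derivative of the form drops out, and the Hessian
	  remains.\<close>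
	have H:"form c p0 (fder X p0 l) w = fder (grad c) p0 l \<bullet> w" for l w
	proof -
	have lin:"linear (%v. form c q v w)" if "q : img c" for q using bilinear_form[OF cs that] by (simp add:bilinear_def)
	have "((%q. form c q (X q) w) has_derivative
	(%l. fder (%q. form c q (X p0) w) p0 l + form c p0 (fder X p0 l) w)) (at p0)"
	by (rule has_derivative_linear_family[OF o p0 lin sm_hd[OF o smooth_form[OF cs] p0] DX])
	hence "((%q. fder (hrep c) q w) has_derivative
	(%l. fder (%q. form c q (X p0) w) p0 l + form c p0 (fder X p0 l) w)) (at p0)"
	by (rule hd_transform[OF _ o p0]) (use X(2) in blast)
	from fder_eq[OF this,of l]
	have "fder (%q. fder (hrep c) q w) p0 l = fder (%q. form c q (X p0) w) p0 l + form c p0 (fder X p0 l) w" by simp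
	moreover have "fder (%q. form c q (X p0) w) p0 = (%_. 0)"
	by (rule fder_zero_on_open[OF o p0]) (simp add:X0 form_0[OF cs])
	ultimately show ?thesis using grad_deriv_inner[OF cs p0,of l w] by simp
	qed
	have K1:"compact {io x}" "{io x} \<subseteq> U" and K2:"compact {p0}" "{p0} \<subseteq> img c" using r(2) p0 by auto
	obtain a3 where a3:"a3 > 0" "!!y v. y : {io x} ==> norm (fder r y v) <= a3 * norm v"
	by (rule fder_bounded_on_compact[OF U K1]) (rule that; blast)
	obtain a4 where a4:"a4 > 0" "!!q v. q : {p0} ==> norm (fder (rep c) q v) <= a4 * norm v"
	by (rule fder_bounded_on_compact[OF o rep_smooth[OF cs] K2]) (rule that; blast)
	obtain CF where CF:"CF > 0" "ALL p:{p0}. (ALL v w. \<bar>form c p v w\<bar> <= CF * norm v * norm w) &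
	(ALL v. ALL m. (ALL w. \<bar>form c p v w\<bar> <= m * norm w) --> norm v <= CF * m)" using form_bounds[OF cs K2] by (elim exE conjE)
	define mu where "mu = CF * (a3 * (3 * B\<^sup>2 * a4))"
	have mu:"mu > 0" using CF(1) a3(1) a4(1) B_pos by (simp add:mu_def)
	have "mderiv M M (ph de) x v - v ~: perp x"
	if de:"0 < de" "de * B <= 1 / 12" "de < ka / mu" and v:"v : tangent_space M N x" "v ~= 0" for de v
	proof
	assume pp:"mderiv M M (ph de) x v - v : perp x"
	interpret H: ham_flow M om N io f h V K0 C0 C B de by unfold_locales (use de in auto)
	obtain D where "ALL t:{-1..2}. ((%x. flow H.W x t) has_derivative (%h. D h t)) (at (io x))" using H.F.flow_has_derivative[of "io x"] by (elim exE conjE)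
	hence D:"((%x. flow H.W x 1) has_derivative (%h. D h 1)) (at (io x))" by simp
	obtain l where l:"l : L" "v = chart_deriv M c x l" using v(1) unfolding tangent_space_slice[OF sl xN] by blast
	have l0:"l ~= 0" using v(2) l(2) linear_0[OF linear_chart_deriv[OF cs sl(2)]] by auto
	define u where "u = fder (rep c) p0 l"
	define R where "R = D u 1 - u - de *\<^sub>R fder V (io x) u"
	have linr:"linear (fder r (io x))" by (rule sm_linear_fder[OF U r(2)])
	have "norm R <= 3 * (de * B)\<^sup>2 * norm u"
	using H.F.flow_derivative_first_order(2)[OF D,of u] V0 by (simp add:R_def H.fder_W)
	also have "... <= 3 * (de * B)\<^sup>2 * (a4 * norm l)" using a4(2)[of p0 l] by (intro mult_left_mono) (auto simp:u_def)
	finally have Rn:"norm R <= 3 * (de * B)\<^sup>2 * (a4 * norm l)" .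
	define R' where "R' = fder r (io x) R"
	have "norm R' <= a3 * norm R" using a3(2) by (simp add:R'_def)
	also have "... <= a3 * (3 * (de * B)\<^sup>2 * (a4 * norm l))" using a3(1) by (intro mult_left_mono[OF Rn]) auto
	finally have R'n:"norm R' <= a3 * (3 * (de * B)\<^sup>2 * (a4 * norm l))" .
	have ru:"fder r (io x) (fder (rep c) p0 w) = w" for w using retr_deriv[OF cs r(1) xM r(2)] by (simp add:p0_def)
	have "D u 1 = R + (u + de *\<^sub>R fder V (io x) u)" by (simp add:R_def)
	hence "fder r (io x) (D u 1) = fder r (io x) R + (fder r (io x) u + de *\<^sub>R fder r (io x) (fder V (io x) u))"
	by (simp only: linear_add[OF linr] linear_scale[OF linr])
	also have "... = R' + (l + de *\<^sub>R fder X p0 l)" unfolding R'_def u_def dV ru ..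
	finally have Dr:"fder r (io x) (D u 1) = R' + (l + de *\<^sub>R fder X p0 l)" .
	have "mderiv M M (ph de) x v - v = chart_deriv M c x (R' + (l + de *\<^sub>R fder X p0 l)) - chart_deriv M c x l"
	unfolding l(2) using ph_mderiv[OF de(1,2) cs sl(2) V0 r D,of l] Dr by (simp add:u_def p0_def)
	also have "... = chart_deriv M c x (R' + de *\<^sub>R fder X p0 l)"
	using linear_diff[OF linear_chart_deriv[OF cs sl(2)],of "R' + (l + de *\<^sub>R fder X p0 l)" l] by simp
	finally have "R' + de *\<^sub>R fder X p0 l : kern c L p0"
	using pp perp_iff_kern[OF sl xN] by (simp add:p0_def)
	hence kz:"form c p0 (R' + de *\<^sub>R fder X p0 l) w = 0" if "w : L" for w using that by (simp add:kern_def)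
	\<comment> \<open>The test vector: it lies in \<open>L\<close>, so kernel elements pair to 0 with
	  it, and its norm is at least \<open>ka * norm l\<close>.\<close>
	define w where "w = proj L (fder (grad c) p0 l)"
	have wL:"w : L" by (simp add:w_def proj_in[OF L])
	have lin:"linear (%v. form c p0 v w)" using bilinear_form[OF cs p0] by (simp add:bilinear_def)
	have e:"form c p0 R' w + de * form c p0 (fder X p0 l) w = 0"
	using kz[OF wL] linear_add[OF lin,of R' "de *\<^sub>R fder X p0 l"] linear_scale[OF lin,of de "fder X p0 l"] by simp
	have "fder (grad c) p0 l \<bullet> w = w \<bullet> w"
	using proj_orthogonal[OF L wL,of "fder (grad c) p0 l"] by (simp add:inner_diff_left w_def)
	hence "de * (norm w * norm w) = - form c p0 R' w" using e H[of l w] by (simp add:norm_eq_sqrt_inner)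
	also have "... <= CF * norm R' * norm w" using CF(2) by (metis abs_ge_minus_self order_trans singletonI)
	finally have "(de * norm w) * norm w <= (CF * norm R') * norm w" by (simp add:mult.assoc)
	moreover have wn:"ka * norm l <= norm w" using ka(2) l(1) by (simp add:w_def p0_def)
	moreover have "ka * norm l > 0" using ka(1) l0 by simp
	ultimately have "de * norm w <= CF * norm R'" by (meson less_le_trans mult_right_le_imp_le)
	also have "... <= CF * (a3 * (3 * (de * B)\<^sup>2 * (a4 * norm l)))" using CF(1) by (intro mult_left_mono[OF R'n]) auto
	also have "... = de * (mu * de * norm l)" by (simp add:mu_def power2_eq_square mult_ac)
	finally have "norm w <= mu * de * norm l" using de(1) by simp
	hence "ka * norm l <= mu * de * norm l" using wn by simp
	hence "ka <= mu * de" using l0 by simp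
	thus False using de(3) mu by (simp add:pos_less_divide_eq mult.commute)
	qed
	thus ?thesis using ka(1) mu by (intro exI[of _ "ka / mu"]) simp
qed

text \<open>The threshold of \<open>nondeg_at\<close> depends on the critical point. Every point of
  N has a neighbourhood with at most one critical point, so a local threshold exists.\<close>

lemma nondeg_local:
	assumes x0:"x0 : N"
	shows "EX U de0. open U & io x0 : U & de0 > 0 & (ALL de. 0 < de & de * B <= 1 / 12 & de < de0 -->
	(ALL x:N. io x : U --> x : Crit M N f --> (ALL v:tangent_space M N x. v ~= 0 --> mderiv M M (ph de) x v - v ~: perp x)))"
proof (cases "x0 : Crit M N f")
	case True
	obtain U where U:"open U" "io x0 : U" "ALL x:Crit M N f. io x : U --> x = x0" using Crit_isolated[OF True] by blast
	obtain de0 where "de0 > 0" "ALL de. 0 < de & de * B <= 1 / 12 & de < de0 -->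
	(ALL v:tangent_space M N x0. v ~= 0 --> mderiv M M (ph de) x0 v - v ~: perp x0)" using nondeg_at[OF True] by (elim exE conjE)
	with U show ?thesis by (intro exI[of _ U] exI[of _ de0]) blast
next
	case False
	obtain U where "open U" "io x0 : U" "ALL x:N. io x : U --> x ~: Crit M N f" using noncrit_open[OF x0 False] by blast
	thus ?thesis by (intro exI[of _ U] exI[of _ 1]) auto
qed

text \<open>A path in a leaf with \<open>ph de (x 0) = x 1\<close> makes \<open>x 0\<close> a
  leafwise fixed point, hence critical and fixed. The path is then a loop with trivial holonomy, and
  the claim becomes that no non-zero tangent vector of N is preserved modulo the kernel.\<close>

lemma nondegenerate_if:
	assumes de:"0 < de" "de * B <= 1 / 12" and fx:"ALL x:N. ph de x : leaf M om N x --> x : Crit M N f"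
	and nd:"ALL x:N. x : Crit M N f --> (ALL v:tangent_space M N x. v ~= 0 --> mderiv M M (ph de) x v - v ~: perp x)"
	shows "nondegenerate M om N (ph de)"
	unfolding nondegenerate_def
proof (intro ballI allI impI,elim conjE)
	fix F :: "'a set" and x :: "real => 'a" and v
	assume F:"F : leaf M om N ` N" and x:"smooth_map_on euc M {0..1} x" "x ` {0..1} \<subseteq> F" "ph de (x 0) = x 1"
	and v:"v : tangent_space M N (x 0) Int tangent_space M {y : points M. ph de y : N} (x 0)" "v ~= 0"
	obtain y where y:"F = leaf M om N y" using F by blast
	have xF:"x t : leaf M om N y" if "t : {0..1}" for t using x(2) that y by blast
	have lf:"ALL t:{0..1}. x t : leaf M om N (x 0)"
	using xF leaf_trans[OF leaf_sym] by (meson atLeastAtMost_iff order_refl zero_le_one)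
	have x0:"x 0 : N" using xF[of 0] leaf_subset by auto
	have cr:"x 0 : Crit M N f" using fx x0 lf x(3) by simp
	have loop:"x 1 = x 0" using Crit_zero(2)[OF cr,of de] de x(3) by simp
	have "linear_holonomy M om N x (quot_proj M om N (x 0) v) = quot_proj M om N (x 0) v"
	by (rule linear_holonomy_loop[OF x(1) lf x0 loop]) (use v(1) in blast)
	moreover have "quot_proj M om N (x 0) (mderiv M M (ph de) (x 0) v) ~= quot_proj M om N (x 0) v"
	unfolding quot_proj_def coset_eq_iff[OF subspace_perp[OF x0]] using nd x0 cr v by blast
	ultimately show "linear_holonomy M om N x (quot_proj M om N (x 0) v) ~= quot_proj M om N (x 1) (mderiv M M (ph de) (x 0) v)"
	unfolding loop by simp
qed

lemma Fix_eq:
	assumes de:"0 < de" "de * B <= 1 / 12" and fx:"ALL x:N. ph de x : leaf M om N x --> x : Crit M N f"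
	shows "Fix M om (ph de) N = Crit M N f"
proof (intro equalityI subsetI)
	fix x assume "x : Fix M om (ph de) N"
	thus "x : Crit M N f" using fx by (simp add:Fix_def)
next
	fix x assume x:"x : Crit M N f"
	hence "x : N" by (simp add:Crit_def)
	moreover have "ph de x = x" using Crit_zero(2)[OF x,of de] de by simp
	ultimately show "x : Fix M om (ph de) N" using leaf_refl by (simp add:Fix_def)
qed

lemma small_flow_exists:
	assumes "ep > 0"
	shows "EX ph:Ham_c M om. nondegenerate M om N ph & Fix M om ph N = Crit M N f &
	C1_norm (io ` points M) (%y. io (ph (inv_into (points M) io y)) - y) < ennreal ep"
proof -
	have "EX de0>0. ALL de. 0 < de & de * B <= 1 / 12 & de < de0 --> (ALL x:N. ph de x : leaf M om N x --> x : Crit M N f)"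
	by (rule small_uniform,rule ballI,rule fix_local)
	then obtain d1 where d1:"d1 > 0" "ALL de. 0 < de & de * B <= 1 / 12 & de < d1 --> (ALL x:N. ph de x : leaf M om N x --> x : Crit M N f)"
	by (elim exE conjE)
	have "EX de0>0. ALL de. 0 < de & de * B <= 1 / 12 & de < de0 --> (ALL x:N. x : Crit M N f -->
	(ALL v:tangent_space M N x. v ~= 0 --> mderiv M M (ph de) x v - v ~: perp x))"
	by (rule small_uniform,rule ballI,rule nondeg_local)
	then obtain d2 where d2:"d2 > 0" "ALL de. 0 < de & de * B <= 1 / 12 & de < d2 --> (ALL x:N. x : Crit M N f -->
	(ALL v:tangent_space M N x. v ~= 0 --> mderiv M M (ph de) x v - v ~: perp x))"
	by (elim exE conjE)
	\<comment> \<open>The bound 1/12 is the one required by \<open>ham_flow\<close>, and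
	  \<open>ep / 6\<close> answers the estimate \<open>6 * (de * B)\<close> of the C1 norm.\<close>
	define d3 where "d3 = min (1 / 12) (ep / 6) / B"
	have e:"d3 > 0" using assms B_pos by (simp add:d3_def)
	define de where "de = min (min d1 d2) d3 / 2"
	have de:"0 < de" "de < d1" "de < d2" "de < d3" using d1(1) d2(1) e by (auto simp:de_def min_def)
	have "de * B < min (1 / 12) (ep / 6)" using de(4) unfolding d3_def pos_less_divide_eq[OF B_pos] .
	hence deB:"de * B <= 1 / 12" "6 * (de * B) < ep" by auto
	interpret H: ham_flow M om N io f h V K0 C0 C B de by unfold_locales (use de deB in auto)
	have phps:"H.ps 1 = ph de" by (rule ext) (simp add:ph_def H.ps_def)
	have fx:"ALL x:N. ph de x : leaf M om N x --> x : Crit M N f" using d1(2) de deB(1) by blast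
	have nd:"ALL x:N. x : Crit M N f --> (ALL v:tangent_space M N x. v ~= 0 --> mderiv M M (ph de) x v - v ~: perp x)"
	using d2(2) de deB(1) by blast
	have "C1_norm (io ` points M) (%y. io (ph de (inv_into (points M) io y)) - y) < ennreal ep"
	by (rule le_less_trans[OF H.C1_small[unfolded phps]]) (use deB(2) de(1) B_pos in \<open>simp add:ennreal_less_iff\<close>)
	thus ?thesis
	using H.ps_Ham_c[unfolded phps] nondegenerate_if[OF de(1) deB(1) fx nd] Fix_eq[OF de(1) deB(1) fx]
	by (intro bexI[of _ "ph de"] conjI)
qed

end

theorem theorem2:
  fixes M :: "('a, 'e::euclidean_space) manifold"
    and \<omega> :: "'a \<Rightarrow> 'e \<Rightarrow> 'e \<Rightarrow> real"
    and N :: "'a set"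
    and f :: "'a \<Rightarrow> real"
    and \<iota> :: "'a \<Rightarrow> 'b::euclidean_space"
    and n :: nat
    and \<epsilon> :: real
  assumes "symplectic_manifold M \<omega>" and "DIM('e) = 2 * n"
    and "coisotropic M \<omega> N" and "compactin (mtop M) N" and "regular M \<omega> N"
    and "morse_function M N f"
    and "smooth_embedding M euclidean_manifold \<iota>" and "DIM('b) = 4 * n"
    and "\<epsilon> > 0"
  shows "\<exists>\<phi>\<in>Ham_c M \<omega>.
           nondegenerate M \<omega> N \<phi> \<and>
           Fix M \<omega> \<phi> N = Crit M N f \<and>
           C1_norm (\<iota> ` points M) (\<lambda>y. \<iota> (\<phi> (inv_into (points M) \<iota> y)) - y) < ennreal \<epsilon>"
proof -
  have M: "smooth_manifold M" "symplectic_form M \<omega>" using assms(1) by (auto simp: symplectic_manifold_def)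
  interpret smooth_mfd M by (rule smooth_mfdI[OF M(1)])
  have "Hausdorff_space (mtop M)" using M(1) by (simp add: smooth_manifold_def)
  then interpret setting M \<omega> N \<iota> f by unfold_locales (use M(2) assms in auto)
  obtain h K0 C where h: "smooth_on UNIV h" "compact K0" "K0 \<subseteq> \<iota> ` points M" "\<forall>x\<in>points M. \<iota> x \<notin> K0 \<longrightarrow> h (\<iota> x) = 0"
     "\<forall>x\<in>N. h (\<iota> x) = f x" "0 \<le> C"
     "\<forall>x\<in>N. \<forall>m\<ge>0. (\<forall>w\<in>tangent_space M N x. \<bar>df x w\<bar> \<le> m * norm (dio x w)) \<longrightarrow> (\<forall>u. \<bar>fder h (\<iota> x) u\<bar> \<le> C * m * norm u)"
    using hamiltonian_exists by (elim exE conjE) (rule that, assumption+)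
  obtain V C0 where V: "smooth_on UNIV V" "compact C0" "\<forall>y. y \<notin> C0 \<longrightarrow> V y = 0"
     "\<forall>x\<in>points M. V (\<iota> x) = dio x (ham_vector_field M \<omega> (\<lambda>x. h (\<iota> x)) x)" "\<forall>x\<in>points M. \<iota> x \<notin> K0 \<longrightarrow> V (\<iota> x) = 0"
    using extension_exists[OF h(1,2,4,3)] by (elim exE conjE) (rule that, assumption+)
  obtain B where B: "B > 0" "\<And>x. norm (V x) \<le> B" "\<And>x v. norm (fder V x v) \<le> B * norm v"
    by (rule compact_support_bounds[OF V(1,2)], use V(3) in blast) (rule that; blast)
  interpret ham_setting M \<omega> N \<iota> f h V K0 C0 C B
    by (unfold_locales; fact)
  show ?thesis by (rule small_flow_exists[OF assms(9)])
qed

end
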